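(* Let $(\mathbb X,\mathbb T)$ be a tangentad in a 2-category $\mathbf K$ which admits the construction of display differential bundles, with universal pointwise display differential bundle $\mathcal Q=(\mathcal q,\mathcal z,\mathcal s,\mathcal l):\mathrm{Tot}\to\mathrm{Base}$, and suppose that the inserter $\mathbb I^k_0$ and the equifiers $\mathbb E^k_1,\dots,\mathbb E^k_4$ described in the context exist in $\mathbf K$. Then $(\mathbb X,\mathbb T)$ admits the construction of vertical linear connections in $\mathbf K$, and the tangentad $\mathsf{VLC}(\mathbb X,\mathbb T)$ of vertical linear connections of $(\mathbb X,\mathbb T)$ is the equifier $(\mathbb E^k_4,\mathbb T^k_4)$.
   Context: Composition $\circ$ is in the usual order; $F\varphi,\varphi_F$ denote whiskering. A limit in a hom-category of $\mathbf K$ is pointwise if preserved by precomposition with 1-morphisms. A tangentad $(\mathbb X,\mathbb T)$ in $\mathbf K$ is an object with a 1-morphism $T:\mathbb X\to\mathbb X$ and 2-morphisms $p:T\Rightarrow\mathrm{id}$, $z:\mathrm{id}\Rightarrow T$, $s:T_2\Rightarrow T$, $l:T\Rightarrow T^2$, $c:T^2\Rightarrow T^2$, where $T_n$ is the pointwise $n$-fold pullback of $p$ along itself (required to exist, preserved by all $T^m$), such that: $(p,z,s)$ is a commutative monoid over $\mathrm{id}_{\mathbb X}$; $Tp\circ l=z\circ p$, $l\circ z=Tz\circ z$, $l\circ s=Ts\circ\langle l\pi_1,l\pi_2\rangle$; $p_T\circ c=Tp$, $c\circ Tz=z_T$, $c\circ Ts=s_T\circ\langle c\,T\pi_1,c\,T\pi_2\rangle$;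 $Tl\circ l=l_T\circ l$, $c\circ l=l$, $c_T\circ Tc\circ l_T=Tl\circ c$; $c\circ c=\mathrm{id}$, $Tc\circ c_T\circ Tc=c_T\circ Tc\circ c_T$; and the square with top $Ts\circ\langle z_T\pi_1,l\pi_2\rangle:T_2\Rightarrow T^2$, left $p\pi_1$, right $Tp$, bottom $z$ is a pointwise pullback. Tangentads in $\mathsf{Cat}$ are tangent categories. A lax tangent morphism $(F,\alpha):(\mathbb X',\mathbb T')\to(\mathbb X,\mathbb T)$ is a 1-morphism with $\alpha:FT'\Rightarrow TF$ such that $p_F\circ\alpha=Fp'$, $\alpha\circ Fz'=z_F$, $\alpha\circ Fs'=s_F\circ\langle\alpha F\pi_1,\alpha F\pi_2\rangle$, $l_F\circ\alpha=T\alpha\circ\alpha_{T'}\circ Fl'$, $c_F\circ T\alpha\circ\alpha_{T'}=T\alpha\circ\alpha_{T'}\circ Fc'$ (strict if $\alpha=\mathrm{id}$). Tangent 2-morphisms satisfy $T\varphi\circ\alpha=\beta\circ\varphi_{T'}$. The hom-category $[\mathbb X',\mathbb T'\mid\mathbb X,\mathbb T]$ is a tangent category with $\bar T(F,\alpha)=(TF,c_F\circ T\alpha)$, $\bar T\varphi=T\varphi$, $\bar p_{(F,\alpha)}=p_F$, etc. In a tangent category, a tangent display map is $q:E\to M$ such that all pullbacks of $T^nq$ along maps $M'\to T^nM$ exist and are preserved by all $T^m$. A display differential bundle $\mathbf q=(q,z_q,s_q,l_q)$ is a tangent display map $q:E\to M$ with $z_q:M\to E$, $s_q:E_2=E\times_ME\to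 E$, $l_q:E\to TE$ such that $(q,z_q,s_q)$ is a commutative monoid over $M$; $Tq\circ l_q=z_M\circ q$, $l_q\circ z_q=Tz_q\circ z_M$, $l_q\circ s_q=Ts_q\circ\langle l_q\pi_1,l_q\pi_2\rangle$; $p_E\circ l_q=z_q\circ q$, $l_q\circ z_q=z_E\circ z_q$, $l_q\circ s_q=s_E\circ\langle l_q\pi_1,l_q\pi_2\rangle$; $Tl_q\circ l_q=l_E\circ l_q$; and the square with top $Ts_q\circ\langle l_q\pi_1,z_E\pi_2\rangle:E_2\to TE$, left $q\pi_1$, right $Tq$, bottom $z_M$ is a pullback. Linear morphisms $(f,g)$: $q'g=fq$, $Tg\circ l_q=l_{q'}\circ g$; tangent functor $\mathbf q\mapsto T\mathbf q=(Tq,Tz_q,Ts_q,c_E\circ Tl_q)$. In $[\mathbb X',\mathbb T'\mid\mathbb X,\mathbb T]$ it is pointwise if its projection stays a tangent display map after precomposition with any lax tangent morphism into $(\mathbb X',\mathbb T')$ and the pullbacks involved are pointwise; these form a tangent category $\mathsf{DB}_{\mathsf{pt}}[\mathbb X',\mathbb T'\mid\mathbb X,\mathbb T]$. $(\mathbb X,\mathbb T)$ admits the construction of display differential bundles if there are a tangentad $\mathsf{DB}(\mathbb X,\mathbb T)$, strict $\mathrm{Base},\mathrm{Tot}:\mathsf{DB}(\mathbb X,\mathbb T)\to(\mathbb X,\mathbb T)$ and a pointwise display differential bundle $\mathcal Q:\mathrm{Tot}\to\mathrm{Base}$ in $[\mathsf{DB}(\mathbb X,\mathbb T)\mid\mathbb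 X,\mathbb T]$ such that $H\mapsto\mathcal Q_H$ is an isomorphism of tangent categories $[\mathbb X',\mathbb T'\mid\mathsf{DB}(\mathbb X,\mathbb T)]\cong\mathsf{DB}_{\mathsf{pt}}[\mathbb X',\mathbb T'\mid\mathbb X,\mathbb T]$ for each tangentad $(\mathbb X',\mathbb T')$. A vertical linear connection on $\mathbf q$ is $k:TE\to E$ with $k\circ l_q=\mathrm{id}_E$, $q\circ k=q\circ p_E$, $l_q\circ k=Tk\circ l_E$, $l_q\circ k=Tk\circ c_E\circ Tl_q$. $\mathsf{VLC}[\mathbb X',\mathbb T'\mid\mathbb X,\mathbb T]$ is the tangent category of pairs $(\mathbf q,k)$ with $\mathbf q$ a pointwise display differential bundle in $[\mathbb X',\mathbb T'\mid\mathbb X,\mathbb T]$ and $k$ a vertical linear connection on it, morphisms being linear $(f,g)$ with $g\circ k=k'\circ Tg$, and tangent functor $(\mathbf q,k)\mapsto(T\mathbf q,Tk\circ c_E)$. $(\mathbb X,\mathbb T)$ admits the construction of vertical linear connections if there are a tangentad $\mathsf{VLC}(\mathbb X,\mathbb T)$ and an object of $\mathsf{VLC}[\mathsf{VLC}(\mathbb X,\mathbb T)\mid\mathbb X,\mathbb T]$ such that precomposition is an isomorphism of tangent categories $[\mathbb X',\mathbb T'\mid\mathsf{VLC}(\mathbb X,\mathbb T)]\cong\mathsf{VLC}[\mathbb X',\mathbb T'\mid\mathbb X,\mathbb T]$ for each tangentad $(\mathbb X',\mathbb T')$. Inserter and equifiers. $\mathbb I^k_0$ is the inserter in $\mathbf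 K$ of $T\circ\mathrm{Tot},\mathrm{Tot}:\mathsf{DB}(\mathbb X,\mathbb T)\to\mathbb X$, with universal $V_0:\mathbb I^k_0\to\mathsf{DB}(\mathbb X,\mathbb T)$ and $K_0:T\circ\mathrm{Tot}\circ V_0\Rightarrow\mathrm{Tot}\circ V_0$. Then successively, for $i=1,\dots,4$, $W_i:\mathbb E^k_i\to\mathbb E^k_{i-1}$ (with $\mathbb E^k_0:=\mathbb I^k_0$) is an equifier in $\mathbf K$ of a pair of 2-morphisms, and $V_i=V_{i-1}\circ W_i$, $K_i=(K_{i-1})_{W_i}$: the pairs are, for $i=1$, $K_0\circ\mathcal l_{V_0}$ and $\mathrm{id}_{\mathrm{Tot}\circ V_0}$; for $i=2$, $\mathcal q_{V_1}\circ K_1$ and $\mathcal q_{V_1}\circ p_{\mathrm{Tot}\circ V_1}$; for $i=3$, $\mathcal l_{V_2}\circ K_2$ and $TK_2\circ l_{\mathrm{Tot}\circ V_2}$; for $i=4$, $\mathcal l_{V_3}\circ K_3$ and $TK_3\circ c_{\mathrm{Tot}\circ V_3}\circ T\mathcal l_{V_3}$. They carry the induced tangent structures $\mathbb T^k_0,\dots,\mathbb T^k_4$ for which $V_0,W_1,\dots,W_4$ are strict tangent morphisms and $K_0$ is a tangent 2-morphism. *)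

theory Defs
  imports Main
begin

section \<open>Categories, pullbacks and tangent structures on categories\<close>

record ('o, 'a) cat =
  obj :: "'o set"
  hom :: "'o \<Rightarrow> 'o \<Rightarrow> 'a set"
  idm :: "'o \<Rightarrow> 'a"
  cmp :: "'a \<Rightarrow> 'a \<Rightarrow> 'a"  (infixr "\<cdot>\<index>" 70)

text \<open>\<open>P\<close> with legs \<open>u : P \<rightarrow> A\<close> and \<open>v : P \<rightarrow> B\<close> is a pullback of \<open>f : A \<rightarrow> D\<close> and \<open>g : B \<rightarrow> D\<close>.\<close>

definition is_pb ::
  "('o, 'a, 'z) cat_scheme \<Rightarrow> 'o \<Rightarrow> 'o \<Rightarrow> 'o \<Rightarrow> 'a \<Rightarrow> 'a \<Rightarrow> 'o \<Rightarrow> 'a \<Rightarrow> 'a \<Rightarrow> bool" where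
  "is_pb C A B D f g P u v \<longleftrightarrow>
     A \<in> obj C \<and> B \<in> obj C \<and> D \<in> obj C \<and> f \<in> hom C A D \<and> g \<in> hom C B D \<and>
     P \<in> obj C \<and> u \<in> hom C P A \<and> v \<in> hom C P B \<and> f \<cdot>\<^bsub>C\<^esub> u = g \<cdot>\<^bsub>C\<^esub> v \<and>
     (\<forall>Z\<in>obj C. \<forall>a\<in>hom C Z A. \<forall>b\<in>hom C Z B. f \<cdot>\<^bsub>C\<^esub> a = g \<cdot>\<^bsub>C\<^esub> b \<longrightarrow>
        (\<exists>!h. h \<in> hom C Z P \<and> u \<cdot>\<^bsub>C\<^esub> h = a \<and> v \<cdot>\<^bsub>C\<^esub> h = b))"

text \<open>\<open>P\<close> with legs \<open>p 0, \<dots>, p (n - 1)\<close> is the pullback of \<open>n \<ge> 1\<close> copies of \<open>f : A \<rightarrow> B\<close>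
  along each other.\<close>

definition is_nfold ::
  "('o, 'a, 'z) cat_scheme \<Rightarrow> nat \<Rightarrow> 'o \<Rightarrow> 'o \<Rightarrow> 'a \<Rightarrow> 'o \<Rightarrow> (nat \<Rightarrow> 'a) \<Rightarrow> bool" where
  "is_nfold C n A B f P p \<longleftrightarrow>
     n \<ge> 1 \<and> A \<in> obj C \<and> B \<in> obj C \<and> f \<in> hom C A B \<and>
     P \<in> obj C \<and> (\<forall>i<n. p i \<in> hom C P A) \<and> (\<forall>i<n. \<forall>j<n. f \<cdot>\<^bsub>C\<^esub> p i = f \<cdot>\<^bsub>C\<^esub> p j) \<and>
     (\<forall>Z\<in>obj C. \<forall>a. (\<forall>i<n. a i \<in> hom C Z A) \<and> (\<forall>i<n. \<forall>j<n. f \<cdot>\<^bsub>C\<^esub> a i = f \<cdot>\<^bsub>C\<^esub> a j) \<longrightarrow>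
        (\<exists>!h. h \<in> hom C Z P \<and> (\<forall>i<n. p i \<cdot>\<^bsub>C\<^esub> h = a i)))"

text \<open>A choice of kernel pairs, fixed once and for all. It gives meaning to \<open>T\<^sub>2\<close> and to
  \<open>E\<^sub>2 = E \<times>\<^sub>M E\<close> as domains of the additions, so that neither is part of the data of a tangent
  structure or of a differential bundle. Whenever a functor is applied to a chosen pullback, the
  addition is transported along the comparison with the chosen one.\<close>

definition kpair :: "('o, 'a, 'z) cat_scheme \<Rightarrow> 'o \<Rightarrow> 'o \<Rightarrow> 'a \<Rightarrow> 'o \<times> 'a \<times> 'a" where
  "kpair C A B f = (SOME (P, u, v). is_pb C A A B f f P u v)"

definition kp0 :: "('o, 'a, 'z) cat_scheme \<Rightarrow> 'o \<Rightarrow> 'o \<Rightarrow> 'a \<Rightarrow> 'o" where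
  "kp0 C A B f = fst (kpair C A B f)"

definition kp1 :: "('o, 'a, 'z) cat_scheme \<Rightarrow> 'o \<Rightarrow> 'o \<Rightarrow> 'a \<Rightarrow> 'a" where
  "kp1 C A B f = fst (snd (kpair C A B f))"

definition kp2 :: "('o, 'a, 'z) cat_scheme \<Rightarrow> 'o \<Rightarrow> 'o \<Rightarrow> 'a \<Rightarrow> 'a" where
  "kp2 C A B f = snd (snd (kpair C A B f))"

text \<open>The induced map \<open>\<langle>a, b\<rangle> : Z \<rightarrow> P\<close> into a pullback \<open>P\<close> with legs \<open>u\<close>, \<open>v\<close>.\<close>

definition pair ::
  "('o, 'a, 'z) cat_scheme \<Rightarrow> 'o \<Rightarrow> 'o \<Rightarrow> 'a \<Rightarrow> 'a \<Rightarrow> 'a \<Rightarrow> 'a \<Rightarrow> 'a" where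
  "pair C Z P u v a b = (THE h. h \<in> hom C Z P \<and> u \<cdot>\<^bsub>C\<^esub> h = a \<and> v \<cdot>\<^bsub>C\<^esub> h = b)"

text \<open>The sum \<open>s \<circ> \<langle>a, b\<rangle>\<close> of two maps \<open>a, b : Z \<rightarrow> E\<close> over \<open>M\<close>, for \<open>q : E \<rightarrow> M\<close> and
  \<open>s : E \<times>\<^sub>M E \<rightarrow> E\<close>.\<close>

definition plus_over ::
  "('o, 'a, 'z) cat_scheme \<Rightarrow> 'o \<Rightarrow> 'o \<Rightarrow> 'a \<Rightarrow> 'a \<Rightarrow> 'o \<Rightarrow> 'a \<Rightarrow> 'a \<Rightarrow> 'a" where
  "plus_over C E M q s Z a b =
     s \<cdot>\<^bsub>C\<^esub> pair C Z (kp0 C E M q) (kp1 C E M q) (kp2 C E M q) a b"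

definition comm_monoid_over ::
  "('o, 'a, 'z) cat_scheme \<Rightarrow> 'o \<Rightarrow> 'o \<Rightarrow> 'a \<Rightarrow> 'a \<Rightarrow> 'a \<Rightarrow> bool" where
  "comm_monoid_over C E M q z s \<longleftrightarrow>
     E \<in> obj C \<and> M \<in> obj C \<and> q \<in> hom C E M \<and> z \<in> hom C M E \<and>
     is_pb C E E M q q (kp0 C E M q) (kp1 C E M q) (kp2 C E M q) \<and>
     s \<in> hom C (kp0 C E M q) E \<and>
     q \<cdot>\<^bsub>C\<^esub> z = idm C M \<and> q \<cdot>\<^bsub>C\<^esub> s = q \<cdot>\<^bsub>C\<^esub> kp1 C E M q \<and>
     (\<forall>Z\<in>obj C. \<forall>a\<in>hom C Z E.
        plus_over C E M q s Z (z \<cdot>\<^bsub>C\<^esub> q \<cdot>\<^bsub>C\<^esub> a) a = a) \<and>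
     (\<forall>Z\<in>obj C. \<forall>a\<in>hom C Z E. \<forall>b\<in>hom C Z E. q \<cdot>\<^bsub>C\<^esub> a = q \<cdot>\<^bsub>C\<^esub> b \<longrightarrow>
        plus_over C E M q s Z a b = plus_over C E M q s Z b a) \<and>
     (\<forall>Z\<in>obj C. \<forall>a\<in>hom C Z E. \<forall>b\<in>hom C Z E. \<forall>c\<in>hom C Z E.
        q \<cdot>\<^bsub>C\<^esub> a = q \<cdot>\<^bsub>C\<^esub> b \<and> q \<cdot>\<^bsub>C\<^esub> b = q \<cdot>\<^bsub>C\<^esub> c \<longrightarrow>
        plus_over C E M q s Z (plus_over C E M q s Z a b) c =
        plus_over C E M q s Z a (plus_over C E M q s Z b c))"

text \<open>Categories with the data of a tangent structure; \<open>ts A\<close> has as domain the chosen kernel pair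
  \<open>T\<^sub>2 A\<close> of \<open>tp A : T A \<rightarrow> A\<close>. The record is only used for the hom-categories of tangentads and for
  the categories of differential bundles and of vertical linear connections in them, which inherit
  the tangent category axioms from the target tangentad.\<close>

record ('o, 'a) tcat = "('o, 'a) cat" +
  tob :: "'o \<Rightarrow> 'o"
  tar :: "'a \<Rightarrow> 'a"
  tp :: "'o \<Rightarrow> 'a"
  tz :: "'o \<Rightarrow> 'a"
  ts :: "'o \<Rightarrow> 'a"
  tl :: "'o \<Rightarrow> 'a"
  tc :: "'o \<Rightarrow> 'a"

text \<open>\<open>s\<^sub>A \<circ> \<langle>a, b\<rangle>\<close> for \<open>a, b : Z \<rightarrow> T A\<close> with \<open>p\<^sub>A \<circ> a = p\<^sub>A \<circ> b\<close>.\<close>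

definition tplus :: "('o, 'a, 'z) tcat_scheme \<Rightarrow> 'o \<Rightarrow> 'o \<Rightarrow> 'a \<Rightarrow> 'a \<Rightarrow> 'a" where
  "tplus C A Z a b = plus_over C (tob C A) A (tp C A) (ts C A) Z a b"

text \<open>Isomorphism of tangent categories: an isomorphism of categories, given by \<open>Fo\<close> on objects and
  \<open>Fa\<close> on morphisms, which is a strict tangent morphism.\<close>

definition tangent_iso ::
  "('o, 'a, 'y) tcat_scheme \<Rightarrow> ('p, 'b, 'z) tcat_scheme \<Rightarrow> ('o \<Rightarrow> 'p) \<Rightarrow> ('a \<Rightarrow> 'b) \<Rightarrow> bool" where
  "tangent_iso C D Fo Fa \<longleftrightarrow>
     bij_betw Fo (obj C) (obj D) \<and>
     (\<forall>A\<in>obj C. \<forall>B\<in>obj C. bij_betw Fa (hom C A B) (hom D (Fo A) (Fo B))) \<and>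
     (\<forall>A\<in>obj C. Fa (idm C A) = idm D (Fo A)) \<and>
     (\<forall>A\<in>obj C. \<forall>B\<in>obj C. \<forall>E\<in>obj C. \<forall>f\<in>hom C A B. \<forall>g\<in>hom C B E.
        Fa (g \<cdot>\<^bsub>C\<^esub> f) = Fa g \<cdot>\<^bsub>D\<^esub> Fa f) \<and>
     (\<forall>A\<in>obj C. Fo (tob C A) = tob D (Fo A)) \<and>
     (\<forall>A\<in>obj C. \<forall>B\<in>obj C. \<forall>f\<in>hom C A B. Fa (tar C f) = tar D (Fa f)) \<and>
     (\<forall>A\<in>obj C. Fa (tp C A) = tp D (Fo A) \<and> Fa (tz C A) = tz D (Fo A) \<and>
        Fa (tl C A) = tl D (Fo A) \<and> Fa (tc C A) = tc D (Fo A) \<and>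
        Fa (ts C A) =
          tplus D (Fo A) (Fo (kp0 C (tob C A) A (tp C A)))
            (Fa (kp1 C (tob C A) A (tp C A))) (Fa (kp2 C (tob C A) A (tp C A))))"


section \<open>Differential bundles and vertical linear connections in a tangent category\<close>

definition tangent_display :: "('o, 'a, 'z) tcat_scheme \<Rightarrow> 'o \<Rightarrow> 'o \<Rightarrow> 'a \<Rightarrow> bool" where
  "tangent_display C E M q \<longleftrightarrow>
     E \<in> obj C \<and> M \<in> obj C \<and> q \<in> hom C E M \<and>
     (\<forall>n. \<forall>N\<in>obj C. \<forall>f\<in>hom C N ((tob C ^^ n) M).
        \<exists>P u v. \<forall>m.
          is_pb C ((tob C ^^ m) N) ((tob C ^^ (m + n)) E) ((tob C ^^ (m + n)) M)
            ((tar C ^^ m) f) ((tar C ^^ (m + n)) q)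
            ((tob C ^^ m) P) ((tar C ^^ m) u) ((tar C ^^ m) v))"

text \<open>A bundle \<open>(q, z, s, l)\<close> with base \<open>dM\<close> and total object \<open>dE\<close>.\<close>

record ('o, 'a) dbun =
  dM :: 'o
  dE :: 'o
  dq :: 'a
  dz :: 'a
  ds :: 'a
  dl :: 'a

definition Esq :: "('o, 'a, 'z) cat_scheme \<Rightarrow> ('o, 'a) dbun \<Rightarrow> 'o" where
  "Esq C B = kp0 C (dE B) (dM B) (dq B)"

definition pi1 :: "('o, 'a, 'z) cat_scheme \<Rightarrow> ('o, 'a) dbun \<Rightarrow> 'a" where
  "pi1 C B = kp1 C (dE B) (dM B) (dq B)"

definition pi2 :: "('o, 'a, 'z) cat_scheme \<Rightarrow> ('o, 'a) dbun \<Rightarrow> 'a" where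
  "pi2 C B = kp2 C (dE B) (dM B) (dq B)"

text \<open>The map \<open>\<langle>a, b\<rangle> : E\<^sub>2 \<rightarrow> T E\<^sub>2\<close>.\<close>

definition pairTE2 :: "('o, 'a, 'z) tcat_scheme \<Rightarrow> ('o, 'a) dbun \<Rightarrow> 'a \<Rightarrow> 'a \<Rightarrow> 'a" where
  "pairTE2 C B a b =
     pair C (Esq C B) (tob C (Esq C B)) (tar C (pi1 C B)) (tar C (pi2 C B)) a b"

text \<open>The top edge of the universality square.\<close>

definition vlift :: "('o, 'a, 'z) tcat_scheme \<Rightarrow> ('o, 'a) dbun \<Rightarrow> 'a" where
  "vlift C B =
     tar C (ds B) \<cdot>\<^bsub>C\<^esub> pairTE2 C B (dl B \<cdot>\<^bsub>C\<^esub> pi1 C B) (tz C (dE B) \<cdot>\<^bsub>C\<^esub> pi2 C B)"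

definition display_bundle :: "('o, 'a, 'z) tcat_scheme \<Rightarrow> ('o, 'a) dbun \<Rightarrow> bool" where
  "display_bundle C B \<longleftrightarrow>
     (let E = dE B; M = dM B; q = dq B; z = dz B; s = ds B; l = dl B in
      tangent_display C E M q \<and>
      comm_monoid_over C E M q z s \<and>
      l \<in> hom C E (tob C E) \<and>
      tar C q \<cdot>\<^bsub>C\<^esub> l = tz C M \<cdot>\<^bsub>C\<^esub> q \<and>
      l \<cdot>\<^bsub>C\<^esub> z = tar C z \<cdot>\<^bsub>C\<^esub> tz C M \<and>
      l \<cdot>\<^bsub>C\<^esub> s = tar C s \<cdot>\<^bsub>C\<^esub> pairTE2 C B (l \<cdot>\<^bsub>C\<^esub> pi1 C B) (l \<cdot>\<^bsub>C\<^esub> pi2 C B) \<and>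
      tp C E \<cdot>\<^bsub>C\<^esub> l = z \<cdot>\<^bsub>C\<^esub> q \<and>
      l \<cdot>\<^bsub>C\<^esub> z = tz C E \<cdot>\<^bsub>C\<^esub> z \<and>
      l \<cdot>\<^bsub>C\<^esub> s = tplus C E (Esq C B) (l \<cdot>\<^bsub>C\<^esub> pi1 C B) (l \<cdot>\<^bsub>C\<^esub> pi2 C B) \<and>
      tar C l \<cdot>\<^bsub>C\<^esub> l = tl C E \<cdot>\<^bsub>C\<^esub> l \<and>
      is_pb C M (tob C E) (tob C M) (tz C M) (tar C q)
        (Esq C B) (q \<cdot>\<^bsub>C\<^esub> pi1 C B) (vlift C B))"

definition linear_morphisms ::
  "('o, 'a, 'z) tcat_scheme \<Rightarrow> ('o, 'a) dbun \<Rightarrow> ('o, 'a) dbun \<Rightarrow> ('a \<times> 'a) set" where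
  "linear_morphisms C A B =
     {(f, g). f \<in> hom C (dM A) (dM B) \<and> g \<in> hom C (dE A) (dE B) \<and>
        dq B \<cdot>\<^bsub>C\<^esub> g = f \<cdot>\<^bsub>C\<^esub> dq A \<and> tar C g \<cdot>\<^bsub>C\<^esub> dl A = dl B \<cdot>\<^bsub>C\<^esub> g}"

text \<open>The tangent bundle \<open>T\<^bold>q = (T q, T z, T s, c \<circ> T l)\<close>, where \<open>T s : T E\<^sub>2 \<rightarrow> T E\<close> is
  precomposed with the comparison \<open>(T E)\<^sub>2 \<rightarrow> T E\<^sub>2\<close>.\<close>

definition tangent_bundle :: "('o, 'a, 'z) tcat_scheme \<Rightarrow> ('o, 'a) dbun \<Rightarrow> ('o, 'a) dbun" where
  "tangent_bundle C B =
     (let TE = tob C (dE B); TM = tob C (dM B); Tq = tar C (dq B) in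
      \<lparr>dM = TM, dE = TE, dq = Tq, dz = tar C (dz B),
       ds = tar C (ds B) \<cdot>\<^bsub>C\<^esub>
              pair C (kp0 C TE TM Tq) (tob C (Esq C B)) (tar C (pi1 C B)) (tar C (pi2 C B))
                (kp1 C TE TM Tq) (kp2 C TE TM Tq),
       dl = tc C (dE B) \<cdot>\<^bsub>C\<^esub> tar C (dl B)\<rparr>)"

text \<open>The category on a set \<open>S\<close> of bundles in \<open>C\<close>, with linear morphisms, and its componentwise
  tangent structure.\<close>

definition bundle_cat ::
  "('o, 'a, 'z) tcat_scheme \<Rightarrow> ('o, 'a) dbun set \<Rightarrow> (('o, 'a) dbun, 'a \<times> 'a) cat" where
  "bundle_cat C S =
     \<lparr>obj = S, hom = linear_morphisms C,
      idm = (\<lambda>B. (idm C (dM B), idm C (dE B))),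
      cmp = (\<lambda>(f', g') (f, g). (f' \<cdot>\<^bsub>C\<^esub> f, g' \<cdot>\<^bsub>C\<^esub> g))\<rparr>"

definition bundle_tcat ::
  "('o, 'a, 'z) tcat_scheme \<Rightarrow> ('o, 'a) dbun set \<Rightarrow> (('o, 'a) dbun, 'a \<times> 'a) tcat" where
  "bundle_tcat C S =
     (let D = bundle_cat C S; p = (\<lambda>B. (tp C (dM B), tp C (dE B))) in
      \<lparr>obj = obj D, hom = hom D, idm = idm D, cmp = cmp D,
       tob = tangent_bundle C,
       tar = (\<lambda>(f, g). (tar C f, tar C g)),
       tp = p,
       tz = (\<lambda>B. (tz C (dM B), tz C (dE B))),
       ts = (\<lambda>B. let T2 = kp0 D (tangent_bundle C B) B (p B);
                     k1 = kp1 D (tangent_bundle C B) B (p B);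
                     k2 = kp2 D (tangent_bundle C B) B (p B)
                 in (tplus C (dM B) (dM T2) (fst k1) (fst k2),
                     tplus C (dE B) (dE T2) (snd k1) (snd k2))),
       tl = (\<lambda>B. (tl C (dM B), tl C (dE B))),
       tc = (\<lambda>B. (tc C (dM B), tc C (dE B)))\<rparr>)"

definition vertical_linear_connection ::
  "('o, 'a, 'z) tcat_scheme \<Rightarrow> ('o, 'a) dbun \<Rightarrow> 'a \<Rightarrow> bool" where
  "vertical_linear_connection C B k \<longleftrightarrow>
     k \<in> hom C (tob C (dE B)) (dE B) \<and>
     k \<cdot>\<^bsub>C\<^esub> dl B = idm C (dE B) \<and>
     dq B \<cdot>\<^bsub>C\<^esub> k = dq B \<cdot>\<^bsub>C\<^esub> tp C (dE B) \<and>
     dl B \<cdot>\<^bsub>C\<^esub> k = tar C k \<cdot>\<^bsub>C\<^esub> tl C (dE B) \<and>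
     dl B \<cdot>\<^bsub>C\<^esub> k = tar C k \<cdot>\<^bsub>C\<^esub> tc C (dE B) \<cdot>\<^bsub>C\<^esub> tar C (dl B)"

definition tangent_conn ::
  "('o, 'a, 'z) tcat_scheme \<Rightarrow> ('o, 'a) dbun \<times> 'a \<Rightarrow> ('o, 'a) dbun \<times> 'a" where
  "tangent_conn C = (\<lambda>(B, k). (tangent_bundle C B, tar C k \<cdot>\<^bsub>C\<^esub> tc C (dE B)))"

definition conn_cat ::
  "('o, 'a, 'z) tcat_scheme \<Rightarrow> ('o, 'a) dbun set \<Rightarrow> (('o, 'a) dbun \<times> 'a, 'a \<times> 'a) cat" where
  "conn_cat C S =
     \<lparr>obj = {(B, k). B \<in> S \<and> vertical_linear_connection C B k},
      hom = (\<lambda>(A, j) (B, k).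
        {(f, g). (f, g) \<in> linear_morphisms C A B \<and> g \<cdot>\<^bsub>C\<^esub> j = k \<cdot>\<^bsub>C\<^esub> tar C g}),
      idm = (\<lambda>(B, k). (idm C (dM B), idm C (dE B))),
      cmp = (\<lambda>(f', g') (f, g). (f' \<cdot>\<^bsub>C\<^esub> f, g' \<cdot>\<^bsub>C\<^esub> g))\<rparr>"

definition conn_tcat ::
  "('o, 'a, 'z) tcat_scheme \<Rightarrow> ('o, 'a) dbun set \<Rightarrow> (('o, 'a) dbun \<times> 'a, 'a \<times> 'a) tcat" where
  "conn_tcat C S =
     (let D = conn_cat C S; p = (\<lambda>(B, k). (tp C (dM B), tp C (dE B))) in
      \<lparr>obj = obj D, hom = hom D, idm = idm D, cmp = cmp D,
       tob = tangent_conn C,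
       tar = (\<lambda>(f, g). (tar C f, tar C g)),
       tp = p,
       tz = (\<lambda>(B, k). (tz C (dM B), tz C (dE B))),
       ts = (\<lambda>A. let T2 = fst (kp0 D (tangent_conn C A) A (p A));
                     k1 = kp1 D (tangent_conn C A) A (p A);
                     k2 = kp2 D (tangent_conn C A) A (p A)
                 in (tplus C (dM (fst A)) (dM T2) (fst k1) (fst k2),
                     tplus C (dE (fst A)) (dE T2) (snd k1) (snd k2))),
       tl = (\<lambda>(B, k). (tl C (dM B), tl C (dE B))),
       tc = (\<lambda>(B, k). (tc C (dM B), tc C (dE B)))\<rparr>)"

text \<open>In the tangent categories \<open>D\<close> of bundles or connections in \<open>C\<close>, the pullbacks \<open>T\<^sub>n\<close> exist and
  are computed in \<open>C\<close> on base objects (\<open>b\<close>) and on total objects (\<open>t\<close>), like all of the tangent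
  structure of \<open>D\<close>. This is what makes \<open>D\<close> a tangent category: the remaining axioms are equations
  and pullbacks that hold componentwise.\<close>

definition componentwise_Tn ::
  "('o, 'a, 'y) tcat_scheme \<Rightarrow> ('d, 'a \<times> 'a, 'z) tcat_scheme \<Rightarrow> ('d \<Rightarrow> 'o) \<Rightarrow> ('d \<Rightarrow> 'o) \<Rightarrow> bool"
  where
  "componentwise_Tn C D b t \<longleftrightarrow>
     (\<forall>A\<in>obj D. \<forall>n\<ge>1. \<exists>P p.
        is_nfold D n (tob D A) A (tp D A) P p \<and>
        is_nfold C n (tob C (b A)) (b A) (tp C (b A)) (b P) (\<lambda>i. fst (p i)) \<and>
        is_nfold C n (tob C (t A)) (t A) (tp C (t A)) (t P) (\<lambda>i. snd (p i)))"


section \<open>2-categories\<close>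

record ('x, 'm, 'c) twocat =
  cells0 :: "'x set"
  cells1 :: "'m set"
  dom1 :: "'m \<Rightarrow> 'x"
  cod1 :: "'m \<Rightarrow> 'x"
  cells2 :: "'c set"
  dom2 :: "'c \<Rightarrow> 'm"
  cod2 :: "'c \<Rightarrow> 'm"
  id1 :: "'x \<Rightarrow> 'm"
  comp1 :: "'m \<Rightarrow> 'm \<Rightarrow> 'm"  (infixr "\<odot>\<index>" 75)
  id2 :: "'m \<Rightarrow> 'c"
  vcomp :: "'c \<Rightarrow> 'c \<Rightarrow> 'c"  (infixr "\<bullet>\<index>" 65)
  hcomp :: "'c \<Rightarrow> 'c \<Rightarrow> 'c"  (infixr "\<star>\<index>" 70)

definition hom1 :: "('x, 'm, 'c) twocat \<Rightarrow> 'x \<Rightarrow> 'x \<Rightarrow> 'm set" where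
  "hom1 K X Y = {F \<in> cells1 K. dom1 K F = X \<and> cod1 K F = Y}"

definition hom2 :: "('x, 'm, 'c) twocat \<Rightarrow> 'm \<Rightarrow> 'm \<Rightarrow> 'c set" where
  "hom2 K F G = {\<phi> \<in> cells2 K. dom2 K \<phi> = F \<and> cod2 K \<phi> = G}"

text \<open>Whiskering: \<open>F\<phi>\<close> is \<open>F \<rhd> \<phi>\<close> and \<open>\<phi>\<^sub>F\<close> is \<open>\<phi> \<lhd> F\<close>.\<close>

definition whl :: "('x, 'm, 'c) twocat \<Rightarrow> 'm \<Rightarrow> 'c \<Rightarrow> 'c"  (infixr "\<rhd>\<index>" 75) where
  "whl K F \<phi> = id2 K F \<star>\<^bsub>K\<^esub> \<phi>"

definition whr :: "('x, 'm, 'c) twocat \<Rightarrow> 'c \<Rightarrow> 'm \<Rightarrow> 'c"  (infixl "\<lhd>\<index>" 76) where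
  "whr K \<phi> F = \<phi> \<star>\<^bsub>K\<^esub> id2 K F"

locale two_category =
  fixes K :: "('x, 'm, 'c) twocat" (structure)
  assumes cells1_cells0: "F \<in> cells1 K \<Longrightarrow> dom1 K F \<in> cells0 K \<and> cod1 K F \<in> cells0 K"
    and cells2_cells1: "\<phi> \<in> cells2 K \<Longrightarrow>
      dom2 K \<phi> \<in> cells1 K \<and> cod2 K \<phi> \<in> cells1 K \<and>
      dom1 K (dom2 K \<phi>) = dom1 K (cod2 K \<phi>) \<and> cod1 K (dom2 K \<phi>) = cod1 K (cod2 K \<phi>)"
    and id1_hom: "X \<in> cells0 K \<Longrightarrow> id1 K X \<in> hom1 K X X"
    and comp1_hom: "F \<in> hom1 K X Y \<Longrightarrow> G \<in> hom1 K Y Z \<Longrightarrow> G \<odot> F \<in> hom1 K X Z"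
    and comp1_id_left: "F \<in> hom1 K X Y \<Longrightarrow> id1 K Y \<odot> F = F"
    and comp1_id_right: "F \<in> hom1 K X Y \<Longrightarrow> F \<odot> id1 K X = F"
    and comp1_assoc: "F \<in> hom1 K W X \<Longrightarrow> G \<in> hom1 K X Y \<Longrightarrow> H \<in> hom1 K Y Z \<Longrightarrow>
      (H \<odot> G) \<odot> F = H \<odot> (G \<odot> F)"
    and id2_hom: "F \<in> cells1 K \<Longrightarrow> id2 K F \<in> hom2 K F F"
    and vcomp_hom: "\<phi> \<in> hom2 K F G \<Longrightarrow> \<psi> \<in> hom2 K G H \<Longrightarrow> \<psi> \<bullet> \<phi> \<in> hom2 K F H"
    and vcomp_id_left: "\<phi> \<in> hom2 K F G \<Longrightarrow> id2 K G \<bullet> \<phi> = \<phi>"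
    and vcomp_id_right: "\<phi> \<in> hom2 K F G \<Longrightarrow> \<phi> \<bullet> id2 K F = \<phi>"
    and vcomp_assoc: "\<phi> \<in> hom2 K F G \<Longrightarrow> \<psi> \<in> hom2 K G H \<Longrightarrow> \<chi> \<in> hom2 K H I \<Longrightarrow>
      (\<chi> \<bullet> \<psi>) \<bullet> \<phi> = \<chi> \<bullet> (\<psi> \<bullet> \<phi>)"
    and hcomp_hom: "F \<in> hom1 K X Y \<Longrightarrow> G \<in> hom1 K Y Z \<Longrightarrow>
      \<phi> \<in> hom2 K F F' \<Longrightarrow> \<psi> \<in> hom2 K G G' \<Longrightarrow> \<psi> \<star> \<phi> \<in> hom2 K (G \<odot> F) (G' \<odot> F')"
    and hcomp_id2: "F \<in> hom1 K X Y \<Longrightarrow> G \<in> hom1 K Y Z \<Longrightarrow> id2 K G \<star> id2 K F = id2 K (G \<odot> F)"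
    and hcomp_id_left: "F \<in> hom1 K X Y \<Longrightarrow> \<phi> \<in> hom2 K F F' \<Longrightarrow> id2 K (id1 K Y) \<star> \<phi> = \<phi>"
    and hcomp_id_right: "F \<in> hom1 K X Y \<Longrightarrow> \<phi> \<in> hom2 K F F' \<Longrightarrow> \<phi> \<star> id2 K (id1 K X) = \<phi>"
    and hcomp_assoc: "F \<in> hom1 K W X \<Longrightarrow> G \<in> hom1 K X Y \<Longrightarrow> H \<in> hom1 K Y Z \<Longrightarrow>
      \<phi> \<in> hom2 K F F' \<Longrightarrow> \<psi> \<in> hom2 K G G' \<Longrightarrow> \<chi> \<in> hom2 K H H' \<Longrightarrow>
      (\<chi> \<star> \<psi>) \<star> \<phi> = \<chi> \<star> (\<psi> \<star> \<phi>)"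
    and interchange: "F \<in> hom1 K X Y \<Longrightarrow> G \<in> hom1 K Y Z \<Longrightarrow>
      \<phi> \<in> hom2 K F F' \<Longrightarrow> \<phi>' \<in> hom2 K F' F'' \<Longrightarrow> \<psi> \<in> hom2 K G G' \<Longrightarrow> \<psi>' \<in> hom2 K G' G'' \<Longrightarrow>
      (\<psi>' \<bullet> \<psi>) \<star> (\<phi>' \<bullet> \<phi>) = (\<psi>' \<star> \<phi>') \<bullet> (\<psi> \<star> \<phi>)"


section \<open>Tangentads\<close>

record ('x, 'm, 'c) tstruct =
  carr :: 'x
  TT :: 'm
  pp :: 'c
  zz :: 'c
  ss :: 'c
  ll :: 'c
  cc :: 'c

context two_category
begin

definition homcat :: "'x \<Rightarrow> 'x \<Rightarrow> ('m, 'c) cat" where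
  "homcat X Y = \<lparr>obj = hom1 K X Y, hom = hom2 K, idm = id2 K, cmp = vcomp K\<rparr>"

definition T2 :: "('x, 'm, 'c) tstruct \<Rightarrow> 'm" where
  "T2 X = kp0 (homcat (carr X) (carr X)) (TT X) (id1 K (carr X)) (pp X)"

definition \<pi>1 :: "('x, 'm, 'c) tstruct \<Rightarrow> 'c" where
  "\<pi>1 X = kp1 (homcat (carr X) (carr X)) (TT X) (id1 K (carr X)) (pp X)"

definition \<pi>2 :: "('x, 'm, 'c) tstruct \<Rightarrow> 'c" where
  "\<pi>2 X = kp2 (homcat (carr X) (carr X)) (TT X) (id1 K (carr X)) (pp X)"

definition Tpow :: "('x, 'm, 'c) tstruct \<Rightarrow> nat \<Rightarrow> 'm" where
  "Tpow X m = ((\<lambda>F. TT X \<odot> F) ^^ m) (id1 K (carr X))"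

text \<open>\<open>\<langle>a, b\<rangle> : A \<Rightarrow> T T\<^sub>2\<close> (with respect to \<open>T \<pi>\<^sub>i\<close>), and \<open>\<langle>a, b\<rangle> : A \<Rightarrow> T\<^sub>2 F\<close> (with respect to
  \<open>\<pi>\<^sub>i\<^sub>F\<close>) for \<open>F : Y \<rightarrow> X\<close>.\<close>

definition pair_TT2 :: "('x, 'm, 'c) tstruct \<Rightarrow> 'm \<Rightarrow> 'c \<Rightarrow> 'c \<Rightarrow> 'c" where
  "pair_TT2 X A a b =
     pair (homcat (carr X) (carr X)) A (TT X \<odot> T2 X) (TT X \<rhd> \<pi>1 X) (TT X \<rhd> \<pi>2 X) a b"

definition pair_T2 :: "'x \<Rightarrow> ('x, 'm, 'c) tstruct \<Rightarrow> 'm \<Rightarrow> 'm \<Rightarrow> 'c \<Rightarrow> 'c \<Rightarrow> 'c" where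
  "pair_T2 Y X F A a b =
     pair (homcat Y (carr X)) A (T2 X \<odot> F) (\<pi>1 X \<lhd> F) (\<pi>2 X \<lhd> F) a b"

text \<open>For each \<open>n\<close>, the \<open>n\<close>-fold pullback \<open>T\<^sub>n\<close> of \<open>p\<close> along itself exists pointwise and is preserved
  by all \<open>T\<^sup>m\<close>: each \<open>T\<^sup>m T\<^sub>n\<close> is again a pointwise pullback (the case \<open>m = 0\<close> being \<open>T\<^sub>n\<close> itself).
  Pointwise means preserved by precomposition with all 1-morphisms \<open>G\<close>.\<close>

definition has_Tn :: "('x, 'm, 'c) tstruct \<Rightarrow> bool" where
  "has_Tn X \<longleftrightarrow>
     (\<forall>n\<ge>1. \<exists>P\<in>hom1 K (carr X) (carr X). \<exists>\<pi>. (\<forall>i<n. \<pi> i \<in> hom2 K P (TT X)) \<and>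
        (\<forall>m. \<forall>Y\<in>cells0 K. \<forall>G\<in>hom1 K Y (carr X).
           is_nfold (homcat Y (carr X)) n
             ((Tpow X m \<odot> TT X) \<odot> G) (Tpow X m \<odot> G) ((Tpow X m \<rhd> pp X) \<lhd> G)
             ((Tpow X m \<odot> P) \<odot> G) (\<lambda>i. (Tpow X m \<rhd> \<pi> i) \<lhd> G)))"

definition tangentad :: "('x, 'm, 'c) tstruct \<Rightarrow> bool" where
  "tangentad X \<longleftrightarrow>
     (let x = carr X; T = TT X; p = pp X; z = zz X; s = ss X; l = ll X; c = cc X;
          p1 = \<pi>1 X; p2 = \<pi>2 X; I = id1 K x; vl = (T \<rhd> s) \<bullet> pair_TT2 X (T2 X) ((z \<lhd> T) \<bullet> p1) (l \<bullet> p2)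
      in
      x \<in> cells0 K \<and> T \<in> hom1 K x x \<and> p \<in> hom2 K T I \<and> z \<in> hom2 K I T \<and>
      s \<in> hom2 K (T2 X) T \<and> l \<in> hom2 K T (T \<odot> T) \<and> c \<in> hom2 K (T \<odot> T) (T \<odot> T) \<and>
      has_Tn X \<and>
      comm_monoid_over (homcat x x) T I p z s \<and>
      (T \<rhd> p) \<bullet> l = z \<bullet> p \<and>
      l \<bullet> z = (T \<rhd> z) \<bullet> z \<and>
      l \<bullet> s = (T \<rhd> s) \<bullet> pair_TT2 X (T2 X) (l \<bullet> p1) (l \<bullet> p2) \<and>
      (p \<lhd> T) \<bullet> c = T \<rhd> p \<and>
      c \<bullet> (T \<rhd> z) = z \<lhd> T \<and>
      c \<bullet> (T \<rhd> s) = (s \<lhd> T) \<bullet> pair_T2 x X T (T \<odot> T2 X) (c \<bullet> (T \<rhd> p1)) (c \<bullet> (T \<rhd> p2)) \<and>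
      (T \<rhd> l) \<bullet> l = (l \<lhd> T) \<bullet> l \<and>
      c \<bullet> l = l \<and>
      (c \<lhd> T) \<bullet> (T \<rhd> c) \<bullet> (l \<lhd> T) = (T \<rhd> l) \<bullet> c \<and>
      c \<bullet> c = id2 K (T \<odot> T) \<and>
      (T \<rhd> c) \<bullet> (c \<lhd> T) \<bullet> (T \<rhd> c) = (c \<lhd> T) \<bullet> (T \<rhd> c) \<bullet> (c \<lhd> T) \<and>
      (\<forall>Y\<in>cells0 K. \<forall>G\<in>hom1 K Y x.
         is_pb (homcat Y x) (I \<odot> G) ((T \<odot> T) \<odot> G) (T \<odot> G) (z \<lhd> G) ((T \<rhd> p) \<lhd> G)
           (T2 X \<odot> G) ((p \<bullet> p1) \<lhd> G) (vl \<lhd> G)))"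

text \<open>Lax tangent morphisms \<open>(F, \<alpha>) : X' \<rightarrow> X\<close>, with \<open>\<alpha> : F T' \<Rightarrow> T F\<close>.\<close>

definition lax :: "('x, 'm, 'c) tstruct \<Rightarrow> ('x, 'm, 'c) tstruct \<Rightarrow> 'm \<times> 'c \<Rightarrow> bool" where
  "lax X' X = (\<lambda>(F, \<alpha>).
     (let T' = TT X'; T = TT X in
      F \<in> hom1 K (carr X') (carr X) \<and> \<alpha> \<in> hom2 K (F \<odot> T') (T \<odot> F) \<and>
      (pp X \<lhd> F) \<bullet> \<alpha> = F \<rhd> pp X' \<and>
      \<alpha> \<bullet> (F \<rhd> zz X') = zz X \<lhd> F \<and>
      \<alpha> \<bullet> (F \<rhd> ss X') = (ss X \<lhd> F) \<bullet>
        pair_T2 (carr X') X F (F \<odot> T2 X') (\<alpha> \<bullet> (F \<rhd> \<pi>1 X')) (\<alpha> \<bullet> (F \<rhd> \<pi>2 X')) \<and>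
      (ll X \<lhd> F) \<bullet> \<alpha> = (T \<rhd> \<alpha>) \<bullet> (\<alpha> \<lhd> T') \<bullet> (F \<rhd> ll X') \<and>
      (cc X \<lhd> F) \<bullet> (T \<rhd> \<alpha>) \<bullet> (\<alpha> \<lhd> T') = (T \<rhd> \<alpha>) \<bullet> (\<alpha> \<lhd> T') \<bullet> (F \<rhd> cc X')))"

text \<open>The lax tangent morphism \<open>(F, id)\<close>; \<open>F\<close> is a strict tangent morphism iff it is lax, which
  includes \<open>F T' = T F\<close>.\<close>

definition strict_lax :: "('x, 'm, 'c) tstruct \<Rightarrow> 'm \<Rightarrow> 'm \<times> 'c" where
  "strict_lax X' F = (F, id2 K (F \<odot> TT X'))"

definition strict :: "('x, 'm, 'c) tstruct \<Rightarrow> ('x, 'm, 'c) tstruct \<Rightarrow> 'm \<Rightarrow> bool" where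
  "strict X' X F \<longleftrightarrow> lax X' X (strict_lax X' F)"

definition lcomp :: "'m \<times> 'c \<Rightarrow> 'm \<times> 'c \<Rightarrow> 'm \<times> 'c"  (infixr "\<odot>\<^sub>l" 75) where
  "lcomp = (\<lambda>(F, \<alpha>) (G, \<beta>). (F \<odot> G, (\<alpha> \<lhd> G) \<bullet> (F \<rhd> \<beta>)))"

text \<open>The hom-category \<open>[X' | X]\<close> of lax tangent morphisms and tangent 2-morphisms, and its tangent
  structure. The addition on \<open>(F, \<alpha>)\<close> is \<open>s\<^sub>F\<close>, up to the comparison from the chosen kernel pair of
  \<open>p\<^sub>F\<close> to \<open>T\<^sub>2 F\<close>.\<close>

definition tancat ::
  "('x, 'm, 'c) tstruct \<Rightarrow> ('x, 'm, 'c) tstruct \<Rightarrow> ('m \<times> 'c, 'c) cat" where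
  "tancat X' X =
     \<lparr>obj = {F. lax X' X F},
      hom = (\<lambda>(F, \<alpha>) (G, \<beta>). {\<phi> \<in> hom2 K F G. (TT X \<rhd> \<phi>) \<bullet> \<alpha> = \<beta> \<bullet> (\<phi> \<lhd> TT X')}),
      idm = (\<lambda>F. id2 K (fst F)),
      cmp = vcomp K\<rparr>"

definition tan_T ::
  "('x, 'm, 'c) tstruct \<Rightarrow> 'm \<times> 'c \<Rightarrow> 'm \<times> 'c" where
  "tan_T X = (\<lambda>(F, \<alpha>). (TT X \<odot> F, (cc X \<lhd> F) \<bullet> (TT X \<rhd> \<alpha>)))"

definition homt ::
  "('x, 'm, 'c) tstruct \<Rightarrow> ('x, 'm, 'c) tstruct \<Rightarrow> ('m \<times> 'c, 'c) tcat" where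
  "homt X' X =
     (let C = tancat X' X; p = (\<lambda>F. pp X \<lhd> fst F) in
      \<lparr>obj = obj C, hom = hom C, idm = idm C, cmp = cmp C,
       tob = tan_T X,
       tar = (\<lambda>\<phi>. TT X \<rhd> \<phi>),
       tp = p,
       tz = (\<lambda>F. zz X \<lhd> fst F),
       ts = (\<lambda>F. (ss X \<lhd> fst F) \<bullet>
               pair_T2 (carr X') X (fst F) (fst (kp0 C (tan_T X F) F (p F)))
                 (kp1 C (tan_T X F) F (p F)) (kp2 C (tan_T X F) F (p F))),
       tl = (\<lambda>F. ll X \<lhd> fst F),
       tc = (\<lambda>F. cc X \<lhd> fst F)\<rparr>)"


section \<open>Pointwise display differential bundles\<close>

text \<open>Pullbacks in \<open>[X' | X]\<close> preserved by precomposition with lax tangent morphisms into \<open>X'\<close>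
  (the 1-morphisms of the 2-category of tangentads).\<close>

definition pointwise_pb ::
  "('x, 'm, 'c) tstruct \<Rightarrow> ('x, 'm, 'c) tstruct \<Rightarrow> 'm \<times> 'c \<Rightarrow> 'm \<times> 'c \<Rightarrow> 'm \<times> 'c \<Rightarrow>
   'c \<Rightarrow> 'c \<Rightarrow> 'm \<times> 'c \<Rightarrow> 'c \<Rightarrow> 'c \<Rightarrow> bool" where
  "pointwise_pb X' X A B D f g P u v \<longleftrightarrow>
     is_pb (homt X' X) A B D f g P u v \<and>
     (\<forall>Y G. tangentad Y \<and> lax Y X' G \<longrightarrow>
        is_pb (homt Y X) (A \<odot>\<^sub>l G) (B \<odot>\<^sub>l G) (D \<odot>\<^sub>l G) (f \<lhd> fst G) (g \<lhd> fst G)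
          (P \<odot>\<^sub>l G) (u \<lhd> fst G) (v \<lhd> fst G))"

definition pointwise_pullbacks ::
  "('x, 'm, 'c) tstruct \<Rightarrow> ('x, 'm, 'c) tstruct \<Rightarrow> 'm \<times> 'c \<Rightarrow> 'm \<times> 'c \<Rightarrow> 'c \<Rightarrow> bool" where
  "pointwise_pullbacks X' X E M q \<longleftrightarrow>
     (let C = homt X' X in
      \<forall>n. \<forall>N\<in>obj C. \<forall>f\<in>hom C N ((tob C ^^ n) M).
        \<exists>P u v. \<forall>m.
          pointwise_pb X' X ((tob C ^^ m) N) ((tob C ^^ (m + n)) E) ((tob C ^^ (m + n)) M)
            ((tar C ^^ m) f) ((tar C ^^ (m + n)) q)
            ((tob C ^^ m) P) ((tar C ^^ m) u) ((tar C ^^ m) v))"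

definition pointwise_display_bundle ::
  "('x, 'm, 'c) tstruct \<Rightarrow> ('x, 'm, 'c) tstruct \<Rightarrow> ('m \<times> 'c, 'c) dbun \<Rightarrow> bool" where
  "pointwise_display_bundle X' X B \<longleftrightarrow>
     (let C = homt X' X; E = dE B; M = dM B; q = dq B in
      display_bundle C B \<and>
      (\<forall>Y G. tangentad Y \<and> lax Y X' G \<longrightarrow>
         tangent_display (homt Y X) (E \<odot>\<^sub>l G) (M \<odot>\<^sub>l G) (q \<lhd> fst G) \<and>
         pointwise_pullbacks Y X (E \<odot>\<^sub>l G) (M \<odot>\<^sub>l G) (q \<lhd> fst G)) \<and>
      pointwise_pb X' X E E M q q (Esq C B) (pi1 C B) (pi2 C B) \<and>
      pointwise_pb X' X M (tob C E) (tob C M) (tz C M) (tar C q)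
        (Esq C B) (q \<bullet> pi1 C B) (vlift C B))"

definition DBpt ::
  "('x, 'm, 'c) tstruct \<Rightarrow> ('x, 'm, 'c) tstruct \<Rightarrow> (('m \<times> 'c, 'c) dbun, 'c \<times> 'c) tcat" where
  "DBpt X' X = bundle_tcat (homt X' X) {B. pointwise_display_bundle X' X B}"

definition VLC ::
  "('x, 'm, 'c) tstruct \<Rightarrow> ('x, 'm, 'c) tstruct \<Rightarrow>
   (('m \<times> 'c, 'c) dbun \<times> 'c, 'c \<times> 'c) tcat" where
  "VLC X' X = conn_tcat (homt X' X) {B. pointwise_display_bundle X' X B}"

text \<open>Precomposition \<open>B\<^sub>H\<close> of a bundle \<open>B\<close> in \<open>[X' | X]\<close> with \<open>H : X'' \<rightarrow> X'\<close>.\<close>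

definition bundle_at ::
  "('x, 'm, 'c) tstruct \<Rightarrow> ('x, 'm, 'c) tstruct \<Rightarrow> ('x, 'm, 'c) tstruct \<Rightarrow>
   ('m \<times> 'c, 'c) dbun \<Rightarrow> 'm \<times> 'c \<Rightarrow> ('m \<times> 'c, 'c) dbun" where
  "bundle_at X'' X' X B H =
     (let C' = homt X' X; C'' = homt X'' X;
          E = dE B \<odot>\<^sub>l H; M = dM B \<odot>\<^sub>l H; q = dq B \<lhd> fst H in
      \<lparr>dM = M, dE = E, dq = q, dz = dz B \<lhd> fst H,
       ds = (ds B \<lhd> fst H) \<bullet>
              pair C'' (kp0 C'' E M q) (Esq C' B \<odot>\<^sub>l H) (pi1 C' B \<lhd> fst H) (pi2 C' B \<lhd> fst H)
                (kp1 C'' E M q) (kp2 C'' E M q),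
       dl = dl B \<lhd> fst H\<rparr>)"

definition conn_at ::
  "('x, 'm, 'c) tstruct \<Rightarrow> ('x, 'm, 'c) tstruct \<Rightarrow> ('x, 'm, 'c) tstruct \<Rightarrow>
   ('m \<times> 'c, 'c) dbun \<times> 'c \<Rightarrow> 'm \<times> 'c \<Rightarrow> ('m \<times> 'c, 'c) dbun \<times> 'c" where
  "conn_at X'' X' X = (\<lambda>(B, k) H. (bundle_at X'' X' X B H, k \<lhd> fst H))"

text \<open>\<open>D\<close> with \<open>Bas\<close>, \<open>Tot\<close> and \<open>Q : Tot \<rightarrow> Bas\<close> is the construction of display differential
  bundles of \<open>X\<close>.\<close>

definition is_DB ::
  "('x, 'm, 'c) tstruct \<Rightarrow> ('x, 'm, 'c) tstruct \<Rightarrow> 'm \<Rightarrow> 'm \<Rightarrow> ('m \<times> 'c, 'c) dbun \<Rightarrow> bool" where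
  "is_DB X D Bas Tot Q \<longleftrightarrow>
     tangentad D \<and> strict D X Bas \<and> strict D X Tot \<and>
     dM Q = strict_lax D Bas \<and> dE Q = strict_lax D Tot \<and>
     pointwise_display_bundle D X Q \<and>
     (\<forall>X'. tangentad X' \<longrightarrow>
        componentwise_Tn (homt X' X) (DBpt X' X) dM dE \<and>
        tangent_iso (homt X' D) (DBpt X' X)
          (\<lambda>H. bundle_at X' D X Q H) (\<lambda>\<phi>. (Bas \<rhd> \<phi>, Tot \<rhd> \<phi>)))"

text \<open>\<open>V\<close> with the universal object \<open>U\<close> is the construction of vertical linear connections of \<open>X\<close>.\<close>

definition is_VLC ::
  "('x, 'm, 'c) tstruct \<Rightarrow> ('x, 'm, 'c) tstruct \<Rightarrow> ('m \<times> 'c, 'c) dbun \<times> 'c \<Rightarrow> bool" where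
  "is_VLC X V U \<longleftrightarrow>
     tangentad V \<and> U \<in> obj (VLC V X) \<and>
     (\<forall>X'. tangentad X' \<longrightarrow>
        componentwise_Tn (homt X' X) (VLC X' X) (dM \<circ> fst) (dE \<circ> fst) \<and>
        tangent_iso (homt X' V) (VLC X' X)
          (\<lambda>H. conn_at X' V X U H)
          (\<lambda>\<phi>. (fst (dM (fst U)) \<rhd> \<phi>, fst (dE (fst U)) \<rhd> \<phi>)))"

definition admits_VLC :: "('x, 'm, 'c) tstruct \<Rightarrow> bool" where
  "admits_VLC X \<longleftrightarrow> (\<exists>V U. is_VLC X V U)"


section \<open>Inserters and equifiers\<close>

text \<open>Inserters and equifiers are strict 2-limits, with their one- and two-dimensional universal
  property.\<close>

definition is_inserter :: "'x \<Rightarrow> 'x \<Rightarrow> 'm \<Rightarrow> 'm \<Rightarrow> 'x \<Rightarrow> 'm \<Rightarrow> 'c \<Rightarrow> bool" where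
  "is_inserter A B F G I V \<kappa> \<longleftrightarrow>
     A \<in> cells0 K \<and> B \<in> cells0 K \<and> F \<in> hom1 K A B \<and> G \<in> hom1 K A B \<and>
     I \<in> cells0 K \<and> V \<in> hom1 K I A \<and> \<kappa> \<in> hom2 K (F \<odot> V) (G \<odot> V) \<and>
     (\<forall>Y\<in>cells0 K. \<forall>H\<in>hom1 K Y A. \<forall>k\<in>hom2 K (F \<odot> H) (G \<odot> H).
        \<exists>!J. J \<in> hom1 K Y I \<and> V \<odot> J = H \<and> \<kappa> \<lhd> J = k) \<and>
     (\<forall>Y\<in>cells0 K. \<forall>J\<in>hom1 K Y I. \<forall>J'\<in>hom1 K Y I. \<forall>\<sigma>\<in>hom2 K (V \<odot> J) (V \<odot> J').
        (G \<rhd> \<sigma>) \<bullet> (\<kappa> \<lhd> J) = (\<kappa> \<lhd> J') \<bullet> (F \<rhd> \<sigma>) \<longrightarrow>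
        (\<exists>!\<tau>. \<tau> \<in> hom2 K J J' \<and> V \<rhd> \<tau> = \<sigma>))"

text \<open>Equifier \<open>W : E \<rightarrow> A\<close> of \<open>\<phi>, \<psi> : F \<Rightarrow> G\<close> between 1-morphisms \<open>F, G : A \<rightarrow> B\<close>.\<close>

definition is_equifier ::
  "'x \<Rightarrow> 'x \<Rightarrow> 'm \<Rightarrow> 'm \<Rightarrow> 'c \<Rightarrow> 'c \<Rightarrow> 'x \<Rightarrow> 'm \<Rightarrow> bool" where
  "is_equifier A B F G \<phi> \<psi> E W \<longleftrightarrow>
     A \<in> cells0 K \<and> B \<in> cells0 K \<and> F \<in> hom1 K A B \<and> G \<in> hom1 K A B \<and>
     \<phi> \<in> hom2 K F G \<and> \<psi> \<in> hom2 K F G \<and>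
     E \<in> cells0 K \<and> W \<in> hom1 K E A \<and> \<phi> \<lhd> W = \<psi> \<lhd> W \<and>
     (\<forall>Y\<in>cells0 K. \<forall>H\<in>hom1 K Y A. \<phi> \<lhd> H = \<psi> \<lhd> H \<longrightarrow>
        (\<exists>!J. J \<in> hom1 K Y E \<and> W \<odot> J = H)) \<and>
     (\<forall>Y\<in>cells0 K. \<forall>J\<in>hom1 K Y E. \<forall>J'\<in>hom1 K Y E. \<forall>\<sigma>\<in>hom2 K (W \<odot> J) (W \<odot> J').
        \<exists>!\<tau>. \<tau> \<in> hom2 K J J' \<and> W \<rhd> \<tau> = \<sigma>)"

text \<open>\<open>X0, \<dots>, X4\<close> are the induced tangent structures on the inserter and the equifiers.\<close>

definition induced_tangent_structures ::
  "('x, 'm, 'c) tstruct \<Rightarrow> ('x, 'm, 'c) tstruct \<Rightarrow> 'm \<Rightarrow>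
   'x \<Rightarrow> 'm \<Rightarrow> 'c \<Rightarrow> 'x \<Rightarrow> 'm \<Rightarrow> 'x \<Rightarrow> 'm \<Rightarrow> 'x \<Rightarrow> 'm \<Rightarrow> 'x \<Rightarrow> 'm \<Rightarrow>
   ('x, 'm, 'c) tstruct \<Rightarrow> ('x, 'm, 'c) tstruct \<Rightarrow> ('x, 'm, 'c) tstruct \<Rightarrow>
   ('x, 'm, 'c) tstruct \<Rightarrow> ('x, 'm, 'c) tstruct \<Rightarrow> bool" where
  "induced_tangent_structures X D Tot I0 V0 K0 E1 W1 E2 W2 E3 W3 E4 W4 X0 X1 X2 X3 X4 \<longleftrightarrow>
     tangentad X0 \<and> tangentad X1 \<and> tangentad X2 \<and> tangentad X3 \<and> tangentad X4 \<and>
     carr X0 = I0 \<and> carr X1 = E1 \<and> carr X2 = E2 \<and> carr X3 = E3 \<and> carr X4 = E4 \<and>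
     strict X0 D V0 \<and> strict X1 X0 W1 \<and> strict X2 X1 W2 \<and> strict X3 X2 W3 \<and> strict X4 X3 W4 \<and>
     (let TotV0 = strict_lax D Tot \<odot>\<^sub>l strict_lax X0 V0 in
      K0 \<in> hom (homt X0 X) (tob (homt X0 X) TotV0) TotV0)"

end

end

theory Submission
  imports Defs
begin

text \<open>The equifier \<open>E\<^sub>4\<close> represents pairs: 1-cells \<open>Y \<rightarrow> E\<^sub>4\<close> are pairs \<open>(H, k)\<close> of a 1-cell
  \<open>H : Y \<rightarrow> DB(X)\<close> and a 2-cell \<open>k : T Tot H \<Rightarrow> Tot H\<close> that satisfies the four equations of a
  vertical linear connection, and 2-cells are those 2-cells between the first components that
  commute with the second ones. The inserter and the first three equifiers represent the same kind
  of pairs with fewer equations. All five objects are therefore treated at once, in the locale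
  \<open>stage\<close> with the number of equations as a parameter.

  A tangent structure on such an object is created by the projection \<open>V\<close> to \<open>DB(X)\<close>. The tangent
  functor sends \<open>(H, k)\<close> to \<open>(T H, T k \<circ> c)\<close>; this is again a pair of the same kind because \<open>q\<close> and
  \<open>l\<close> are tangent 2-cells and \<open>c\<close> is a natural involution that satisfies the Yang-Baxter equation
  and is compatible with \<open>p\<close> and \<open>l\<close> (\<open>pre_conn_T\<close>). The structural 2-cells lift since they commute
  with \<open>k\<close>, and equations between them can be tested after \<open>V\<close>, which is faithful. Limits are the
  delicate point: for \<open>k\<close> to induce a 2-cell on the pullback \<open>T\<^sub>n H\<close>, the 1-cell \<open>Tot\<close> has to
  preserve this pullback, and a strict tangent morphism need not do so. Here it does. By assumption
  the pullbacks \<open>T\<^sub>n\<close> of the category of display bundles in \<open>[DB(X) | X]\<close> are computed on base and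
  total objects. This category is isomorphic to \<open>[DB(X) | DB(X)]\<close>, and the pullbacks \<open>T\<^sub>n\<close> of a
  hom-category of tangentads are those of the underlying category of 1-cells (\<open>Tn_at_lax\<close>,
  \<open>homt_Tn\<close>). At the identity of \<open>DB(X)\<close> this says that \<open>Base\<close> and \<open>Tot\<close> preserve \<open>T\<^sub>n\<close>
  (\<open>is_DB_pres_Tn\<close>). Hence \<open>k\<close> lifts to \<open>T\<^sub>n H\<close> (\<open>pre_conn_Tn\<close>), and \<open>V\<close> reflects the limits in
  question (\<open>reflect_wide_pb\<close>).

  For the universal property, let \<open>(B, k)\<close> be a bundle with a connection in \<open>[X' | X]\<close>. The bundle
  is classified by a unique lax morphism \<open>(H, \<beta>) : X' \<rightarrow> DB(X)\<close>, and \<open>(H, k)\<close> by a unique 1-cell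
  \<open>J : X' \<rightarrow> E\<^sub>4\<close>. The condition for \<open>\<beta>\<close> to lift to a 2-cell \<open>\<alpha> : J T' \<Rightarrow> T J\<close> says exactly that \<open>k\<close>
  is a tangent 2-cell, and the axioms of a lax morphism for \<open>\<alpha>\<close> follow from those for \<open>\<beta>\<close> because
  \<open>V\<close> is faithful. The same argument applies to morphisms, and the tangent structures agree since
  \<open>V\<close> is strict. This uses only that \<open>V\<close> is strict and \<open>k\<close> a tangent 2-cell, so it covers every
  choice of induced tangent structures.\<close>

section \<open>Categories and wide pullbacks\<close>

locale category =
  fixes C :: "('o, 'a, 'z) cat_scheme" (structure)
  assumes idm_hom: "A \<in> obj C \<Longrightarrow> idm C A \<in> hom C A A"
    and cmp_hom: "A \<in> obj C \<Longrightarrow> B \<in> obj C \<Longrightarrow> E \<in> obj C \<Longrightarrow> f \<in> hom C A B \<Longrightarrow> g \<in> hom C B E \<Longrightarrow>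
      g \<cdot> f \<in> hom C A E"
    and cmp_idm: "A \<in> obj C \<Longrightarrow> B \<in> obj C \<Longrightarrow> f \<in> hom C A B \<Longrightarrow> f \<cdot> idm C A = f"
    and idm_cmp: "A \<in> obj C \<Longrightarrow> B \<in> obj C \<Longrightarrow> f \<in> hom C A B \<Longrightarrow> idm C B \<cdot> f = f"
    and cmp_assoc: "A \<in> obj C \<Longrightarrow> B \<in> obj C \<Longrightarrow> E \<in> obj C \<Longrightarrow> G \<in> obj C \<Longrightarrow>
      f \<in> hom C A B \<Longrightarrow> g \<in> hom C B E \<Longrightarrow> h \<in> hom C E G \<Longrightarrow> (h \<cdot> g) \<cdot> f = h \<cdot> (g \<cdot> f)"

text \<open>Kept as a predicate of its own: its symmetric equations loop when they are used for
  rewriting.\<close>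

definition wide_cone ::
  "('o, 'a, 'z) cat_scheme \<Rightarrow> nat \<Rightarrow> (nat \<Rightarrow> 'o) \<Rightarrow> (nat \<Rightarrow> 'a) \<Rightarrow> 'o \<Rightarrow> (nat \<Rightarrow> 'a) \<Rightarrow> bool" where
  "wide_cone C n A f Z a \<longleftrightarrow> Z \<in> obj C \<and> (\<forall>i<n. a i \<in> hom C Z (A i)) \<and>
     (\<forall>i<n. \<forall>j<n. f i \<cdot>\<^bsub>C\<^esub> a i = f j \<cdot>\<^bsub>C\<^esub> a j)"

text \<open>A limit over a family of maps into \<open>B\<close>. It subsumes both the pullbacks of two maps and the
  \<open>n\<close>-fold pullbacks of one map along itself, so that transport, preservation and reflection of
  limits have to be proved only once.\<close>

definition wide_pb ::
  "('o, 'a, 'z) cat_scheme \<Rightarrow> nat \<Rightarrow> (nat \<Rightarrow> 'o) \<Rightarrow> 'o \<Rightarrow> (nat \<Rightarrow> 'a) \<Rightarrow> 'o \<Rightarrow> (nat \<Rightarrow> 'a) \<Rightarrow> bool" where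
  "wide_pb C n A B f P p \<longleftrightarrow>
     n \<ge> 1 \<and> B \<in> obj C \<and> (\<forall>i<n. A i \<in> obj C \<and> f i \<in> hom C (A i) B) \<and> wide_cone C n A f P p \<and>
     (\<forall>Z a. wide_cone C n A f Z a \<longrightarrow>
        (\<exists>!h. h \<in> hom C Z P \<and> (\<forall>i<n. p i \<cdot>\<^bsub>C\<^esub> h = a i)))"

abbreviation two :: "'b \<Rightarrow> 'b \<Rightarrow> nat \<Rightarrow> 'b" where
  "two a b i \<equiv> (if i = 0 then a else b)"

lemma all_less_2: "(\<forall>i<2. R i) \<longleftrightarrow> R (0::nat) \<and> R 1"
  by (auto simp: less_2_cases_iff)

lemma wide_pbI:
  assumes "n \<ge> 1" "B \<in> obj C" "\<And>i. i < n \<Longrightarrow> A i \<in> obj C" "\<And>i. i < n \<Longrightarrow> f i \<in> hom C (A i) B"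
    "wide_cone C n A f P p"
    "\<And>Z a. wide_cone C n A f Z a \<Longrightarrow> \<exists>!h. h \<in> hom C Z P \<and> (\<forall>i<n. p i \<cdot>\<^bsub>C\<^esub> h = a i)"
  shows "wide_pb C n A B f P p"
  using assms unfolding wide_pb_def by simp

lemma wide_coneI:
  assumes "Z \<in> obj C" "\<And>i. i < n \<Longrightarrow> a i \<in> hom C Z (A i)"
    "\<And>i j. i < n \<Longrightarrow> j < n \<Longrightarrow> f i \<cdot>\<^bsub>C\<^esub> a i = f j \<cdot>\<^bsub>C\<^esub> a j"
  shows "wide_cone C n A f Z a"
  using assms unfolding wide_cone_def by blast

lemma wide_coneD:
  assumes "wide_cone C n A f P p"
  shows "P \<in> obj C" "\<And>i. i < n \<Longrightarrow> p i \<in> hom C P (A i)"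
    "\<And>i j. i < n \<Longrightarrow> j < n \<Longrightarrow> f i \<cdot>\<^bsub>C\<^esub> p i = f j \<cdot>\<^bsub>C\<^esub> p j"
proof -
  note a = assms[unfolded wide_cone_def]
  show "P \<in> obj C" by (rule conjunct1[OF a])
  show "p i \<in> hom C P (A i)" if "i < n" for i
    using conjunct1[OF conjunct2[OF a]] that by blast
  show "f i \<cdot>\<^bsub>C\<^esub> p i = f j \<cdot>\<^bsub>C\<^esub> p j" if "i < n" "j < n" for i j
    using conjunct2[OF conjunct2[OF a]] that by blast
qed

lemma wide_pb_cone: "wide_pb C n A B f P p \<Longrightarrow> wide_cone C n A f P p"
  unfolding wide_pb_def by simp

lemma wide_pb_ex1:
  "wide_pb C n A B f P p \<Longrightarrow> wide_cone C n A f Z a \<Longrightarrow> \<exists>!h. h \<in> hom C Z P \<and> (\<forall>i<n. p i \<cdot>\<^bsub>C\<^esub> h = a i)"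
  unfolding wide_pb_def by simp

lemma wide_pbD:
  assumes "wide_pb C n A B f P p"
  shows "P \<in> obj C" "B \<in> obj C" "n \<ge> 1" "\<And>i. i < n \<Longrightarrow> A i \<in> obj C" "\<And>i. i < n \<Longrightarrow> f i \<in> hom C (A i) B"
    "\<And>i. i < n \<Longrightarrow> p i \<in> hom C P (A i)" "\<And>i j. i < n \<Longrightarrow> j < n \<Longrightarrow> f i \<cdot>\<^bsub>C\<^esub> p i = f j \<cdot>\<^bsub>C\<^esub> p j"
  by (fact wide_coneD[OF wide_pb_cone[OF assms]] | use assms in \<open>simp add: wide_pb_def\<close>)+

lemma is_nfold_iff_wide_pb:
  "is_nfold C n A B f P p \<longleftrightarrow> wide_pb C n (\<lambda>_. A) B (\<lambda>_. f) P p"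
proof -
  have ex: "n \<ge> 1 \<Longrightarrow> (\<forall>i<n. R) \<longleftrightarrow> R" for R by (auto intro: exI[of _ 0])
  have univ: "(\<forall>Z\<in>obj C. \<forall>a. (\<forall>i<n. a i \<in> hom C Z A) \<and> (\<forall>i<n. \<forall>j<n. f \<cdot>\<^bsub>C\<^esub> a i = f \<cdot>\<^bsub>C\<^esub> a j)
    \<longrightarrow> R Z a) \<longleftrightarrow>
    (\<forall>Z a. wide_cone C n (\<lambda>_. A) (\<lambda>_. f) Z a \<longrightarrow> R Z a)" for R
    unfolding wide_cone_def by (simp only: Ball_def imp_conjL) blast
  have cone: "wide_cone C n (\<lambda>_. A) (\<lambda>_. f) P p \<longleftrightarrow>
    P \<in> obj C \<and> (\<forall>i<n. p i \<in> hom C P A) \<and> (\<forall>i<n. \<forall>j<n. f \<cdot>\<^bsub>C\<^esub> p i = f \<cdot>\<^bsub>C\<^esub> p j)"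
    unfolding wide_cone_def ..
  show ?thesis
    unfolding is_nfold_def wide_pb_def univ
      by (cases "n \<ge> 1") (simp_all only: ex cone simp_thms conj_ac)
qed

lemma wide_cone_2:
  "wide_cone C 2 (two A B) (two f g) Z a \<longleftrightarrow>
     Z \<in> obj C \<and> a 0 \<in> hom C Z A \<and> a 1 \<in> hom C Z B \<and> f \<cdot>\<^bsub>C\<^esub> a 0 = g \<cdot>\<^bsub>C\<^esub> a 1"
  unfolding wide_cone_def all_less_2 by auto

lemma is_pb_iff_wide_pb:
  "is_pb C A B D f g P u v \<longleftrightarrow> wide_pb C 2 (two A B) D (two f g) P (two u v)"
proof
  assume L: "is_pb C A B D f g P u v"
  show "wide_pb C 2 (two A B) D (two f g) P (two u v)"
    unfolding wide_pb_def wide_cone_2 all_less_2 using L unfolding is_pb_def by simp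
next
  assume R: "wide_pb C 2 (two A B) D (two f g) P (two u v)"
  note R = R[unfolded wide_pb_def wide_cone_2 all_less_2]
  show "is_pb C A B D f g P u v"
    unfolding is_pb_def
  proof (intro conjI ballI impI)
    fix Z a b assume "Z \<in> obj C" "a \<in> hom C Z A" "b \<in> hom C Z B" "f \<cdot>\<^bsub>C\<^esub> a = g \<cdot>\<^bsub>C\<^esub> b"
    with R have "\<exists>!h. h \<in> hom C Z P \<and> two u v 0 \<cdot>\<^bsub>C\<^esub> h = two a b 0 \<and> two u v 1 \<cdot>\<^bsub>C\<^esub> h = two a b 1"
      by (elim conjE allE[of _ Z] allE[of _ "two a b"]) simp
    then show "\<exists>!h. h \<in> hom C Z P \<and> u \<cdot>\<^bsub>C\<^esub> h = a \<and> v \<cdot>\<^bsub>C\<^esub> h = b" by simp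
  qed (use R in simp_all)
qed

lemma wide_pb_transport:
  assumes W: "wide_pb C n A B f P p"
    and eq: "\<And>i. i < n \<Longrightarrow> A i = A' i" "\<And>i. i < n \<Longrightarrow> f i = f' i" "\<And>i. i < n \<Longrightarrow> p i = p' i"
  shows "wide_pb C n A' B f' P p'"
proof (rule wide_pbI)
  have c: "wide_cone C n A f Z a \<longleftrightarrow> wide_cone C n A' f' Z a" for Z a
    unfolding wide_cone_def using eq by auto
  show "wide_cone C n A' f' P p'"
  proof (rule wide_coneI)
    show "P \<in> obj C" by (fact wide_pbD(1)[OF W])
    show "p' i \<in> hom C P (A' i)" if "i < n" for i using wide_pbD(6)[OF W that] eq that by simp
    show "f' i \<cdot>\<^bsub>C\<^esub> p' i = f' j \<cdot>\<^bsub>C\<^esub> p' j" if "i < n" "j < n" for i j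
      using wide_pbD(7)[OF W that] by (simp add: eq[symmetric] that)
  qed
  fix Z a assume "wide_cone C n A' f' Z a"
  then have "\<exists>!h. h \<in> hom C Z P \<and> (\<forall>i<n. p i \<cdot>\<^bsub>C\<^esub> h = a i)"
    using wide_pb_ex1[OF W] c by simp
  moreover have "(\<forall>i<n. p i \<cdot>\<^bsub>C\<^esub> h = a i) \<longleftrightarrow> (\<forall>i<n. p' i \<cdot>\<^bsub>C\<^esub> h = a i)" for h using eq by simp
  ultimately show "\<exists>!h. h \<in> hom C Z P \<and> (\<forall>i<n. p' i \<cdot>\<^bsub>C\<^esub> h = a i)" by simp
qed (use wide_pbD(2-5)[OF W] eq in simp_all)

lemma wide_pb_cong:
  assumes "\<And>i. i < n \<Longrightarrow> A i = A' i" "\<And>i. i < n \<Longrightarrow> f i = f' i" "\<And>i. i < n \<Longrightarrow> p i = p' i"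
  shows "wide_pb C n A B f P p \<longleftrightarrow> wide_pb C n A' B f' P p'"
proof
  assume W: "wide_pb C n A B f P p"
  show "wide_pb C n A' B f' P p'" by (rule wide_pb_transport[OF W]) (use assms in auto)
next
  assume W: "wide_pb C n A' B f' P p'"
  show "wide_pb C n A B f P p" by (rule wide_pb_transport[OF W]) (use assms in auto)
qed

text \<open>Records that extend a category differ in their further fields, but the chosen kernel pairs
  depend on the category only.\<close>

lemma kpair_cong:
  assumes "obj C = obj C'" "hom C = hom C'" "cmp C = cmp C'"
  shows "kp0 C = kp0 C'" "kp1 C = kp1 C'" "kp2 C = kp2 C'"
proof -
  have "is_pb C = is_pb C'" unfolding is_pb_def[abs_def] using assms by simp
  then have "kpair C = kpair C'" unfolding kpair_def[abs_def] by simp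
  then show "kp0 C = kp0 C'" "kp1 C = kp1 C'" "kp2 C = kp2 C'"
    unfolding kp0_def[abs_def] kp1_def[abs_def] kp2_def[abs_def] by simp_all
qed

lemma is_pb_kpair:
  assumes "is_pb C A A B f f P u v"
  shows "is_pb C A A B f f (kp0 C A B f) (kp1 C A B f) (kp2 C A B f)"
proof -
  have "case kpair C A B f of (P, u, v) \<Rightarrow> is_pb C A A B f f P u v"
    unfolding kpair_def by (rule someI[of _ "(P, u, v)"]) (simp add: assms)
  then show ?thesis unfolding kp0_def kp1_def kp2_def by (simp split: prod.splits)
qed

lemma wide_pb_const_2_iff:
  "wide_pb C 2 (\<lambda>_. A) B (\<lambda>_. f) P p \<longleftrightarrow> is_pb C A A B f f P (p 0) (p 1)"
  unfolding is_pb_iff_wide_pb by (rule wide_pb_cong) (auto simp: less_2_cases_iff)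

lemma wide_pb_ex:
  assumes W: "wide_pb C n A B f P p" and "Z \<in> obj C" "\<And>i. i < n \<Longrightarrow> a i \<in> hom C Z (A i)"
    "\<And>i j. i < n \<Longrightarrow> j < n \<Longrightarrow> f i \<cdot>\<^bsub>C\<^esub> a i = f j \<cdot>\<^bsub>C\<^esub> a j"
  obtains h where "h \<in> hom C Z P" "\<And>i. i < n \<Longrightarrow> p i \<cdot>\<^bsub>C\<^esub> h = a i"
  using wide_pb_ex1[OF W wide_coneI[of Z C n a A f]] assms(2-4) that by metis

lemma (in category) wide_pb_eqI:
  assumes W: "wide_pb C n A B f P p" and Z: "Z \<in> obj C" "h \<in> hom C Z P" "h' \<in> hom C Z P"
    and eq: "\<And>i. i < n \<Longrightarrow> p i \<cdot> h = p i \<cdot> h'"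
  shows "h = h'"
proof -
  have obj: "P \<in> obj C" "B \<in> obj C" "\<And>i. i < n \<Longrightarrow> A i \<in> obj C"
    "\<And>i. i < n \<Longrightarrow> f i \<in> hom C (A i) B" "\<And>i. i < n \<Longrightarrow> p i \<in> hom C P (A i)"
    "\<And>i j. i < n \<Longrightarrow> j < n \<Longrightarrow> f i \<cdot> p i = f j \<cdot> p j"
    by (fact wide_pbD[OF W])+
  have 1: "p i \<cdot> h \<in> hom C Z (A i)" if "i < n" for i
    by (rule cmp_hom[OF Z(1) obj(1) obj(3)]) (use that obj Z in auto)
  have 2: "f i \<cdot> (p i \<cdot> h) = f j \<cdot> (p j \<cdot> h)" if "i < n" "j < n" for i j
    using cmp_assoc[OF Z(1) obj(1) obj(3) obj(2) Z(2) obj(5) obj(4)] obj(6) that by metis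
  have "\<exists>!h'. h' \<in> hom C Z P \<and> (\<forall>i<n. p i \<cdot> h' = p i \<cdot> h)"
    using wide_pb_ex1[OF W wide_coneI[OF Z(1) 1 2]] .
  then show ?thesis using Z eq by metis
qed

lemma (in category) wide_pb_unique:
  assumes W: "wide_pb C n A B f P p" and W': "wide_pb C n A B f P' p'"
  obtains e e' where "e \<in> hom C P' P" "e' \<in> hom C P P'" "e \<cdot> e' = idm C P" "e' \<cdot> e = idm C P'"
    "\<And>i. i < n \<Longrightarrow> p i \<cdot> e = p' i" "\<And>i. i < n \<Longrightarrow> p' i \<cdot> e' = p i"
proof -
  have obj: "P \<in> obj C" "P' \<in> obj C" "B \<in> obj C" "\<And>i. i < n \<Longrightarrow> A i \<in> obj C"
    and p: "\<And>i. i < n \<Longrightarrow> p i \<in> hom C P (A i)" "\<And>i. i < n \<Longrightarrow> p' i \<in> hom C P' (A i)"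
    "\<And>i j. i < n \<Longrightarrow> j < n \<Longrightarrow> f i \<cdot> p i = f j \<cdot> p j" "\<And>i j. i < n \<Longrightarrow> j < n \<Longrightarrow> f i \<cdot> p' i = f j \<cdot> p' j"
    by (fact wide_pbD[OF W] wide_pbD[OF W'])+
  obtain e where e: "e \<in> hom C P' P" "\<And>i. i < n \<Longrightarrow> p i \<cdot> e = p' i"
    using wide_pb_ex[OF W obj(2) p(2) p(4)] by blast
  obtain e' where e': "e' \<in> hom C P P'" "\<And>i. i < n \<Longrightarrow> p' i \<cdot> e' = p i"
    using wide_pb_ex[OF W' obj(1) p(1) p(3)] by blast
  have "e \<cdot> e' = idm C P"
  proof (rule wide_pb_eqI[OF W obj(1)])
    show "e \<cdot> e' \<in> hom C P P" "idm C P \<in> hom C P P"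
      using cmp_hom[OF obj(1,2,1) e'(1) e(1)] idm_hom[OF obj(1)] by auto
    show "p i \<cdot> e \<cdot> e' = p i \<cdot> idm C P" if "i < n" for i
      using cmp_assoc[OF obj(1,2,1) obj(4) e'(1) e(1) p(1)] cmp_idm[OF obj(1) obj(4) p(1)] e(2)
        e'(2) that
      by metis
  qed
  moreover have "e' \<cdot> e = idm C P'"
  proof (rule wide_pb_eqI[OF W' obj(2)])
    show "e' \<cdot> e \<in> hom C P' P'" "idm C P' \<in> hom C P' P'"
      using cmp_hom[OF obj(2,1,2) e(1) e'(1)] idm_hom[OF obj(2)] by auto
    show "p' i \<cdot> e' \<cdot> e = p' i \<cdot> idm C P'" if "i < n" for i
      using cmp_assoc[OF obj(2,1,2) obj(4) e(1) e'(1) p(2)] cmp_idm[OF obj(2) obj(4) p(2)] e(2)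
        e'(2) that
      by metis
  qed
  ultimately show ?thesis using e e' that by blast
qed

lemma (in category) wide_pb_iso:
  assumes W: "wide_pb C n A B f P p" and P': "P' \<in> obj C"
    and e: "e \<in> hom C P' P" "e' \<in> hom C P P'" "e \<cdot> e' = idm C P" "e' \<cdot> e = idm C P'"
    and p': "\<And>i. i < n \<Longrightarrow> p i \<cdot> e = p' i"
  shows "wide_pb C n A B f P' p'"
proof -
  have obj: "P \<in> obj C" "B \<in> obj C" "\<And>i. i < n \<Longrightarrow> A i \<in> obj C"
    and f: "\<And>i. i < n \<Longrightarrow> f i \<in> hom C (A i) B"
    and p: "\<And>i. i < n \<Longrightarrow> p i \<in> hom C P (A i)" "\<And>i j. i < n \<Longrightarrow> j < n \<Longrightarrow> f i \<cdot> p i = f j \<cdot> p j"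
    and n: "n \<ge> 1"
    by (fact wide_pbD[OF W])+
  have p'h: "p' i \<in> hom C P' (A i)" if "i < n" for i
    using cmp_hom[OF P' obj(1) obj(3) e(1) p(1)] p' that by metis
  have c: "f i \<cdot> p' i = f j \<cdot> p' j" if "i < n" "j < n" for i j
    using cmp_assoc[OF P' obj(1) obj(3) obj(2) e(1) p(1) f] p' p(2) that by metis
  have u: "\<exists>!h. h \<in> hom C Z P' \<and> (\<forall>i<n. p' i \<cdot> h = a i)"
    if c: "wide_cone C n A f Z a" for Z a
  proof -
    note Z = wide_coneD(1)[OF c] and a = wide_coneD(2,3)[OF c]
    have ep: "p' i \<cdot> h = p i \<cdot> (e \<cdot> h)" if "h \<in> hom C Z P'" "i < n" for h i
      using cmp_assoc[OF Z P' obj(1) obj(3) that(1) e(1) p(1)] p' that by metis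
    obtain h where h: "h \<in> hom C Z P" "\<And>i. i < n \<Longrightarrow> p i \<cdot> h = a i"
      using wide_pb_ex[OF W Z a] by blast
    show ?thesis
    proof (rule ex1I[of _ "e' \<cdot> h"], intro conjI allI impI)
      show e'h: "e' \<cdot> h \<in> hom C Z P'" by (rule cmp_hom[OF Z obj(1) P' h(1) e(2)])
      have "e \<cdot> e' \<cdot> h = h"
        using cmp_assoc[OF Z obj(1) P' obj(1) h(1) e(2) e(1)] e(3) idm_cmp[OF Z obj(1) h(1)] by simp
      then show "p' i \<cdot> e' \<cdot> h = a i" if "i < n" for i using ep[OF e'h that] h(2)[OF that] by simp
    next
      fix k assume k: "k \<in> hom C Z P' \<and> (\<forall>i<n. p' i \<cdot> k = a i)"
      have "e \<cdot> k = h"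
        by (rule wide_pb_eqI[OF W Z]) (use k h ep cmp_hom[OF Z P' obj(1) _ e(1)] in metis)+
      moreover have "e' \<cdot> e \<cdot> k = k"
        using cmp_assoc[OF Z P' obj(1) P' _ e(1) e(2), of k] e(4) idm_cmp[OF Z P', of k] k by simp
      ultimately show "k = e' \<cdot> h" by simp
    qed
  qed
  show ?thesis by (rule wide_pbI[OF n obj(2,3) f wide_coneI[OF P' p'h c] u])
qed

text \<open>The part of \<^const>\<open>tangent_iso\<close> that transports limits.\<close>

definition cat_iso ::
  "('o, 'a, 'y) cat_scheme \<Rightarrow> ('p, 'b, 'z) cat_scheme \<Rightarrow> ('o \<Rightarrow> 'p) \<Rightarrow> ('a \<Rightarrow> 'b) \<Rightarrow> bool" where
  "cat_iso C D Fo Fa \<longleftrightarrow>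
     bij_betw Fo (obj C) (obj D) \<and>
     (\<forall>A\<in>obj C. \<forall>B\<in>obj C. bij_betw Fa (hom C A B) (hom D (Fo A) (Fo B))) \<and>
     (\<forall>A\<in>obj C. Fa (idm C A) = idm D (Fo A)) \<and>
     (\<forall>A\<in>obj C. \<forall>B\<in>obj C. \<forall>E\<in>obj C. \<forall>f\<in>hom C A B. \<forall>g\<in>hom C B E.
        Fa (g \<cdot>\<^bsub>C\<^esub> f) = Fa g \<cdot>\<^bsub>D\<^esub> Fa f)"

lemma tangent_iso_cat_iso: "tangent_iso C D Fo Fa \<Longrightarrow> cat_iso C D Fo Fa"
  unfolding tangent_iso_def cat_iso_def by blast

lemma cat_iso_hom:
  "cat_iso C D Fo Fa \<Longrightarrow> A \<in> obj C \<Longrightarrow> B \<in> obj C \<Longrightarrow> f \<in> hom C A B \<Longrightarrow> Fa f \<in> hom D (Fo A) (Fo B)"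
  unfolding cat_iso_def by (meson bij_betwE)

lemma cat_iso_obj: "cat_iso C D Fo Fa \<Longrightarrow> A \<in> obj C \<Longrightarrow> Fo A \<in> obj D"
  unfolding cat_iso_def by (meson bij_betwE)

lemma cat_iso_cmp:
  "cat_iso C D Fo Fa \<Longrightarrow> A \<in> obj C \<Longrightarrow> B \<in> obj C \<Longrightarrow> E \<in> obj C \<Longrightarrow> f \<in> hom C A B \<Longrightarrow> g \<in> hom C B E \<Longrightarrow>
   Fa (g \<cdot>\<^bsub>C\<^esub> f) = Fa g \<cdot>\<^bsub>D\<^esub> Fa f"
  unfolding cat_iso_def by blast

lemma cat_iso_inj:
  "cat_iso C D Fo Fa \<Longrightarrow> A \<in> obj C \<Longrightarrow> B \<in> obj C \<Longrightarrow> f \<in> hom C A B \<Longrightarrow> g \<in> hom C A B \<Longrightarrow> Fa f = Fa g \<Longrightarrow> f = g"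
  unfolding cat_iso_def by (meson bij_betw_imp_inj_on inj_onD)

lemma cat_iso_full:
  assumes "cat_iso C D Fo Fa" "A \<in> obj C" "B \<in> obj C" "g \<in> hom D (Fo A) (Fo B)"
  obtains f where "f \<in> hom C A B" "Fa f = g"
  using assms unfolding cat_iso_def bij_betw_def by (metis imageE)

lemma cat_iso_surj:
  assumes "cat_iso C D Fo Fa" "B \<in> obj D"
  obtains A where "A \<in> obj C" "Fo A = B"
  using assms unfolding cat_iso_def bij_betw_def by (metis imageE)

lemma cat_iso_category:
  assumes I: "cat_iso C D Fo Fa" and C: "category C"
  shows "category D"
proof -
  interpret category C by fact
  note s = cat_iso_surj[OF I] and fl = cat_iso_full[OF I] and c = cat_iso_cmp[OF I]
    and ho = cat_iso_hom[OF I]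
  have i: "Fa (idm C A) = idm D (Fo A)" if "A \<in> obj C" for A using I that
    unfolding cat_iso_def by blast
  show ?thesis
  proof
    fix A' assume "A' \<in> obj D"
    then show "idm D A' \<in> hom D A' A'" by (metis s i ho idm_hom)
  next
    fix A' B' E' f' g' assume "A' \<in> obj D" "B' \<in> obj D" "E' \<in> obj D"
      and f': "f' \<in> hom D A' B'" "g' \<in> hom D B' E'"
    then obtain A B E where o: "A \<in> obj C" "B \<in> obj C" "E \<in> obj C" "A' = Fo A" "B' = Fo B"
      "E' = Fo E"
      by (metis s)
    then obtain f g where "f \<in> hom C A B" "g \<in> hom C B E" "f' = Fa f" "g' = Fa g"
      using f' fl by metis
    then show "g' \<cdot>\<^bsub>D\<^esub> f' \<in> hom D A' E'" using c o ho cmp_hom by metis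
  next
    fix A' B' f' assume "A' \<in> obj D" "B' \<in> obj D" and f': "f' \<in> hom D A' B'"
    then obtain A B where o: "A \<in> obj C" "B \<in> obj C" "A' = Fo A" "B' = Fo B"
      by (metis s)
    then obtain f where f: "f \<in> hom C A B" "f' = Fa f" using f' fl by metis
    show "f' \<cdot>\<^bsub>D\<^esub> idm D A' = f'"
      using c[OF o(1,1,2) idm_hom[OF o(1)] f(1)] i[OF o(1)] cmp_idm[OF o(1,2) f(1)] f(2) o(3)
        by metis
    show "idm D B' \<cdot>\<^bsub>D\<^esub> f' = f'"
      using c[OF o(1,2,2) f(1) idm_hom[OF o(2)]] i[OF o(2)] idm_cmp[OF o(1,2) f(1)] f(2) o(4)
        by metis
  next
    fix A' B' E' G' f' g' h' assume "A' \<in> obj D" "B' \<in> obj D" "E' \<in> obj D" "G' \<in> obj D"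
      and f': "f' \<in> hom D A' B'" "g' \<in> hom D B' E'" "h' \<in> hom D E' G'"
    then obtain A B E G where o: "A \<in> obj C" "B \<in> obj C" "E \<in> obj C" "G \<in> obj C"
      "A' = Fo A" "B' = Fo B" "E' = Fo E" "G' = Fo G"
      by (metis s)
    obtain f where f: "f \<in> hom C A B" "f' = Fa f" using f' fl o by metis
    obtain g where g: "g \<in> hom C B E" "g' = Fa g" using f' fl o by metis
    obtain h where h: "h \<in> hom C E G" "h' = Fa h" using f' fl o by metis
    show "(h' \<cdot>\<^bsub>D\<^esub> g') \<cdot>\<^bsub>D\<^esub> f' = h' \<cdot>\<^bsub>D\<^esub> g' \<cdot>\<^bsub>D\<^esub> f'"
      using c[OF o(1,2,4) f(1) cmp_hom[OF o(2,3,4) g(1) h(1)]] c[OF o(2,3,4) g(1) h(1)]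
        c[OF o(1,3,4) cmp_hom[OF o(1,2,3) f(1) g(1)] h(1)] c[OF o(1,2,3) f(1) g(1)]
        cmp_assoc[OF o(1-4) f(1) g(1) h(1)] f(2) g(2) h(2) by metis
  qed
qed

lemma cat_iso_wide_pb:
  assumes I: "cat_iso C D Fo Fa" and C: "category C" and W: "wide_pb C n A B f P p"
  shows "wide_pb D n (\<lambda>i. Fo (A i)) (Fo B) (\<lambda>i. Fa (f i)) (Fo P) (\<lambda>i. Fa (p i))"
proof -
  interpret category C by fact
  note s = cat_iso_surj[OF I] and fl = cat_iso_full[OF I] and c = cat_iso_cmp[OF I]
    and ho = cat_iso_hom[OF I]
  have obj: "P \<in> obj C" "B \<in> obj C" "\<And>i. i < n \<Longrightarrow> A i \<in> obj C"
    and f: "\<And>i. i < n \<Longrightarrow> f i \<in> hom C (A i) B"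
    and p: "\<And>i. i < n \<Longrightarrow> p i \<in> hom C P (A i)" "\<And>i j. i < n \<Longrightarrow> j < n \<Longrightarrow> f i \<cdot>\<^bsub>C\<^esub> p i = f j \<cdot>\<^bsub>C\<^esub> p j"
    and n: "n \<ge> 1"
    by (fact wide_pbD[OF W])+
  show ?thesis
  proof (rule wide_pbI)
    show "n \<ge> 1" by (rule n)
    show "Fo B \<in> obj D" using obj cat_iso_obj[OF I] by auto
    show "Fo (A i) \<in> obj D" "Fa (f i) \<in> hom D (Fo (A i)) (Fo B)" if "i < n" for i
      using obj cat_iso_obj[OF I] ho f that by auto
    show "wide_cone D n (\<lambda>i. Fo (A i)) (\<lambda>i. Fa (f i)) (Fo P) (\<lambda>i. Fa (p i))"
    proof (rule wide_coneI)
      show "Fo P \<in> obj D" using obj cat_iso_obj[OF I] by auto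
      show "Fa (p i) \<in> hom D (Fo P) (Fo (A i))" if "i < n" for i using obj ho p that by auto
      show "Fa (f i) \<cdot>\<^bsub>D\<^esub> Fa (p i) = Fa (f j) \<cdot>\<^bsub>D\<^esub> Fa (p j)" if "i < n" "j < n" for i j
        using c[OF obj(1) obj(3) obj(2) p(1) f] p(2) that by metis
    qed
    fix Z' a' assume "wide_cone D n (\<lambda>i. Fo (A i)) (\<lambda>i. Fa (f i)) Z' a'"
    note Z' = wide_coneD(1)[OF this] and a' = wide_coneD(2,3)[OF this]
    obtain Z where Z: "Z \<in> obj C" "Z' = Fo Z" using s Z' by metis
    have "\<exists>a. a \<in> hom C Z (A i) \<and> Fa a = a' i" if "i < n" for i
      using fl[OF Z(1) obj(3)] a'(1) Z(2) that by metis
    then obtain a where a: "\<And>i. i < n \<Longrightarrow> a i \<in> hom C Z (A i)" "\<And>i. i < n \<Longrightarrow> Fa (a i) = a' i" by metis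
    have "f i \<cdot>\<^bsub>C\<^esub> a i = f j \<cdot>\<^bsub>C\<^esub> a j" if "i < n" "j < n" for i j
    proof (rule cat_iso_inj[OF I Z(1) obj(2)])
      show "f i \<cdot>\<^bsub>C\<^esub> a i \<in> hom C Z B" "f j \<cdot>\<^bsub>C\<^esub> a j \<in> hom C Z B"
        using cmp_hom[OF Z(1) obj(3) obj(2) a(1) f] that by auto
      show "Fa (f i \<cdot>\<^bsub>C\<^esub> a i) = Fa (f j \<cdot>\<^bsub>C\<^esub> a j)"
        using c[OF Z(1) obj(3) obj(2) a(1) f] a(2) a' that by metis
    qed
    then obtain h where h: "h \<in> hom C Z P" "\<And>i. i < n \<Longrightarrow> p i \<cdot>\<^bsub>C\<^esub> h = a i"
      using wide_pb_ex[OF W Z(1) a(1)] by blast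
    show "\<exists>!h. h \<in> hom D Z' (Fo P) \<and> (\<forall>i<n. Fa (p i) \<cdot>\<^bsub>D\<^esub> h = a' i)"
    proof (rule ex1I[of _ "Fa h"], intro conjI allI impI)
      show "Fa h \<in> hom D Z' (Fo P)" using ho[OF Z(1) obj(1) h(1)] Z(2) by simp
      show "Fa (p i) \<cdot>\<^bsub>D\<^esub> Fa h = a' i" if "i < n" for i
        using c[OF Z(1) obj(1) obj(3) h(1) p(1)] h(2) a(2) that by metis
    next
      fix k' assume k': "k' \<in> hom D Z' (Fo P) \<and> (\<forall>i<n. Fa (p i) \<cdot>\<^bsub>D\<^esub> k' = a' i)"
      then obtain k where k: "k \<in> hom C Z P" "k' = Fa k" using fl[OF Z(1) obj(1)] Z(2) by metis
      have "k = h"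
      proof (rule wide_pb_eqI[OF W Z(1) k(1) h(1)])
        fix i assume i: "i < n"
        show "p i \<cdot>\<^bsub>C\<^esub> k = p i \<cdot>\<^bsub>C\<^esub> h"
        proof (rule cat_iso_inj[OF I Z(1) obj(3)[OF i]])
          show "p i \<cdot>\<^bsub>C\<^esub> k \<in> hom C Z (A i)" "p i \<cdot>\<^bsub>C\<^esub> h \<in> hom C Z (A i)"
            using cmp_hom[OF Z(1) obj(1) obj(3) _ p(1)] i k(1) h(1) by auto
          show "Fa (p i \<cdot>\<^bsub>C\<^esub> k) = Fa (p i \<cdot>\<^bsub>C\<^esub> h)"
            using c[OF Z(1) obj(1) obj(3) k(1) p(1)] h(2) a(2) k' k(2) i by metis
        qed
      qed
      then show "k' = Fa h" using k by simp
    qed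
  qed
qed

lemma pair_props:
  assumes W: "is_pb C A B D f g P u v" and Z: "Z \<in> obj C" "a \<in> hom C Z A" "b \<in> hom C Z B"
    "f \<cdot>\<^bsub>C\<^esub> a = g \<cdot>\<^bsub>C\<^esub> b"
  shows "pair C Z P u v a b \<in> hom C Z P" "u \<cdot>\<^bsub>C\<^esub> pair C Z P u v a b = a"
    "v \<cdot>\<^bsub>C\<^esub> pair C Z P u v a b = b"
proof -
  have "\<exists>!h. h \<in> hom C Z P \<and> u \<cdot>\<^bsub>C\<^esub> h = a \<and> v \<cdot>\<^bsub>C\<^esub> h = b" using W Z unfolding is_pb_def by blast
  from theI'[OF this] show "pair C Z P u v a b \<in> hom C Z P" "u \<cdot>\<^bsub>C\<^esub> pair C Z P u v a b = a"
    "v \<cdot>\<^bsub>C\<^esub> pair C Z P u v a b = b" unfolding pair_def by auto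
qed

lemma (in category) pair_eqI:
  assumes W: "is_pb C A B D f g P u v" and Z: "Z \<in> obj C" "h \<in> hom C Z P" "u \<cdot> h = a" "v \<cdot> h = b"
  shows "pair C Z P u v a b = h"
  unfolding pair_def
proof (rule the_equality)
  show "h \<in> hom C Z P \<and> u \<cdot> h = a \<and> v \<cdot> h = b" using Z by simp
next
  fix k assume k: "k \<in> hom C Z P \<and> u \<cdot> k = a \<and> v \<cdot> k = b"
  show "k = h"
    by (rule wide_pb_eqI[OF W[unfolded is_pb_iff_wide_pb] Z(1)]) (use k Z in auto)
qed

section \<open>Calculus of 2-cells\<close>

context two_category
begin

text \<open>Membership in a hom-set is rewritten to equations on domains and codomains. Typing conditions
  of rewrite rules then contain no variables beyond those of the left-hand side, and the simplifier
  can normalise pasting diagrams: vertical composites are bracketed to the right, whiskerings are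
  moved inwards to single 2-cells, and left whiskerings are applied one 1-cell at a time.\<close>

lemma in_hom1 [simp]: "F \<in> hom1 K X Y \<longleftrightarrow> F \<in> cells1 K \<and> dom1 K F = X \<and> cod1 K F = Y"
  by (simp add: hom1_def)

lemma in_hom2 [simp]: "\<phi> \<in> hom2 K F G \<longleftrightarrow> \<phi> \<in> cells2 K \<and> dom2 K \<phi> = F \<and> cod2 K \<phi> = G"
  by (simp add: hom2_def)

lemma cells0_dom1 [simp]: "F \<in> cells1 K \<Longrightarrow> dom1 K F \<in> cells0 K"
  and cells0_cod1 [simp]: "F \<in> cells1 K \<Longrightarrow> cod1 K F \<in> cells0 K"
  using cells1_cells0 by auto

lemma cells1_dom2 [simp]: "\<phi> \<in> cells2 K \<Longrightarrow> dom2 K \<phi> \<in> cells1 K"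
  and cells1_cod2 [simp]: "\<phi> \<in> cells2 K \<Longrightarrow> cod2 K \<phi> \<in> cells1 K"
  and dom1_cod2: "\<phi> \<in> cells2 K \<Longrightarrow> dom1 K (cod2 K \<phi>) = dom1 K (dom2 K \<phi>)"
  and cod1_cod2: "\<phi> \<in> cells2 K \<Longrightarrow> cod1 K (cod2 K \<phi>) = cod1 K (dom2 K \<phi>)"
  using cells2_cells1 by auto

lemma id1_cell [simp]: "X \<in> cells0 K \<Longrightarrow> id1 K X \<in> cells1 K"
    "X \<in> cells0 K \<Longrightarrow> dom1 K (id1 K X) = X" "X \<in> cells0 K \<Longrightarrow> cod1 K (id1 K X) = X"
  using id1_hom by auto

lemma comp1_cell [simp]:
  assumes "F \<in> cells1 K" "G \<in> cells1 K" "dom1 K G = cod1 K F"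
  shows "G \<odot> F \<in> cells1 K" "dom1 K (G \<odot> F) = dom1 K F" "cod1 K (G \<odot> F) = cod1 K G"
  using comp1_hom[of F "dom1 K F" "cod1 K F" G "cod1 K G"] assms by auto

lemma comp1_unit [simp]:
  "F \<in> cells1 K \<Longrightarrow> cod1 K F = Y \<Longrightarrow> id1 K Y \<odot> F = F"
  "F \<in> cells1 K \<Longrightarrow> dom1 K F = Y \<Longrightarrow> F \<odot> id1 K Y = F"
  using comp1_id_left comp1_id_right by auto

lemma comp1_assoc' [simp]:
  "F \<in> cells1 K \<Longrightarrow> G \<in> cells1 K \<Longrightarrow> H \<in> cells1 K \<Longrightarrow> dom1 K G = cod1 K F \<Longrightarrow> dom1 K H = cod1 K G \<Longrightarrow>
   (H \<odot> G) \<odot> F = H \<odot> G \<odot> F"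
  using comp1_assoc[of F "dom1 K F" "cod1 K F" G "cod1 K G" H "cod1 K H"] by auto

lemma id2_cell [simp]:
  "F \<in> cells1 K \<Longrightarrow> id2 K F \<in> cells2 K" "F \<in> cells1 K \<Longrightarrow> dom2 K (id2 K F) = F"
  "F \<in> cells1 K \<Longrightarrow> cod2 K (id2 K F) = F"
  using id2_hom by auto

lemma vcomp_cell [simp]:
  assumes "\<phi> \<in> cells2 K" "\<psi> \<in> cells2 K" "dom2 K \<psi> = cod2 K \<phi>"
  shows "\<psi> \<bullet> \<phi> \<in> cells2 K" "dom2 K (\<psi> \<bullet> \<phi>) = dom2 K \<phi>" "cod2 K (\<psi> \<bullet> \<phi>) = cod2 K \<psi>"
  using vcomp_hom[of \<phi> "dom2 K \<phi>" "cod2 K \<phi>" \<psi> "cod2 K \<psi>"] assms by auto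

lemma vcomp_unit [simp]:
  "\<phi> \<in> cells2 K \<Longrightarrow> cod2 K \<phi> = F \<Longrightarrow> id2 K F \<bullet> \<phi> = \<phi>"
  "\<phi> \<in> cells2 K \<Longrightarrow> dom2 K \<phi> = F \<Longrightarrow> \<phi> \<bullet> id2 K F = \<phi>"
  using vcomp_id_left[of \<phi> "dom2 K \<phi>" "cod2 K \<phi>"] vcomp_id_right[of \<phi> "dom2 K \<phi>" "cod2 K \<phi>"] by auto

lemma vcomp_assoc' [simp]:
  "\<phi> \<in> cells2 K \<Longrightarrow> \<psi> \<in> cells2 K \<Longrightarrow> \<chi> \<in> cells2 K \<Longrightarrow> dom2 K \<psi> = cod2 K \<phi> \<Longrightarrow> dom2 K \<chi> = cod2 K \<psi> \<Longrightarrow>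
   (\<chi> \<bullet> \<psi>) \<bullet> \<phi> = \<chi> \<bullet> \<psi> \<bullet> \<phi>"
  using vcomp_assoc[of \<phi> "dom2 K \<phi>" "cod2 K \<phi>" \<psi> "cod2 K \<psi>" \<chi> "cod2 K \<chi>"] by auto

lemma whl_cell [simp]:
  assumes "F \<in> cells1 K" "\<phi> \<in> cells2 K" "dom1 K F = cod1 K (dom2 K \<phi>)"
  shows "F \<rhd> \<phi> \<in> cells2 K" "dom2 K (F \<rhd> \<phi>) = F \<odot> dom2 K \<phi>" "cod2 K (F \<rhd> \<phi>) = F \<odot> cod2 K \<phi>"
  using hcomp_hom[of "dom2 K \<phi>" "dom1 K (dom2 K \<phi>)" "cod1 K (dom2 K \<phi>)" F "cod1 K F" \<phi> "cod2 K \<phi>"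
    "id2 K F" F] assms
  unfolding whl_def by auto

lemma whr_cell [simp]:
  assumes "F \<in> cells1 K" "\<phi> \<in> cells2 K" "dom1 K (dom2 K \<phi>) = cod1 K F"
  shows "\<phi> \<lhd> F \<in> cells2 K" "dom2 K (\<phi> \<lhd> F) = dom2 K \<phi> \<odot> F" "cod2 K (\<phi> \<lhd> F) = cod2 K \<phi> \<odot> F"
  using hcomp_hom[of F "dom1 K F" "cod1 K F" "dom2 K \<phi>" "cod1 K (dom2 K \<phi>)" "id2 K F" F \<phi>
    "cod2 K \<phi>"] assms
  unfolding whr_def by auto

lemma whl_comp [simp]:
  assumes "F \<in> cells1 K" "G \<in> cells1 K" "\<phi> \<in> cells2 K" "dom1 K F = cod1 K (dom2 K \<phi>)"
    "dom1 K G = cod1 K F"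
  shows "(G \<odot> F) \<rhd> \<phi> = G \<rhd> F \<rhd> \<phi>"
  using hcomp_assoc[of "dom2 K \<phi>" "dom1 K (dom2 K \<phi>)" "dom1 K F" F "cod1 K F" G "cod1 K G" \<phi>
    "cod2 K \<phi>" "id2 K F" F "id2 K G" G]
    hcomp_id2[of F "dom1 K F" "cod1 K F" G "cod1 K G"] assms
  unfolding whl_def by auto

lemma whr_comp [simp]:
  assumes "F \<in> cells1 K" "G \<in> cells1 K" "\<phi> \<in> cells2 K" "dom1 K (dom2 K \<phi>) = cod1 K G"
    "dom1 K G = cod1 K F"
  shows "\<phi> \<lhd> G \<lhd> F = \<phi> \<lhd> (G \<odot> F)"
  using hcomp_assoc[of F "dom1 K F" "cod1 K F" G "cod1 K G" "dom2 K \<phi>" "cod1 K (dom2 K \<phi>)"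
    "id2 K F" F "id2 K G" G \<phi> "cod2 K \<phi>"]
    hcomp_id2[of F "dom1 K F" "cod1 K F" G "cod1 K G"] assms
  unfolding whr_def by auto

lemma whl_whr [simp]:
  assumes "F \<in> cells1 K" "G \<in> cells1 K" "\<phi> \<in> cells2 K" "dom1 K (dom2 K \<phi>) = cod1 K G"
    "dom1 K F = cod1 K (dom2 K \<phi>)"
  shows "(F \<rhd> \<phi>) \<lhd> G = F \<rhd> (\<phi> \<lhd> G)"
  using hcomp_assoc[of G "dom1 K G" "cod1 K G" "dom2 K \<phi>" "cod1 K (dom2 K \<phi>)" F "cod1 K F"
    "id2 K G" G \<phi> "cod2 K \<phi>" "id2 K F" F] assms
  unfolding whr_def whl_def by auto

lemma whl_id2 [simp]: "F \<in> cells1 K \<Longrightarrow> G \<in> cells1 K \<Longrightarrow> dom1 K F = cod1 K G \<Longrightarrow> F \<rhd> id2 K G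
    = id2 K (F \<odot> G)"
  unfolding whl_def using hcomp_id2 by auto

lemma id2_whr [simp]: "F \<in> cells1 K \<Longrightarrow> G \<in> cells1 K \<Longrightarrow> dom1 K F = cod1 K G \<Longrightarrow> id2 K F \<lhd> G
    = id2 K (F \<odot> G)"
  unfolding whr_def using hcomp_id2 by auto

lemma id1_whl [simp]: "\<phi> \<in> cells2 K \<Longrightarrow> cod1 K (dom2 K \<phi>) = Y \<Longrightarrow> id1 K Y \<rhd> \<phi> = \<phi>"
  unfolding whl_def using hcomp_id_left[of "dom2 K \<phi>" "dom1 K (dom2 K \<phi>)" Y \<phi> "cod2 K \<phi>"] by auto

lemma whr_id1 [simp]: "\<phi> \<in> cells2 K \<Longrightarrow> dom1 K (dom2 K \<phi>) = Y \<Longrightarrow> \<phi> \<lhd> id1 K Y = \<phi>"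
  unfolding whr_def using hcomp_id_right[of "dom2 K \<phi>" Y "cod1 K (dom2 K \<phi>)" \<phi> "cod2 K \<phi>"] by auto

lemma whl_vcomp [simp]:
  assumes "F \<in> cells1 K" "\<phi> \<in> cells2 K" "\<psi> \<in> cells2 K" "dom2 K \<psi> = cod2 K \<phi>"
    "dom1 K F = cod1 K (dom2 K \<phi>)"
  shows "F \<rhd> (\<psi> \<bullet> \<phi>) = (F \<rhd> \<psi>) \<bullet> (F \<rhd> \<phi>)"
  using interchange[of "dom2 K \<phi>" "dom1 K (dom2 K \<phi>)" "cod1 K (dom2 K \<phi>)" F "cod1 K F" \<phi>
    "cod2 K \<phi>" \<psi> "cod2 K \<psi>" "id2 K F" F "id2 K F" F] assms
  unfolding whl_def by auto

lemma vcomp_whr [simp]: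
  assumes "F \<in> cells1 K" "\<phi> \<in> cells2 K" "\<psi> \<in> cells2 K" "dom2 K \<psi> = cod2 K \<phi>"
    "dom1 K (dom2 K \<phi>) = cod1 K F"
  shows "(\<psi> \<bullet> \<phi>) \<lhd> F = (\<psi> \<lhd> F) \<bullet> (\<phi> \<lhd> F)"
  using interchange[of F "dom1 K F" "cod1 K F" "dom2 K \<phi>" "cod1 K (dom2 K \<phi>)" "id2 K F" F
    "id2 K F" F \<phi> "cod2 K \<phi>" \<psi> "cod2 K \<psi>"] assms
  unfolding whr_def by auto

text \<open>Both sides are the horizontal composite of \<open>\<psi>\<close> and \<open>\<phi>\<close>.\<close>

lemma naturality:
  assumes "\<phi> \<in> cells2 K" "\<psi> \<in> cells2 K" "dom1 K (dom2 K \<psi>) = cod1 K (dom2 K \<phi>)"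
  shows "(\<psi> \<lhd> cod2 K \<phi>) \<bullet> (dom2 K \<psi> \<rhd> \<phi>) = (cod2 K \<psi> \<rhd> \<phi>) \<bullet> (\<psi> \<lhd> dom2 K \<phi>)"
proof -
  note a = interchange[of "dom2 K \<phi>" "dom1 K (dom2 K \<phi>)" "cod1 K (dom2 K \<phi>)" "dom2 K \<psi>"
    "cod1 K (dom2 K \<psi>)"]
  show ?thesis
    using a[of \<phi> "cod2 K \<phi>" "id2 K (cod2 K \<phi>)" "cod2 K \<phi>" "id2 K (dom2 K \<psi>)" "dom2 K \<psi>" \<psi>
      "cod2 K \<psi>"]
      a[of "id2 K (dom2 K \<phi>)" "dom2 K \<phi>" \<phi> "cod2 K \<phi>" \<psi> "cod2 K \<psi>" "id2 K (cod2 K \<psi>)"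
        "cod2 K \<psi>"] assms
    unfolding whr_def whl_def by auto
qed

lemma nat_eq:
  assumes "\<psi> \<in> cells2 K" "dom2 K \<psi> = F" "cod2 K \<psi> = F'" "\<phi> \<in> cells2 K" "dom2 K \<phi> = G"
    "cod2 K \<phi> = G'"
    "dom1 K F = cod1 K G"
  shows "(\<psi> \<lhd> G') \<bullet> (F \<rhd> \<phi>) = (F' \<rhd> \<phi>) \<bullet> (\<psi> \<lhd> G)"
  using naturality[of \<phi> \<psi>] assms by auto

lemma homcat_sel [simp]: "obj (homcat X Y) = hom1 K X Y" "hom (homcat X Y) = hom2 K"
  "idm (homcat X Y) = id2 K" "cmp (homcat X Y) = vcomp K"
  by (simp_all add: homcat_def)

lemma category_homcat: "category (homcat X Y)"
  by unfold_locales (auto simp: dom1_cod2 cod1_cod2)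

lemma cells1_Tpow:
  assumes "TT X \<in> hom1 K (carr X) (carr X)"
  shows "Tpow X m \<in> hom1 K (carr X) (carr X)"
proof -
  have "carr X \<in> cells0 K" using assms cells0_dom1[of "TT X"] by simp
  then show ?thesis using assms by (induction m) (auto simp: Tpow_def)
qed

end

section \<open>The pullbacks of the projection of a tangent structure\<close>

context two_category
begin

text \<open>An equation between composites, put in the form in which it rewrites inside longer composites
  that are bracketed to the right; the second version also brackets the new composite.\<close>

lemma vcomp_extend:
  assumes "a \<bullet> b = r" "a \<in> cells2 K" "b \<in> cells2 K" "x \<in> cells2 K" "dom2 K a = cod2 K b"
    "dom2 K b = cod2 K x"
  shows "a \<bullet> b \<bullet> x = r \<bullet> x"
  using assms by (metis vcomp_assoc')

lemma vcomp_extend2: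
  assumes "a \<bullet> b = c \<bullet> d" "a \<in> cells2 K" "b \<in> cells2 K" "c \<in> cells2 K" "d \<in> cells2 K" "x \<in> cells2 K"
    "dom2 K a = cod2 K b" "dom2 K b = cod2 K x" "dom2 K c = cod2 K d" "dom2 K d = cod2 K x"
  shows "a \<bullet> b \<bullet> x = c \<bullet> d \<bullet> x"
  using assms by (metis vcomp_assoc')

text \<open>The typing of a tangent structure together with the existence of the pullbacks \<open>T\<^sub>n\<close>. Sums
  make sense from here on, before the equations of a tangentad are known; this is needed while a
  tangent structure is being constructed.\<close>

definition tang_data :: "('x, 'm, 'c) tstruct \<Rightarrow> bool" where
  "tang_data X \<longleftrightarrow>
     carr X \<in> cells0 K \<and> TT X \<in> hom1 K (carr X) (carr X) \<and> pp X \<in> hom2 K (TT X) (id1 K (carr X)) \<and>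
     zz X \<in> hom2 K (id1 K (carr X)) (TT X) \<and> ss X \<in> hom2 K (T2 X) (TT X) \<and>
     ll X \<in> hom2 K (TT X) (TT X \<odot> TT X) \<and> cc X \<in> hom2 K (TT X \<odot> TT X) (TT X \<odot> TT X) \<and> has_Tn X"

lemma tangentad_tang_data [simp]: "tangentad X \<Longrightarrow> tang_data X"
  unfolding tangentad_def tang_data_def by (simp add: Let_def)

lemma tang_data_cells [simp]:
  assumes "tang_data X"
  shows "carr X \<in> cells0 K" "TT X \<in> cells1 K" "dom1 K (TT X) = carr X" "cod1 K (TT X) = carr X"
    "pp X \<in> cells2 K" "dom2 K (pp X) = TT X" "cod2 K (pp X) = id1 K (carr X)"
    "zz X \<in> cells2 K" "dom2 K (zz X) = id1 K (carr X)" "cod2 K (zz X) = TT X"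
    "ss X \<in> cells2 K" "dom2 K (ss X) = T2 X" "cod2 K (ss X) = TT X"
    "ll X \<in> cells2 K" "dom2 K (ll X) = TT X" "cod2 K (ll X) = TT X \<odot> TT X"
    "cc X \<in> cells2 K" "dom2 K (cc X) = TT X \<odot> TT X" "cod2 K (cc X) = TT X \<odot> TT X"
  using assms unfolding tang_data_def by auto

lemma Tpow_cells [simp]:
  assumes "tang_data X"
  shows "Tpow X m \<in> cells1 K" "dom1 K (Tpow X m) = carr X" "cod1 K (Tpow X m) = carr X"
  using cells1_Tpow[of X m] assms by auto

lemma Tpow_0 [simp]: "Tpow X 0 = id1 K (carr X)"
  and Tpow_Suc [simp]: "Tpow X (Suc m) = TT X \<odot> Tpow X m"
  by (simp_all add: Tpow_def)

text \<open>\<open>P\<close> is the \<open>n\<close>-fold pullback of \<open>p\<^sub>F\<close> along itself, pointwise and preserved by all \<open>T\<^sup>m\<close>. For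
  the identity \<open>F\<close> this is \<open>T\<^sub>n\<close> itself. The version over an arbitrary \<open>F\<close> is stable under
  precomposition and isomorphism.\<close>

definition Tn_at :: "('x, 'm, 'c) tstruct \<Rightarrow> 'x \<Rightarrow> 'm \<Rightarrow> nat \<Rightarrow> 'm \<Rightarrow> (nat \<Rightarrow> 'c) \<Rightarrow> bool" where
  "Tn_at X Y F n P \<pi> \<longleftrightarrow> Y \<in> cells0 K \<and> F \<in> hom1 K Y (carr X) \<and>
     P \<in> hom1 K Y (carr X) \<and> (\<forall>i<n. \<pi> i \<in> hom2 K P (TT X \<odot> F)) \<and>
     (\<forall>m. \<forall>Z\<in>cells0 K. \<forall>G\<in>hom1 K Z Y.
        wide_pb (homcat Z (carr X)) n (\<lambda>_. Tpow X m \<odot> TT X \<odot> F \<odot> G) (Tpow X m \<odot> F \<odot> G)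
          (\<lambda>_. Tpow X m \<rhd> (pp X \<lhd> (F \<odot> G))) (Tpow X m \<odot> P \<odot> G) (\<lambda>i. Tpow X m \<rhd> (\<pi> i \<lhd> G)))"

lemma Tn_at_cells:
  assumes "Tn_at X Y F n P \<pi>"
  shows "Y \<in> cells0 K" "F \<in> cells1 K" "dom1 K F = Y" "cod1 K F = carr X"
    "P \<in> cells1 K" "dom1 K P = Y" "cod1 K P = carr X"
    "\<And>i. i < n \<Longrightarrow> \<pi> i \<in> cells2 K" "\<And>i. i < n \<Longrightarrow> dom2 K (\<pi> i) = P"
      "\<And>i. i < n \<Longrightarrow> cod2 K (\<pi> i) = TT X \<odot> F"
  using assms unfolding Tn_at_def by auto

lemma Tn_at_wide_pb:
  assumes "Tn_at X Y F n P \<pi>" "Z \<in> cells0 K" "G \<in> cells1 K" "dom1 K G = Z" "cod1 K G = Y"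
  shows "wide_pb (homcat Z (carr X)) n (\<lambda>_. Tpow X m \<odot> TT X \<odot> F \<odot> G) (Tpow X m \<odot> F \<odot> G)
          (\<lambda>_. Tpow X m \<rhd> (pp X \<lhd> (F \<odot> G))) (Tpow X m \<odot> P \<odot> G) (\<lambda>i. Tpow X m \<rhd> (\<pi> i \<lhd> G))"
  using assms unfolding Tn_at_def by simp

lemma Tn_at_ge1:
  assumes "Tn_at X Y F n P \<pi>"
  shows "n \<ge> 1"
  using wide_pbD(3)[OF Tn_at_wide_pb[OF assms, of Y "id1 K Y" 0]] Tn_at_cells[OF assms] by simp

lemma Tn_at_wide_pb_0:
  assumes X: "tang_data X" and T: "Tn_at X Y F n P \<pi>"
  shows "wide_pb (homcat Y (carr X)) n (\<lambda>_. TT X \<odot> F) F (\<lambda>_. pp X \<lhd> F) P \<pi>"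
proof -
  note [simp] = X Tn_at_cells[OF T]
  show ?thesis
    by (rule wide_pb_transport[OF Tn_at_wide_pb[OF T, of Y "id1 K Y" 0, simplified]]) simp_all
qed

lemma Tn_at_wide_pb_1:
  assumes X: "tang_data X" and T: "Tn_at X Y F n P \<pi>"
  shows "wide_pb (homcat Y (carr X)) n (\<lambda>_. TT X \<odot> TT X \<odot> F) (TT X \<odot> F) (\<lambda>_. TT X \<rhd> (pp X \<lhd> F))
    (TT X \<odot> P) (\<lambda>i. TT X \<rhd> \<pi> i)"
proof -
  note [simp] = X Tn_at_cells[OF T]
  show ?thesis
    by (rule wide_pb_transport[OF Tn_at_wide_pb[OF T, of Y "id1 K Y" "Suc 0", simplified]]) simp_all
qed

lemma Tn_at_wide_pb_2:
  assumes X: "tang_data X" and T: "Tn_at X Y F n P \<pi>"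
  shows "wide_pb (homcat Y (carr X)) n (\<lambda>_. TT X \<odot> TT X \<odot> TT X \<odot> F) (TT X \<odot> TT X \<odot> F)
    (\<lambda>_. TT X \<rhd> TT X \<rhd> (pp X \<lhd> F)) (TT X \<odot> TT X \<odot> P) (\<lambda>i. TT X \<rhd> TT X \<rhd> \<pi> i)"
proof -
  note [simp] = X Tn_at_cells[OF T]
  show ?thesis
    by (rule wide_pb_transport[OF Tn_at_wide_pb[OF T, of Y "id1 K Y" "Suc (Suc 0)", simplified]])
      simp_all
qed

lemma Tn_at_whr:
  assumes X: "tang_data X" and T: "Tn_at X Y F n P \<pi>" and H: "H \<in> cells1 K" "dom1 K H = Z"
    "cod1 K H = Y"
  shows "Tn_at X Z (F \<odot> H) n (P \<odot> H) (\<lambda>i. \<pi> i \<lhd> H)"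
proof -
  note [simp] = X Tn_at_cells[OF T] H
  have [simp]: "Z \<in> cells0 K" using cells0_dom1[OF H(1)] H(2) by simp
  show ?thesis
    unfolding Tn_at_def
  proof (intro conjI allI ballI)
    fix m W G assume W: "W \<in> cells0 K" and G: "G \<in> hom1 K W Z"
    note [simp] = W G[simplified]
    show "wide_pb (homcat W (carr X)) n (\<lambda>_. Tpow X m \<odot> TT X \<odot> (F \<odot> H) \<odot> G) (Tpow X m \<odot> (F \<odot> H) \<odot> G)
          (\<lambda>_. Tpow X m \<rhd> pp X \<lhd> ((F \<odot> H) \<odot> G)) (Tpow X m \<odot> (P \<odot> H) \<odot> G)
          (\<lambda>i. Tpow X m \<rhd> ((\<pi> i \<lhd> H) \<lhd> G))"
      using G
        by simp (rule wide_pb_transport[OF Tn_at_wide_pb[OF T, of W "H \<odot> G" m, simplified]]; simp)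
  qed simp_all
qed

lemma Tn_at_unique:
  assumes X: "tang_data X" and T: "Tn_at X Y F n P \<pi>" and T': "Tn_at X Y F n P' \<pi>'"
  obtains e e' where "e \<in> hom2 K P' P" "e' \<in> hom2 K P P'" "e \<bullet> e' = id2 K P" "e' \<bullet> e = id2 K P'"
    "\<And>i. i < n \<Longrightarrow> \<pi> i \<bullet> e = \<pi>' i" "\<And>i. i < n \<Longrightarrow> \<pi>' i \<bullet> e' = \<pi> i"
  using category.wide_pb_unique[OF category_homcat Tn_at_wide_pb_0[OF X T] Tn_at_wide_pb_0[OF X T']]
  by (metis homcat_sel(2-4))

lemma wide_pb_homcat_iso:
  assumes W: "wide_pb (homcat Y Z) n A B f P p" and P': "P' \<in> hom1 K Y Z"
    and e: "e \<in> hom2 K P' P" "e' \<in> hom2 K P P'" "e \<bullet> e' = id2 K P" "e' \<bullet> e = id2 K P'"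
    and p': "\<And>i. i < n \<Longrightarrow> p i \<bullet> e = p' i"
  shows "wide_pb (homcat Y Z) n A B f P' p'"
  by (rule category.wide_pb_iso[OF category_homcat W, where e = e and e' = e']) (use assms in auto)

lemma Tn_at_iso:
  assumes X: "tang_data X" and T: "Tn_at X Y F n P \<pi>"
    and P': "P' \<in> cells1 K" "dom1 K P' = Y" "cod1 K P' = carr X"
    and e: "e \<in> hom2 K P' P" "e' \<in> hom2 K P P'" "e \<bullet> e' = id2 K P" "e' \<bullet> e = id2 K P'"
    and \<pi>': "\<And>i. i < n \<Longrightarrow> \<pi> i \<bullet> e = \<pi>' i"
  shows "Tn_at X Y F n P' \<pi>'"
proof -
  note [simp] = X Tn_at_cells[OF T] P' e[simplified]
  have [simp]: "\<pi>' i \<in> cells2 K" "dom2 K (\<pi>' i) = P'" "cod2 K (\<pi>' i) = TT X \<odot> F" if "i < n" for i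
    using that \<pi>'[OF that, symmetric] by auto
  show ?thesis
    unfolding Tn_at_def
  proof (intro conjI allI ballI)
    fix m W G assume W: "W \<in> cells0 K" and G: "G \<in> hom1 K W Y"
    note [simp] = W G[simplified]
    have "(Tpow X m \<rhd> (e \<lhd> G)) \<bullet> (Tpow X m \<rhd> (e' \<lhd> G)) = Tpow X m \<rhd> ((e \<bullet> e') \<lhd> G)"
      "(Tpow X m \<rhd> (e' \<lhd> G)) \<bullet> (Tpow X m \<rhd> (e \<lhd> G)) = Tpow X m \<rhd> ((e' \<bullet> e) \<lhd> G)"
      by (simp_all del: e)
    moreover have "(Tpow X m \<rhd> (\<pi> i \<lhd> G)) \<bullet> (Tpow X m \<rhd> (e \<lhd> G)) = Tpow X m \<rhd> ((\<pi> i \<bullet> e) \<lhd> G)"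
      if "i < n" for i
      using that by simp
    ultimately show "wide_pb (homcat W (carr X)) n (\<lambda>_. Tpow X m \<odot> TT X \<odot> F \<odot> G) (Tpow X m \<odot> F \<odot> G)
          (\<lambda>_. Tpow X m \<rhd> pp X \<lhd> (F \<odot> G)) (Tpow X m \<odot> P' \<odot> G) (\<lambda>i. Tpow X m \<rhd> (\<pi>' i \<lhd> G))"
      by (intro wide_pb_homcat_iso[OF Tn_at_wide_pb[OF T, of W G m],
            where e = "Tpow X m \<rhd> (e \<lhd> G)" and e' = "Tpow X m \<rhd> (e' \<lhd> G)"])
        (use \<pi>' in simp_all)
  qed simp_all
qed

lemma has_Tn_iff:
  assumes "carr X \<in> cells0 K" "TT X \<in> hom1 K (carr X) (carr X)"
    "pp X \<in> hom2 K (TT X) (id1 K (carr X))"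
  shows "has_Tn X \<longleftrightarrow> (\<forall>n\<ge>1. \<exists>P \<pi>. Tn_at X (carr X) (id1 K (carr X)) n P \<pi>)"
proof -
  note [simp] = assms[simplified] cells1_Tpow[OF assms(2), simplified]
  have "(P \<in> hom1 K (carr X) (carr X) \<and> (\<forall>i<n. \<pi> i \<in> hom2 K P (TT X)) \<and>
        (\<forall>m. \<forall>Y\<in>cells0 K. \<forall>G\<in>hom1 K Y (carr X).
           is_nfold (homcat Y (carr X)) n
             ((Tpow X m \<odot> TT X) \<odot> G) (Tpow X m \<odot> G) ((Tpow X m \<rhd> pp X) \<lhd> G)
             ((Tpow X m \<odot> P) \<odot> G) (\<lambda>i. (Tpow X m \<rhd> \<pi> i) \<lhd> G))) \<longleftrightarrow> Tn_at X (carr X) (id1 K (carr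
               X)) n P \<pi>"
    (is "?L \<longleftrightarrow> ?R") for n P \<pi>
  proof (cases "P \<in> hom1 K (carr X) (carr X) \<and> (\<forall>i<n. \<pi> i \<in> hom2 K P (TT X))")
    case True
    then have [simp]: "P \<in> cells1 K" "dom1 K P = carr X" "cod1 K P = carr X"
      "\<And>i. i < n \<Longrightarrow> \<pi> i \<in> cells2 K" "\<And>i. i < n \<Longrightarrow> dom2 K (\<pi> i) = P" "\<And>i. i < n \<Longrightarrow> cod2 K (\<pi> i) = TT X"
      by auto
    have "is_nfold (homcat Y (carr X)) n
             ((Tpow X m \<odot> TT X) \<odot> G) (Tpow X m \<odot> G) ((Tpow X m \<rhd> pp X) \<lhd> G)
             ((Tpow X m \<odot> P) \<odot> G) (\<lambda>i. (Tpow X m \<rhd> \<pi> i) \<lhd> G) \<longleftrightarrow>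
        wide_pb (homcat Y (carr X)) n (\<lambda>_. Tpow X m \<odot> TT X \<odot> id1 K (carr X) \<odot> G)
          (Tpow X m \<odot> id1 K (carr X) \<odot> G)
          (\<lambda>_. Tpow X m \<rhd> (pp X \<lhd> (id1 K (carr X) \<odot> G))) (Tpow X m \<odot> P \<odot> G)
            (\<lambda>i. Tpow X m \<rhd> (\<pi> i \<lhd> G))"
      if G: "G \<in> hom1 K Y (carr X)" for m Y G
      using that unfolding is_nfold_iff_wide_pb by simp (rule wide_pb_cong; simp)
    note eq = this
    have "(\<forall>m. \<forall>Y\<in>cells0 K. \<forall>G\<in>hom1 K Y (carr X).
           is_nfold (homcat Y (carr X)) n
             ((Tpow X m \<odot> TT X) \<odot> G) (Tpow X m \<odot> G) ((Tpow X m \<rhd> pp X) \<lhd> G)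
             ((Tpow X m \<odot> P) \<odot> G) (\<lambda>i. (Tpow X m \<rhd> \<pi> i) \<lhd> G)) \<longleftrightarrow>
      (\<forall>m. \<forall>Y\<in>cells0 K. \<forall>G\<in>hom1 K Y (carr X).
        wide_pb (homcat Y (carr X)) n (\<lambda>_. Tpow X m \<odot> TT X \<odot> id1 K (carr X) \<odot> G)
          (Tpow X m \<odot> id1 K (carr X) \<odot> G)
          (\<lambda>_. Tpow X m \<rhd> (pp X \<lhd> (id1 K (carr X) \<odot> G))) (Tpow X m \<odot> P \<odot> G)
            (\<lambda>i. Tpow X m \<rhd> (\<pi> i \<lhd> G)))"
      by (intro all_cong1 ball_cong refl eq)
    then show ?thesis using True unfolding Tn_at_def by simp
  qed (auto simp: Tn_at_def)
  note eq = this
  show ?thesis unfolding has_Tn_def Bex_def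
    by (rule all_cong, rule ex_cong1, unfold eq[symmetric]) auto
qed

lemma has_Tn_Tn_at:
  assumes "tang_data X" "n \<ge> 1"
  obtains P \<pi> where "Tn_at X (carr X) (id1 K (carr X)) n P \<pi>"
  using assms has_Tn_iff[of X] unfolding tang_data_def by blast

text \<open>The chosen kernel pair \<open>T\<^sub>2\<close> is only known to be some pullback in the category of
  endomorphisms; being isomorphic to the pullback given by the axioms, it is pointwise and
  preserved by all \<open>T\<^sup>m\<close> as well.\<close>

lemma T2_Tn_at_id:
  assumes X: "tang_data X"
  shows "Tn_at X (carr X) (id1 K (carr X)) 2 (T2 X) (two (\<pi>1 X) (\<pi>2 X))"
proof -
  note [simp] = X
  obtain P \<pi> where T: "Tn_at X (carr X) (id1 K (carr X)) 2 P \<pi>"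
    using has_Tn_Tn_at[OF X, of 2] by auto
  have "is_pb (homcat (carr X) (carr X)) (TT X) (TT X) (id1 K (carr X)) (pp X) (pp X) P (\<pi> 0) (\<pi> 1)"
    using Tn_at_wide_pb_0[OF X T] by (simp add: wide_pb_const_2_iff)
  from is_pb_kpair[OF this]
  have "is_pb (homcat (carr X) (carr X)) (TT X) (TT X) (id1 K (carr X)) (pp X) (pp X) (T2 X)
    (\<pi>1 X) (\<pi>2 X)"
    unfolding T2_def \<pi>1_def \<pi>2_def .
  then have W: "wide_pb (homcat (carr X) (carr X)) 2 (\<lambda>_. TT X) (id1 K (carr X)) (\<lambda>_. pp X) (T2 X)
    (two (\<pi>1 X) (\<pi>2 X))"
    by (simp add: wide_pb_const_2_iff)
  have W': "wide_pb (homcat (carr X) (carr X)) 2 (\<lambda>_. TT X) (id1 K (carr X)) (\<lambda>_. pp X) P \<pi>"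
    using Tn_at_wide_pb_0[OF X T] by simp
  obtain e e' where e: "e \<in> hom2 K (T2 X) P" "e' \<in> hom2 K P (T2 X)" "e \<bullet> e' = id2 K P"
    "e' \<bullet> e = id2 K (T2 X)"
    "\<And>i. i < 2 \<Longrightarrow> \<pi> i \<bullet> e = two (\<pi>1 X) (\<pi>2 X) i"
    using category.wide_pb_unique[OF category_homcat W' W] by (metis homcat_sel(2-4))
  show ?thesis
    by (rule Tn_at_iso[OF X T _ _ _ e]) (use wide_pbD(1)[OF W] in auto)
qed

lemma T2_cells [simp]:
  assumes X: "tang_data X"
  shows "T2 X \<in> cells1 K" "dom1 K (T2 X) = carr X" "cod1 K (T2 X) = carr X"
    "\<pi>1 X \<in> cells2 K" "dom2 K (\<pi>1 X) = T2 X" "cod2 K (\<pi>1 X) = TT X"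
    "\<pi>2 X \<in> cells2 K" "dom2 K (\<pi>2 X) = T2 X" "cod2 K (\<pi>2 X) = TT X"
  using Tn_at_cells[OF T2_Tn_at_id[OF X]] Tn_at_cells(8-10)[OF T2_Tn_at_id[OF X], of 0]
    Tn_at_cells(8-10)[OF T2_Tn_at_id[OF X], of 1] X by auto

lemma T2_Tn_at:
  assumes X: "tang_data X" and F: "F \<in> cells1 K" "dom1 K F = Y" "cod1 K F = carr X"
  shows "Tn_at X Y F 2 (T2 X \<odot> F) (two (\<pi>1 X \<lhd> F) (\<pi>2 X \<lhd> F))"
proof -
  have "(\<lambda>i. two (\<pi>1 X) (\<pi>2 X) i \<lhd> F) = two (\<pi>1 X \<lhd> F) (\<pi>2 X \<lhd> F)" by auto
  then show ?thesis using Tn_at_whr[OF X T2_Tn_at_id[OF X] F(1,2,3)] F X by simp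
qed

lemma T2_pb:
  assumes X: "tang_data X" and F: "F \<in> cells1 K" "dom1 K F = Y" "cod1 K F = carr X"
  shows "is_pb (homcat Y (carr X)) (TT X \<odot> F) (TT X \<odot> F) F (pp X \<lhd> F) (pp X \<lhd> F) (T2 X \<odot> F)
    (\<pi>1 X \<lhd> F) (\<pi>2 X \<lhd> F)"
  using Tn_at_wide_pb_0[OF X T2_Tn_at[OF assms]] by (simp add: wide_pb_const_2_iff)

lemma T2_pb_T:
  assumes X: "tang_data X" and F: "F \<in> cells1 K" "dom1 K F = Y" "cod1 K F = carr X"
  shows "is_pb (homcat Y (carr X)) (TT X \<odot> TT X \<odot> F) (TT X \<odot> TT X \<odot> F) (TT X \<odot> F)
    (TT X \<rhd> (pp X \<lhd> F)) (TT X \<rhd> (pp X \<lhd> F)) (TT X \<odot> T2 X \<odot> F) (TT X \<rhd> (\<pi>1 X \<lhd> F))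
      (TT X \<rhd> (\<pi>2 X \<lhd> F))"
  using Tn_at_wide_pb_1[OF X T2_Tn_at[OF assms]] by (simp add: wide_pb_const_2_iff)

lemma p_pi:
  assumes X: "tang_data X"
  shows "pp X \<bullet> \<pi>2 X = pp X \<bullet> \<pi>1 X"
  using T2_pb[OF X, of "id1 K (carr X)" "carr X"] X unfolding is_pb_def by auto

definition addable :: "('x, 'm, 'c) tstruct \<Rightarrow> 'm \<Rightarrow> 'c \<Rightarrow> 'c \<Rightarrow> bool" where
  "addable X F a b \<longleftrightarrow> F \<in> cells1 K \<and> cod1 K F = carr X \<and> a \<in> cells2 K \<and> b \<in> cells2 K \<and> dom2 K b
    = dom2 K a \<and>
     cod2 K a = TT X \<odot> F \<and> cod2 K b = TT X \<odot> F \<and> (pp X \<lhd> F) \<bullet> a = (pp X \<lhd> F) \<bullet> b"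

text \<open>The sum \<open>s\<^sub>F \<circ> \<langle>a, b\<rangle>\<close> of two 2-cells into \<open>T F\<close> over \<open>F\<close>. All equations about \<open>s\<close> are
  restated with it, which eliminates the induced maps into pullbacks from later calculations.\<close>

definition tsum :: "('x, 'm, 'c) tstruct \<Rightarrow> 'm \<Rightarrow> 'c \<Rightarrow> 'c \<Rightarrow> 'c" where
  "tsum X F a b = (ss X \<lhd> F) \<bullet> pair_T2 (dom1 K F) X F (dom2 K a) a b"

lemma pair_T2_tsum: "dom2 K a = A \<Longrightarrow> (ss X \<lhd> F) \<bullet> pair_T2 Y X F A a b = tsum X F a b"
  unfolding tsum_def pair_T2_def pair_def by simp

lemma addableI:
  assumes "tang_data X" "F \<in> cells1 K" "cod1 K F = carr X" "h \<in> cells2 K" "cod2 K h = T2 X \<odot> F"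
  shows "addable X F ((\<pi>1 X \<lhd> F) \<bullet> h) ((\<pi>2 X \<lhd> F) \<bullet> h)"
proof -
  note [simp] = assms
  have "(pp X \<lhd> F) \<bullet> (\<pi>1 X \<lhd> F) \<bullet> h = ((pp X \<bullet> \<pi>1 X) \<lhd> F) \<bullet> h"
    "(pp X \<lhd> F) \<bullet> (\<pi>2 X \<lhd> F) \<bullet> h = ((pp X \<bullet> \<pi>2 X) \<lhd> F) \<bullet> h" by simp_all
  then show ?thesis unfolding addable_def p_pi[OF assms(1)] by simp
qed

lemma addable_obtain:
  assumes X: "tang_data X" and A: "addable X F a b"
  obtains h where "h \<in> cells2 K" "dom2 K h = dom2 K a" "cod2 K h = T2 X \<odot> F"
    "(\<pi>1 X \<lhd> F) \<bullet> h = a" "(\<pi>2 X \<lhd> F) \<bullet> h = b"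
proof -
  note a = A[unfolded addable_def]
  have d: "dom1 K (dom2 K a) = dom1 K F" "cod1 K (dom2 K a) = carr X"
    using a X dom1_cod2[of a] cod1_cod2[of a] by auto
  note p = pair_props[OF T2_pb[OF X, of F "dom1 K F"], of "dom2 K a" a b]
  show ?thesis
    by (rule that[of "pair (homcat (dom1 K F) (carr X)) (dom2 K a) (T2 X \<odot> F) (\<pi>1 X \<lhd> F)
      (\<pi>2 X \<lhd> F) a b"])
      (use a p d in auto)
qed

text \<open>Every addable pair comes from a 2-cell \<open>h\<close> into \<open>T\<^sub>2 F\<close>, so this equation turns each statement
  on sums into one on composites with \<open>s\<^sub>F\<close>.\<close>

lemma tsum_pi:
  assumes X: "tang_data X" and F: "F \<in> cells1 K" "cod1 K F = carr X"
    and h: "h \<in> cells2 K" "cod2 K h = T2 X \<odot> F"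
  shows "tsum X F ((\<pi>1 X \<lhd> F) \<bullet> h) ((\<pi>2 X \<lhd> F) \<bullet> h) = (ss X \<lhd> F) \<bullet> h"
proof -
  note [simp] = assms
  have d: "dom1 K (dom2 K h) = dom1 K F" "cod1 K (dom2 K h) = carr X"
    using dom1_cod2[of h] cod1_cod2[of h] by auto
  note p = category.pair_eqI[OF category_homcat T2_pb[OF X, of F "dom1 K F"], of "dom2 K h" h]
  show ?thesis unfolding tsum_def pair_T2_def using d by (simp add: p)
qed

lemma tsum_cells [simp]:
  assumes X: "tang_data X" and A: "addable X F a b"
  shows "tsum X F a b \<in> cells2 K" "dom2 K (tsum X F a b) = dom2 K a"
    "cod2 K (tsum X F a b) = TT X \<odot> F"
proof -
  obtain h where h: "h \<in> cells2 K" "dom2 K h = dom2 K a" "cod2 K h = T2 X \<odot> F"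
    "(\<pi>1 X \<lhd> F) \<bullet> h = a" "(\<pi>2 X \<lhd> F) \<bullet> h = b" using addable_obtain[OF X A] .
  note [simp] = X h(1-3) A[unfolded addable_def]
  note t = tsum_pi[OF X, of F h, unfolded h(4,5)]
  show "tsum X F a b \<in> cells2 K" "dom2 K (tsum X F a b) = dom2 K a"
    "cod2 K (tsum X F a b) = TT X \<odot> F"
    by (simp_all add: t)
qed

lemma addable_comp:
  assumes "tang_data X" "addable X F a b" "g \<in> cells2 K" "cod2 K g = dom2 K a"
  shows "addable X F (a \<bullet> g) (b \<bullet> g)"
proof -
  note [simp] = assms(1,3,4) assms(2)[unfolded addable_def]
  have "(pp X \<lhd> F) \<bullet> a \<bullet> g = (pp X \<lhd> F) \<bullet> b \<bullet> g"
    by (rule vcomp_extend2) simp_all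
  then show ?thesis unfolding addable_def by simp
qed

end

section \<open>Addition of 2-cells\<close>

context two_category
begin

lemma addableD:
  assumes "addable X F a b"
  shows "F \<in> cells1 K" "cod1 K F = carr X" "a \<in> cells2 K" "b \<in> cells2 K" "dom2 K b = dom2 K a"
    "cod2 K a = TT X \<odot> F" "cod2 K b = TT X \<odot> F" "(pp X \<lhd> F) \<bullet> a = (pp X \<lhd> F) \<bullet> b"
  using assms unfolding addable_def by blast+

lemma dom1_dom2: "\<phi> \<in> cells2 K \<Longrightarrow> cod2 K \<phi> = G \<Longrightarrow> dom1 K (dom2 K \<phi>) = dom1 K G"
  and cod1_dom2: "\<phi> \<in> cells2 K \<Longrightarrow> cod2 K \<phi> = G \<Longrightarrow> cod1 K (dom2 K \<phi>) = cod1 K G"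
  using dom1_cod2 cod1_cod2 by auto

lemma tsum_comp:
  assumes X: "tang_data X" and A: "addable X F a b" and g: "g \<in> cells2 K" "cod2 K g = dom2 K a"
  shows "tsum X F a b \<bullet> g = tsum X F (a \<bullet> g) (b \<bullet> g)"
proof -
  obtain h where h: "h \<in> cells2 K" "dom2 K h = dom2 K a" "cod2 K h = T2 X \<odot> F"
    "(\<pi>1 X \<lhd> F) \<bullet> h = a" "(\<pi>2 X \<lhd> F) \<bullet> h = b" using addable_obtain[OF X A] .
  note [simp] = X h(1-3) addableD(1-7)[OF A] g
  show ?thesis
    using tsum_pi[OF X, of F h] tsum_pi[OF X, of F "h \<bullet> g"]
    by (simp add: h(4,5) vcomp_extend[OF h(4)] vcomp_extend[OF h(5)])
qed

lemma tsum_nat: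
  assumes X: "tang_data X" and A: "addable X F a b" and \<phi>: "\<phi> \<in> cells2 K" "dom2 K \<phi> = F"
    "cod2 K \<phi> = G"
  shows "(TT X \<rhd> \<phi>) \<bullet> tsum X F a b = tsum X G ((TT X \<rhd> \<phi>) \<bullet> a) ((TT X \<rhd> \<phi>) \<bullet> b)"
proof -
  obtain h where h: "h \<in> cells2 K" "dom2 K h = dom2 K a" "cod2 K h = T2 X \<odot> F"
    "(\<pi>1 X \<lhd> F) \<bullet> h = a" "(\<pi>2 X \<lhd> F) \<bullet> h = b" using addable_obtain[OF X A] .
  note [simp] = X h(1-3) addableD(1,2)[OF A] \<phi>
  have [simp]: "G \<in> cells1 K" "dom1 K G = dom1 K F" "cod1 K G = carr X"
    using cells1_cod2[of \<phi>] dom1_cod2[of \<phi>] cod1_cod2[of \<phi>] by simp_all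
  have n: "(x \<lhd> G) \<bullet> (T2 X \<rhd> \<phi>) = (TT X \<rhd> \<phi>) \<bullet> (x \<lhd> F)" if "x \<in> cells2 K" "dom2 K x = T2 X"
    "cod2 K x = TT X" for x
    by (rule nat_eq) (use that in simp_all)
  have n': "(x \<lhd> G) \<bullet> (T2 X \<rhd> \<phi>) \<bullet> h = (TT X \<rhd> \<phi>) \<bullet> (x \<lhd> F) \<bullet> h" if "x \<in> cells2 K" "dom2 K x = T2 X"
    "cod2 K x = TT X" for x
    by (rule vcomp_extend2[OF n]) (use that in simp_all)
  show ?thesis
    using tsum_pi[OF X, of F h] tsum_pi[OF X, of G "(T2 X \<rhd> \<phi>) \<bullet> h"]
    by (simp add: h(4,5) n')
qed

lemma addable_whr:
  assumes X: "tang_data X" and A: "addable X F a b" and G: "G \<in> cells1 K" "cod1 K G = dom1 K F"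
  shows "addable X (F \<odot> G) (a \<lhd> G) (b \<lhd> G)"
proof -
  note [simp] = X addableD(1-7)[OF A] G dom1_dom2[OF addableD(3,6)[OF A]]
  show ?thesis using arg_cong[OF addableD(8)[OF A], of "\<lambda>x. x \<lhd> G"] unfolding addable_def by simp
qed

lemma tsum_whr:
  assumes X: "tang_data X" and A: "addable X F a b" and G: "G \<in> cells1 K" "cod1 K G = dom1 K F"
  shows "tsum X F a b \<lhd> G = tsum X (F \<odot> G) (a \<lhd> G) (b \<lhd> G)"
proof -
  obtain h where h: "h \<in> cells2 K" "dom2 K h = dom2 K a" "cod2 K h = T2 X \<odot> F"
    "(\<pi>1 X \<lhd> F) \<bullet> h = a" "(\<pi>2 X \<lhd> F) \<bullet> h = b" using addable_obtain[OF X A] .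
  note [simp] = X h(1-3) addableD(1-7)[OF A] G dom1_dom2[OF addableD(3,6)[OF A]]
  have hw: "(\<pi>1 X \<lhd> (F \<odot> G)) \<bullet> (h \<lhd> G) = a \<lhd> G" "(\<pi>2 X \<lhd> (F \<odot> G)) \<bullet> (h \<lhd> G) = b \<lhd> G"
    using arg_cong[OF h(4), of "\<lambda>x. x \<lhd> G"] arg_cong[OF h(5), of "\<lambda>x. x \<lhd> G"] by simp_all
  show ?thesis
    using tsum_pi[OF X, of F h] tsum_pi[OF X, of "F \<odot> G" "h \<lhd> G"]
    by (simp add: h(4,5) hw)
qed

lemma tsum_T2: "tang_data X \<Longrightarrow> F \<in> cells1 K \<Longrightarrow> cod1 K F = carr X \<Longrightarrow> tsum X F (\<pi>1 X \<lhd> F) (\<pi>2 X \<lhd> F)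
    = ss X \<lhd> F"
  using tsum_pi[of X F "id2 K (T2 X \<odot> F)"] by simp

lemma addable_T2: "tang_data X \<Longrightarrow> F \<in> cells1 K \<Longrightarrow> cod1 K F = carr X \<Longrightarrow> addable X F (\<pi>1 X \<lhd> F)
    (\<pi>2 X \<lhd> F)"
  using addableI[of X F "id2 K (T2 X \<odot> F)"] by simp

lemma plus_over_tsum:
  assumes "tang_data X" "dom2 K a = Z"
  shows "plus_over (homcat (carr X) (carr X)) (TT X) (id1 K (carr X)) (pp X) (ss X) Z a b
    = tsum X (id1 K (carr X)) a b"
  using assms unfolding plus_over_def tsum_def pair_T2_def T2_def[symmetric] \<pi>1_def[symmetric]
    \<pi>2_def[symmetric]
  by simp

text \<open>The commutative monoid axioms for \<open>(p, z, s)\<close>, in terms of sums.\<close>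

definition tang_monoid :: "('x, 'm, 'c) tstruct \<Rightarrow> bool" where
  "tang_monoid X \<longleftrightarrow>
     (let I = id1 K (carr X) in
      pp X \<bullet> zz X = id2 K I \<and> pp X \<bullet> ss X = pp X \<bullet> \<pi>1 X \<and>
      (\<forall>Z\<in>hom1 K (carr X) (carr X). \<forall>a\<in>hom2 K Z (TT X). tsum X I (zz X \<bullet> pp X \<bullet> a) a = a) \<and>
      (\<forall>Z\<in>hom1 K (carr X) (carr X). \<forall>a\<in>hom2 K Z (TT X). \<forall>b\<in>hom2 K Z (TT X). pp X \<bullet> a = pp X \<bullet> b \<longrightarrow>
         tsum X I a b = tsum X I b a) \<and>
      (\<forall>Z\<in>hom1 K (carr X) (carr X). \<forall>a\<in>hom2 K Z (TT X). \<forall>b\<in>hom2 K Z (TT X). \<forall>c\<in>hom2 K Z (TT X).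
         pp X \<bullet> a = pp X \<bullet> b \<and> pp X \<bullet> b = pp X \<bullet> c \<longrightarrow>
         tsum X I (tsum X I a b) c = tsum X I a (tsum X I b c)))"

lemma p_tsum0:
  assumes X: "tang_data X" and M: "pp X \<bullet> ss X = pp X \<bullet> \<pi>1 X" and A: "addable X F a b"
  shows "(pp X \<lhd> F) \<bullet> tsum X F a b = (pp X \<lhd> F) \<bullet> a"
proof -
  obtain h where h: "h \<in> cells2 K" "dom2 K h = dom2 K a" "cod2 K h = T2 X \<odot> F"
    "(\<pi>1 X \<lhd> F) \<bullet> h = a" "(\<pi>2 X \<lhd> F) \<bullet> h = b" using addable_obtain[OF X A] .
  note [simp] = X h(1-3) addableD(1-7)[OF A]
  have "(pp X \<lhd> F) \<bullet> (ss X \<lhd> F) = (pp X \<lhd> F) \<bullet> (\<pi>1 X \<lhd> F)"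
    using arg_cong[OF M, of "\<lambda>x. x \<lhd> F"] by simp
  then have "(pp X \<lhd> F) \<bullet> (ss X \<lhd> F) \<bullet> h = (pp X \<lhd> F) \<bullet> (\<pi>1 X \<lhd> F) \<bullet> h"
    by (rule vcomp_extend2) simp_all
  then show ?thesis using tsum_pi[OF X, of F h] by (simp add: h(4,5))
qed

lemma comm_monoid_over_iff:
  assumes X: "tang_data X"
  shows "comm_monoid_over (homcat (carr X) (carr X)) (TT X) (id1 K (carr X)) (pp X) (zz X) (ss X)
    \<longleftrightarrow> tang_monoid X"
proof -
  note [simp] = X
  have pb: "is_pb (homcat (carr X) (carr X)) (TT X) (TT X) (id1 K (carr X)) (pp X) (pp X) (T2 X)
    (\<pi>1 X) (\<pi>2 X)"
    using T2_pb[OF X, of "id1 K (carr X)" "carr X"] by simp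
  have ad: "addable X (id1 K (carr X)) a b" if "a \<in> cells2 K" "b \<in> cells2 K" "cod2 K a = TT X"
    "cod2 K b = TT X"
    "dom2 K b = dom2 K a" "pp X \<bullet> a = pp X \<bullet> b" for a b
    unfolding addable_def using that by simp
  have d: "a \<in> cells2 K \<Longrightarrow> b \<in> cells2 K \<Longrightarrow> cod2 K a = TT X \<Longrightarrow> cod2 K b = TT X \<Longrightarrow>
    dom2 K a = Z \<Longrightarrow> dom2 K b = Z \<Longrightarrow> pp X \<bullet> a = pp X \<bullet> b \<Longrightarrow> dom2 K (tsum X (id1 K (carr X)) a b) =
      Z" for a b Z
    using tsum_cells(2)[OF X ad[of a b]] by simp
  show ?thesis
    unfolding comm_monoid_over_def tang_monoid_def T2_def[symmetric] \<pi>1_def[symmetric]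
      \<pi>2_def[symmetric] Let_def
    by (simp add: pb plus_over_tsum d cong: conj_cong imp_cong)
qed

text \<open>Since \<open>c\<close> is an involution with \<open>c \<circ> T s = s\<^sub>T \<circ> \<langle>c T\<pi>\<^sub>1, c T\<pi>\<^sub>2\<rangle>\<close>, the addition \<open>T s\<close> is
  conjugate to \<open>s\<^sub>T\<close> by \<open>c\<close>. Hence one kind of sum suffices.\<close>

lemma Ts_pair_TT2:
  assumes X: "tang_data X" and c: "cc X \<bullet> cc X = id2 K (TT X \<odot> TT X)"
    "(pp X \<lhd> TT X) \<bullet> cc X = TT X \<rhd> pp X"
    "cc X \<bullet> (TT X \<rhd> ss X) = tsum X (TT X) (cc X \<bullet> (TT X \<rhd> \<pi>1 X)) (cc X \<bullet> (TT X \<rhd> \<pi>2 X))"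
    and a: "a \<in> cells2 K" "b \<in> cells2 K" "dom2 K a = A" "dom2 K b = A" "cod2 K a = TT X \<odot> TT X"
      "cod2 K b = TT X \<odot> TT X"
      "(TT X \<rhd> pp X) \<bullet> a = (TT X \<rhd> pp X) \<bullet> b"
  shows "(TT X \<rhd> ss X) \<bullet> pair_TT2 X A a b = cc X \<bullet> tsum X (TT X) (cc X \<bullet> a) (cc X \<bullet> b)"
    "addable X (TT X) (cc X \<bullet> a) (cc X \<bullet> b)"
proof -
  note [simp] = X a(1-6)
  have [simp]: "dom1 K A = carr X" "cod1 K A = carr X" "A \<in> cells1 K"
    using dom1_dom2[of a] cod1_dom2[of a] cells1_dom2[of a] by simp_all
  define h where "h = pair_TT2 X A a b"
  have h: "h \<in> hom2 K A (TT X \<odot> T2 X)" "(TT X \<rhd> \<pi>1 X) \<bullet> h = a" "(TT X \<rhd> \<pi>2 X) \<bullet> h = b"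
    using pair_props[OF T2_pb_T[OF X, of "id1 K (carr X)" "carr X"], of A a b] a(7)
    unfolding h_def pair_TT2_def by simp_all
  note [simp] = h(1)[simplified]
  have ad: "addable X (TT X) (cc X \<bullet> (TT X \<rhd> \<pi>1 X)) (cc X \<bullet> (TT X \<rhd> \<pi>2 X))"
  proof -
    have "(pp X \<lhd> TT X) \<bullet> cc X \<bullet> x = (TT X \<rhd> pp X) \<bullet> x" if "x \<in> cells2 K" "cod2 K x = TT X \<odot> TT X"
      for x
      by (rule vcomp_extend[OF c(2)]) (use that in simp_all)
    moreover have "(TT X \<rhd> pp X) \<bullet> (TT X \<rhd> \<pi>1 X) = (TT X \<rhd> pp X) \<bullet> (TT X \<rhd> \<pi>2 X)"
      using arg_cong[OF p_pi[OF X], of "\<lambda>x. TT X \<rhd> x"] by simp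
    ultimately show ?thesis unfolding addable_def by simp
  qed
  have "cc X \<bullet> (cc X \<bullet> (TT X \<rhd> ss X)) \<bullet> h = (TT X \<rhd> ss X) \<bullet> h"
    using vcomp_extend[OF c(1), of "(TT X \<rhd> ss X) \<bullet> h"] by simp
  moreover have "(cc X \<bullet> (TT X \<rhd> ss X)) \<bullet> h = tsum X (TT X) (cc X \<bullet> a) (cc X \<bullet> b)"
    unfolding c(3) by (subst tsum_comp[OF X ad]) (simp_all add: h(2,3))
  ultimately show "(TT X \<rhd> ss X) \<bullet> pair_TT2 X A a b = cc X \<bullet> tsum X (TT X) (cc X \<bullet> a) (cc X \<bullet> b)"
    by (simp add: h_def)
  show "addable X (TT X) (cc X \<bullet> a) (cc X \<bullet> b)"
    using addable_comp[OF X ad, of h] by (simp add: h(2,3))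
qed

end

section \<open>Tangentads, lax tangent morphisms and their hom-categories\<close>

context two_category
begin

text \<open>The top edge of the universality square of the vertical lift: \<open>T s \<circ> \<langle>z\<^sub>T \<pi>\<^sub>1, l \<pi>\<^sub>2\<rangle>\<close>
  conjugated by \<open>c\<close>, with \<open>c \<circ> z\<^sub>T = T z\<close> and \<open>c \<circ> l = l\<close>.\<close>

definition vl_map :: "('x, 'm, 'c) tstruct \<Rightarrow> 'c" where
  "vl_map X = cc X \<bullet> tsum X (TT X) ((TT X \<rhd> zz X) \<bullet> \<pi>1 X) (ll X \<bullet> \<pi>2 X)"

definition tang_eqs :: "('x, 'm, 'c) tstruct \<Rightarrow> bool" where
  "tang_eqs X \<longleftrightarrow>
     (TT X \<rhd> pp X) \<bullet> ll X = zz X \<bullet> pp X \<and>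
     ll X \<bullet> zz X = (TT X \<rhd> zz X) \<bullet> zz X \<and>
     ll X \<bullet> ss X = cc X \<bullet> tsum X (TT X) (ll X \<bullet> \<pi>1 X) (ll X \<bullet> \<pi>2 X) \<and>
     (pp X \<lhd> TT X) \<bullet> cc X = TT X \<rhd> pp X \<and>
     cc X \<bullet> (TT X \<rhd> zz X) = zz X \<lhd> TT X \<and>
     cc X \<bullet> (TT X \<rhd> ss X) = tsum X (TT X) (cc X \<bullet> (TT X \<rhd> \<pi>1 X)) (cc X \<bullet> (TT X \<rhd> \<pi>2 X)) \<and>
     (TT X \<rhd> ll X) \<bullet> ll X = (ll X \<lhd> TT X) \<bullet> ll X \<and>
     cc X \<bullet> ll X = ll X \<and>
     (cc X \<lhd> TT X) \<bullet> (TT X \<rhd> cc X) \<bullet> (ll X \<lhd> TT X) = (TT X \<rhd> ll X) \<bullet> cc X \<and>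
     cc X \<bullet> cc X = id2 K (TT X \<odot> TT X) \<and>
     (TT X \<rhd> cc X) \<bullet> (cc X \<lhd> TT X) \<bullet> (TT X \<rhd> cc X) = (cc X \<lhd> TT X) \<bullet> (TT X \<rhd> cc X) \<bullet> (cc X \<lhd> TT X)"

definition vl_pb :: "('x, 'm, 'c) tstruct \<Rightarrow> bool" where
  "vl_pb X \<longleftrightarrow> (\<forall>Y\<in>cells0 K. \<forall>G\<in>hom1 K Y (carr X).
         is_pb (homcat Y (carr X)) G (TT X \<odot> TT X \<odot> G) (TT X \<odot> G) (zz X \<lhd> G) (TT X \<rhd> (pp X \<lhd> G))
           (T2 X \<odot> G) ((pp X \<lhd> G) \<bullet> (\<pi>1 X \<lhd> G)) (vl_map X \<lhd> G))"

text \<open>Both occurrences of \<open>T s\<close> in the definition, in the additivity of the lift and in the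
  universality square, are turned into sums by \<open>c\<close>. The equations needed for this are among the
  axioms themselves; they are collected in \<open>cE\<close>.\<close>

lemma tangentad_iff: "tangentad X \<longleftrightarrow> tang_data X \<and> tang_monoid X \<and> tang_eqs X \<and> vl_pb X"
proof (cases "tang_data X")
  case True
  note [simp] = True
  define cE where "cE \<longleftrightarrow> (pp X \<lhd> TT X) \<bullet> cc X = TT X \<rhd> pp X \<and>
     cc X \<bullet> (TT X \<rhd> ss X) = tsum X (TT X) (cc X \<bullet> (TT X \<rhd> \<pi>1 X)) (cc X \<bullet> (TT X \<rhd> \<pi>2 X)) \<and>
     cc X \<bullet> ll X = ll X \<and> cc X \<bullet> cc X = id2 K (TT X \<odot> TT X) \<and> (TT X \<rhd> pp X) \<bullet> ll X = zz X \<bullet> pp X \<and>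
     cc X \<bullet> (TT X \<rhd> zz X) = zz X \<lhd> TT X"
  have t: "(ss X \<lhd> TT X) \<bullet> pair_T2 (carr X) X (TT X) (TT X \<odot> T2 X) (cc X \<bullet> (TT X \<rhd> \<pi>1 X))
    (cc X \<bullet> (TT X \<rhd> \<pi>2 X)) =
    tsum X (TT X) (cc X \<bullet> (TT X \<rhd> \<pi>1 X)) (cc X \<bullet> (TT X \<rhd> \<pi>2 X))"
    by (rule pair_T2_tsum) simp
  have pl: "(TT X \<rhd> pp X) \<bullet> ll X \<bullet> \<pi>1 X = (TT X \<rhd> pp X) \<bullet> ll X \<bullet> \<pi>2 X" if cE
  proof -
    have "(TT X \<rhd> pp X) \<bullet> ll X \<bullet> x = zz X \<bullet> pp X \<bullet> x" if "x \<in> cells2 K" "cod2 K x = TT X" for x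
      by (rule vcomp_extend2) (use \<open>cE\<close> that in \<open>simp_all add: cE_def\<close>)
    then show ?thesis by (simp add: p_pi)
  qed
  have pz: "(TT X \<rhd> pp X) \<bullet> (zz X \<lhd> TT X) = zz X \<bullet> pp X"
    using nat_eq[of "zz X" "id1 K (carr X)" "TT X" "pp X" "TT X" "id1 K (carr X)"] by simp
  have pz': "(TT X \<rhd> pp X) \<bullet> (zz X \<lhd> TT X) \<bullet> x = zz X \<bullet> pp X \<bullet> x"
    if "x \<in> cells2 K" "cod2 K x = TT X" for x
    by (rule vcomp_extend2[OF pz]) (use that in simp_all)
  have cl: "cc X \<bullet> ll X \<bullet> x = ll X \<bullet> x" if cE "x \<in> cells2 K" "cod2 K x = TT X" for x
    by (rule vcomp_extend) (use that in \<open>simp_all add: cE_def\<close>)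
  have l: "cE \<Longrightarrow> (TT X \<rhd> ss X) \<bullet> pair_TT2 X (T2 X) (ll X \<bullet> \<pi>1 X) (ll X \<bullet> \<pi>2 X) =
    cc X \<bullet> tsum X (TT X) (ll X \<bullet> \<pi>1 X) (ll X \<bullet> \<pi>2 X)"
    using Ts_pair_TT2(1)[of X "ll X \<bullet> \<pi>1 X" "ll X \<bullet> \<pi>2 X" "T2 X"] pl
      by (simp add: cE_def cl[simplified cE_def])
  have v: "(TT X \<rhd> ss X) \<bullet> pair_TT2 X (T2 X) ((zz X \<lhd> TT X) \<bullet> \<pi>1 X) (ll X \<bullet> \<pi>2 X) = vl_map X" if cE
  proof -
    have "cc X \<bullet> (zz X \<lhd> TT X) = TT X \<rhd> zz X"
      using that vcomp_extend[of "cc X" "cc X" "id2 K (TT X \<odot> TT X)" "TT X \<rhd> zz X"]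
        by (simp add: cE_def)
    then have "cc X \<bullet> (zz X \<lhd> TT X) \<bullet> \<pi>1 X = (TT X \<rhd> zz X) \<bullet> \<pi>1 X" by (rule vcomp_extend) simp_all
    moreover have "(TT X \<rhd> pp X) \<bullet> ll X \<bullet> \<pi>2 X = zz X \<bullet> pp X \<bullet> \<pi>2 X"
      by (rule vcomp_extend2) (use that in \<open>simp_all add: cE_def\<close>)
    ultimately show ?thesis
      using Ts_pair_TT2(1)[of X "(zz X \<lhd> TT X) \<bullet> \<pi>1 X" "ll X \<bullet> \<pi>2 X" "T2 X"] that
        cl[OF that, of "\<pi>2 X"]
      by (simp add: cE_def pz' p_pi vl_map_def)
  qed
  define LS where "LS \<longleftrightarrow> ll X \<bullet> ss X = (TT X \<rhd> ss X) \<bullet> pair_TT2 X (T2 X) (ll X \<bullet> \<pi>1 X) (ll X \<bullet> \<pi>2 X)"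
  define PB where "PB \<longleftrightarrow> (\<forall>Y\<in>cells0 K. \<forall>G\<in>hom1 K Y (carr X).
         is_pb (homcat Y (carr X)) (id1 K (carr X) \<odot> G) ((TT X \<odot> TT X) \<odot> G) (TT X \<odot> G) (zz X \<lhd> G)
           ((TT X \<rhd> pp X) \<lhd> G)
           (T2 X \<odot> G) ((pp X \<bullet> \<pi>1 X) \<lhd> G) (((TT X \<rhd> ss X) \<bullet> pair_TT2 X (T2 X) ((zz X \<lhd> TT X) \<bullet> \<pi>1 X)
             (ll X \<bullet> \<pi>2 X)) \<lhd> G))"
  have pb: "PB \<longleftrightarrow> vl_pb X" if cE
    unfolding PB_def vl_pb_def v[OF that] by (intro ball_cong refl) simp
  define rest where "rest \<longleftrightarrow> ll X \<bullet> zz X = (TT X \<rhd> zz X) \<bullet> zz X \<and> (TT X \<rhd> ll X) \<bullet> ll X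
    = (ll X \<lhd> TT X) \<bullet> ll X \<and>
     (cc X \<lhd> TT X) \<bullet> (TT X \<rhd> cc X) \<bullet> (ll X \<lhd> TT X) = (TT X \<rhd> ll X) \<bullet> cc X \<and>
     (TT X \<rhd> cc X) \<bullet> (cc X \<lhd> TT X) \<bullet> (TT X \<rhd> cc X) = (cc X \<lhd> TT X) \<bullet> (TT X \<rhd> cc X) \<bullet> (cc X \<lhd> TT X)"
  note td = True[unfolded tang_data_def]
  have "tangentad X \<longleftrightarrow> tang_monoid X \<and> LS \<and> PB \<and> rest \<and> cE"
    unfolding tangentad_def Let_def comm_monoid_over_iff[OF True] t LS_def[symmetric]
      PB_def[symmetric]
    unfolding rest_def cE_def using td by blast
  moreover have "tang_eqs X \<longleftrightarrow> (ll X \<bullet> ss X = cc X \<bullet> tsum X (TT X) (ll X \<bullet> \<pi>1 X) (ll X \<bullet> \<pi>2 X))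
    \<and> rest \<and> cE"
    unfolding tang_eqs_def rest_def cE_def by blast
  moreover have "cE \<Longrightarrow> LS \<longleftrightarrow> ll X \<bullet> ss X = cc X \<bullet> tsum X (TT X) (ll X \<bullet> \<pi>1 X) (ll X \<bullet> \<pi>2 X)"
    unfolding LS_def using l by simp
  ultimately show ?thesis using pb True by blast
qed (use tangentad_tang_data in blast)

lemma tangentadD:
  assumes "tangentad X"
  shows "(TT X \<rhd> pp X) \<bullet> ll X = zz X \<bullet> pp X"
     "ll X \<bullet> zz X = (TT X \<rhd> zz X) \<bullet> zz X"
     "ll X \<bullet> ss X = cc X \<bullet> tsum X (TT X) (ll X \<bullet> \<pi>1 X) (ll X \<bullet> \<pi>2 X)"
     "(pp X \<lhd> TT X) \<bullet> cc X = TT X \<rhd> pp X"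
     "cc X \<bullet> (TT X \<rhd> zz X) = zz X \<lhd> TT X"
     "cc X \<bullet> (TT X \<rhd> ss X) = tsum X (TT X) (cc X \<bullet> (TT X \<rhd> \<pi>1 X)) (cc X \<bullet> (TT X \<rhd> \<pi>2 X))"
     "(TT X \<rhd> ll X) \<bullet> ll X = (ll X \<lhd> TT X) \<bullet> ll X"
     "cc X \<bullet> ll X = ll X"
     "(cc X \<lhd> TT X) \<bullet> (TT X \<rhd> cc X) \<bullet> (ll X \<lhd> TT X) = (TT X \<rhd> ll X) \<bullet> cc X"
     "cc X \<bullet> cc X = id2 K (TT X \<odot> TT X)"
     "(TT X \<rhd> cc X) \<bullet> (cc X \<lhd> TT X) \<bullet> (TT X \<rhd> cc X) = (cc X \<lhd> TT X) \<bullet> (TT X \<rhd> cc X) \<bullet> (cc X \<lhd> TT X)"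
  using assms unfolding tangentad_iff tang_eqs_def by blast+

lemma p_tsum: "tangentad X \<Longrightarrow> addable X F a b \<Longrightarrow> (pp X \<lhd> F) \<bullet> tsum X F a b = (pp X \<lhd> F) \<bullet> a"
  using p_tsum0[of X F a b] unfolding tangentad_iff tang_monoid_def Let_def by blast

lemma lax_iff:
  assumes X': "tang_data X'"
  shows "lax X' X (F, \<alpha>) \<longleftrightarrow>
      F \<in> hom1 K (carr X') (carr X) \<and> \<alpha> \<in> hom2 K (F \<odot> TT X') (TT X \<odot> F) \<and>
      (pp X \<lhd> F) \<bullet> \<alpha> = F \<rhd> pp X' \<and>
      \<alpha> \<bullet> (F \<rhd> zz X') = zz X \<lhd> F \<and>
      \<alpha> \<bullet> (F \<rhd> ss X') = tsum X F (\<alpha> \<bullet> (F \<rhd> \<pi>1 X')) (\<alpha> \<bullet> (F \<rhd> \<pi>2 X')) \<and>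
      (ll X \<lhd> F) \<bullet> \<alpha> = (TT X \<rhd> \<alpha>) \<bullet> (\<alpha> \<lhd> TT X') \<bullet> (F \<rhd> ll X') \<and>
      (cc X \<lhd> F) \<bullet> (TT X \<rhd> \<alpha>) \<bullet> (\<alpha> \<lhd> TT X') = (TT X \<rhd> \<alpha>) \<bullet> (\<alpha> \<lhd> TT X') \<bullet> (F \<rhd> cc X')"
proof -
  note [simp] = X'
  have t: "(ss X \<lhd> F) \<bullet> pair_T2 (carr X') X F (F \<odot> T2 X') (\<alpha> \<bullet> (F \<rhd> \<pi>1 X')) (\<alpha> \<bullet> (F \<rhd> \<pi>2 X')) =
    tsum X F (\<alpha> \<bullet> (F \<rhd> \<pi>1 X')) (\<alpha> \<bullet> (F \<rhd> \<pi>2 X'))" if "F \<in> hom1 K (carr X') (carr X)" "\<alpha> \<in> hom2 K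
      (F \<odot> TT X') (TT X \<odot> F)"
    by (rule pair_T2_tsum) (use that in simp)
  show ?thesis
    unfolding lax_def Let_def prod.case using t by (auto 0 0 simp del: in_hom1 in_hom2)
qed

lemma laxD:
  assumes "tang_data X'" "lax X' X (F, \<alpha>)"
  shows "F \<in> cells1 K" "dom1 K F = carr X'" "cod1 K F = carr X"
      "\<alpha> \<in> cells2 K" "dom2 K \<alpha> = F \<odot> TT X'" "cod2 K \<alpha> = TT X \<odot> F"
      "(pp X \<lhd> F) \<bullet> \<alpha> = F \<rhd> pp X'"
      "\<alpha> \<bullet> (F \<rhd> zz X') = zz X \<lhd> F"
      "\<alpha> \<bullet> (F \<rhd> ss X') = tsum X F (\<alpha> \<bullet> (F \<rhd> \<pi>1 X')) (\<alpha> \<bullet> (F \<rhd> \<pi>2 X'))"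
      "(ll X \<lhd> F) \<bullet> \<alpha> = (TT X \<rhd> \<alpha>) \<bullet> (\<alpha> \<lhd> TT X') \<bullet> (F \<rhd> ll X')"
      "(cc X \<lhd> F) \<bullet> (TT X \<rhd> \<alpha>) \<bullet> (\<alpha> \<lhd> TT X') = (TT X \<rhd> \<alpha>) \<bullet> (\<alpha> \<lhd> TT X') \<bullet> (F \<rhd> cc X')"
  using assms(2) unfolding lax_iff[OF assms(1)] by simp_all

text \<open>The axiom on \<open>s\<close> is the case of the universal pair of addends \<open>\<pi>\<^sub>1, \<pi>\<^sub>2\<close>.\<close>

lemma lax_tsum:
  assumes X': "tang_data X'" and X: "tang_data X" and L: "lax X' X (F, \<alpha>)" and A: "addable X' G a b"
  shows "addable X (F \<odot> G) ((\<alpha> \<lhd> G) \<bullet> (F \<rhd> a)) ((\<alpha> \<lhd> G) \<bullet> (F \<rhd> b))"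
    "(\<alpha> \<lhd> G) \<bullet> (F \<rhd> tsum X' G a b) = tsum X (F \<odot> G) ((\<alpha> \<lhd> G) \<bullet> (F \<rhd> a)) ((\<alpha> \<lhd> G) \<bullet> (F \<rhd> b))"
proof -
  obtain h where h: "h \<in> cells2 K" "dom2 K h = dom2 K a" "cod2 K h = T2 X' \<odot> G"
    "(\<pi>1 X' \<lhd> G) \<bullet> h = a" "(\<pi>2 X' \<lhd> G) \<bullet> h = b" using addable_obtain[OF X' A] .
  note [simp] = X X' h(1-3) addableD(1-7)[OF A] laxD(1-6)[OF X' L] cod1_dom2[OF h(1,3)]
    cod1_dom2[OF addableD(3,6)[OF A]]
  have p: "(pp X \<lhd> F) \<bullet> \<alpha> \<bullet> x = (F \<rhd> pp X') \<bullet> x" if "x \<in> cells2 K" "cod2 K x = F \<odot> TT X'" for x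
    by (rule vcomp_extend[OF laxD(7)[OF X' L]]) (use that in simp_all)
  have ad: "addable X F (\<alpha> \<bullet> (F \<rhd> \<pi>1 X')) (\<alpha> \<bullet> (F \<rhd> \<pi>2 X'))"
    unfolding addable_def using arg_cong[OF p_pi[OF X'], of "\<lambda>x. F \<rhd> x"] by (simp add: p)
  have ad': "addable X (F \<odot> G) ((\<alpha> \<lhd> G) \<bullet> (F \<rhd> (\<pi>1 X' \<lhd> G))) ((\<alpha> \<lhd> G) \<bullet> (F \<rhd> (\<pi>2 X' \<lhd> G)))"
    using addable_whr[OF X ad, of G] by simp
  have ha: "(F \<rhd> (\<pi>1 X' \<lhd> G)) \<bullet> (F \<rhd> h) = F \<rhd> a" "(F \<rhd> (\<pi>2 X' \<lhd> G)) \<bullet> (F \<rhd> h) = F \<rhd> b"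
    using arg_cong[OF h(4), of "\<lambda>x. F \<rhd> x"] arg_cong[OF h(5), of "\<lambda>x. F \<rhd> x"] by simp_all
  show "addable X (F \<odot> G) ((\<alpha> \<lhd> G) \<bullet> (F \<rhd> a)) ((\<alpha> \<lhd> G) \<bullet> (F \<rhd> b))"
    using addable_comp[OF X ad', of "F \<rhd> h"] by (simp add: ha)
  have "(\<alpha> \<lhd> G) \<bullet> (F \<rhd> (ss X' \<lhd> G)) = tsum X (F \<odot> G) ((\<alpha> \<lhd> G) \<bullet> (F \<rhd> (\<pi>1 X' \<lhd> G)))
    ((\<alpha> \<lhd> G) \<bullet> (F \<rhd> (\<pi>2 X' \<lhd> G)))"
    using arg_cong[OF laxD(9)[OF X' L], of "\<lambda>x. x \<lhd> G"] by (simp add: tsum_whr[OF X ad])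
  then have "(\<alpha> \<lhd> G) \<bullet> (F \<rhd> (ss X' \<lhd> G)) \<bullet> (F \<rhd> h) =
    tsum X (F \<odot> G) ((\<alpha> \<lhd> G) \<bullet> (F \<rhd> (\<pi>1 X' \<lhd> G))) ((\<alpha> \<lhd> G) \<bullet> (F \<rhd> (\<pi>2 X' \<lhd> G))) \<bullet> (F \<rhd> h)"
    by (rule vcomp_extend) simp_all
  also have "\<dots> = tsum X (F \<odot> G) ((\<alpha> \<lhd> G) \<bullet> (F \<rhd> a)) ((\<alpha> \<lhd> G) \<bullet> (F \<rhd> b))"
    by (subst tsum_comp[OF X ad']) (simp_all add: ha)
  finally show "(\<alpha> \<lhd> G) \<bullet> (F \<rhd> tsum X' G a b) = tsum X (F \<odot> G) ((\<alpha> \<lhd> G) \<bullet> (F \<rhd> a))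
    ((\<alpha> \<lhd> G) \<bullet> (F \<rhd> b))"
    using tsum_pi[OF X', of G h] by (simp add: h(4,5))
qed

lemma fst_lcomp [simp]: "fst (A \<odot>\<^sub>l B) = fst A \<odot> fst B"
  by (simp add: lcomp_def split: prod.splits)

lemma lax_lcomp:
  assumes X'': "tang_data X''" and X': "tang_data X'" and X: "tang_data X"
    and L: "lax X' X (F, \<alpha>)" and M: "lax X'' X' (G, \<beta>)"
  shows "lax X'' X ((F, \<alpha>) \<odot>\<^sub>l (G, \<beta>))"
proof -
  note [simp] = X X' X'' laxD(1-6)[OF X' L] laxD(1-6)[OF X'' M]
  note l = laxD[OF X' L] and m = laxD[OF X'' M]
  let ?T = "TT X" and ?T' = "TT X'" and ?T'' = "TT X''"
  have a1: "(pp X \<lhd> (F \<odot> G)) \<bullet> (\<alpha> \<lhd> G) = F \<rhd> (pp X' \<lhd> G)"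
    using arg_cong[OF l(7), of "\<lambda>x. x \<lhd> G"] by simp
  have 1: "(pp X \<lhd> (F \<odot> G)) \<bullet> (\<alpha> \<lhd> G) \<bullet> (F \<rhd> \<beta>) = F \<rhd> G \<rhd> pp X''"
    using vcomp_extend[OF a1, of "F \<rhd> \<beta>"] arg_cong[OF m(7), of "\<lambda>x. F \<rhd> x"] by simp
  have 2: "(\<alpha> \<lhd> G) \<bullet> (F \<rhd> \<beta>) \<bullet> (F \<rhd> G \<rhd> zz X'') = zz X \<lhd> (F \<odot> G)"
    using arg_cong[OF m(8), of "\<lambda>x. F \<rhd> x"] arg_cong[OF l(8), of "\<lambda>x. x \<lhd> G"] by simp
  have adb: "addable X' G (\<beta> \<bullet> (G \<rhd> \<pi>1 X'')) (\<beta> \<bullet> (G \<rhd> \<pi>2 X''))"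
    using lax_tsum(1)[OF X'' X' M addable_T2[OF X'', of "id1 K (carr X'')"]] by simp
  have 3: "(\<alpha> \<lhd> G) \<bullet> (F \<rhd> \<beta>) \<bullet> (F \<rhd> G \<rhd> ss X'') = tsum X (F \<odot> G) ((\<alpha> \<lhd> G) \<bullet> (F \<rhd> \<beta>) \<bullet>
    (F \<rhd> G \<rhd> \<pi>1 X'')) ((\<alpha> \<lhd> G) \<bullet> (F \<rhd> \<beta>) \<bullet> (F \<rhd> G \<rhd> \<pi>2 X''))"
    using arg_cong[OF m(9), of "\<lambda>x. F \<rhd> x"] lax_tsum(2)[OF X' X L adb] by simp
  have n: "(\<alpha> \<lhd> (?T' \<odot> G)) \<bullet> (F \<rhd> ?T' \<rhd> \<beta>) = (?T \<rhd> F \<rhd> \<beta>) \<bullet> (\<alpha> \<lhd> (G \<odot> ?T''))"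
    using nat_eq[of \<alpha> "F \<odot> ?T'" "?T \<odot> F" \<beta> "G \<odot> ?T''" "?T' \<odot> G"] by simp
  have n': "(\<alpha> \<lhd> (?T' \<odot> G)) \<bullet> (F \<rhd> ?T' \<rhd> \<beta>) \<bullet> x = (?T \<rhd> F \<rhd> \<beta>) \<bullet> (\<alpha> \<lhd> (G \<odot> ?T'')) \<bullet> x"
    if "x \<in> cells2 K" "cod2 K x = F \<odot> ?T' \<odot> G \<odot> ?T''" for x
    by (rule vcomp_extend2[OF n]) (use that in simp_all)
  have l1: "(ll X \<lhd> (F \<odot> G)) \<bullet> (\<alpha> \<lhd> G) = (?T \<rhd> (\<alpha> \<lhd> G)) \<bullet> (\<alpha> \<lhd> (?T' \<odot> G)) \<bullet> (F \<rhd> (ll X' \<lhd> G))"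
    using arg_cong[OF l(10), of "\<lambda>x. x \<lhd> G"] by simp
  have m1: "(F \<rhd> (ll X' \<lhd> G)) \<bullet> (F \<rhd> \<beta>) = (F \<rhd> ?T' \<rhd> \<beta>) \<bullet> (F \<rhd> (\<beta> \<lhd> ?T'')) \<bullet> (F \<rhd> G \<rhd> ll X'')"
    using arg_cong[OF m(10), of "\<lambda>x. F \<rhd> x"] by simp
  have 4: "(ll X \<lhd> (F \<odot> G)) \<bullet> (\<alpha> \<lhd> G) \<bullet> (F \<rhd> \<beta>) =
    (?T \<rhd> (\<alpha> \<lhd> G)) \<bullet> (?T \<rhd> F \<rhd> \<beta>) \<bullet> (\<alpha> \<lhd> (G \<odot> ?T'')) \<bullet> (F \<rhd> (\<beta> \<lhd> ?T'')) \<bullet> (F \<rhd> G \<rhd> ll X'')"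
    using vcomp_extend[OF l1, of "F \<rhd> \<beta>"] by (simp add: m1 n')
  have c1: "(cc X \<lhd> (F \<odot> G)) \<bullet> (?T \<rhd> (\<alpha> \<lhd> G)) \<bullet> (\<alpha> \<lhd> (?T' \<odot> G)) =
    (?T \<rhd> (\<alpha> \<lhd> G)) \<bullet> (\<alpha> \<lhd> (?T' \<odot> G)) \<bullet> (F \<rhd> (cc X' \<lhd> G))"
    using arg_cong[OF l(11), of "\<lambda>x. x \<lhd> G"] by simp
  have c2: "(cc X \<lhd> (F \<odot> G)) \<bullet> (?T \<rhd> (\<alpha> \<lhd> G)) \<bullet> (\<alpha> \<lhd> (?T' \<odot> G)) \<bullet> x =
    (?T \<rhd> (\<alpha> \<lhd> G)) \<bullet> (\<alpha> \<lhd> (?T' \<odot> G)) \<bullet> (F \<rhd> (cc X' \<lhd> G)) \<bullet> x" if "x \<in> cells2 K" "cod2 K x = F \<odot> ?T'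
      \<odot> ?T' \<odot> G" for x
    using that arg_cong[OF c1, of "\<lambda>y. y \<bullet> x"] by simp
  have m2: "(F \<rhd> (cc X' \<lhd> G)) \<bullet> (F \<rhd> ?T' \<rhd> \<beta>) \<bullet> (F \<rhd> (\<beta> \<lhd> ?T'')) = (F \<rhd> ?T' \<rhd> \<beta>) \<bullet> (F \<rhd> (\<beta> \<lhd> ?T''))
    \<bullet> (F \<rhd> G \<rhd> cc X'')"
    using arg_cong[OF m(11), of "\<lambda>x. F \<rhd> x"] by simp
  have "(cc X \<lhd> (F \<odot> G)) \<bullet> (?T \<rhd> (\<alpha> \<lhd> G)) \<bullet> (?T \<rhd> F \<rhd> \<beta>) \<bullet> (\<alpha> \<lhd> (G \<odot> ?T'')) \<bullet> (F \<rhd> (\<beta> \<lhd> ?T''))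
    = (cc X \<lhd> (F \<odot> G)) \<bullet> (?T \<rhd> (\<alpha> \<lhd> G)) \<bullet> (\<alpha> \<lhd> (?T' \<odot> G)) \<bullet> (F \<rhd> ?T' \<rhd> \<beta>) \<bullet> (F \<rhd> (\<beta> \<lhd> ?T''))"
    by (simp add: n')
  also have "\<dots> = (?T \<rhd> (\<alpha> \<lhd> G)) \<bullet> (\<alpha> \<lhd> (?T' \<odot> G)) \<bullet> (F \<rhd> (cc X' \<lhd> G)) \<bullet> (F \<rhd> ?T' \<rhd> \<beta>) \<bullet>
    (F \<rhd> (\<beta> \<lhd> ?T''))"
    by (rule c2) simp_all
  also have "\<dots> = (?T \<rhd> (\<alpha> \<lhd> G)) \<bullet> (?T \<rhd> F \<rhd> \<beta>) \<bullet> (\<alpha> \<lhd> (G \<odot> ?T'')) \<bullet> (F \<rhd> (\<beta> \<lhd> ?T'')) \<bullet>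
    (F \<rhd> G \<rhd> cc X'')"
    by (simp add: m2 n')
  finally show ?thesis
    unfolding lcomp_def prod.case lax_iff[OF X''] using 1 2 3 4 by simp
qed

text \<open>The axiom on \<open>l\<close> is obtained from \<open>c\<^sub>T \<circ> T c \<circ> l\<^sub>T = T l \<circ> c\<close> by cancelling involutions, and
  the one on \<open>c\<close> is the Yang-Baxter equation.\<close>

lemma T_lax:
  assumes X: "tangentad X"
  shows "lax X X (TT X, cc X)"
proof -
  note [simp] = X and t = tangentadD[OF X]
  let ?T = "TT X"
  have Tcc: "(?T \<rhd> cc X) \<bullet> (?T \<rhd> cc X) = id2 K (?T \<odot> ?T \<odot> ?T)"
    using arg_cong[OF t(10), of "\<lambda>x. ?T \<rhd> x"] by simp
  have ccT: "(cc X \<lhd> ?T) \<bullet> (cc X \<lhd> ?T) = id2 K (?T \<odot> ?T \<odot> ?T)"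
    using arg_cong[OF t(10), of "\<lambda>x. x \<lhd> ?T"] by simp
  have "(?T \<rhd> ll X) = (?T \<rhd> ll X) \<bullet> cc X \<bullet> cc X" by (simp add: t(10))
  also have "\<dots> = ((cc X \<lhd> ?T) \<bullet> (?T \<rhd> cc X) \<bullet> (ll X \<lhd> ?T)) \<bullet> cc X"
    using vcomp_extend[OF t(9)[symmetric], of "cc X"] by simp
  finally have l: "?T \<rhd> ll X = (cc X \<lhd> ?T) \<bullet> (?T \<rhd> cc X) \<bullet> (ll X \<lhd> ?T) \<bullet> cc X" by simp
  have "(?T \<rhd> cc X) \<bullet> (cc X \<lhd> ?T) \<bullet> (?T \<rhd> ll X) = (ll X \<lhd> ?T) \<bullet> cc X"
    unfolding l using vcomp_extend[OF ccT, of "(?T \<rhd> cc X) \<bullet> (ll X \<lhd> ?T) \<bullet> cc X"]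
      vcomp_extend[OF Tcc, of "(ll X \<lhd> ?T) \<bullet> cc X"] by simp
  then show ?thesis
    unfolding lax_iff[OF tangentad_tang_data[OF X]] using t(4-6,11) by simp
qed

text \<open>The tangent functor of a hom-category is composition with the lax morphism \<open>(T, c)\<close>, so it
  preserves lax morphisms.\<close>

lemma tan_T_lcomp: "tan_T X A = (TT X, cc X) \<odot>\<^sub>l A"
  by (simp add: tan_T_def lcomp_def split: prod.splits)

lemma tan_T_lax:
  assumes "tangentad X" "tang_data X'" "lax X' X A"
  shows "lax X' X (tan_T X A)"
  unfolding tan_T_lcomp using lax_lcomp[of X' X X "TT X" "cc X" "fst A" "snd A"] assms T_lax by simp

lemma lcomp_assoc:
  assumes "tang_data W" "tang_data X" "tang_data Y" "lax X Y A" "lax W X B" "lax V W C"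
    "tang_data V"
  shows "(A \<odot>\<^sub>l B) \<odot>\<^sub>l C = A \<odot>\<^sub>l (B \<odot>\<^sub>l C)"
proof -
  obtain F \<alpha> G \<beta> H \<gamma> where e: "A = (F, \<alpha>)" "B = (G, \<beta>)" "C = (H, \<gamma>)" by (metis surj_pair)
  note [simp] = assms laxD(1-6)[OF assms(2) assms(4)[unfolded e]]
    laxD(1-6)[OF assms(1) assms(5)[unfolded e]]
    laxD(1-6)[OF assms(7) assms(6)[unfolded e]]
  show ?thesis unfolding e lcomp_def prod.case by simp
qed

lemma id_lax:
  assumes [simp]: "tang_data X"
  shows "lax X X (id1 K (carr X), id2 K (TT X))"
  unfolding lax_iff[OF assms] using tsum_T2[of X "id1 K (carr X)"] by simp

lemma homt_sel [simp]: "obj (homt X' X) = {F. lax X' X F}" "cmp (homt X' X) = vcomp K"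
  "idm (homt X' X) = (\<lambda>F. id2 K (fst F))" "tob (homt X' X) = tan_T X"
    "tar (homt X' X) = (\<lambda>\<phi>. TT X \<rhd> \<phi>)"
  "tp (homt X' X) = (\<lambda>F. pp X \<lhd> fst F)" "tz (homt X' X) = (\<lambda>F. zz X \<lhd> fst F)"
  "tl (homt X' X) = (\<lambda>F. ll X \<lhd> fst F)" "tc (homt X' X) = (\<lambda>F. cc X \<lhd> fst F)"
  by (simp_all add: homt_def tancat_def Let_def)

lemma hom_homt [simp]:
  "\<phi> \<in> hom (homt X' X) A B \<longleftrightarrow> \<phi> \<in> hom2 K (fst A) (fst B) \<and> (TT X \<rhd> \<phi>) \<bullet> snd A = snd B \<bullet> (\<phi> \<lhd> TT X')"
  by (cases A; cases B) (simp add: homt_def tancat_def Let_def del: in_hom2)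

lemma category_homt:
  assumes X': "tang_data X'" and X: "tang_data X"
  shows "category (homt X' X)"
proof
  note [simp] = X X'
  have c: "fst A \<in> cells1 K" "dom1 K (fst A) = carr X'" "cod1 K (fst A) = carr X"
      "snd A \<in> cells2 K" "dom2 K (snd A) = fst A \<odot> TT X'" "cod2 K (snd A) = TT X \<odot> fst A"
        if "A \<in> obj (homt X' X)" for A
    using laxD[OF X', of X "fst A" "snd A"] that by simp_all
  show "idm (homt X' X) A \<in> hom (homt X' X) A A" if "A \<in> obj (homt X' X)" for A
    by (simp add: c[OF that])
  show "g \<cdot>\<^bsub>homt X' X\<^esub> f \<in> hom (homt X' X) A E"
    if "A \<in> obj (homt X' X)" "B \<in> obj (homt X' X)" "E \<in> obj (homt X' X)" "f \<in> hom (homt X' X) A B"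
      "g \<in> hom (homt X' X) B E"
    for A B E f g
  proof -
    note [simp] = that(4,5)[simplified, THEN conjunct1] c[OF that(1)] c[OF that(2)] c[OF that(3)]
    have f: "(TT X \<rhd> f) \<bullet> snd A = snd B \<bullet> (f \<lhd> TT X')"
      and g: "(TT X \<rhd> g) \<bullet> snd B = snd E \<bullet> (g \<lhd> TT X')"
      using that(4,5) by simp_all
    have [simp]: "f \<in> cells2 K" "dom2 K f = fst A" "cod2 K f = fst B" "g \<in> cells2 K"
      "dom2 K g = fst B" "cod2 K g = fst E"
      using that(4,5) by simp_all
    have "(TT X \<rhd> g) \<bullet> snd B \<bullet> (f \<lhd> TT X') = snd E \<bullet> (g \<lhd> TT X') \<bullet> (f \<lhd> TT X')"
      by (rule vcomp_extend2[OF g]) simp_all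
    then show ?thesis by (simp add: f)
  qed
qed (auto simp: )

end

section \<open>Limits of lax tangent morphisms\<close>

context two_category
begin

lemma strict_iff:
  assumes X': "tang_data X'" and X: "tang_data X"
  shows "strict X' X F \<longleftrightarrow> F \<in> hom1 K (carr X') (carr X) \<and> F \<odot> TT X' = TT X \<odot> F \<and>
    F \<rhd> pp X' = pp X \<lhd> F \<and> F \<rhd> zz X' = zz X \<lhd> F \<and> F \<rhd> ss X' = tsum X F (F \<rhd> \<pi>1 X') (F \<rhd> \<pi>2 X') \<and>
    F \<rhd> ll X' = ll X \<lhd> F \<and> F \<rhd> cc X' = cc X \<lhd> F"
proof (cases "F \<in> hom1 K (carr X') (carr X) \<and> F \<odot> TT X' = TT X \<odot> F")
  case True
  note [simp] = X X' True[simplified]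
  have t: "F \<odot> TT X' \<odot> TT X' = TT X \<odot> TT X \<odot> F"
    using comp1_assoc'[of "TT X'" "TT X'" F] comp1_assoc'[of "TT X'" F "TT X"] by simp
  show ?thesis
    unfolding strict_def strict_lax_def lax_iff[OF X'] by (auto simp: t)
next
  case False
  then show ?thesis unfolding strict_def strict_lax_def lax_iff[OF X'] using X X' by auto
qed

text \<open>Rewrite rules that move a strict morphism inwards past the tangent structure.\<close>

lemma strictD:
  assumes S: "strict X' X F" and X': "tang_data X'" and X: "tang_data X"
  shows "F \<in> cells1 K" "dom1 K F = carr X'" "cod1 K F = carr X" "F \<odot> TT X' = TT X \<odot> F"
    "\<And>G. G \<in> cells1 K \<Longrightarrow> cod1 K G = carr X' \<Longrightarrow> F \<odot> TT X' \<odot> G = TT X \<odot> F \<odot> G"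
    "\<And>\<phi>. \<phi> \<in> cells2 K \<Longrightarrow> cod1 K (dom2 K \<phi>) = carr X' \<Longrightarrow> F \<rhd> TT X' \<rhd> \<phi> = TT X \<rhd> F \<rhd> \<phi>"
    "F \<rhd> pp X' = pp X \<lhd> F" "\<And>G. G \<in> cells1 K \<Longrightarrow> cod1 K G = carr X' \<Longrightarrow> F \<rhd> (pp X' \<lhd> G)
      = pp X \<lhd> (F \<odot> G)"
    "F \<rhd> zz X' = zz X \<lhd> F" "\<And>G. G \<in> cells1 K \<Longrightarrow> cod1 K G = carr X' \<Longrightarrow> F \<rhd> (zz X' \<lhd> G)
      = zz X \<lhd> (F \<odot> G)"
    "F \<rhd> ll X' = ll X \<lhd> F" "\<And>G. G \<in> cells1 K \<Longrightarrow> cod1 K G = carr X' \<Longrightarrow> F \<rhd> (ll X' \<lhd> G)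
      = ll X \<lhd> (F \<odot> G)"
    "F \<rhd> cc X' = cc X \<lhd> F" "\<And>G. G \<in> cells1 K \<Longrightarrow> cod1 K G = carr X' \<Longrightarrow> F \<rhd> (cc X' \<lhd> G)
      = cc X \<lhd> (F \<odot> G)"
proof -
  note s = S[unfolded strict_iff[OF X' X]]
  show [simp]: "F \<in> cells1 K" "dom1 K F = carr X'" "cod1 K F = carr X" and t: "F \<odot> TT X' = TT X \<odot> F"
    and e: "F \<rhd> pp X' = pp X \<lhd> F" "F \<rhd> zz X' = zz X \<lhd> F" "F \<rhd> ll X' = ll X \<lhd> F"
      "F \<rhd> cc X' = cc X \<lhd> F"
    using s by auto
  note [simp] = X X'
  show "F \<odot> TT X' \<odot> G = TT X \<odot> F \<odot> G" if "G \<in> cells1 K" "cod1 K G = carr X'" for G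
    using that comp1_assoc'[of G "TT X'" F] comp1_assoc'[of G F "TT X"] t by simp
  show "F \<rhd> TT X' \<rhd> \<phi> = TT X \<rhd> F \<rhd> \<phi>" if "\<phi> \<in> cells2 K" "cod1 K (dom2 K \<phi>) = carr X'" for \<phi>
    using that whl_comp[of "TT X'" F \<phi>] whl_comp[of F "TT X" \<phi>] t by simp
  show "F \<rhd> (pp X' \<lhd> G) = pp X \<lhd> (F \<odot> G)" "F \<rhd> (zz X' \<lhd> G) = zz X \<lhd> (F \<odot> G)"
    "F \<rhd> (ll X' \<lhd> G) = ll X \<lhd> (F \<odot> G)"
    "F \<rhd> (cc X' \<lhd> G) = cc X \<lhd> (F \<odot> G)" if "G \<in> cells1 K" "cod1 K G = carr X'" for G
    using that e[THEN arg_cong, of "\<lambda>x. x \<lhd> G"] by simp_all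
qed

lemma strict_Tpow:
  assumes S: "strict X' X F" and X': "tang_data X'" and X: "tang_data X"
  shows "G \<in> cells1 K \<Longrightarrow> cod1 K G = carr X' \<Longrightarrow> F \<odot> Tpow X' m \<odot> G = Tpow X m \<odot> F \<odot> G"
    "\<phi> \<in> cells2 K \<Longrightarrow> cod1 K (dom2 K \<phi>) = carr X' \<Longrightarrow> F \<rhd> Tpow X' m \<rhd> \<phi> = Tpow X m \<rhd> F \<rhd> \<phi>"
proof -
  note [simp] = X X' strictD[OF S X' X]
  show "G \<in> cells1 K \<Longrightarrow> cod1 K G = carr X' \<Longrightarrow> F \<odot> Tpow X' m \<odot> G = Tpow X m \<odot> F \<odot> G"
    by (induction m) simp_all
  show "\<phi> \<in> cells2 K \<Longrightarrow> cod1 K (dom2 K \<phi>) = carr X' \<Longrightarrow> F \<rhd> Tpow X' m \<rhd> \<phi> = Tpow X m \<rhd> F \<rhd> \<phi>"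
    by (induction m) simp_all
qed

lemma strict_tsum:
  assumes S: "strict X' X F" and X': "tang_data X'" and X: "tang_data X" and A: "addable X' G a b"
  shows "addable X (F \<odot> G) (F \<rhd> a) (F \<rhd> b)" "F \<rhd> tsum X' G a b = tsum X (F \<odot> G) (F \<rhd> a) (F \<rhd> b)"
proof -
  note [simp] = X X' strictD(1-6)[OF S X' X] addableD(1-7)[OF A] cod1_dom2[OF addableD(3,6)[OF A]]
  note l = lax_tsum[OF X' X S[unfolded strict_def strict_lax_def] A]
  show "addable X (F \<odot> G) (F \<rhd> a) (F \<rhd> b)" using l(1) by simp
  show "F \<rhd> tsum X' G a b = tsum X (F \<odot> G) (F \<rhd> a) (F \<rhd> b)" using l(2) A by simp
qed

lemma strict_lax_lcomp:
  assumes S: "strict X' X F" and X': "tang_data X'" and X: "tang_data X" and L: "lax X'' X' (G, \<beta>)"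
    and X'': "tang_data X''"
  shows "strict_lax X' F \<odot>\<^sub>l (G, \<beta>) = (F \<odot> G, F \<rhd> \<beta>)"
proof -
  note [simp] = X X' X'' strictD(1-6)[OF S X' X] laxD(1-6)[OF X'' L]
  show ?thesis unfolding strict_lax_def lcomp_def by simp
qed

lemma strict_lax_strict_lax:
  assumes S: "strict X' X F" and X': "tang_data X'" and X: "tang_data X" and L: "strict X'' X' G"
    and X'': "tang_data X''"
  shows "strict_lax X' F \<odot>\<^sub>l strict_lax X'' G = strict_lax X'' (F \<odot> G)" "strict X'' X (F \<odot> G)"
proof -
  note [simp] = X X' X'' strictD(1-6)[OF S X' X] strictD(1-6)[OF L X'' X']
  show *: "strict_lax X' F \<odot>\<^sub>l strict_lax X'' G = strict_lax X'' (F \<odot> G)"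
    using strict_lax_lcomp[OF S X' X L[unfolded strict_def strict_lax_def] X'']
      by (simp add: strict_lax_def)
  show "strict X'' X (F \<odot> G)"
    unfolding strict_def *[symmetric]
    using lax_lcomp[OF X'' X' X, of F _ G] S L unfolding strict_def strict_lax_def by simp
qed

lemma laxD_pair:
  assumes "tang_data X'" "lax X' X A"
  shows "fst A \<in> cells1 K" "dom1 K (fst A) = carr X'" "cod1 K (fst A) = carr X"
      "snd A \<in> cells2 K" "dom2 K (snd A) = fst A \<odot> TT X'" "cod2 K (snd A) = TT X \<odot> fst A"
  using laxD(1-6)[of X' X "fst A" "snd A"] assms by simp_all

lemma T_p_lax:
  assumes X': "tang_data X'" and X: "tangentad X" and L: "lax X' X (F, \<alpha>)"
  shows "(TT X \<rhd> (pp X \<lhd> F)) \<bullet> (cc X \<lhd> F) \<bullet> (TT X \<rhd> \<alpha>) = \<alpha> \<bullet> (pp X \<lhd> (F \<odot> TT X'))"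
proof -
  note [simp] = X X' laxD(1-6)[OF X' L]
  have "(TT X \<rhd> pp X) \<bullet> cc X = (pp X \<lhd> TT X)"
    using vcomp_extend[OF tangentadD(4)[OF X], of "cc X"] tangentadD(10)[OF X] by simp
  then have "(TT X \<rhd> (pp X \<lhd> F)) \<bullet> (cc X \<lhd> F) = pp X \<lhd> (TT X \<odot> F)"
    by (drule_tac arg_cong[of _ _ "\<lambda>x. x \<lhd> F"]) simp
  then have "(TT X \<rhd> (pp X \<lhd> F)) \<bullet> (cc X \<lhd> F) \<bullet> (TT X \<rhd> \<alpha>) = (pp X \<lhd> (TT X \<odot> F)) \<bullet> (TT X \<rhd> \<alpha>)"
    by (rule vcomp_extend) simp_all
  also have "\<dots> = \<alpha> \<bullet> (pp X \<lhd> (F \<odot> TT X'))"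
    using nat_eq[of "pp X" "TT X" "id1 K (carr X)" \<alpha> "F \<odot> TT X'" "TT X \<odot> F"] by simp
  finally show ?thesis .
qed

text \<open>The structure \<open>\<gamma>\<close> of a lax morphism on \<open>P\<close> is induced by those on \<open>T F\<close>, as \<open>T\<close> preserves the
  pullback. Its axioms are equations between 2-cells into \<open>P\<close>, \<open>T P\<close> and \<open>T\<^sup>2 P\<close>, and can be tested
  on the legs because these three are pullbacks. The same holds for the condition that an induced
  map is a tangent 2-cell.\<close>

lemma Tn_at_lax:
  assumes X': "tangentad X'" and X: "tangentad X" and L: "lax X' X (F, \<alpha>)"
    and T: "Tn_at X (carr X') F n P \<pi>"
  obtains \<gamma> where "lax X' X (P, \<gamma>)"
    "wide_pb (homt X' X) n (\<lambda>_. tan_T X (F, \<alpha>)) (F, \<alpha>) (\<lambda>_. pp X \<lhd> F) (P, \<gamma>) \<pi>"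
proof -
  define \<beta> where "\<beta> = (cc X \<lhd> F) \<bullet> (TT X \<rhd> \<alpha>)"
  have tF: "tan_T X (F, \<alpha>) = (TT X \<odot> F, \<beta>)" unfolding tan_T_def \<beta>_def by simp
  have L': "lax X' X (TT X \<odot> F, \<beta>)" using tan_T_lax[OF X _ L] X' tF by simp
  note [simp] = X X' laxD(1-6)[OF tangentad_tang_data[OF X'] L]
    laxD(4-6)[OF tangentad_tang_data[OF X'] L']
    Tn_at_cells(5-10)[OF T]
  note b = laxD(7-11)[OF tangentad_tang_data[OF X'] L']
  let ?T = "TT X" and ?T' = "TT X'"
  have Xd: "tang_data X" and Xd': "tang_data X'" by simp_all
  note w0 = Tn_at_wide_pb_0[OF Xd T] and w1 = Tn_at_wide_pb_1[OF Xd T]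
    and w2 = Tn_at_wide_pb_2[OF Xd T]
  have pb: "(?T \<rhd> (pp X \<lhd> F)) \<bullet> \<beta> = \<alpha> \<bullet> (pp X \<lhd> (F \<odot> ?T'))"
    using T_p_lax[OF Xd' X L] unfolding \<beta>_def by simp
  have pp: "(pp X \<lhd> F) \<bullet> \<pi> i = (pp X \<lhd> F) \<bullet> \<pi> j" if "i < n" "j < n" for i j
    using wide_pbD(7)[OF w0 that] by simp
  have pb': "(?T \<rhd> (pp X \<lhd> F)) \<bullet> \<beta> \<bullet> (\<pi> i \<lhd> ?T') = \<alpha> \<bullet> (pp X \<lhd> (F \<odot> ?T')) \<bullet> (\<pi> i \<lhd> ?T')"
    if "i < n" for i
    by (rule vcomp_extend2[OF pb]) (use that in simp_all)
  have ppT: "(pp X \<lhd> (F \<odot> ?T')) \<bullet> (\<pi> i \<lhd> ?T') = (pp X \<lhd> (F \<odot> ?T')) \<bullet> (\<pi> j \<lhd> ?T')"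
    if "i < n" "j < n" for i j
    using that pp[OF that, THEN arg_cong, of "\<lambda>x. x \<lhd> ?T'"] by simp
  have cmp: "(?T \<rhd> (pp X \<lhd> F)) \<bullet> \<beta> \<bullet> (\<pi> i \<lhd> ?T') = (?T \<rhd> (pp X \<lhd> F)) \<bullet> \<beta> \<bullet> (\<pi> j \<lhd> ?T')"
    if "i < n" "j < n" for i j
    using that by (simp add: pb' ppT[OF that])
  have "wide_cone (homcat (carr X') (carr X)) n (\<lambda>_. ?T \<odot> ?T \<odot> F) (\<lambda>_. ?T \<rhd> (pp X \<lhd> F)) (P \<odot> ?T')
    (\<lambda>i. \<beta> \<bullet> (\<pi> i \<lhd> ?T'))"
    by (rule wide_coneI, simp, simp, simp only: homcat_sel, erule (1) cmp)
  from wide_pb_ex1[OF w1 this]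
  obtain \<gamma> where "\<gamma> \<in> hom2 K (P \<odot> ?T') (?T \<odot> P)"
    and g: "\<And>i. i < n \<Longrightarrow> (?T \<rhd> \<pi> i) \<bullet> \<gamma> = \<beta> \<bullet> (\<pi> i \<lhd> ?T')"
    by (auto simp del: in_hom2)
  then have [simp]: "\<gamma> \<in> cells2 K" "dom2 K \<gamma> = P \<odot> ?T'" "cod2 K \<gamma> = ?T \<odot> P" by simp_all
  have g': "(?T \<rhd> \<pi> i) \<bullet> \<gamma> \<bullet> x = \<beta> \<bullet> (\<pi> i \<lhd> ?T') \<bullet> x" if "i < n" "x \<in> cells2 K" "cod2 K x = P \<odot> ?T'"
    for i x
    by (rule vcomp_extend2[OF g]) (use that in simp_all)
  have Tg: "(?T \<rhd> ?T \<rhd> \<pi> i) \<bullet> (?T \<rhd> \<gamma>) = (?T \<rhd> \<beta>) \<bullet> (?T \<rhd> (\<pi> i \<lhd> ?T'))" if "i < n" for i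
    using that g[OF that, THEN arg_cong, of "\<lambda>x. ?T \<rhd> x"] by simp
  have Tg': "(?T \<rhd> ?T \<rhd> \<pi> i) \<bullet> (?T \<rhd> \<gamma>) \<bullet> x = (?T \<rhd> \<beta>) \<bullet> (?T \<rhd> (\<pi> i \<lhd> ?T')) \<bullet> x"
    if "i < n" "x \<in> cells2 K" "cod2 K x = ?T \<odot> P \<odot> ?T'" for i x
    by (rule vcomp_extend2[OF Tg]) (use that in simp_all)
  have gT: "(?T \<rhd> (\<pi> i \<lhd> ?T')) \<bullet> (\<gamma> \<lhd> ?T') = (\<beta> \<lhd> ?T') \<bullet> (\<pi> i \<lhd> (?T' \<odot> ?T'))" if "i < n" for i
    using that g[OF that, THEN arg_cong, of "\<lambda>x. x \<lhd> ?T'"] by simp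
  have gT': "(?T \<rhd> (\<pi> i \<lhd> ?T')) \<bullet> (\<gamma> \<lhd> ?T') \<bullet> x = (\<beta> \<lhd> ?T') \<bullet> (\<pi> i \<lhd> (?T' \<odot> ?T')) \<bullet> x"
    if "i < n" "x \<in> cells2 K" "cod2 K x = P \<odot> ?T' \<odot> ?T'" for i x
    by (rule vcomp_extend2[OF gT]) (use that in simp_all)
  have n: "(\<pi> i \<lhd> H) \<bullet> (P \<rhd> x) = (?T \<rhd> F \<rhd> x) \<bullet> (\<pi> i \<lhd> G)" if "i < n" "x \<in> cells2 K" "dom2 K x = G"
    "cod2 K x = H" "cod1 K G = carr X'" for i x G H
    using nat_eq[of "\<pi> i" P "?T \<odot> F" x G H] that by simp
  have e0: "h = h'" if "h \<in> hom2 K Z P" "h' \<in> hom2 K Z P" "Z \<in> hom1 K (carr X') (carr X)"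
    "\<And>i. i < n \<Longrightarrow> \<pi> i \<bullet> h = \<pi> i \<bullet> h'" for h h' Z
    using category.wide_pb_eqI[OF category_homcat w0, of Z h h'] that by simp
  have e1: "h = h'" if "h \<in> hom2 K Z (?T \<odot> P)" "h' \<in> hom2 K Z (?T \<odot> P)"
    "Z \<in> hom1 K (carr X') (carr X)" "\<And>i. i < n \<Longrightarrow> (?T \<rhd> \<pi> i) \<bullet> h = (?T \<rhd> \<pi> i) \<bullet> h'" for h h' Z
    using category.wide_pb_eqI[OF category_homcat w1, of Z h h'] that by simp
  have e2: "h = h'" if "h \<in> hom2 K Z (?T \<odot> ?T \<odot> P)" "h' \<in> hom2 K Z (?T \<odot> ?T \<odot> P)"
    "Z \<in> hom1 K (carr X') (carr X)" "\<And>i. i < n \<Longrightarrow> (?T \<rhd> ?T \<rhd> \<pi> i) \<bullet> h = (?T \<rhd> ?T \<rhd> \<pi> i) \<bullet> h'"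
    for h h' Z
    using category.wide_pb_eqI[OF category_homcat w2, of Z h h'] that by simp
  have nX: "(?T \<rhd> \<pi> i) \<bullet> (x \<lhd> P) = (x \<lhd> (?T \<odot> F)) \<bullet> \<pi> i"
    if "i < n" "x \<in> cells2 K" "dom2 K x = id1 K (carr X)" "cod2 K x = ?T" for i x
    using nat_eq[of x "id1 K (carr X)" ?T "\<pi> i" P "?T \<odot> F"] that by simp
  have c1: "(pp X \<lhd> P) \<bullet> \<gamma> = P \<rhd> pp X'"
  proof (rule e0[where Z = "P \<odot> ?T'"])
    fix i assume i: "i < n"
    have "\<pi> i \<bullet> (pp X \<lhd> P) = (pp X \<lhd> (?T \<odot> F)) \<bullet> (?T \<rhd> \<pi> i)"
      using nat_eq[of "pp X" ?T "id1 K (carr X)" "\<pi> i" P "?T \<odot> F"] i by simp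
    then have "\<pi> i \<bullet> (pp X \<lhd> P) \<bullet> \<gamma> = (pp X \<lhd> (?T \<odot> F)) \<bullet> (?T \<rhd> \<pi> i) \<bullet> \<gamma>"
      by (rule vcomp_extend2) (use i in simp_all)
    also have "\<dots> = ((pp X \<lhd> (?T \<odot> F)) \<bullet> \<beta>) \<bullet> (\<pi> i \<lhd> ?T')" using i by (simp add: g)
    also have "\<dots> = (?T \<rhd> F \<rhd> pp X') \<bullet> (\<pi> i \<lhd> ?T')" using b(1) by simp
    also have "\<dots> = \<pi> i \<bullet> (P \<rhd> pp X')" using n[OF i, of "pp X'" ?T' "id1 K (carr X')"] i by simp
    finally show "\<pi> i \<bullet> (pp X \<lhd> P) \<bullet> \<gamma> = \<pi> i \<bullet> (P \<rhd> pp X')" .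
  qed simp_all
  have c2: "\<gamma> \<bullet> (P \<rhd> zz X') = zz X \<lhd> P"
  proof (rule e1[where Z = "P"])
    fix i assume i: "i < n"
    have "(?T \<rhd> \<pi> i) \<bullet> \<gamma> \<bullet> (P \<rhd> zz X') = \<beta> \<bullet> (?T \<rhd> F \<rhd> zz X') \<bullet> \<pi> i"
      using i n[OF i, of "zz X'" "id1 K (carr X')" ?T'] by (simp add: g')
    also have "\<dots> = (zz X \<lhd> (?T \<odot> F)) \<bullet> \<pi> i" by (rule vcomp_extend) (use i b(2) in simp_all)
    finally show "(?T \<rhd> \<pi> i) \<bullet> \<gamma> \<bullet> (P \<rhd> zz X') = (?T \<rhd> \<pi> i) \<bullet> (zz X \<lhd> P)"
      using nX[OF i, of "zz X"] by simp
  qed simp_all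
  have ad: "addable X P (\<gamma> \<bullet> (P \<rhd> \<pi>1 X')) (\<gamma> \<bullet> (P \<rhd> \<pi>2 X'))"
  proof -
    have "(pp X \<lhd> P) \<bullet> \<gamma> \<bullet> x = (P \<rhd> pp X') \<bullet> x" if "x \<in> cells2 K" "cod2 K x = P \<odot> ?T'" for x
      by (rule vcomp_extend[OF c1]) (use that in simp_all)
    then show ?thesis unfolding addable_def using arg_cong[OF p_pi[OF Xd'], of "\<lambda>x. P \<rhd> x"] by simp
  qed
  have adb: "addable X (?T \<odot> F) (\<beta> \<bullet> (?T \<rhd> F \<rhd> \<pi>1 X')) (\<beta> \<bullet> (?T \<rhd> F \<rhd> \<pi>2 X'))"
    using lax_tsum(1)[OF Xd' Xd L' addable_T2[of X' "id1 K (carr X')"]] by simp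
  have c3: "\<gamma> \<bullet> (P \<rhd> ss X') = tsum X P (\<gamma> \<bullet> (P \<rhd> \<pi>1 X')) (\<gamma> \<bullet> (P \<rhd> \<pi>2 X'))"
  proof (rule e1[where Z = "P \<odot> T2 X'"])
    fix i assume i: "i < n"
    have "(?T \<rhd> \<pi> i) \<bullet> \<gamma> \<bullet> (P \<rhd> ss X') = \<beta> \<bullet> (?T \<rhd> F \<rhd> ss X') \<bullet> (\<pi> i \<lhd> T2 X')"
      using i n[OF i, of "ss X'" "T2 X'" ?T'] by (simp add: g')
    also have "\<dots> = tsum X (?T \<odot> F) (\<beta> \<bullet> (?T \<rhd> F \<rhd> \<pi>1 X')) (\<beta> \<bullet> (?T \<rhd> F \<rhd> \<pi>2 X')) \<bullet> (\<pi> i \<lhd> T2 X')"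
      by (rule vcomp_extend) (use i b(3) in simp_all)
    also have "\<dots> = tsum X (?T \<odot> F) ((?T \<rhd> \<pi> i) \<bullet> \<gamma> \<bullet> (P \<rhd> \<pi>1 X')) ((?T \<rhd> \<pi> i) \<bullet> \<gamma> \<bullet> (P \<rhd> \<pi>2 X'))"
      by (subst tsum_comp[OF Xd adb]) (use i n[OF i, of "\<pi>1 X'" "T2 X'" ?T'] n[OF i, of "\<pi>2 X'"
        "T2 X'" ?T'] in \<open>simp_all add: g'\<close>)
    also have "\<dots> = (?T \<rhd> \<pi> i) \<bullet> tsum X P (\<gamma> \<bullet> (P \<rhd> \<pi>1 X')) (\<gamma> \<bullet> (P \<rhd> \<pi>2 X'))"
      by (rule tsum_nat[OF Xd ad, symmetric]) (use i in simp_all)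
    finally show "(?T \<rhd> \<pi> i) \<bullet> \<gamma> \<bullet> (P \<rhd> ss X') = \<dots>" .
  qed (use ad in simp_all)
  have c4: "(ll X \<lhd> P) \<bullet> \<gamma> = (?T \<rhd> \<gamma>) \<bullet> (\<gamma> \<lhd> ?T') \<bullet> (P \<rhd> ll X')"
  proof (rule e2[where Z = "P \<odot> ?T'"])
    fix i assume i: "i < n"
    have "(?T \<rhd> ?T \<rhd> \<pi> i) \<bullet> (ll X \<lhd> P) = (ll X \<lhd> (?T \<odot> F)) \<bullet> (?T \<rhd> \<pi> i)"
      using nat_eq[of "ll X" ?T "?T \<odot> ?T" "\<pi> i" P "?T \<odot> F"] i by simp
    then have "(?T \<rhd> ?T \<rhd> \<pi> i) \<bullet> (ll X \<lhd> P) \<bullet> \<gamma> = (ll X \<lhd> (?T \<odot> F)) \<bullet> (?T \<rhd> \<pi> i) \<bullet> \<gamma>"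
      by (rule vcomp_extend2) (use i in simp_all)
    also have "\<dots> = ((ll X \<lhd> (?T \<odot> F)) \<bullet> \<beta>) \<bullet> (\<pi> i \<lhd> ?T')" using i by (simp add: g)
    also have "\<dots> = (?T \<rhd> \<beta>) \<bullet> (\<beta> \<lhd> ?T') \<bullet> (\<pi> i \<lhd> (?T' \<odot> ?T')) \<bullet> (P \<rhd> ll X')"
      unfolding b(4) using i n[OF i, of "ll X'" ?T' "?T' \<odot> ?T'"] by simp
    also have "\<dots> = (?T \<rhd> ?T \<rhd> \<pi> i) \<bullet> (?T \<rhd> \<gamma>) \<bullet> (\<gamma> \<lhd> ?T') \<bullet> (P \<rhd> ll X')"
      using i by (simp add: Tg' gT')
    finally show "(?T \<rhd> ?T \<rhd> \<pi> i) \<bullet> (ll X \<lhd> P) \<bullet> \<gamma> = \<dots>" .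
  qed simp_all
  have c5: "(cc X \<lhd> P) \<bullet> (?T \<rhd> \<gamma>) \<bullet> (\<gamma> \<lhd> ?T') = (?T \<rhd> \<gamma>) \<bullet> (\<gamma> \<lhd> ?T') \<bullet> (P \<rhd> cc X')"
  proof (rule e2[where Z = "P \<odot> ?T' \<odot> ?T'"])
    fix i assume i: "i < n"
    have "(?T \<rhd> ?T \<rhd> \<pi> i) \<bullet> (cc X \<lhd> P) = (cc X \<lhd> (?T \<odot> F)) \<bullet> (?T \<rhd> ?T \<rhd> \<pi> i)"
      using nat_eq[of "cc X" "?T \<odot> ?T" "?T \<odot> ?T" "\<pi> i" P "?T \<odot> F"] i by simp
    then have "(?T \<rhd> ?T \<rhd> \<pi> i) \<bullet> (cc X \<lhd> P) \<bullet> (?T \<rhd> \<gamma>) \<bullet> (\<gamma> \<lhd> ?T') = (cc X \<lhd> (?T \<odot> F)) \<bullet>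
      (?T \<rhd> ?T \<rhd> \<pi> i) \<bullet> (?T \<rhd> \<gamma>) \<bullet> (\<gamma> \<lhd> ?T')"
      by (rule vcomp_extend2) (use i in simp_all)
    also have "\<dots> = ((cc X \<lhd> (?T \<odot> F)) \<bullet> (?T \<rhd> \<beta>) \<bullet> (\<beta> \<lhd> ?T')) \<bullet> (\<pi> i \<lhd> (?T' \<odot> ?T'))" using i
      by (simp add: Tg' gT)
    also have "\<dots> = (?T \<rhd> \<beta>) \<bullet> (\<beta> \<lhd> ?T') \<bullet> (\<pi> i \<lhd> (?T' \<odot> ?T')) \<bullet> (P \<rhd> cc X')"
      unfolding b(5) using i n[OF i, of "cc X'" "?T' \<odot> ?T'" "?T' \<odot> ?T'"] by simp
    also have "\<dots> = (?T \<rhd> ?T \<rhd> \<pi> i) \<bullet> (?T \<rhd> \<gamma>) \<bullet> (\<gamma> \<lhd> ?T') \<bullet> (P \<rhd> cc X')"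
      using i by (simp add: Tg' gT')
    finally show "(?T \<rhd> ?T \<rhd> \<pi> i) \<bullet> (cc X \<lhd> P) \<bullet> (?T \<rhd> \<gamma>) \<bullet> (\<gamma> \<lhd> ?T') = \<dots>" .
  qed simp_all
  have LP: "lax X' X (P, \<gamma>)"
    unfolding lax_iff[OF Xd'] using c1 c2 c3 c4 c5 by simp
  have pi_hom: "\<pi> i \<in> hom (homt X' X) (P, \<gamma>) (?T \<odot> F, \<beta>)" if "i < n" for i
    using that g by simp
  have W: "wide_pb (homt X' X) n (\<lambda>_. (?T \<odot> F, \<beta>)) (F, \<alpha>) (\<lambda>_. pp X \<lhd> F) (P, \<gamma>) \<pi>"
  proof (rule wide_pbI)
    show "n \<ge> 1" by (rule Tn_at_ge1[OF T])
    show "wide_cone (homt X' X) n (\<lambda>_. (?T \<odot> F, \<beta>)) (\<lambda>_. pp X \<lhd> F) (P, \<gamma>) \<pi>"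
      by (rule wide_coneI, simp add: LP, erule pi_hom, simp only: homt_sel, erule (1) pp)
    fix Z a assume c: "wide_cone (homt X' X) n (\<lambda>_. (?T \<odot> F, \<beta>)) (\<lambda>_. pp X \<lhd> F) Z a"
    have LZ: "lax X' X Z" using wide_coneD(1)[OF c] by simp
    note [simp] = laxD_pair[OF Xd' LZ]
    have [simp]: "a i \<in> cells2 K" "dom2 K (a i) = fst Z" "cod2 K (a i) = ?T \<odot> F" if "i < n" for i
      using wide_coneD(2)[OF c that] by simp_all
    have a: "(?T \<rhd> a i) \<bullet> snd Z = \<beta> \<bullet> (a i \<lhd> ?T')" if "i < n" for i
      using wide_coneD(2)[OF c that] by simp
    have "wide_cone (homcat (carr X') (carr X)) n (\<lambda>_. ?T \<odot> F) (\<lambda>_. pp X \<lhd> F) (fst Z) a"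
      by (rule wide_coneI, simp, simp, unfold homcat_sel, rule wide_coneD(3)[OF c, unfolded
        homt_sel])
    from wide_pb_ex1[OF w0 this]
    obtain h where "h \<in> hom2 K (fst Z) P" and h: "\<And>i. i < n \<Longrightarrow> \<pi> i \<bullet> h = a i"
      by (auto simp del: in_hom2)
    then have [simp]: "h \<in> cells2 K" "dom2 K h = fst Z" "cod2 K h = P" by simp_all
    have "(?T \<rhd> h) \<bullet> snd Z = \<gamma> \<bullet> (h \<lhd> ?T')"
    proof (rule e1[where Z = "fst Z \<odot> ?T'"])
      fix i assume i: "i < n"
      have 1: "(?T \<rhd> \<pi> i) \<bullet> (?T \<rhd> h) = ?T \<rhd> a i" using i h[OF i, THEN arg_cong, of "\<lambda>x. ?T \<rhd> x"]
        by simp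
      have 2: "(\<pi> i \<lhd> ?T') \<bullet> (h \<lhd> ?T') = a i \<lhd> ?T'" using i h[OF i, THEN arg_cong, of "\<lambda>x. x \<lhd> ?T'"]
        by simp
      show "(?T \<rhd> \<pi> i) \<bullet> (?T \<rhd> h) \<bullet> snd Z = (?T \<rhd> \<pi> i) \<bullet> \<gamma> \<bullet> (h \<lhd> ?T')"
        using i vcomp_extend[OF 1, of "snd Z"] by (simp add: g' 2 a)
    qed simp_all
    then have "h \<in> hom (homt X' X) Z (P, \<gamma>)" by simp
    moreover have "k = h" if "k \<in> hom (homt X' X) Z (P, \<gamma>)" "\<forall>i<n. \<pi> i \<bullet> k = a i" for k
      by (rule e0[of k "fst Z"]) (use that h in simp_all)
    ultimately show "\<exists>!h. h \<in> hom (homt X' X) Z (P, \<gamma>) \<and> (\<forall>i<n. \<pi> i \<cdot>\<^bsub>homt X' X\<^esub> h = a i)"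
      unfolding homt_sel using h by (intro ex1I[of _ h]) blast+
  qed (use L L' pb in simp_all)
  show ?thesis using that[OF LP] W unfolding tF by simp
qed

text \<open>Limits are unique up to isomorphism, so every pullback in the hom-category is the one
  computed on 1-cells.\<close>

lemma homt_Tn:
  assumes X': "tangentad X'" and X: "tangentad X" and L: "lax X' X A"
    and W: "wide_pb (homt X' X) n (\<lambda>_. tan_T X A) A (\<lambda>_. pp X \<lhd> fst A) P \<pi>"
  shows "Tn_at X (carr X') (fst A) n (fst P) \<pi>"
proof -
  have Xd: "tang_data X" and Xd': "tang_data X'" using X X' by simp_all
  obtain P0 \<pi>0 where "Tn_at X (carr X) (id1 K (carr X)) n P0 \<pi>0"
    using has_Tn_Tn_at[OF Xd wide_pbD(3)[OF W]] .
  from Tn_at_whr[OF Xd this, of "fst A" "carr X'"]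
  have T: "Tn_at X (carr X') (fst A) n (P0 \<odot> fst A) (\<lambda>i. \<pi>0 i \<lhd> fst A)"
    using laxD_pair[OF Xd' L] by simp
  obtain \<gamma>
    where "wide_pb (homt X' X) n (\<lambda>_. tan_T X A) A (\<lambda>_. pp X \<lhd> fst A) (P0 \<odot> fst A, \<gamma>)
    (\<lambda>i. \<pi>0 i \<lhd> fst A)"
    using Tn_at_lax[OF X' X, of "fst A" "snd A", simplified, OF L T] by blast
  from category.wide_pb_unique[OF category_homt[OF Xd' Xd] this W]
  obtain e e' where e: "e \<in> hom (homt X' X) P (P0 \<odot> fst A, \<gamma>)"
    "e' \<in> hom (homt X' X) (P0 \<odot> fst A, \<gamma>) P"
    "e \<bullet> e' = id2 K (P0 \<odot> fst A)" "e' \<bullet> e = id2 K (fst P)" "\<And>i. i < n \<Longrightarrow> (\<pi>0 i \<lhd> fst A) \<bullet> e = \<pi> i"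
    by (metis (no_types, lifting) homt_sel(2,3) fst_conv)
  show ?thesis
    by (rule Tn_at_iso[OF Xd T, where e = e and e' = e'])
      (use e laxD_pair[OF Xd', of X P] wide_pbD(1)[OF W] in auto)
qed

lemma homt_ex_Tn:
  assumes X': "tangentad X'" and X: "tangentad X" and L: "lax X' X A" and n: "n \<ge> 1"
  obtains P \<pi> where "wide_pb (homt X' X) n (\<lambda>_. tan_T X A) A (\<lambda>_. pp X \<lhd> fst A) P \<pi>"
proof -
  have Xd: "tang_data X" and Xd': "tang_data X'" using X X' by simp_all
  obtain P0 \<pi>0 where "Tn_at X (carr X) (id1 K (carr X)) n P0 \<pi>0"
    using has_Tn_Tn_at[OF Xd n] .
  from Tn_at_whr[OF Xd this, of "fst A" "carr X'"]
  have T: "Tn_at X (carr X') (fst A) n (P0 \<odot> fst A) (\<lambda>i. \<pi>0 i \<lhd> fst A)"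
    using laxD_pair[OF Xd' L] by simp
  show ?thesis
    using Tn_at_lax[OF X' X, of "fst A" "snd A", simplified, OF L T] that by blast
qed

end

section \<open>Laws of addition and morphisms that preserve the pullbacks\<close>

context two_category
begin

lemma Tn_at_cong:
  assumes X: "tang_data X" and T: "Tn_at X Y F n P \<pi>" and eq: "\<And>i. i < n \<Longrightarrow> \<pi> i = \<pi>' i"
  shows "Tn_at X Y F n P \<pi>'"
proof -
  note [simp] = Tn_at_cells[OF T]
  show ?thesis by (rule Tn_at_iso[OF X T, where e = "id2 K P" and e' = "id2 K P"])
    (simp_all add: eq[symmetric])
qed

text \<open>A law of \<open>n\<close> summands over \<open>F\<close> follows from its universal instance, the legs of \<open>T\<^sub>n\<close>, by
  whiskering with \<open>F\<close> and composing with \<open>h\<close>.\<close>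

lemma tsum_factor:
  fixes n :: nat
  assumes X: "tang_data X" and F: "F \<in> cells1 K" "cod1 K F = carr X"
    and A: "\<And>i. i < n \<Longrightarrow> a i \<in> hom2 K A (TT X \<odot> F)" "\<And>i j. i < n \<Longrightarrow> j < n \<Longrightarrow> (pp X \<lhd> F) \<bullet> a i
      = (pp X \<lhd> F) \<bullet> a j"
    and n: "n \<ge> 1"
  obtains P \<pi> h where "P \<in> hom1 K (carr X) (carr X)" "\<And>i. i < n \<Longrightarrow> \<pi> i \<in> hom2 K P (TT X)"
    "\<And>i j. i < n \<Longrightarrow> j < n \<Longrightarrow> pp X \<bullet> \<pi> i = pp X \<bullet> \<pi> j"
    "h \<in> hom2 K A (P \<odot> F)" "\<And>i. i < n \<Longrightarrow> (\<pi> i \<lhd> F) \<bullet> h = a i"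
proof -
  note [simp] = X F
  obtain P \<pi> where T: "Tn_at X (carr X) (id1 K (carr X)) n P \<pi>" using has_Tn_Tn_at[OF X n] .
  note [simp] = Tn_at_cells(5-9)[OF T]
  have [simp]: "cod2 K (\<pi> i) = TT X" if "i < n" for i using Tn_at_cells(10)[OF T that] by simp
  have A0: "A \<in> hom1 K (dom1 K F) (carr X)"
    using A(1)[of 0] n dom1_dom2[of "a 0" "TT X \<odot> F"] cod1_dom2[of "a 0" "TT X \<odot> F"] by auto
  have W: "wide_pb (homcat (dom1 K F) (carr X)) n (\<lambda>_. TT X \<odot> F) F (\<lambda>_. pp X \<lhd> F) (P \<odot> F)
    (\<lambda>i. \<pi> i \<lhd> F)"
    using Tn_at_wide_pb_0[OF X Tn_at_whr[OF X T, of F "dom1 K F"]] by simp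
  have c: "wide_cone (homcat (dom1 K F) (carr X)) n (\<lambda>_. TT X \<odot> F) (\<lambda>_. pp X \<lhd> F) A a"
    by (rule wide_coneI, use A0 in simp, use A(1) in simp, unfold homcat_sel, rule A(2))
  from wide_pb_ex1[OF W c] obtain h where h: "h \<in> hom2 K A (P \<odot> F)"
    "\<And>i. i < n \<Longrightarrow> (\<pi> i \<lhd> F) \<bullet> h = a i"
    by (auto simp del: in_hom2)
  have "pp X \<bullet> \<pi> i = pp X \<bullet> \<pi> j" if "i < n" "j < n" for i j
    using wide_pbD(7)[OF Tn_at_wide_pb_0[OF X T] that] by simp
  note pp = this
  show ?thesis
    by (rule that[of P \<pi> h], simp, simp, erule (1) pp, rule h(1), erule h(2))
qed

lemma tsum_zero:
  assumes X: "tangentad X" and F: "F \<in> cells1 K" "cod1 K F = carr X"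
    and a: "a \<in> cells2 K" "cod2 K a = TT X \<odot> F"
  shows "tsum X F ((zz X \<lhd> F) \<bullet> (pp X \<lhd> F) \<bullet> a) a = a"
proof -
  note [simp] = X F a
  have Xd: "tang_data X" by simp
  have m: "tang_monoid X" using X unfolding tangentad_iff by blast
  have pz: "pp X \<bullet> zz X = id2 K (id1 K (carr X))" using m unfolding tang_monoid_def Let_def by blast
  have m1: "tsum X (id1 K (carr X)) (zz X \<bullet> pp X) (id2 K (TT X)) = id2 K (TT X)"
    using m[unfolded tang_monoid_def Let_def, THEN conjunct2, THEN conjunct2, THEN conjunct1,
      rule_format, of "TT X" "id2 K (TT X)"] by simp
  have "pp X \<bullet> zz X \<bullet> pp X = pp X" using vcomp_extend[OF pz, of "pp X"] by simp
  then have ad: "addable X (id1 K (carr X)) (zz X \<bullet> pp X) (id2 K (TT X))"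
    unfolding addable_def by simp
  have ad': "addable X F ((zz X \<lhd> F) \<bullet> (pp X \<lhd> F)) (id2 K (TT X \<odot> F))"
    using addable_whr[OF Xd ad, of F] by simp
  show ?thesis
    using arg_cong[OF m1, of "\<lambda>x. (x \<lhd> F) \<bullet> a"] tsum_whr[OF Xd ad, of F] tsum_comp[OF Xd ad', of a]
      by simp
qed

lemma tsum_commute:
  assumes X: "tangentad X" and A: "addable X F a b"
  shows "tsum X F a b = tsum X F b a"
proof -
  note [simp] = X addableD(1-7)[OF A]
  have Xd: "tang_data X" by simp
  have m: "tang_monoid X" using X unfolding tangentad_iff by blast
  obtain h where h: "h \<in> cells2 K" "dom2 K h = dom2 K a" "cod2 K h = T2 X \<odot> F"
    "(\<pi>1 X \<lhd> F) \<bullet> h = a" "(\<pi>2 X \<lhd> F) \<bullet> h = b" using addable_obtain[OF Xd A] .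
  have ad: "addable X (id1 K (carr X)) (\<pi>1 X) (\<pi>2 X)" "addable X (id1 K (carr X)) (\<pi>2 X) (\<pi>1 X)"
    unfolding addable_def by (simp_all add: p_pi)
  have m1: "tsum X (id1 K (carr X)) (\<pi>1 X) (\<pi>2 X) = tsum X (id1 K (carr X)) (\<pi>2 X) (\<pi>1 X)"
    using m[unfolded tang_monoid_def Let_def, THEN conjunct2, THEN conjunct2, THEN conjunct2, THEN
      conjunct1,
      rule_format, of "T2 X" "\<pi>1 X" "\<pi>2 X"] by (simp add: p_pi)
  have ad': "addable X F (\<pi>1 X \<lhd> F) (\<pi>2 X \<lhd> F)" "addable X F (\<pi>2 X \<lhd> F) (\<pi>1 X \<lhd> F)"
    using addable_whr[OF Xd ad(1), of F] addable_whr[OF Xd ad(2), of F] by simp_all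
  show ?thesis
    using arg_cong[OF m1, of "\<lambda>x. (x \<lhd> F) \<bullet> h"] tsum_whr[OF Xd ad(1), of F]
      tsum_whr[OF Xd ad(2), of F]
      tsum_comp[OF Xd ad'(1), of h] tsum_comp[OF Xd ad'(2), of h] h by simp
qed

lemma tsum_assoc:
  assumes X: "tangentad X" and A: "addable X F a b" "addable X F b c"
  shows "tsum X F (tsum X F a b) c = tsum X F a (tsum X F b c)"
proof -
  note [simp] = X addableD(1-7)[OF A(1)] addableD(3-7)[OF A(2)]
  have Xd: "tang_data X" by simp
  have m: "tang_monoid X" using X unfolding tangentad_iff by blast
  define x where "x i = (if i = 0 then a else if i = 1 then b else c)" for i :: nat
  have 1: "x i \<in> hom2 K (dom2 K a) (TT X \<odot> F)" if "i < 3" for i by (simp add: x_def)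
  have 2: "(pp X \<lhd> F) \<bullet> x i = (pp X \<lhd> F) \<bullet> x j" if "i < 3" "j < 3" for i j
    using addableD(8)[OF A(1)] addableD(8)[OF A(2)] by (simp add: x_def)
  obtain P \<pi> h where p: "P \<in> hom1 K (carr X) (carr X)" "\<And>i. i < 3 \<Longrightarrow> \<pi> i \<in> hom2 K P (TT X)"
    "\<And>i j. i < 3 \<Longrightarrow> j < 3 \<Longrightarrow> pp X \<bullet> \<pi> i = pp X \<bullet> \<pi> j"
    "h \<in> hom2 K (dom2 K a) (P \<odot> F)" "\<And>i. i < 3 \<Longrightarrow> (\<pi> i \<lhd> F) \<bullet> h = x i"
    using tsum_factor[where n = 3 and a = x, OF Xd addableD(1,2)[OF A(1)] 1 2 one_le_numeral]
      by metis
  have [simp]: "P \<in> cells1 K" "dom1 K P = carr X" "cod1 K P = carr X" "h \<in> cells2 K"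
    "dom2 K h = dom2 K a" "cod2 K h = P \<odot> F"
    using p(1,4) by simp_all
  let ?I = "id1 K (carr X)" and ?a = "\<pi> 0" and ?b = "\<pi> (Suc 0)" and ?c = "\<pi> 2"
  have [simp]: "?a \<in> cells2 K" "dom2 K ?a = P" "cod2 K ?a = TT X" "?b \<in> cells2 K" "dom2 K ?b = P"
    "cod2 K ?b = TT X"
    "?c \<in> cells2 K" "dom2 K ?c = P" "cod2 K ?c = TT X"
    using p(2)[of 0] p(2)[of "Suc 0"] p(2)[of 2] by simp_all
  have h: "(?a \<lhd> F) \<bullet> h = a" "(?b \<lhd> F) \<bullet> h = b" "(?c \<lhd> F) \<bullet> h = c"
    using p(5)[of 0] p(5)[of "Suc 0"] p(5)[of 2] by (simp_all add: x_def)
  have pe: "pp X \<bullet> ?a = pp X \<bullet> ?b" "pp X \<bullet> ?b = pp X \<bullet> ?c" by (rule p(3); simp)+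
  have ad: "addable X ?I ?a ?b" "addable X ?I ?b ?c" unfolding addable_def using pe by simp_all
  have ps: "pp X \<bullet> tsum X ?I ?a ?b = pp X \<bullet> ?a" "pp X \<bullet> tsum X ?I ?b ?c = pp X \<bullet> ?b"
    using p_tsum[OF X ad(1)] p_tsum[OF X ad(2)] by simp_all
  have [simp]: "tsum X ?I ?a ?b \<in> cells2 K" "dom2 K (tsum X ?I ?a ?b) = P"
    "cod2 K (tsum X ?I ?a ?b) = TT X"
    "tsum X ?I ?b ?c \<in> cells2 K" "dom2 K (tsum X ?I ?b ?c) = P" "cod2 K (tsum X ?I ?b ?c) = TT X"
    using tsum_cells[OF Xd ad(1)] tsum_cells[OF Xd ad(2)] by simp_all
  have ad2: "addable X ?I (tsum X ?I ?a ?b) ?c" "addable X ?I ?a (tsum X ?I ?b ?c)"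
    unfolding addable_def using pe ps by simp_all
  have m1: "tsum X ?I (tsum X ?I ?a ?b) ?c = tsum X ?I ?a (tsum X ?I ?b ?c)"
    using m[unfolded tang_monoid_def Let_def, THEN conjunct2, THEN conjunct2, THEN conjunct2, THEN
      conjunct2,
      rule_format, of P ?a ?b ?c] pe by simp
  have t: "(tsum X ?I u v \<lhd> F) \<bullet> h = tsum X F ((u \<lhd> F) \<bullet> h) ((v \<lhd> F) \<bullet> h)" if ad: "addable X ?I u v"
    and [simp]: "dom2 K u = P" for u v
  proof -
    note [simp] = addableD(3-5)[OF ad]
    have "addable X F (u \<lhd> F) (v \<lhd> F)" using addable_whr[OF Xd ad, of F] by simp
    then show ?thesis using tsum_whr[OF Xd ad, of F] tsum_comp[OF Xd, of F "u \<lhd> F" "v \<lhd> F" h]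
       addableD(6)[OF ad] by simp
  qed
  show ?thesis
    using arg_cong[OF m1, of "\<lambda>x. (x \<lhd> F) \<bullet> h"] t[OF ad2(1)] t[OF ad2(2)] t[OF ad(1)] t[OF ad(2)]
      by (simp add: h)
qed

text \<open>Strict morphisms commute with the tangent structure but need not preserve the pullbacks \<open>T\<^sub>n\<close>.\<close>

definition pres_Tn :: "('x, 'm, 'c) tstruct \<Rightarrow> ('x, 'm, 'c) tstruct \<Rightarrow> 'm \<Rightarrow> bool" where
  "pres_Tn X' X F \<longleftrightarrow> strict X' X F \<and>
     (\<forall>n P \<pi>. Tn_at X' (carr X') (id1 K (carr X')) n P \<pi> \<longrightarrow> Tn_at X (carr X') F n (F \<odot> P)
       (\<lambda>i. F \<rhd> \<pi> i))"

lemma pres_Tn_at: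
  assumes S: "pres_Tn X' X F" and X': "tang_data X'" and X: "tang_data X"
    and T: "Tn_at X' Y G n P \<pi>"
  shows "Tn_at X Y (F \<odot> G) n (F \<odot> P) (\<lambda>i. F \<rhd> \<pi> i)"
proof -
  have st: "strict X' X F" using S unfolding pres_Tn_def by blast
  note [simp] = X X' Tn_at_cells[OF T] strictD(1-4)[OF st X' X]
  obtain P0 \<pi>0 where T0: "Tn_at X' (carr X') (id1 K (carr X')) n P0 \<pi>0"
    using has_Tn_Tn_at[OF X' Tn_at_ge1[OF T]] .
  note [simp] = Tn_at_cells(5-9)[OF T0]
  have [simp]: "cod2 K (\<pi>0 i) = TT X'" if "i < n" for i using Tn_at_cells(10)[OF T0 that] by simp
  have T1: "Tn_at X' Y G n (P0 \<odot> G) (\<lambda>i. \<pi>0 i \<lhd> G)" using Tn_at_whr[OF X' T0, of G Y] by simp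
  obtain e e' where e: "e \<in> hom2 K P (P0 \<odot> G)" "e' \<in> hom2 K (P0 \<odot> G) P" "e \<bullet> e' = id2 K (P0 \<odot> G)"
    "e' \<bullet> e = id2 K P"
    "\<And>i. i < n \<Longrightarrow> (\<pi>0 i \<lhd> G) \<bullet> e = \<pi> i"
    using Tn_at_unique[OF X' T1 T] by metis
  note [simp] = e(1,2)[simplified]
  have T2: "Tn_at X Y (F \<odot> G) n (F \<odot> P0 \<odot> G) (\<lambda>i. (F \<rhd> \<pi>0 i) \<lhd> G)"
    using Tn_at_whr[OF X, of "carr X'" F n "F \<odot> P0" "\<lambda>i. F \<rhd> \<pi>0 i" G Y] S T0
      unfolding pres_Tn_def by simp
  show ?thesis
  proof (rule Tn_at_iso[OF X T2, where e = "F \<rhd> e" and e' = "F \<rhd> e'"])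
    show "(F \<rhd> e) \<bullet> (F \<rhd> e') = id2 K (F \<odot> P0 \<odot> G)" "(F \<rhd> e') \<bullet> (F \<rhd> e) = id2 K (F \<odot> P)"
      using e(3,4)[THEN arg_cong, of "\<lambda>x. F \<rhd> x"] by simp_all
    show "((F \<rhd> \<pi>0 i) \<lhd> G) \<bullet> (F \<rhd> e) = F \<rhd> \<pi> i" if "i < n" for i
      using e(5)[OF that, THEN arg_cong, of "\<lambda>x. F \<rhd> x"] that by simp
  qed simp_all
qed

lemma pres_Tn_comp:
  assumes S: "pres_Tn X' X F" "pres_Tn X'' X' G" and X: "tang_data X'" "tang_data X" "tang_data X''"
  shows "pres_Tn X'' X (F \<odot> G)"
  unfolding pres_Tn_def
proof (intro conjI allI impI)
  have st: "strict X' X F" "strict X'' X' G" using S unfolding pres_Tn_def by blast+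
  show "strict X'' X (F \<odot> G)" using strict_lax_strict_lax(2)[OF st(1) X(1,2) st(2) X(3)] .
  fix n P \<pi> assume T: "Tn_at X'' (carr X'') (id1 K (carr X'')) n P \<pi>"
  note [simp] = X strictD(1-4)[OF st(1) X(1,2)] strictD(1-4)[OF st(2) X(3,1)] Tn_at_cells(5-9)[OF T]
  have "Tn_at X' (carr X'') G n (G \<odot> P) (\<lambda>i. G \<rhd> \<pi> i)" using S(2) T unfolding pres_Tn_def by blast
  from pres_Tn_at[OF S(1) X(1,2) this]
  have "Tn_at X (carr X'') (F \<odot> G) n (F \<odot> G \<odot> P) (\<lambda>i. F \<rhd> G \<rhd> \<pi> i)" .
  from Tn_at_cong[OF X(2) this, of "\<lambda>i. (F \<odot> G) \<rhd> \<pi> i"]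
  show "Tn_at X (carr X'') (F \<odot> G) n ((F \<odot> G) \<odot> P) (\<lambda>i. (F \<odot> G) \<rhd> \<pi> i)" by simp
qed

lemma vl_addable:
  assumes X: "tang_data X" and E: "tang_eqs X"
  shows "addable X (TT X) ((TT X \<rhd> zz X) \<bullet> \<pi>1 X) (ll X \<bullet> \<pi>2 X)"
proof -
  note [simp] = X and e = E[unfolded tang_eqs_def]
  have 1: "(pp X \<lhd> TT X) \<bullet> (TT X \<rhd> zz X) = zz X \<bullet> pp X"
    using nat_eq[of "pp X" "TT X" "id1 K (carr X)" "zz X" "id1 K (carr X)" "TT X"] by simp
  have 2: "(pp X \<lhd> TT X) \<bullet> (TT X \<rhd> zz X) \<bullet> \<pi>1 X = zz X \<bullet> pp X \<bullet> \<pi>1 X"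
    by (rule vcomp_extend2[OF 1]) simp_all
  have "(pp X \<lhd> TT X) \<bullet> cc X \<bullet> ll X = (TT X \<rhd> pp X) \<bullet> ll X"
    by (rule vcomp_extend) (use e in simp_all)
  then have 3: "(pp X \<lhd> TT X) \<bullet> ll X = zz X \<bullet> pp X" using e by simp
  have "(pp X \<lhd> TT X) \<bullet> ll X \<bullet> \<pi>2 X = zz X \<bullet> pp X \<bullet> \<pi>2 X" by (rule vcomp_extend2[OF 3]) simp_all
  then show ?thesis unfolding addable_def using 2 by (simp add: p_pi)
qed

lemma vl_map_cells [simp]:
  assumes X: "tang_data X" and E: "tang_eqs X"
  shows "vl_map X \<in> cells2 K" "dom2 K (vl_map X) = T2 X" "cod2 K (vl_map X) = TT X \<odot> TT X"
  using vl_addable[OF assms] X unfolding vl_map_def by simp_all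

text \<open>The image of the square is isomorphic to the square of \<open>X\<close> at \<open>F G\<close>: the apex \<open>F T\<^sub>2\<close> is
  isomorphic to \<open>T\<^sub>2 F\<close>, and \<open>F\<close> preserves the sum that defines the top edge.\<close>

lemma strict_vl_pb:
  assumes Z: "tang_data Z" "tang_eqs Z" and X: "tangentad X" and S: "pres_Tn Z X F"
    and G: "G \<in> cells1 K" "dom1 K G = Y" "cod1 K G = carr Z"
  shows "is_pb (homcat Y (carr X)) (F \<odot> G) (F \<odot> TT Z \<odot> TT Z \<odot> G) (F \<odot> TT Z \<odot> G) (F \<rhd> (zz Z \<lhd> G))
    (F \<rhd> TT Z \<rhd> (pp Z \<lhd> G)) (F \<odot> T2 Z \<odot> G) (F \<rhd> ((pp Z \<lhd> G) \<bullet> (\<pi>1 Z \<lhd> G))) (F \<rhd> (vl_map Z \<lhd> G))"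
proof -
  have Xd: "tang_data X" and Xe: "tang_eqs X" and Xv: "vl_pb X" using X
    unfolding tangentad_iff by blast+
  have st: "strict Z X F" using S unfolding pres_Tn_def by blast
  note sD = strictD[OF st Z(1) Xd]
  note [simp] = Z Xd Xe G sD
  have Yo [simp]: "Y \<in> cells0 K" using cells0_dom1[OF G(1)] G(2) by simp
  have T: "Tn_at X (carr Z) F 2 (F \<odot> T2 Z) (\<lambda>i. F \<rhd> two (\<pi>1 Z) (\<pi>2 Z) i)"
    using S T2_Tn_at_id[OF Z(1)] unfolding pres_Tn_def by blast
  obtain e e' where e: "e \<in> hom2 K (F \<odot> T2 Z) (T2 X \<odot> F)" "e' \<in> hom2 K (T2 X \<odot> F) (F \<odot> T2 Z)"
    "e \<bullet> e' = id2 K (T2 X \<odot> F)" "e' \<bullet> e = id2 K (F \<odot> T2 Z)"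
    "\<And>i. i < 2 \<Longrightarrow> two (\<pi>1 X \<lhd> F) (\<pi>2 X \<lhd> F) i \<bullet> e = F \<rhd> two (\<pi>1 Z) (\<pi>2 Z) i"
    using Tn_at_unique[OF Xd T2_Tn_at[OF Xd sD(1-3)] T] by metis
  note [simp] = e(1,2)[simplified]
  have e1: "(\<pi>1 X \<lhd> F) \<bullet> e = F \<rhd> \<pi>1 Z" and e2: "(\<pi>2 X \<lhd> F) \<bullet> e = F \<rhd> \<pi>2 Z"
    using e(5)[of 0] e(5)[of 1] by simp_all
  have vz: "F \<rhd> vl_map Z = (vl_map X \<lhd> F) \<bullet> e"
  proof -
    have "addable X (TT X \<odot> F) ((TT X \<rhd> (zz X \<lhd> F)) \<bullet> (\<pi>1 X \<lhd> F)) ((ll X \<lhd> F) \<bullet> (\<pi>2 X \<lhd> F))"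
      using addable_whr[OF Xd vl_addable[OF Xd Xe], of F] by simp
    then show ?thesis
      using strict_tsum(2)[OF st Z(1) Xd vl_addable[OF Z]]
        tsum_whr[OF Xd vl_addable[OF Xd Xe], of F]
        vl_addable[OF Xd Xe] vl_addable[OF Z] tsum_comp[OF Xd, of "TT X \<odot> F" _ _ e]
      unfolding vl_map_def by (simp add: e1 e2)
  qed
  have W: "wide_pb (homcat Y (carr X)) 2 (two (F \<odot> G) (TT X \<odot> TT X \<odot> F \<odot> G)) (TT X \<odot> F \<odot> G)
     (two (zz X \<lhd> (F \<odot> G)) (TT X \<rhd> (pp X \<lhd> (F \<odot> G)))) (T2 X \<odot> F \<odot> G)
     (two ((pp X \<lhd> (F \<odot> G)) \<bullet> (\<pi>1 X \<lhd> (F \<odot> G))) (vl_map X \<lhd> (F \<odot> G)))"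
    using Xv[unfolded vl_pb_def, rule_format, of Y "F \<odot> G"] by (simp add: is_pb_iff_wide_pb)
  have v: "(vl_map X \<lhd> (F \<odot> G)) \<bullet> (e \<lhd> G) = F \<rhd> (vl_map Z \<lhd> G)"
    using arg_cong[OF vz, of "\<lambda>x. x \<lhd> G"] by simp
  have p: "(pp X \<lhd> (F \<odot> G)) \<bullet> (\<pi>1 X \<lhd> (F \<odot> G)) \<bullet> (e \<lhd> G) = (pp X \<lhd> (F \<odot> G)) \<bullet> (F \<rhd> (\<pi>1 Z \<lhd> G))"
    using arg_cong[OF e1, of "\<lambda>x. x \<lhd> G"] by simp
  have "wide_pb (homcat Y (carr X)) 2 (two (F \<odot> G) (TT X \<odot> TT X \<odot> F \<odot> G)) (TT X \<odot> F \<odot> G)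
     (two (zz X \<lhd> (F \<odot> G)) (TT X \<rhd> (pp X \<lhd> (F \<odot> G)))) (F \<odot> T2 Z \<odot> G)
     (two ((pp X \<lhd> (F \<odot> G)) \<bullet> (F \<rhd> (\<pi>1 Z \<lhd> G))) (F \<rhd> (vl_map Z \<lhd> G)))"
  proof (rule wide_pb_homcat_iso[OF W, where e = "e \<lhd> G" and e' = "e' \<lhd> G"])
    show "(e \<lhd> G) \<bullet> (e' \<lhd> G) = id2 K (T2 X \<odot> F \<odot> G)" "(e' \<lhd> G) \<bullet> (e \<lhd> G) = id2 K (F \<odot> T2 Z \<odot> G)"
      using e(3,4)[THEN arg_cong, of "\<lambda>x. x \<lhd> G"] by simp_all
  qed (auto simp: v p)
  then show ?thesis by (simp add: is_pb_iff_wide_pb)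
qed

end

section \<open>The universal bundle and the equations of a connection\<close>

lemma bundle_tcat_sel [simp]:
  "obj (bundle_tcat C S) = S" "hom (bundle_tcat C S) = linear_morphisms C"
  "idm (bundle_tcat C S) = (\<lambda>B. (idm C (dM B), idm C (dE B)))"
  "cmp (bundle_tcat C S) = (\<lambda>(f', g') (f, g). (f' \<cdot>\<^bsub>C\<^esub> f, g' \<cdot>\<^bsub>C\<^esub> g))"
  "tob (bundle_tcat C S) = tangent_bundle C" "tar (bundle_tcat C S) = (\<lambda>(f, g). (tar C f, tar C g))"
  "tp (bundle_tcat C S) = (\<lambda>B. (tp C (dM B), tp C (dE B)))"
  by (simp_all add: bundle_tcat_def bundle_cat_def Let_def)

lemma tangent_bundle_sel [simp]:
  "dM (tangent_bundle C B) = tob C (dM B)" "dE (tangent_bundle C B) = tob C (dE B)"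
  "dq (tangent_bundle C B) = tar C (dq B)" "dl (tangent_bundle C B) = tc C (dE B) \<cdot>\<^bsub>C\<^esub> tar C (dl B)"
  by (simp_all add: tangent_bundle_def Let_def)

text \<open>The pullback at hand is isomorphic to one that is computed componentwise, and both components
  of an isomorphism in \<open>D\<close> are isomorphisms in \<open>C\<close>.\<close>

lemma componentwise_any:
  assumes C: "category C" and D: "category D"
    and cmp: "cmp D = (\<lambda>(f', g') (f, g). (f' \<cdot>\<^bsub>C\<^esub> f, g' \<cdot>\<^bsub>C\<^esub> g))"
    and idm: "\<And>A. A \<in> obj D \<Longrightarrow> idm D A = (idm C (b A), idm C (t A))"
    and hom: "\<And>A B f. A \<in> obj D \<Longrightarrow> B \<in> obj D \<Longrightarrow> f \<in> hom D A B \<Longrightarrow> fst f \<in> hom C (b A) (b B)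
      \<and> snd f \<in> hom C (t A) (t B)"
    and ob: "\<And>A. A \<in> obj D \<Longrightarrow> b A \<in> obj C \<and> t A \<in> obj C"
    and cw: "componentwise_Tn C D b t" and A: "A \<in> obj D"
    and W: "wide_pb D n (\<lambda>_. tob D A) A (\<lambda>_. tp D A) P p"
  shows "wide_pb C n (\<lambda>_. tob C (b A)) (b A) (\<lambda>_. tp C (b A)) (b P) (\<lambda>i. fst (p i))"
    "wide_pb C n (\<lambda>_. tob C (t A)) (t A) (\<lambda>_. tp C (t A)) (t P) (\<lambda>i. snd (p i))"
proof -
  obtain P' p' where
    W1: "wide_pb D n (\<lambda>_. tob D A) A (\<lambda>_. tp D A) P' p'" and
    W2: "wide_pb C n (\<lambda>_. tob C (b A)) (b A) (\<lambda>_. tp C (b A)) (b P') (\<lambda>i. fst (p' i))" and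
    W3: "wide_pb C n (\<lambda>_. tob C (t A)) (t A) (\<lambda>_. tp C (t A)) (t P') (\<lambda>i. snd (p' i))"
    using cw A wide_pbD(3)[OF W] unfolding componentwise_Tn_def is_nfold_iff_wide_pb by blast
  obtain e e' where e: "e \<in> hom D P P'" "e' \<in> hom D P' P" "e \<cdot>\<^bsub>D\<^esub> e' = idm D P'"
    "e' \<cdot>\<^bsub>D\<^esub> e = idm D P"
    "\<And>i. i < n \<Longrightarrow> p' i \<cdot>\<^bsub>D\<^esub> e = p i"
    using category.wide_pb_unique[OF D W1 W] by metis
  have P: "P \<in> obj D" "P' \<in> obj D" using wide_pbD(1)[OF W] wide_pbD(1)[OF W1] .
  have c: "f \<cdot>\<^bsub>D\<^esub> g = (fst f \<cdot>\<^bsub>C\<^esub> fst g, snd f \<cdot>\<^bsub>C\<^esub> snd g)" for f g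
    unfolding cmp by (simp split: prod.splits)
  have ii: "fst e \<cdot>\<^bsub>C\<^esub> fst e' = idm C (b P')" "snd e \<cdot>\<^bsub>C\<^esub> snd e' = idm C (t P')"
    "fst e' \<cdot>\<^bsub>C\<^esub> fst e = idm C (b P)" "snd e' \<cdot>\<^bsub>C\<^esub> snd e = idm C (t P)"
    using e(3,4) idm P unfolding c by simp_all
  have ei: "fst (p' i) \<cdot>\<^bsub>C\<^esub> fst e = fst (p i)" "snd (p' i) \<cdot>\<^bsub>C\<^esub> snd e = snd (p i)" if "i < n" for i
    using e(5)[OF that] unfolding c by (metis fst_conv snd_conv)+
  note h = hom[OF P e(1)] hom[OF P(2,1) e(2)] ob[OF P(1)]
  show "wide_pb C n (\<lambda>_. tob C (b A)) (b A) (\<lambda>_. tp C (b A)) (b P) (\<lambda>i. fst (p i))"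
    by (rule category.wide_pb_iso[OF C W2, where e = "fst e" and e' = "fst e'"])
      (use h ii ei in auto)
  show "wide_pb C n (\<lambda>_. tob C (t A)) (t A) (\<lambda>_. tp C (t A)) (t P) (\<lambda>i. snd (p i))"
    by (rule category.wide_pb_iso[OF C W3, where e = "snd e" and e' = "snd e'"])
      (use h ii ei in auto)
qed

lemma tangent_iso_tob: "tangent_iso C D Fo Fa \<Longrightarrow> A \<in> obj C \<Longrightarrow> Fo (tob C A) = tob D (Fo A)"
  unfolding tangent_iso_def by blast

context two_category
begin

lemma DBpt_sel [simp]:
  "obj (DBpt X' X) = {B. pointwise_display_bundle X' X B}"
    "hom (DBpt X' X) = linear_morphisms (homt X' X)"
  "idm (DBpt X' X) = (\<lambda>B. (id2 K (fst (dM B)), id2 K (fst (dE B))))"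
  "cmp (DBpt X' X) = (\<lambda>(f', g') (f, g). (f' \<bullet> f, g' \<bullet> g))"
  "tob (DBpt X' X) = tangent_bundle (homt X' X)"
  "tar (DBpt X' X) = (\<lambda>(f, g). (TT X \<rhd> f, TT X \<rhd> g))"
  "tp (DBpt X' X) = (\<lambda>B. (pp X \<lhd> fst (dM B), pp X \<lhd> fst (dE B)))"
  by (simp_all add: DBpt_def)

lemma pointwise_display_bundleD:
  assumes "pointwise_display_bundle X' X B"
  shows "lax X' X (dM B)" "lax X' X (dE B)" "dq B \<in> hom (homt X' X) (dE B) (dM B)"
    "dl B \<in> hom (homt X' X) (dE B) (tan_T X (dE B))"
  using assms unfolding pointwise_display_bundle_def display_bundle_def comm_monoid_over_def Let_def
  by (simp_all del: hom_homt)

lemma bundle_at_sel [simp]: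
  "dM (bundle_at X'' X' X B H) = dM B \<odot>\<^sub>l H" "dE (bundle_at X'' X' X B H) = dE B \<odot>\<^sub>l H"
  "dq (bundle_at X'' X' X B H) = dq B \<lhd> fst H" "dl (bundle_at X'' X' X B H) = dl B \<lhd> fst H"
  by (simp_all add: bundle_at_def Let_def)

text \<open>The pullback \<open>T\<^sub>n\<close> of \<open>D\<close> is a pullback in \<open>[D | D]\<close>, at the identity. The classification of
  bundles carries it to a pullback of bundles in \<open>[D | X]\<close> with legs \<open>(Bas \<pi>\<^sub>i, Tot \<pi>\<^sub>i)\<close>. As these
  pullbacks are componentwise, \<open>Bas \<pi>\<^sub>i\<close> and \<open>Tot \<pi>\<^sub>i\<close> are the legs of pullbacks in \<open>[D | X]\<close>, hence
  of \<open>T\<^sub>n\<close> at \<open>Bas\<close> and \<open>Tot\<close>.\<close>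

lemma is_DB_pres_Tn:
  assumes X: "tangentad X" and DB: "is_DB X D Bas Tot Q"
  shows "pres_Tn D X Bas" "pres_Tn D X Tot"
proof -
  have D: "tangentad D" and st: "strict D X Bas" "strict D X Tot" and Q: "dM Q = strict_lax D Bas"
    "dE Q = strict_lax D Tot"
    and cw: "componentwise_Tn (homt D X) (DBpt D X) dM dE"
    and iso: "tangent_iso (homt D D) (DBpt D X) (\<lambda>H. bundle_at D D X Q H) (\<lambda>\<phi>. (Bas \<rhd> \<phi>, Tot \<rhd> \<phi>))"
    using DB unfolding is_DB_def by blast+
  have Xd: "tang_data X" and Dd: "tang_data D" using X D by simp_all
  note [simp] = X D Xd Dd strictD(1-4)[OF st(1) Dd Xd] strictD(1-4)[OF st(2) Dd Xd]
  define A where "A = (id1 K (carr D), id2 K (TT D))"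
  have LA: "lax D D A" unfolding A_def by (rule id_lax) simp
  note ci = tangent_iso_cat_iso[OF iso]
  have "Tn_at X (carr D) Bas n (Bas \<odot> P) (\<lambda>i. Bas \<rhd> \<pi> i) \<and> Tn_at X (carr D) Tot n (Tot \<odot> P)
    (\<lambda>i. Tot \<rhd> \<pi> i)"
    if T: "Tn_at D (carr D) (id1 K (carr D)) n P \<pi>" for n P \<pi>
  proof -
    obtain \<gamma> where LP: "lax D D (P, \<gamma>)"
      and W: "wide_pb (homt D D) n (\<lambda>_. tan_T D A) A (\<lambda>_. pp D \<lhd> id1 K (carr D)) (P, \<gamma>) \<pi>"
      using Tn_at_lax[OF D D _ T, of "id2 K (TT D)"] LA unfolding A_def by blast
    let ?\<Phi> = "\<lambda>H. bundle_at D D X Q H"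
    have e1: "?\<Phi> (tan_T D A) = tob (DBpt D X) (?\<Phi> A)"
      and e2: "(Bas \<rhd> (pp D \<lhd> id1 K (carr D)), Tot \<rhd> (pp D \<lhd> id1 K (carr D)))
        = tp (DBpt D X) (?\<Phi> A)"
      using tangent_iso_tob[OF iso, of A] LA strictD(7)[OF st(1) Dd Xd] strictD(7)[OF st(2) Dd Xd]
      by (simp_all add: A_def Q strict_lax_def)
    have W1: "wide_pb (DBpt D X) n (\<lambda>_. tob (DBpt D X) (?\<Phi> A)) (?\<Phi> A) (\<lambda>_. tp (DBpt D X) (?\<Phi> A))
      (?\<Phi> (P, \<gamma>)) (\<lambda>i. (Bas \<rhd> \<pi> i, Tot \<rhd> \<pi> i))"
      using cat_iso_wide_pb[OF ci category_homt[OF Dd Dd] W] unfolding e1 e2 .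
    have A': "?\<Phi> A \<in> obj (DBpt D X)" using cat_iso_obj[OF ci, of A] LA by simp
    have "wide_pb (homt D X) n (\<lambda>_. tob (homt D X) (dM (?\<Phi> A))) (dM (?\<Phi> A)) (\<lambda>_. tp (homt D X)
      (dM (?\<Phi> A))) (dM (?\<Phi> (P, \<gamma>)))
         (\<lambda>i. fst (Bas \<rhd> \<pi> i, Tot \<rhd> \<pi> i))"
      "wide_pb (homt D X) n (\<lambda>_. tob (homt D X) (dE (?\<Phi> A))) (dE (?\<Phi> A)) (\<lambda>_. tp (homt D X)
        (dE (?\<Phi> A))) (dE (?\<Phi> (P, \<gamma>)))
         (\<lambda>i. snd (Bas \<rhd> \<pi> i, Tot \<rhd> \<pi> i))"
      by (rule componentwise_any[OF category_homt[OF Dd Xd]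
        cat_iso_category[OF ci category_homt[OF Dd Dd]] _ _ _ _ cw A' W1];
          auto simp: linear_morphisms_def pointwise_display_bundleD(1,2) simp del: hom_homt)+
    then have W2: "wide_pb (homt D X) n (\<lambda>_. tan_T X (dM Q \<odot>\<^sub>l A)) (dM Q \<odot>\<^sub>l A) (\<lambda>_. pp X \<lhd> fst
      (dM Q \<odot>\<^sub>l A)) (dM Q \<odot>\<^sub>l (P, \<gamma>)) (\<lambda>i. Bas \<rhd> \<pi> i)"
      "wide_pb (homt D X) n (\<lambda>_. tan_T X (dE Q \<odot>\<^sub>l A)) (dE Q \<odot>\<^sub>l A) (\<lambda>_. pp X \<lhd> fst (dE Q \<odot>\<^sub>l A))
        (dE Q \<odot>\<^sub>l (P, \<gamma>)) (\<lambda>i. Tot \<rhd> \<pi> i)"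
      by simp_all
    have L2: "lax D X (dM Q \<odot>\<^sub>l A)" "lax D X (dE Q \<odot>\<^sub>l A)"
      using wide_pbD(2)[OF W2(1)] wide_pbD(2)[OF W2(2)] by simp_all
    show ?thesis using homt_Tn[OF D X L2(1) W2(1)] homt_Tn[OF D X L2(2) W2(2)]
      by (simp add: Q A_def strict_lax_def)
  qed
  then show "pres_Tn D X Bas" "pres_Tn D X Tot" using st unfolding pres_Tn_def by blast+
qed

end

text \<open>What is needed of the universal bundle \<open>Q : Tot \<rightarrow> Bas\<close> in order to construct tangent
  structures. The equations on \<open>q\<close> and \<open>l\<close> say that they are tangent 2-cells.\<close>

locale bundle_data = two_category K for K :: "('x, 'm, 'c) twocat" (structure) +
  fixes X D :: "('x, 'm, 'c) tstruct" and Bas Tot :: 'm and q l :: 'c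
  assumes X: "tangentad X" and D: "tangentad D" and Bas: "pres_Tn D X Bas"
    and Tot: "pres_Tn D X Tot"
    and q: "q \<in> hom2 K Tot Bas" "TT X \<rhd> q = q \<lhd> TT D"
    and l: "l \<in> hom2 K Tot (TT X \<odot> Tot)" "TT X \<rhd> l = (cc X \<lhd> Tot) \<bullet> (l \<lhd> TT D)"
begin

lemma data [simp]: "tang_data X" "tang_data D" using X D by simp_all

lemma stBas: "strict D X Bas" and stTot: "strict D X Tot" using Bas Tot
    unfolding pres_Tn_def by blast+

lemmas Bas_simps [simp] = strictD[OF stBas data(2,1)]
lemmas Tot_simps [simp] = strictD[OF stTot data(2,1)]
lemmas q_cells [simp] = q(1)[simplified]
lemmas l_cells [simp] = l(1)[simplified]

text \<open>The first \<open>i\<close> equations of a vertical linear connection, in the order in which the equifiers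
  impose them.\<close>

definition vlc_eqs :: "nat \<Rightarrow> 'm \<Rightarrow> 'c \<Rightarrow> bool" where
  "vlc_eqs i H k \<longleftrightarrow>
     (i \<ge> 1 \<longrightarrow> k \<bullet> (l \<lhd> H) = id2 K (Tot \<odot> H)) \<and>
     (i \<ge> 2 \<longrightarrow> (q \<lhd> H) \<bullet> k = (q \<lhd> H) \<bullet> (pp X \<lhd> (Tot \<odot> H))) \<and>
     (i \<ge> 3 \<longrightarrow> (l \<lhd> H) \<bullet> k = (TT X \<rhd> k) \<bullet> (ll X \<lhd> (Tot \<odot> H))) \<and>
     (i \<ge> 4 \<longrightarrow> (l \<lhd> H) \<bullet> k = (TT X \<rhd> k) \<bullet> (cc X \<lhd> (Tot \<odot> H)) \<bullet> (TT X \<rhd> (l \<lhd> H)))"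

lemma vlc_eqsD:
  assumes "vlc_eqs i H k"
  shows "i \<ge> 1 \<Longrightarrow> k \<bullet> (l \<lhd> H) = id2 K (Tot \<odot> H)"
    "i \<ge> 2 \<Longrightarrow> (q \<lhd> H) \<bullet> k = (q \<lhd> H) \<bullet> (pp X \<lhd> (Tot \<odot> H))"
    "i \<ge> 3 \<Longrightarrow> (l \<lhd> H) \<bullet> k = (TT X \<rhd> k) \<bullet> (ll X \<lhd> (Tot \<odot> H))"
    "i \<ge> 4 \<Longrightarrow> (l \<lhd> H) \<bullet> k = (TT X \<rhd> k) \<bullet> (cc X \<lhd> (Tot \<odot> H)) \<bullet> (TT X \<rhd> (l \<lhd> H))"
  using assms unfolding vlc_eqs_def by blast+

definition pre_conn :: "nat \<Rightarrow> 'x \<Rightarrow> 'm \<Rightarrow> 'c \<Rightarrow> bool" where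
  "pre_conn i Y H k \<longleftrightarrow> Y \<in> cells0 K \<and> H \<in> hom1 K Y (carr D) \<and> k \<in> hom2 K (TT X \<odot> Tot \<odot> H) (Tot \<odot> H)
    \<and> vlc_eqs i H k"

lemma pre_conn_cells:
  assumes "pre_conn i Y H k"
  shows "Y \<in> cells0 K" "H \<in> cells1 K" "dom1 K H = Y" "cod1 K H = carr D"
    "k \<in> cells2 K" "dom2 K k = TT X \<odot> Tot \<odot> H" "cod2 K k = Tot \<odot> H" "vlc_eqs i H k"
  using assms unfolding pre_conn_def by auto

lemma l_TD:
  assumes "H \<in> cells1 K" "cod1 K H = carr D"
  shows "l \<lhd> (TT D \<odot> H) = (cc X \<lhd> (Tot \<odot> H)) \<bullet> (TT X \<rhd> (l \<lhd> H))"
proof -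
  have "(cc X \<lhd> Tot) \<bullet> (cc X \<lhd> Tot) = id2 K (TT X \<odot> TT X \<odot> Tot)"
    using tangentadD(10)[OF X, THEN arg_cong, of "\<lambda>x. x \<lhd> Tot"] by simp
  then have "(cc X \<lhd> Tot) \<bullet> (TT X \<rhd> l) = l \<lhd> TT D"
    using vcomp_extend[of "cc X \<lhd> Tot" "cc X \<lhd> Tot" _ "l \<lhd> TT D"] by (simp add: l(2))
  from arg_cong[OF this, of "\<lambda>x. x \<lhd> H"] show ?thesis using assms by simp
qed

lemma q_TD:
  assumes "H \<in> cells1 K" "cod1 K H = carr D"
  shows "q \<lhd> (TT D \<odot> H) = TT X \<rhd> (q \<lhd> H)"
  using arg_cong[OF q(2), of "\<lambda>x. x \<lhd> H"] assms by simp

text \<open>With \<open>k' = T k \<circ> c\<close> and \<open>l' = c \<circ> T l\<close>, the first equation uses \<open>c \<circ> c = id\<close>, the second one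
  \<open>T p \<circ> c = p\<^sub>T\<close>, the third one \<open>c\<^sub>T \<circ> T l \<circ> c = T c \<circ> l\<^sub>T\<close> for the lift \<open>l\<close> of \<open>X\<close>, and the fourth
  one the Yang-Baxter equation, each together with \<open>T\<close> applied to the equation for \<open>k\<close>.\<close>

lemma pre_conn_T:
  assumes v: "pre_conn i Y H k"
  shows "pre_conn i Y (TT D \<odot> H) ((TT X \<rhd> k) \<bullet> (cc X \<lhd> (Tot \<odot> H)))"
proof -
  note [simp] = X D pre_conn_cells(1-7)[OF v] l_TD q_TD
  note e = vlc_eqsD[OF pre_conn_cells(8)[OF v]]
  let ?T = "TT X" and ?c = "cc X" let ?E = "Tot \<odot> H" let ?l = "l \<lhd> H"
  have wc: "(?c \<lhd> F) \<bullet> (?c \<lhd> F) = id2 K (?T \<odot> ?T \<odot> F)" if "F \<in> cells1 K" "cod1 K F = carr X" for F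
    using that tangentadD(10)[OF X, THEN arg_cong, of "\<lambda>x. x \<lhd> F"] by simp
  have wc': "(?c \<lhd> F) \<bullet> (?c \<lhd> F) \<bullet> x = x" if "F \<in> cells1 K" "cod1 K F = carr X" "x \<in> cells2 K"
    "cod2 K x = ?T \<odot> ?T \<odot> F" for F x
    using that vcomp_extend[OF wc[OF that(1,2)], of x] by simp
  have nc: "(?c \<lhd> G) \<bullet> (?T \<rhd> ?T \<rhd> x) = (?T \<rhd> ?T \<rhd> x) \<bullet> (?c \<lhd> F)" if "x \<in> cells2 K" "dom2 K x = F"
    "cod2 K x = G" "cod1 K F = carr X" for x F G
    using nat_eq[of ?c "?T \<odot> ?T" "?T \<odot> ?T" x F G] that cod1_cod2[of x] dom1_cod2[of x]
      cells1_cod2[of x] cells1_dom2[of x] by simp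
  have nc': "(?c \<lhd> G) \<bullet> (?T \<rhd> ?T \<rhd> x) \<bullet> y = (?T \<rhd> ?T \<rhd> x) \<bullet> (?c \<lhd> F) \<bullet> y"
    if "x \<in> cells2 K" "dom2 K x = F" "cod2 K x = G" "cod1 K F = carr X"
    "y \<in> cells2 K" "cod2 K y = ?T \<odot> ?T \<odot> F" for x y F G
    by (rule vcomp_extend2[OF nc]) (use that cod1_cod2[of x] dom1_cod2[of x] cells1_cod2[of x]
      cells1_dom2[of x] in simp_all)
  have TT: "(?T \<rhd> a) \<bullet> (?T \<rhd> b) \<bullet> y = (?T \<rhd> c) \<bullet> y" if "a \<bullet> b = c" "a \<in> cells2 K" "b \<in> cells2 K"
    "dom2 K a = cod2 K b"
    "cod1 K (dom2 K b) = carr X" "y \<in> cells2 K" "cod2 K y = ?T \<odot> dom2 K b" for a b c y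
    unfolding that(1)[symmetric] using that(2-) cod1_cod2[of b] by simp
  have e1: "((?T \<rhd> k) \<bullet> (?c \<lhd> ?E)) \<bullet> (l \<lhd> (TT D \<odot> H)) = id2 K (Tot \<odot> TT D \<odot> H)" if "i \<ge> 1"
  proof -
    have "(?T \<rhd> k) \<bullet> (?T \<rhd> ?l) = id2 K (?T \<odot> ?E)"
    proof -
      have "k \<bullet> ?l = id2 K ?E" using e(1) that by simp
      from arg_cong[OF this, of "\<lambda>x. ?T \<rhd> x"] show ?thesis by simp
    qed
    then show ?thesis by (simp add: wc')
  qed
  have e2: "(q \<lhd> (TT D \<odot> H)) \<bullet> ((?T \<rhd> k) \<bullet> (?c \<lhd> ?E)) = (q \<lhd> (TT D \<odot> H)) \<bullet>
    (pp X \<lhd> (Tot \<odot> TT D \<odot> H))" if "i \<ge> 2"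
  proof -
    have 1: "(?T \<rhd> (q \<lhd> H)) \<bullet> (?T \<rhd> k) \<bullet> (?c \<lhd> ?E) = (?T \<rhd> ((q \<lhd> H) \<bullet> (pp X \<lhd> ?E))) \<bullet> (?c \<lhd> ?E)"
      by (rule TT[OF e(2)[OF that]]) simp_all
    have "(?T \<rhd> pp X) \<bullet> ?c = (pp X \<lhd> ?T)"
      using vcomp_extend[OF tangentadD(4)[OF X], of ?c] tangentadD(10)[OF X] by simp
    from arg_cong[OF this, of "\<lambda>x. x \<lhd> ?E"] have "(?T \<rhd> (pp X \<lhd> ?E)) \<bullet> (?c \<lhd> ?E) = pp X \<lhd> (?T \<odot> ?E)"
      by simp
    then show ?thesis using 1 by simp
  qed
  have e3: "(l \<lhd> (TT D \<odot> H)) \<bullet> ((?T \<rhd> k) \<bullet> (?c \<lhd> ?E)) = (?T \<rhd> ((?T \<rhd> k) \<bullet> (?c \<lhd> ?E))) \<bullet>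
    (ll X \<lhd> (Tot \<odot> TT D \<odot> H))" if "i \<ge> 3"
  proof -
    have 1: "(?T \<rhd> ?l) \<bullet> (?T \<rhd> k) \<bullet> (?c \<lhd> ?E) = (?T \<rhd> ((?T \<rhd> k) \<bullet> (ll X \<lhd> ?E))) \<bullet> (?c \<lhd> ?E)"
      by (rule TT[OF e(3)[OF that]]) simp_all
    have "(?c \<lhd> ?T) \<bullet> (?c \<lhd> ?T) \<bullet> (?T \<rhd> ?c) \<bullet> (ll X \<lhd> ?T) = (?c \<lhd> ?T) \<bullet> (?T \<rhd> ll X) \<bullet> ?c"
      using tangentadD(9)[OF X] by simp
    then have "(?c \<lhd> ?T) \<bullet> (?T \<rhd> ll X) \<bullet> ?c = (?T \<rhd> ?c) \<bullet> (ll X \<lhd> ?T)"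
      by (simp add: wc')
    from arg_cong[OF this, of "\<lambda>x. x \<lhd> ?E"]
    have "(?c \<lhd> (?T \<odot> ?E)) \<bullet> (?T \<rhd> (ll X \<lhd> ?E)) \<bullet> (?c \<lhd> ?E) = (?T \<rhd> (?c \<lhd> ?E)) \<bullet> (ll X \<lhd> (?T \<odot> ?E))"
      by simp
    then show ?thesis using 1 nc'[of k "?T \<odot> ?E" ?E "(?T \<rhd> (ll X \<lhd> ?E)) \<bullet> (?c \<lhd> ?E)"] by simp
  qed
  have e4: "(l \<lhd> (TT D \<odot> H)) \<bullet> ((?T \<rhd> k) \<bullet> (?c \<lhd> ?E)) =
    (?T \<rhd> ((?T \<rhd> k) \<bullet> (?c \<lhd> ?E))) \<bullet> (?c \<lhd> (Tot \<odot> TT D \<odot> H)) \<bullet> (?T \<rhd> (l \<lhd> (TT D \<odot> H)))" if "i \<ge> 4"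
  proof -
    have 1: "(?T \<rhd> ?l) \<bullet> (?T \<rhd> k) \<bullet> (?c \<lhd> ?E) = (?T \<rhd> ((?T \<rhd> k) \<bullet> (?c \<lhd> ?E) \<bullet> (?T \<rhd> ?l))) \<bullet>
      (?c \<lhd> ?E)"
      by (rule TT[OF e(4)[OF that]]) simp_all
    have yb: "(?c \<lhd> (?T \<odot> ?E)) \<bullet> (?T \<rhd> (?c \<lhd> ?E)) \<bullet> (?c \<lhd> (?T \<odot> ?E)) = (?T \<rhd> (?c \<lhd> ?E)) \<bullet>
      (?c \<lhd> (?T \<odot> ?E)) \<bullet> (?T \<rhd> (?c \<lhd> ?E))"
      using tangentadD(11)[OF X, THEN arg_cong, of "\<lambda>x. x \<lhd> ?E"] by simp
    have yb': "(?c \<lhd> (?T \<odot> ?E)) \<bullet> (?T \<rhd> (?c \<lhd> ?E)) \<bullet> (?c \<lhd> (?T \<odot> ?E)) \<bullet> (?T \<rhd> ?T \<rhd> ?l) =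
      (?T \<rhd> (?c \<lhd> ?E)) \<bullet> (?c \<lhd> (?T \<odot> ?E)) \<bullet> (?T \<rhd> (?c \<lhd> ?E)) \<bullet> (?T \<rhd> ?T \<rhd> ?l)"
      using yb[THEN arg_cong, of "\<lambda>x. x \<bullet> (?T \<rhd> ?T \<rhd> ?l)"] by simp
    have "(l \<lhd> (TT D \<odot> H)) \<bullet> ((?T \<rhd> k) \<bullet> (?c \<lhd> ?E)) =
      (?c \<lhd> ?E) \<bullet> (?T \<rhd> ?T \<rhd> k) \<bullet> (?T \<rhd> (?c \<lhd> ?E)) \<bullet> (?T \<rhd> ?T \<rhd> ?l) \<bullet> (?c \<lhd> ?E)" using 1 by simp
    also have "\<dots> = (?T \<rhd> ?T \<rhd> k) \<bullet> (?c \<lhd> (?T \<odot> ?E)) \<bullet> (?T \<rhd> (?c \<lhd> ?E)) \<bullet> (?T \<rhd> ?T \<rhd> ?l) \<bullet> (?c \<lhd> ?E)"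
      by (rule nc') simp_all
    also have "(?T \<rhd> ?T \<rhd> ?l) \<bullet> (?c \<lhd> ?E) = (?c \<lhd> (?T \<odot> ?E)) \<bullet> (?T \<rhd> ?T \<rhd> ?l)"
      by (rule nc[symmetric]) simp_all
    finally show ?thesis using yb' by simp
  qed
  show ?thesis unfolding pre_conn_def vlc_eqs_def using e1 e2 e3 e4 by simp
qed

end

section \<open>Connections on pullbacks, and objects that represent partial connections\<close>

context bundle_data
begin

text \<open>The connection on \<open>T H\<close> induces one on \<open>P\<close>, since \<open>Tot\<close> preserves the pullback. Its equations
  are tested on the legs; for this, \<open>Bas\<close> has to preserve the pullback too, and \<open>T\<close> the one at
  \<open>Tot H\<close>.\<close>

lemma pre_conn_Tn:
  assumes v: "pre_conn i Y H k" and T: "Tn_at D Y H n P \<pi>"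
  obtains kP where "pre_conn i Y P kP"
    "\<And>j. j < n \<Longrightarrow> (Tot \<rhd> \<pi> j) \<bullet> kP = (TT X \<rhd> k) \<bullet> (cc X \<lhd> (Tot \<odot> H)) \<bullet> (TT X \<rhd> Tot \<rhd> \<pi> j)"
proof -
  let ?T = "TT X" and ?E = "Tot \<odot> H"
  define k' where "k' = (?T \<rhd> k) \<bullet> (cc X \<lhd> ?E)"
  have v': "pre_conn i Y (TT D \<odot> H) k'" unfolding k'_def by (rule pre_conn_T[OF v])
  note [simp] = pre_conn_cells(1-7)[OF v] Tn_at_cells[OF T] pre_conn_cells(5-7)[OF v', simplified]
  have TX: "Tn_at X Y ?E n (Tot \<odot> P) (\<lambda>j. Tot \<rhd> \<pi> j)" by (rule pres_Tn_at[OF Tot data(2,1) T])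
  have BX: "Tn_at X Y (Bas \<odot> H) n (Bas \<odot> P) (\<lambda>j. Bas \<rhd> \<pi> j)"
    by (rule pres_Tn_at[OF Bas data(2,1) T])
  note w0 = Tn_at_wide_pb_0[OF data(1) TX] and w1 = Tn_at_wide_pb_1[OF data(1) TX]
    and b0 = Tn_at_wide_pb_0[OF data(1) BX]
  have pc: "(?T \<rhd> (pp X \<lhd> ?E)) = (pp X \<lhd> (?T \<odot> ?E)) \<bullet> (cc X \<lhd> ?E)"
    using tangentadD(4)[OF X, THEN arg_cong, of "\<lambda>x. x \<lhd> ?E"] by simp
  have pk: "(pp X \<lhd> ?E) \<bullet> (?T \<rhd> k) = k \<bullet> (pp X \<lhd> (?T \<odot> ?E))"
    using nat_eq[of "pp X" ?T "id1 K (carr X)" k "?T \<odot> ?E" ?E] by simp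
  have pk': "(pp X \<lhd> ?E) \<bullet> k' = k \<bullet> (?T \<rhd> (pp X \<lhd> ?E))"
    unfolding k'_def pc using vcomp_extend2[OF pk, of "cc X \<lhd> ?E"] by simp
  have Tp: "(?T \<rhd> (pp X \<lhd> ?E)) \<bullet> (?T \<rhd> Tot \<rhd> \<pi> j) = (?T \<rhd> (pp X \<lhd> ?E)) \<bullet> (?T \<rhd> Tot \<rhd> \<pi> m)"
    if "j < n" "m < n" for j m
    using wide_pbD(7)[OF w1 that] by simp
  have comp: "(pp X \<lhd> ?E) \<bullet> k' \<bullet> (?T \<rhd> Tot \<rhd> \<pi> j) = (pp X \<lhd> ?E) \<bullet> k' \<bullet> (?T \<rhd> Tot \<rhd> \<pi> m)"
    if "j < n" "m < n" for j m
  proof -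
    have "(pp X \<lhd> ?E) \<bullet> k' \<bullet> (?T \<rhd> Tot \<rhd> \<pi> r) = k \<bullet> (?T \<rhd> (pp X \<lhd> ?E)) \<bullet> (?T \<rhd> Tot \<rhd> \<pi> r)"
      if "r < n" for r
      by (rule vcomp_extend2[OF pk']) (use that in simp_all)
    then show ?thesis using Tp[OF that] that by simp
  qed
  have "wide_cone (homcat Y (carr X)) n (\<lambda>_. ?T \<odot> ?E) (\<lambda>_. pp X \<lhd> ?E) (?T \<odot> Tot \<odot> P)
    (\<lambda>j. k' \<bullet> (?T \<rhd> Tot \<rhd> \<pi> j))"
    by (rule wide_coneI, simp, simp, simp only: homcat_sel, erule (1) comp)
  from wide_pb_ex1[OF w0 this] obtain kP where "kP \<in> hom2 K (?T \<odot> Tot \<odot> P) (Tot \<odot> P)"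
    and kP: "\<And>j. j < n \<Longrightarrow> (Tot \<rhd> \<pi> j) \<bullet> kP = k' \<bullet> (?T \<rhd> Tot \<rhd> \<pi> j)" by (auto simp del: in_hom2)
  then have [simp]: "kP \<in> cells2 K" "dom2 K kP = ?T \<odot> Tot \<odot> P" "cod2 K kP = Tot \<odot> P" by simp_all
  have kP': "(Tot \<rhd> \<pi> j) \<bullet> kP \<bullet> x = k' \<bullet> (?T \<rhd> Tot \<rhd> \<pi> j) \<bullet> x"
    if "j < n" "x \<in> cells2 K" "cod2 K x = ?T \<odot> Tot \<odot> P" for j x
    by (rule vcomp_extend2[OF kP]) (use that in simp_all)
  have TkP: "(?T \<rhd> Tot \<rhd> \<pi> j) \<bullet> (?T \<rhd> kP) = (?T \<rhd> k') \<bullet> (?T \<rhd> ?T \<rhd> Tot \<rhd> \<pi> j)" if "j < n" for j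
    using that kP[OF that, THEN arg_cong, of "\<lambda>x. ?T \<rhd> x"] by simp
  have TkP': "(?T \<rhd> Tot \<rhd> \<pi> j) \<bullet> (?T \<rhd> kP) \<bullet> x = (?T \<rhd> k') \<bullet> (?T \<rhd> ?T \<rhd> Tot \<rhd> \<pi> j) \<bullet> x"
    if "j < n" "x \<in> cells2 K" "cod2 K x = ?T \<odot> ?T \<odot> Tot \<odot> P" for j x
    by (rule vcomp_extend2[OF TkP]) (use that in simp_all)
  have e0: "h = h'" if "h \<in> hom2 K Z (Tot \<odot> P)" "h' \<in> hom2 K Z (Tot \<odot> P)" "Z \<in> hom1 K Y (carr X)"
    "\<And>i. i < n \<Longrightarrow> (Tot \<rhd> \<pi> i) \<bullet> h = (Tot \<rhd> \<pi> i) \<bullet> h'" for h h' Z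
    using category.wide_pb_eqI[OF category_homcat w0, of Z h h'] that by simp
  have e1: "h = h'" if "h \<in> hom2 K Z (?T \<odot> Tot \<odot> P)" "h' \<in> hom2 K Z (?T \<odot> Tot \<odot> P)"
    "Z \<in> hom1 K Y (carr X)"
    "\<And>i. i < n \<Longrightarrow> (?T \<rhd> Tot \<rhd> \<pi> i) \<bullet> h = (?T \<rhd> Tot \<rhd> \<pi> i) \<bullet> h'" for h h' Z
    using category.wide_pb_eqI[OF category_homcat w1, of Z h h'] that by simp
  have eb: "h = h'" if "h \<in> hom2 K Z (Bas \<odot> P)" "h' \<in> hom2 K Z (Bas \<odot> P)" "Z \<in> hom1 K Y (carr X)"
    "\<And>i. i < n \<Longrightarrow> (Bas \<rhd> \<pi> i) \<bullet> h = (Bas \<rhd> \<pi> i) \<bullet> h'" for h h' Z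
    using category.wide_pb_eqI[OF category_homcat b0, of Z h h'] that by simp
  let ?H' = "TT D \<odot> H"
  have nl: "(?T \<rhd> Tot \<rhd> \<pi> j) \<bullet> (l \<lhd> P) = (l \<lhd> ?H') \<bullet> (Tot \<rhd> \<pi> j)" if "j < n" for j
    using nat_eq[of l Tot "?T \<odot> Tot" "\<pi> j" P ?H'] that by simp
  have nl': "(?T \<rhd> Tot \<rhd> \<pi> j) \<bullet> (l \<lhd> P) \<bullet> x = (l \<lhd> ?H') \<bullet> (Tot \<rhd> \<pi> j) \<bullet> x"
    if "j < n" "x \<in> cells2 K" "cod2 K x = Tot \<odot> P" for j x
    by (rule vcomp_extend2[OF nl]) (use that in simp_all)
  have nq: "(Bas \<rhd> \<pi> j) \<bullet> (q \<lhd> P) = (q \<lhd> ?H') \<bullet> (Tot \<rhd> \<pi> j)" if "j < n" for j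
    using nat_eq[of q Tot Bas "\<pi> j" P ?H'] that by simp
  have nq': "(Bas \<rhd> \<pi> j) \<bullet> (q \<lhd> P) \<bullet> x = (q \<lhd> ?H') \<bullet> (Tot \<rhd> \<pi> j) \<bullet> x"
    if "j < n" "x \<in> cells2 K" "cod2 K x = Tot \<odot> P" for j x
    by (rule vcomp_extend2[OF nq]) (use that in simp_all)
  note e = vlc_eqsD[OF pre_conn_cells(8)[OF v']]
  have "vlc_eqs i P kP"
    unfolding vlc_eqs_def
  proof (intro conjI impI)
    assume i: "i \<ge> 1"
    show "kP \<bullet> (l \<lhd> P) = id2 K (Tot \<odot> P)"
    proof (rule e0[where Z = "Tot \<odot> P"])
      fix j assume j: "j < n"
      have "(Tot \<rhd> \<pi> j) \<bullet> kP \<bullet> (l \<lhd> P) = k' \<bullet> (l \<lhd> ?H') \<bullet> (Tot \<rhd> \<pi> j)" using j by (simp add: kP' nl)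
      also have "\<dots> = id2 K (Tot \<odot> ?H') \<bullet> (Tot \<rhd> \<pi> j)"
        by (rule vcomp_extend[OF e(1)[OF i]]) (use j in simp_all)
      finally show "(Tot \<rhd> \<pi> j) \<bullet> kP \<bullet> (l \<lhd> P) = (Tot \<rhd> \<pi> j) \<bullet> id2 K (Tot \<odot> P)" using j by simp
    qed simp_all
  next
    assume i: "i \<ge> 2"
    show "(q \<lhd> P) \<bullet> kP = (q \<lhd> P) \<bullet> (pp X \<lhd> (Tot \<odot> P))"
    proof (rule eb[where Z = "?T \<odot> Tot \<odot> P"])
      fix j assume j: "j < n"
      have p: "(Tot \<rhd> \<pi> j) \<bullet> (pp X \<lhd> (Tot \<odot> P)) = (pp X \<lhd> (Tot \<odot> ?H')) \<bullet> (?T \<rhd> Tot \<rhd> \<pi> j)"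
        using nat_eq[of "pp X" ?T "id1 K (carr X)" "Tot \<rhd> \<pi> j" "Tot \<odot> P" "Tot \<odot> ?H'"] j by simp
      have "(Bas \<rhd> \<pi> j) \<bullet> (q \<lhd> P) \<bullet> kP = (q \<lhd> ?H') \<bullet> k' \<bullet> (?T \<rhd> Tot \<rhd> \<pi> j)" using j
        by (simp add: kP nq')
      also have "\<dots> = (q \<lhd> ?H') \<bullet> (pp X \<lhd> (Tot \<odot> ?H')) \<bullet> (?T \<rhd> Tot \<rhd> \<pi> j)"
        by (rule vcomp_extend2[OF e(2)[OF i]]) (use j in simp_all)
      finally show "(Bas \<rhd> \<pi> j) \<bullet> (q \<lhd> P) \<bullet> kP = (Bas \<rhd> \<pi> j) \<bullet> (q \<lhd> P) \<bullet> (pp X \<lhd> (Tot \<odot> P))"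
        using j p by (simp add: nq')
    qed simp_all
  next
    assume i: "i \<ge> 3"
    show "(l \<lhd> P) \<bullet> kP = (?T \<rhd> kP) \<bullet> (ll X \<lhd> (Tot \<odot> P))"
    proof (rule e1[where Z = "?T \<odot> Tot \<odot> P"])
      fix j assume j: "j < n"
      have p: "(?T \<rhd> ?T \<rhd> Tot \<rhd> \<pi> j) \<bullet> (ll X \<lhd> (Tot \<odot> P)) = (ll X \<lhd> (Tot \<odot> ?H')) \<bullet> (?T \<rhd> Tot \<rhd> \<pi> j)"
        using nat_eq[of "ll X" ?T "?T \<odot> ?T" "Tot \<rhd> \<pi> j" "Tot \<odot> P" "Tot \<odot> ?H'"] j by simp
      have "(?T \<rhd> Tot \<rhd> \<pi> j) \<bullet> (l \<lhd> P) \<bullet> kP = (l \<lhd> ?H') \<bullet> k' \<bullet> (?T \<rhd> Tot \<rhd> \<pi> j)" using j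
        by (simp add: kP nl')
      also have "\<dots> = (?T \<rhd> k') \<bullet> (ll X \<lhd> (Tot \<odot> ?H')) \<bullet> (?T \<rhd> Tot \<rhd> \<pi> j)"
        by (rule vcomp_extend2[OF e(3)[OF i]]) (use j in simp_all)
      finally show "(?T \<rhd> Tot \<rhd> \<pi> j) \<bullet> (l \<lhd> P) \<bullet> kP = (?T \<rhd> Tot \<rhd> \<pi> j) \<bullet> (?T \<rhd> kP) \<bullet>
        (ll X \<lhd> (Tot \<odot> P))"
        using j p by (simp add: TkP')
    qed simp_all
  next
    assume i: "i \<ge> 4"
    show "(l \<lhd> P) \<bullet> kP = (?T \<rhd> kP) \<bullet> (cc X \<lhd> (Tot \<odot> P)) \<bullet> (?T \<rhd> (l \<lhd> P))"
    proof (rule e1[where Z = "?T \<odot> Tot \<odot> P"])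
      fix j assume j: "j < n"
      have p: "(?T \<rhd> ?T \<rhd> Tot \<rhd> \<pi> j) \<bullet> (cc X \<lhd> (Tot \<odot> P)) = (cc X \<lhd> (Tot \<odot> ?H')) \<bullet>
        (?T \<rhd> ?T \<rhd> Tot \<rhd> \<pi> j)"
        using nat_eq[of "cc X" "?T \<odot> ?T" "?T \<odot> ?T" "Tot \<rhd> \<pi> j" "Tot \<odot> P" "Tot \<odot> ?H'"] j by simp
      have p': "(?T \<rhd> ?T \<rhd> Tot \<rhd> \<pi> j) \<bullet> (cc X \<lhd> (Tot \<odot> P)) \<bullet> (?T \<rhd> (l \<lhd> P)) = (cc X \<lhd> (Tot \<odot> ?H')) \<bullet>
        (?T \<rhd> ?T \<rhd> Tot \<rhd> \<pi> j) \<bullet> (?T \<rhd> (l \<lhd> P))"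
        by (rule vcomp_extend2[OF p]) (use j in simp_all)
      have Tnl: "(?T \<rhd> ?T \<rhd> Tot \<rhd> \<pi> j) \<bullet> (?T \<rhd> (l \<lhd> P)) = (?T \<rhd> (l \<lhd> ?H')) \<bullet> (?T \<rhd> Tot \<rhd> \<pi> j)"
        using nl[OF j, THEN arg_cong, of "\<lambda>x. ?T \<rhd> x"] j by simp
      have "(?T \<rhd> Tot \<rhd> \<pi> j) \<bullet> (l \<lhd> P) \<bullet> kP = ((l \<lhd> ?H') \<bullet> k') \<bullet> (?T \<rhd> Tot \<rhd> \<pi> j)" using j
        by (simp add: kP nl')
      also have "\<dots> = ((?T \<rhd> k') \<bullet> (cc X \<lhd> (Tot \<odot> ?H')) \<bullet> (?T \<rhd> (l \<lhd> ?H'))) \<bullet> (?T \<rhd> Tot \<rhd> \<pi> j)"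
        by (subst e(4)[OF i]) simp
      finally show "(?T \<rhd> Tot \<rhd> \<pi> j) \<bullet> (l \<lhd> P) \<bullet> kP = (?T \<rhd> Tot \<rhd> \<pi> j) \<bullet> (?T \<rhd> kP) \<bullet>
        (cc X \<lhd> (Tot \<odot> P)) \<bullet> (?T \<rhd> (l \<lhd> P))"
        using j p' Tnl by (simp add: TkP')
    qed simp_all
  qed
  then have "pre_conn i Y P kP" unfolding pre_conn_def by simp
  then show ?thesis using that kP unfolding k'_def by simp
qed

end

text \<open>\<open>I\<close> represents pairs \<open>(H, k)\<close> that satisfy the first \<open>i\<close> equations of a connection. For
  \<open>i = 0\<close> this is the inserter, and each equifier increases \<open>i\<close> by one.\<close>

locale stage = bundle_data K X D Bas Tot q l
  for K :: "('x, 'm, 'c) twocat" (structure) and X D :: "('x, 'm, 'c) tstruct" and Bas Tot :: 'm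
    and q l :: 'c +
  fixes i :: nat and I :: 'x and V :: 'm and \<kappa> :: 'c
  assumes V_pre_conn: "pre_conn i I V \<kappa>"
    and unique_lift1: "pre_conn i Y H k \<Longrightarrow> \<exists>!J. J \<in> hom1 K Y I \<and> V \<odot> J = H \<and> \<kappa> \<lhd> J = k"
    and unique_lift2: "J \<in> hom1 K Y I \<Longrightarrow> J' \<in> hom1 K Y I \<Longrightarrow> \<sigma> \<in> hom2 K (V \<odot> J) (V \<odot> J') \<Longrightarrow>
      (Tot \<rhd> \<sigma>) \<bullet> (\<kappa> \<lhd> J) = (\<kappa> \<lhd> J') \<bullet> (TT X \<rhd> Tot \<rhd> \<sigma>) \<Longrightarrow> \<exists>!\<tau>. \<tau> \<in> hom2 K J J' \<and> V \<rhd> \<tau> = \<sigma>"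
begin

lemmas V_cells [simp] = pre_conn_cells(1-7)[OF V_pre_conn]

text \<open>Any 2-cell \<open>V \<tau>\<close> commutes with \<open>\<kappa>\<close>, by naturality, so uniqueness in the two-dimensional
  universal property applies.\<close>

lemma faithful:
  assumes "J \<in> hom1 K Y I" "\<tau> \<in> hom2 K J J'" "\<tau>' \<in> hom2 K J J'" "V \<rhd> \<tau> = V \<rhd> \<tau>'"
  shows "\<tau> = \<tau>'"
proof -
  note [simp] = assms(1-3)[simplified]
  have J': "J' \<in> hom1 K Y I" using cells1_cod2[of \<tau>] dom1_cod2[of \<tau>] cod1_cod2[of \<tau>] by simp
  note [simp] = J'[simplified]
  have "(Tot \<rhd> V \<rhd> \<tau>) \<bullet> (\<kappa> \<lhd> J) = (\<kappa> \<lhd> J') \<bullet> (TT X \<rhd> Tot \<rhd> V \<rhd> \<tau>)"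
    using nat_eq[of \<kappa> "TT X \<odot> Tot \<odot> V" "Tot \<odot> V" \<tau> J J'] by simp
  then have "\<exists>!\<tau>''. \<tau>'' \<in> hom2 K J J' \<and> V \<rhd> \<tau>'' = V \<rhd> \<tau>"
    by (intro unique_lift2[OF assms(1) J']) simp_all
  then show ?thesis using assms by metis
qed

lemma lift2:
  assumes "J \<in> hom1 K Y I" "J' \<in> hom1 K Y I" "\<sigma> \<in> hom2 K (V \<odot> J) (V \<odot> J')"
    "(Tot \<rhd> \<sigma>) \<bullet> (\<kappa> \<lhd> J) = (\<kappa> \<lhd> J') \<bullet> (TT X \<rhd> Tot \<rhd> \<sigma>)"
  obtains \<tau> where "\<tau> \<in> hom2 K J J'" "V \<rhd> \<tau> = \<sigma>"
  using unique_lift2[OF assms] by metis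

text \<open>The map induced after \<open>V\<close> lifts to \<open>I\<close> if it commutes with \<open>\<kappa>\<close>. This is an equation between
  2-cells into \<open>Tot V P\<close>, which is tested on the legs by the second limit.\<close>

lemma reflect_wide_pb:
  assumes A: "\<And>j. j < n \<Longrightarrow> A j \<in> hom1 K Y I" "B \<in> hom1 K Y I" "P \<in> hom1 K Y I"
    and f: "\<And>j. j < n \<Longrightarrow> f j \<in> hom2 K (A j) B" "\<And>j. j < n \<Longrightarrow> p j \<in> hom2 K P (A j)"
    and WD: "wide_pb (homcat Y (carr D)) n (\<lambda>j. V \<odot> A j) (V \<odot> B) (\<lambda>j. V \<rhd> f j) (V \<odot> P)
      (\<lambda>j. V \<rhd> p j)"
    and WX: "wide_pb (homcat Y (carr X)) n (\<lambda>j. Tot \<odot> V \<odot> A j) (Tot \<odot> V \<odot> B) (\<lambda>j. Tot \<rhd> V \<rhd> f j)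
      (Tot \<odot> V \<odot> P) (\<lambda>j. Tot \<rhd> V \<rhd> p j)"
  shows "wide_pb (homcat Y I) n A B f P p"
proof -
  have [simp]: "\<And>j. j < n \<Longrightarrow> A j \<in> cells1 K" "\<And>j. j < n \<Longrightarrow> dom1 K (A j) = Y"
    "\<And>j. j < n \<Longrightarrow> cod1 K (A j) = I"
    "\<And>j. j < n \<Longrightarrow> f j \<in> cells2 K" "\<And>j. j < n \<Longrightarrow> dom2 K (f j) = A j" "\<And>j. j < n \<Longrightarrow> cod2 K (f j) = B"
    "\<And>j. j < n \<Longrightarrow> p j \<in> cells2 K" "\<And>j. j < n \<Longrightarrow> dom2 K (p j) = P" "\<And>j. j < n \<Longrightarrow> cod2 K (p j) = A j"
    using A(1) f by simp_all
  note [simp] = A(2,3)[simplified]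
  have comp: "f j \<bullet> p j = f m \<bullet> p m" if "j < n" "m < n" for j m
    by (rule faithful[of P Y _ B]) (use that wide_pbD(7)[OF WD that] in simp_all)
  show ?thesis
  proof (rule wide_pbI)
    show "wide_cone (homcat Y I) n A f P p"
      by (rule wide_coneI, simp, simp, simp only: homcat_sel, erule (1) comp)
    fix Z a assume c: "wide_cone (homcat Y I) n A f Z a"
    have Z: "Z \<in> hom1 K Y I" using wide_coneD(1)[OF c] by simp
    note [simp] = Z[simplified]
    have [simp]: "a j \<in> cells2 K" "dom2 K (a j) = Z" "cod2 K (a j) = A j" if "j < n" for j
      using wide_coneD(2)[OF c that] by simp_all
    have ca: "(V \<rhd> f j) \<bullet> (V \<rhd> a j) = (V \<rhd> f m) \<bullet> (V \<rhd> a m)" if "j < n" "m < n" for j m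
      using wide_coneD(3)[OF c that, THEN arg_cong, of "\<lambda>x. V \<rhd> x"] that by simp
    have "wide_cone (homcat Y (carr D)) n (\<lambda>j. V \<odot> A j) (\<lambda>j. V \<rhd> f j) (V \<odot> Z) (\<lambda>j. V \<rhd> a j)"
      by (rule wide_coneI, simp, simp, simp only: homcat_sel, erule (1) ca)
    from wide_pb_ex1[OF WD this] obtain h where "h \<in> hom2 K (V \<odot> Z) (V \<odot> P)"
      and h: "\<And>j. j < n \<Longrightarrow> (V \<rhd> p j) \<bullet> h = V \<rhd> a j" by (auto simp del: in_hom2)
    then have [simp]: "h \<in> cells2 K" "dom2 K h = V \<odot> Z" "cod2 K h = V \<odot> P" by simp_all
    have "(Tot \<rhd> h) \<bullet> (\<kappa> \<lhd> Z) = (\<kappa> \<lhd> P) \<bullet> (TT X \<rhd> Tot \<rhd> h)"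
    proof (rule category.wide_pb_eqI[OF category_homcat WX, of "TT X \<odot> Tot \<odot> V \<odot> Z"])
      fix j assume j: "j < n"
      have 1: "(Tot \<rhd> V \<rhd> p j) \<bullet> (Tot \<rhd> h) = Tot \<rhd> V \<rhd> a j"
        using h[OF j, THEN arg_cong, of "\<lambda>x. Tot \<rhd> x"] j by simp
      have 2: "(TT X \<rhd> Tot \<rhd> V \<rhd> p j) \<bullet> (TT X \<rhd> Tot \<rhd> h) = TT X \<rhd> Tot \<rhd> V \<rhd> a j"
        using 1[THEN arg_cong, of "\<lambda>x. TT X \<rhd> x"] j by simp
      have n: "(Tot \<rhd> V \<rhd> x) \<bullet> (\<kappa> \<lhd> F) = (\<kappa> \<lhd> A j) \<bullet> (TT X \<rhd> Tot \<rhd> V \<rhd> x)"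
        if "x \<in> cells2 K" "dom2 K x = F" "cod2 K x = A j" "cod1 K F = I" for x F
        using nat_eq[of \<kappa> "TT X \<odot> Tot \<odot> V" "Tot \<odot> V" x F "A j"] that j cells1_dom2[of x]
          cells1_cod2[of x] by simp
      have "(Tot \<rhd> V \<rhd> p j) \<bullet> (Tot \<rhd> h) \<bullet> (\<kappa> \<lhd> Z) = (Tot \<rhd> V \<rhd> a j) \<bullet> (\<kappa> \<lhd> Z)"
        by (rule vcomp_extend[OF 1]) (use j in simp_all)
      also have "\<dots> = (\<kappa> \<lhd> A j) \<bullet> (TT X \<rhd> Tot \<rhd> V \<rhd> p j) \<bullet> (TT X \<rhd> Tot \<rhd> h)"
        using n[of "a j" Z] j 2 by simp
      also have "\<dots> = (Tot \<rhd> V \<rhd> p j) \<bullet> (\<kappa> \<lhd> P) \<bullet> (TT X \<rhd> Tot \<rhd> h)"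
        by (rule vcomp_extend2[OF n[of "p j" P, symmetric]]) (use j in simp_all)
      finally show "(Tot \<rhd> V \<rhd> p j) \<cdot>\<^bsub>homcat Y (carr X)\<^esub> ((Tot \<rhd> h) \<bullet> (\<kappa> \<lhd> Z)) =
        (Tot \<rhd> V \<rhd> p j) \<cdot>\<^bsub>homcat Y (carr X)\<^esub> ((\<kappa> \<lhd> P) \<bullet> (TT X \<rhd> Tot \<rhd> h))" by simp
    qed simp_all
    then obtain \<tau> where \<tau>: "\<tau> \<in> hom2 K Z P" "V \<rhd> \<tau> = h" by (rule lift2[OF Z A(3), rotated]) simp_all
    note [simp] = \<tau>(1)[simplified]
    show "\<exists>!h. h \<in> hom (homcat Y I) Z P \<and> (\<forall>i<n. p i \<cdot>\<^bsub>homcat Y I\<^esub> h = a i)"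
    proof (rule ex1I[of _ \<tau>], intro conjI allI impI)
      show "p j \<cdot>\<^bsub>homcat Y I\<^esub> \<tau> = a j" if "j < n" for j
        using that \<tau>(2) h[OF that] by - (rule faithful[of Z Y _ "A j"], simp_all)
    next
      fix \<tau>' assume t: "\<tau>' \<in> hom (homcat Y I) Z P \<and> (\<forall>i<n. p i \<cdot>\<^bsub>homcat Y I\<^esub> \<tau>' = a i)"
      have [simp]: "\<tau>' \<in> cells2 K" "dom2 K \<tau>' = Z" "cod2 K \<tau>' = P" using t by simp_all
      have tj: "p j \<bullet> \<tau>' = a j" if "j < n" for j using t that by simp
      show "\<tau>' = \<tau>"
      proof (rule faithful[of Z Y _ P])
        show "V \<rhd> \<tau>' = V \<rhd> \<tau>"
          unfolding \<tau>(2)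
        proof (rule category.wide_pb_eqI[OF category_homcat WD, of "V \<odot> Z"])
          show "(V \<rhd> p j) \<cdot>\<^bsub>homcat Y (carr D)\<^esub> (V \<rhd> \<tau>') = (V \<rhd> p j) \<cdot>\<^bsub>homcat Y (carr D)\<^esub> h"
            if "j < n" for j
            using h[OF that] tj[OF that, THEN arg_cong, of "\<lambda>x. V \<rhd> x"] that by simp
        qed simp_all
      qed simp_all
    qed (use \<tau> in simp)
  qed (use wide_pbD(3)[OF WD] in simp_all)
qed

end

section \<open>Creation of a tangent structure\<close>

context bundle_data
begin

text \<open>The last equation says that \<open>\<kappa>\<close> is a tangent 2-cell. Together with strictness of \<open>V\<close>, it
  determines the 1-cell \<open>T\<close>.\<close>

definition induced :: "'x \<Rightarrow> 'm \<Rightarrow> 'c \<Rightarrow> ('x, 'm, 'c) tstruct \<Rightarrow> bool" where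
  "induced I V \<kappa> Z \<longleftrightarrow> tang_data Z \<and> carr Z = I \<and> strict Z D V \<and> \<kappa> \<lhd> TT Z = (TT X \<rhd> \<kappa>) \<bullet>
    (cc X \<lhd> (Tot \<odot> V))"

end

context stage
begin

text \<open>The part of an induced tangent structure that determines the pullbacks \<open>T\<^sub>n\<close>. It makes no
  reference to the addition, whose domain can only be chosen once these pullbacks exist.\<close>

definition lifts_T :: "('x, 'm, 'c) tstruct \<Rightarrow> bool" where
  "lifts_T Z \<longleftrightarrow> carr Z = I \<and> TT Z \<in> hom1 K I I \<and> pp Z \<in> hom2 K (TT Z) (id1 K I) \<and> V \<odot> TT Z
    = TT D \<odot> V \<and>
     V \<rhd> pp Z = pp D \<lhd> V \<and> \<kappa> \<lhd> TT Z = (TT X \<rhd> \<kappa>) \<bullet> (cc X \<lhd> (Tot \<odot> V))"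

text \<open>The connection on \<open>P\<close> classifies a 1-cell \<open>J\<close>, the legs lift because they commute with the
  connections, and the lifted cone is a limit by reflection.\<close>

lemma lift_Tn:
  assumes S: "lifts_T Z" and T: "Tn_at D I V n P \<pi>"
  obtains J \<rho> where "Tn_at Z I (id1 K I) n J \<rho>" "V \<odot> J = P" "\<And>j. j < n \<Longrightarrow> V \<rhd> \<rho> j = \<pi> j"
proof -
  have [simp]: "carr Z = I" "TT Z \<in> cells1 K" "dom1 K (TT Z) = I" "cod1 K (TT Z) = I"
    "pp Z \<in> cells2 K" "dom2 K (pp Z) = TT Z" "cod2 K (pp Z) = id1 K I"
      and VT [simp]: "V \<odot> TT Z = TT D \<odot> V" and
    Vp: "V \<rhd> pp Z = pp D \<lhd> V" and \<kappa>T: "\<kappa> \<lhd> TT Z = (TT X \<rhd> \<kappa>) \<bullet> (cc X \<lhd> (Tot \<odot> V))"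
    using S unfolding lifts_T_def by simp_all
  have VTG [simp]: "V \<odot> TT Z \<odot> G = TT D \<odot> V \<odot> G" if "G \<in> cells1 K" "cod1 K G = I" for G
    using that comp1_assoc'[of G "TT Z" V] comp1_assoc'[of G V "TT D"] by simp
  have VTp [simp]: "V \<rhd> TT Z \<rhd> \<phi> = TT D \<rhd> V \<rhd> \<phi>" if "\<phi> \<in> cells2 K" "cod1 K (dom2 K \<phi>) = I" for \<phi>
    using that whl_comp[of "TT Z" V \<phi>] whl_comp[of V "TT D" \<phi>] by simp
  have VpG [simp]: "V \<rhd> (pp Z \<lhd> G) = pp D \<lhd> (V \<odot> G)" if "G \<in> cells1 K" "cod1 K G = I" for G
    using that Vp[THEN arg_cong, of "\<lambda>x. x \<lhd> G"] by simp
  note [simp] = Vp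
  have [simp]: "Tpow Z m \<in> cells1 K" "dom1 K (Tpow Z m) = I" "cod1 K (Tpow Z m) = I" for m
    using cells1_Tpow[of Z m] by simp_all
  have Vpow [simp]: "V \<odot> Tpow Z m \<odot> G = Tpow D m \<odot> V \<odot> G" if "G \<in> cells1 K" "cod1 K G = I" for G m
    using that by (induction m) simp_all
  have Vpow2 [simp]: "V \<rhd> Tpow Z m \<rhd> \<phi> = Tpow D m \<rhd> V \<rhd> \<phi>" if "\<phi> \<in> cells2 K" "cod1 K (dom2 K \<phi>) = I"
    for \<phi> m
    using that by (induction m) simp_all
  obtain kP where v: "pre_conn i I P kP"
    and kP: "\<And>j. j < n \<Longrightarrow> (Tot \<rhd> \<pi> j) \<bullet> kP = (TT X \<rhd> \<kappa>) \<bullet> (cc X \<lhd> (Tot \<odot> V)) \<bullet> (TT X \<rhd> Tot \<rhd> \<pi> j)"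
    using pre_conn_Tn[OF V_pre_conn T] by metis
  obtain J where J: "J \<in> hom1 K I I" "V \<odot> J = P" "\<kappa> \<lhd> J = kP" using unique_lift1[OF v] by metis
  note [simp] = J(1)[simplified] pre_conn_cells(1-7)[OF v] Tn_at_cells[OF T]
  have "\<exists>\<rho>. \<rho> \<in> hom2 K J (TT Z) \<and> V \<rhd> \<rho> = \<pi> j" if j: "j < n" for j
  proof -
    have "(Tot \<rhd> \<pi> j) \<bullet> (\<kappa> \<lhd> J) = (\<kappa> \<lhd> TT Z) \<bullet> (TT X \<rhd> Tot \<rhd> \<pi> j)"
      unfolding J(3) \<kappa>T using j kP[OF j] by simp
    then show ?thesis by (rule lift2[of J I "TT Z" "\<pi> j", rotated 3]) (use j J in auto)
  qed
  then obtain \<rho> where \<rho>: "\<And>j. j < n \<Longrightarrow> \<rho> j \<in> hom2 K J (TT Z)" "\<And>j. j < n \<Longrightarrow> V \<rhd> \<rho> j = \<pi> j" by metis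
  have [simp]: "\<rho> j \<in> cells2 K" "dom2 K (\<rho> j) = J" "cod2 K (\<rho> j) = TT Z" if "j < n" for j
    using \<rho>(1)[OF that] by simp_all
  have "Tn_at Z I (id1 K I) n J \<rho>"
    unfolding Tn_at_def
  proof (intro conjI allI ballI)
    fix m Y G assume Y: "Y \<in> cells0 K" and G: "G \<in> hom1 K Y I"
    note [simp] = Y G[simplified]
    have VJG: "V \<odot> J \<odot> G = P \<odot> G" using comp1_assoc'[of G J V] J(2) by simp
    have V\<rho>: "V \<rhd> (\<rho> j \<lhd> G) = \<pi> j \<lhd> G" if "j < n" for j
      using \<rho>(2)[OF that, THEN arg_cong, of "\<lambda>x. x \<lhd> G"] that by simp
    have TX: "Tn_at X I (Tot \<odot> V) n (Tot \<odot> P) (\<lambda>j. Tot \<rhd> \<pi> j)"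
      by (rule pres_Tn_at[OF Tot data(2,1) T])
    note sp = strict_Tpow[OF stTot data(2,1)]
    have WD: "wide_pb (homcat Y (carr D)) n (\<lambda>j. V \<odot> Tpow Z m \<odot> TT Z \<odot> G) (V \<odot> Tpow Z m \<odot> G)
       (\<lambda>j. V \<rhd> Tpow Z m \<rhd> (pp Z \<lhd> G)) (V \<odot> Tpow Z m \<odot> J \<odot> G) (\<lambda>j. V \<rhd> Tpow Z m \<rhd> (\<rho> j \<lhd> G))"
      using Tn_at_wide_pb[OF T, of Y G m] by (simp add: VJG) (erule wide_pb_transport; simp add: V\<rho>)
    have WX: "wide_pb (homcat Y (carr X)) n (\<lambda>j. Tot \<odot> V \<odot> Tpow Z m \<odot> TT Z \<odot> G)
      (Tot \<odot> V \<odot> Tpow Z m \<odot> G)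
       (\<lambda>j. Tot \<rhd> V \<rhd> Tpow Z m \<rhd> (pp Z \<lhd> G)) (Tot \<odot> V \<odot> Tpow Z m \<odot> J \<odot> G) (\<lambda>j. Tot \<rhd> V \<rhd> Tpow Z m \<rhd>
         (\<rho> j \<lhd> G))"
      using Tn_at_wide_pb[OF TX, of Y G m]
        by (simp add: VJG sp) (erule wide_pb_transport; simp add: V\<rho> sp)
    have "wide_pb (homcat Y I) n (\<lambda>j. Tpow Z m \<odot> TT Z \<odot> G) (Tpow Z m \<odot> G)
       (\<lambda>j. Tpow Z m \<rhd> (pp Z \<lhd> G)) (Tpow Z m \<odot> J \<odot> G) (\<lambda>j. Tpow Z m \<rhd> (\<rho> j \<lhd> G))"
      by (rule reflect_wide_pb[OF _ _ _ _ _ WD WX]) simp_all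
    then show "wide_pb (homcat Y (carr Z)) n (\<lambda>_. Tpow Z m \<odot> TT Z \<odot> id1 K I \<odot> G)
      (Tpow Z m \<odot> id1 K I \<odot> G)
          (\<lambda>_. Tpow Z m \<rhd> pp Z \<lhd> (id1 K I \<odot> G)) (Tpow Z m \<odot> J \<odot> G) (\<lambda>i. Tpow Z m \<rhd> \<rho> i \<lhd> G)" by simp
  qed simp_all
  then show ?thesis using that J(2) \<rho>(2) by blast
qed

lemma induced_lifts_T: "induced I V \<kappa> Z \<Longrightarrow> lifts_T Z"
  unfolding induced_def lifts_T_def using strictD[of Z D V] tang_data_cells[of Z] by auto

text \<open>Some pullback of \<open>p\<close> is a lift of one in \<open>D\<close>, and all others are isomorphic to it.\<close>

lemma induced_pres_Tn:
  assumes C: "induced I V \<kappa> Z"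
  shows "pres_Tn Z D V"
  unfolding pres_Tn_def
proof (intro conjI allI impI)
  have Z: "tang_data Z" and c [simp]: "carr Z = I" and st: "strict Z D V" using C
    unfolding induced_def by blast+
  show "strict Z D V" by (rule st)
  fix n P \<pi> assume T: "Tn_at Z (carr Z) (id1 K (carr Z)) n P \<pi>"
  note [simp] = Z strictD(1-4)[OF st Z data(2)] Tn_at_cells(5-9)[OF T]
  have [simp]: "cod2 K (\<pi> i) = TT Z" if "i < n" for i using Tn_at_cells(10)[OF T that] by simp
  obtain P0 \<pi>0 where "Tn_at D (carr D) (id1 K (carr D)) n P0 \<pi>0"
    using has_Tn_Tn_at[OF data(2) Tn_at_ge1[OF T]] .
  from Tn_at_whr[OF data(2) this, of V I] have T0: "Tn_at D I V n (P0 \<odot> V) (\<lambda>i. \<pi>0 i \<lhd> V)" by simp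
  obtain J \<rho> where J: "Tn_at Z I (id1 K I) n J \<rho>" "V \<odot> J = P0 \<odot> V" "\<And>j. j < n \<Longrightarrow> V \<rhd> \<rho> j = \<pi>0 j \<lhd> V"
    using lift_Tn[OF induced_lifts_T[OF C] T0] by metis
  obtain e e' where e: "e \<in> hom2 K P J" "e' \<in> hom2 K J P" "e \<bullet> e' = id2 K J" "e' \<bullet> e = id2 K P"
    "\<And>i. i < n \<Longrightarrow> \<rho> i \<bullet> e = \<pi> i"
    using Tn_at_unique[OF Z J(1) T[unfolded c]] by metis
  note [simp] = e(1,2)[simplified] Tn_at_cells(5-9)[OF J(1)]
  have [simp]: "cod2 K (\<rho> i) = TT Z" if "i < n" for i using Tn_at_cells(10)[OF J(1) that] by simp
  show "Tn_at D (carr Z) V n (V \<odot> P) (\<lambda>i. V \<rhd> \<pi> i)"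
    unfolding c
  proof (rule Tn_at_iso[OF data(2) T0, where e = "V \<rhd> e" and e' = "V \<rhd> e'"])
    show "(V \<rhd> e) \<bullet> (V \<rhd> e') = id2 K (P0 \<odot> V)" using e(3)[THEN arg_cong, of "\<lambda>x. V \<rhd> x"] J(2)
      by simp
    show "(V \<rhd> e') \<bullet> (V \<rhd> e) = id2 K (V \<odot> P)" using e(4)[THEN arg_cong, of "\<lambda>x. V \<rhd> x"] by simp
    show "(\<pi>0 i \<lhd> V) \<bullet> (V \<rhd> e) = V \<rhd> \<pi> i" if "i < n" for i
      using e(5)[OF that, THEN arg_cong, of "\<lambda>x. V \<rhd> x"] J(3)[OF that] that by simp
  qed (simp_all add: J(2))
qed

lemma induced_pres_Tn_Tot:
  assumes C: "induced I V \<kappa> Z"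
  shows "pres_Tn Z X (Tot \<odot> V)" "pres_Tn Z X (Bas \<odot> V)"
  using pres_Tn_comp[OF Tot induced_pres_Tn[OF C]] pres_Tn_comp[OF Bas induced_pres_Tn[OF C]] C
    unfolding induced_def by simp_all

lemma induced_faithful:
  assumes C: "induced I V \<kappa> Z" and \<tau>: "\<tau> \<in> cells2 K" "\<tau>' \<in> cells2 K" "dom2 K \<tau> = dom2 K \<tau>'"
    "cod2 K \<tau> = cod2 K \<tau>'"
    "cod1 K (dom2 K \<tau>) = I" "V \<rhd> \<tau> = V \<rhd> \<tau>'"
  shows "\<tau> = \<tau>'"
  by (rule faithful[of "dom2 K \<tau>" "dom1 K (dom2 K \<tau>)" \<tau> "cod2 K \<tau>"]) (use assms in auto)

text \<open>Equations are tested after the faithful and strict \<open>V\<close>, where they become axioms of \<open>D\<close> at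
  \<open>V\<close>. The universality square is reflected, since \<open>V\<close> and \<open>Tot V\<close> map it to such squares of \<open>D\<close>
  and \<open>X\<close>.\<close>

lemma induced_tangentad:
  assumes C: "induced I V \<kappa> Z"
  shows "tangentad Z"
proof -
  have Z [simp]: "tang_data Z" and c [simp]: "carr Z = I" and st: "strict Z D V" using C
    unfolding induced_def by blast+
  note sD = strictD[OF st Z data(2)]
  note [simp] = sD
  let ?T = "TT Z" and ?I = "id1 K I"
  have I0: "dom1 K (TT Z) = I" "cod1 K (TT Z) = I" "pp Z \<in> cells2 K" "cod2 K (pp Z) = id1 K I"
    using tang_data_cells[OF Z] by simp_all
  note [simp] = I0 tang_data_cells[OF Z, unfolded c] T2_cells[OF Z, unfolded c]
  note f = induced_faithful[OF C]
  note d = tangentadD[OF D]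
  have dV: "x \<lhd> V = y \<lhd> V" if "x = y" for x y using that by simp
  have s: "V \<rhd> ss Z = tsum D V (V \<rhd> \<pi>1 Z) (V \<rhd> \<pi>2 Z)" using st
    unfolding strict_iff[OF Z data(2)] by blast
  have add: "addable D (V \<odot> F) (V \<rhd> a) (V \<rhd> b)" "V \<rhd> tsum Z F a b = tsum D (V \<odot> F) (V \<rhd> a) (V \<rhd> b)"
    if "addable Z F a b" for F a b
    using strict_tsum[OF st Z data(2) that] .
  have addI: "addable Z ?I a b \<longleftrightarrow> a \<in> cells2 K \<and> b \<in> cells2 K \<and> dom2 K b = dom2 K a \<and> cod2 K a = TT Z
    \<and> cod2 K b = TT Z \<and> pp Z \<bullet> a = pp Z \<bullet> b" for a b
    unfolding addable_def by auto
  have ad12: "addable Z ?I (\<pi>1 Z) (\<pi>2 Z)" using addable_T2[OF Z, of ?I] by simp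
  have pz: "pp Z \<bullet> zz Z = id2 K ?I"
  proof (rule f)
    have "pp D \<bullet> zz D = id2 K (id1 K (carr D))" using D
      unfolding tangentad_iff tang_monoid_def Let_def by blast
    from dV[OF this] show "V \<rhd> (pp Z \<bullet> zz Z) = V \<rhd> id2 K ?I" by simp
  qed simp_all
  have psum: "pp Z \<bullet> ss Z = pp Z \<bullet> \<pi>1 Z"
  proof (rule f)
    show "V \<rhd> (pp Z \<bullet> ss Z) = V \<rhd> (pp Z \<bullet> \<pi>1 Z)"
      using p_tsum[OF D, of V "V \<rhd> \<pi>1 Z" "V \<rhd> \<pi>2 Z"] add(1)[OF ad12] s by simp
  qed simp_all
  have pt: "pp Z \<bullet> tsum Z ?I a b = pp Z \<bullet> a" if "addable Z ?I a b" for a b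
    using p_tsum0[OF Z psum that] by (simp add: addableD[OF that])
  have zero: "tsum Z ?I (zz Z \<bullet> pp Z \<bullet> a) a = a" if "a \<in> cells2 K" "cod2 K a = TT Z" for a
  proof -
    have "pp Z \<bullet> zz Z \<bullet> pp Z \<bullet> a = pp Z \<bullet> a" using vcomp_extend[OF pz, of "pp Z \<bullet> a"] that by simp
    then have ad: "addable Z ?I (zz Z \<bullet> pp Z \<bullet> a) a" unfolding addI using that by simp
    note [simp] = that cod1_dom2[OF that] tsum_cells[OF Z ad]
    show ?thesis
      by (rule f) (use add[OF ad] tsum_zero[OF D, of V "V \<rhd> a"] in simp_all)
  qed
  have comm: "tsum Z ?I a b = tsum Z ?I b a" if ad: "addable Z ?I a b" for a b
  proof -
    have ad2: "addable Z ?I b a" using ad unfolding addI by simp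
    note [simp] = tsum_cells[OF Z ad] tsum_cells[OF Z ad2] cod1_dom2[OF addableD(3,6)[OF ad]]
      addableD(3-5)[OF ad]
    show ?thesis
      by (rule f) (use add[OF ad] add(2)[OF ad2] tsum_commute[OF D add(1)[OF ad]] in simp_all)
  qed
  have assoc: "tsum Z ?I (tsum Z ?I a b) c = tsum Z ?I a (tsum Z ?I b c)"
    if ad: "addable Z ?I a b" "addable Z ?I b c" for a b c
  proof -
    note [simp] = tsum_cells[OF Z ad(1)] tsum_cells[OF Z ad(2)]
      cod1_dom2[OF addableD(3,6)[OF ad(1)]] addableD(3-5)[OF ad(1)] addableD(3-5)[OF ad(2)]
    have ad2: "addable Z ?I (tsum Z ?I a b) c" "addable Z ?I a (tsum Z ?I b c)"
      unfolding addI using ad[unfolded addI] pt[OF ad(1)] pt[OF ad(2)] by simp_all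
    note [simp] = tsum_cells[OF Z ad2(1)] tsum_cells[OF Z ad2(2)]
    show ?thesis
      by (rule f) (use add(2)[OF ad(1)] add(2)[OF ad(2)] add(2)[OF ad2(1)] add(2)[OF ad2(2)]
         tsum_assoc[OF D add(1)[OF ad(1)] add(1)[OF ad(2)]] in simp_all)
  qed
  have monoid: "tang_monoid Z"
    unfolding tang_monoid_def Let_def c
    using pz psum zero comm assoc by (auto simp: addI)
  have l1: "(?T \<rhd> pp Z) \<bullet> ll Z = zz Z \<bullet> pp Z" by (rule f) (use dV[OF d(1)] in simp_all)
  have l2: "ll Z \<bullet> zz Z = (?T \<rhd> zz Z) \<bullet> zz Z" by (rule f) (use dV[OF d(2)] in simp_all)
  have c1: "(pp Z \<lhd> ?T) \<bullet> cc Z = ?T \<rhd> pp Z" by (rule f) (use dV[OF d(4)] in simp_all)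
  have c2: "cc Z \<bullet> (?T \<rhd> zz Z) = zz Z \<lhd> ?T" by (rule f) (use dV[OF d(5)] in simp_all)
  have l4: "(?T \<rhd> ll Z) \<bullet> ll Z = (ll Z \<lhd> ?T) \<bullet> ll Z" by (rule f) (use dV[OF d(7)] in simp_all)
  have c3: "cc Z \<bullet> ll Z = ll Z" by (rule f) (use dV[OF d(8)] in simp_all)
  have lc: "(cc Z \<lhd> ?T) \<bullet> (?T \<rhd> cc Z) \<bullet> (ll Z \<lhd> ?T) = (?T \<rhd> ll Z) \<bullet> cc Z"
    by (rule f) (use dV[OF d(9)] in simp_all)
  have c4: "cc Z \<bullet> cc Z = id2 K (?T \<odot> ?T)" by (rule f) (use dV[OF d(10)] in simp_all)
  have yb: "(?T \<rhd> cc Z) \<bullet> (cc Z \<lhd> ?T) \<bullet> (?T \<rhd> cc Z) = (cc Z \<lhd> ?T) \<bullet> (?T \<rhd> cc Z) \<bullet> (cc Z \<lhd> ?T)"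
    by (rule f) (use dV[OF d(11)] in simp_all)
  have pc: "(pp Z \<lhd> ?T) \<bullet> cc Z \<bullet> x = (?T \<rhd> pp Z) \<bullet> x" if "x \<in> cells2 K" "cod2 K x = ?T \<odot> ?T" for x
    by (rule vcomp_extend[OF c1]) (use that in simp_all)
  have adc: "addable Z ?T (cc Z \<bullet> (?T \<rhd> \<pi>1 Z)) (cc Z \<bullet> (?T \<rhd> \<pi>2 Z))"
    unfolding addable_def using arg_cong[OF p_pi[OF Z], of "\<lambda>x. ?T \<rhd> x"] by (simp add: pc)
  have plT: "(pp Z \<lhd> ?T) \<bullet> ll Z = zz Z \<bullet> pp Z" using pc[of "ll Z"] c3 l1 by simp
  have "(pp Z \<lhd> ?T) \<bullet> ll Z \<bullet> x = zz Z \<bullet> pp Z \<bullet> x" if "x \<in> cells2 K" "cod2 K x = ?T" for x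
    by (rule vcomp_extend2[OF plT]) (use that in simp_all)
  then have adl: "addable Z ?T (ll Z \<bullet> \<pi>1 Z) (ll Z \<bullet> \<pi>2 Z)"
    unfolding addable_def using p_pi[OF Z] by simp
  have aVV: "addable D V (V \<rhd> \<pi>1 Z) (V \<rhd> \<pi>2 Z)" using add(1)[OF ad12] by simp
  obtain h where h: "h \<in> cells2 K" "dom2 K h = V \<odot> T2 Z" "cod2 K h = T2 D \<odot> V"
    "(\<pi>1 D \<lhd> V) \<bullet> h = V \<rhd> \<pi>1 Z" "(\<pi>2 D \<lhd> V) \<bullet> h = V \<rhd> \<pi>2 Z"
      using addable_obtain[OF data(2) aVV] by auto
  note [simp] = h(1-3)
  have sh: "V \<rhd> ss Z = (ss D \<lhd> V) \<bullet> h" using tsum_pi[OF data(2), of V h] s by (simp add: h(4,5))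
  have adD: "addable D (TT D) (ll D \<bullet> \<pi>1 D) (ll D \<bullet> \<pi>2 D)"
  proof -
    have "(pp D \<lhd> TT D) \<bullet> cc D \<bullet> ll D = (TT D \<rhd> pp D) \<bullet> ll D"
      by (rule vcomp_extend[OF d(4)]) simp_all
    then have e: "(pp D \<lhd> TT D) \<bullet> ll D = zz D \<bullet> pp D" using d(8) d(1) by simp
    have "(pp D \<lhd> TT D) \<bullet> ll D \<bullet> x = zz D \<bullet> pp D \<bullet> x" if "x \<in> cells2 K" "cod2 K x = TT D" for x
      by (rule vcomp_extend2[OF e]) (use that in simp_all)
    then show ?thesis unfolding addable_def using p_pi[OF data(2)] by simp
  qed
  have adcD: "addable D (TT D) (cc D \<bullet> (TT D \<rhd> \<pi>1 D)) (cc D \<bullet> (TT D \<rhd> \<pi>2 D))"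
  proof -
    have "(pp D \<lhd> TT D) \<bullet> cc D \<bullet> x = (TT D \<rhd> pp D) \<bullet> x" if "x \<in> cells2 K" "cod2 K x = TT D \<odot> TT D"
      for x
      by (rule vcomp_extend[OF d(4)]) (use that in simp_all)
    then show ?thesis unfolding addable_def using arg_cong[OF p_pi[OF data(2)], of "\<lambda>x. TT D \<rhd> x"]
      by simp
  qed
  \<comment> \<open>Evaluating the axiom of \<open>D\<close> on the map \<open>h\<close> into \<open>T\<^sub>2 V\<close> turns \<open>s\<^sub>V\<close> into the image of the
    addition of \<open>Z\<close>.\<close>
  have ls: "ll Z \<bullet> ss Z = cc Z \<bullet> tsum Z ?T (ll Z \<bullet> \<pi>1 Z) (ll Z \<bullet> \<pi>2 Z)"
  proof (rule f)
    have "(ll D \<lhd> V) \<bullet> (ss D \<lhd> V) = (cc D \<lhd> V) \<bullet> tsum D (TT D \<odot> V) ((ll D \<lhd> V) \<bullet> (\<pi>1 D \<lhd> V))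
      ((ll D \<lhd> V) \<bullet> (\<pi>2 D \<lhd> V))"
      using dV[OF d(3)] tsum_whr[OF data(2) adD, of V] adD by simp
    moreover have aw: "addable D (TT D \<odot> V) ((ll D \<lhd> V) \<bullet> (\<pi>1 D \<lhd> V)) ((ll D \<lhd> V) \<bullet> (\<pi>2 D \<lhd> V))"
      using addable_whr[OF data(2) adD, of V] by simp
    ultimately have "(ll D \<lhd> V) \<bullet> (ss D \<lhd> V) \<bullet> h = (cc D \<lhd> V) \<bullet> tsum D (TT D \<odot> V) ((ll D \<lhd> V) \<bullet>
      (\<pi>1 D \<lhd> V)) ((ll D \<lhd> V) \<bullet> (\<pi>2 D \<lhd> V)) \<bullet> h"
      by (intro vcomp_extend2) simp_all
    then show "V \<rhd> (ll Z \<bullet> ss Z) = V \<rhd> (cc Z \<bullet> tsum Z ?T (ll Z \<bullet> \<pi>1 Z) (ll Z \<bullet> \<pi>2 Z))"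
      using adl add(2)[OF adl] aw tsum_comp[OF data(2) aw, of h] by (simp add: sh h(4,5))
  qed (use adl in simp_all)
  have cs: "cc Z \<bullet> (?T \<rhd> ss Z) = tsum Z ?T (cc Z \<bullet> (?T \<rhd> \<pi>1 Z)) (cc Z \<bullet> (?T \<rhd> \<pi>2 Z))"
  proof (rule f)
    have aw: "addable D (TT D \<odot> V) ((cc D \<lhd> V) \<bullet> (TT D \<rhd> (\<pi>1 D \<lhd> V))) ((cc D \<lhd> V) \<bullet>
      (TT D \<rhd> (\<pi>2 D \<lhd> V)))"
      using addable_whr[OF data(2) adcD, of V] by simp
    have "(cc D \<lhd> V) \<bullet> (TT D \<rhd> (ss D \<lhd> V)) = tsum D (TT D \<odot> V) ((cc D \<lhd> V) \<bullet> (TT D \<rhd> (\<pi>1 D \<lhd> V)))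
      ((cc D \<lhd> V) \<bullet> (TT D \<rhd> (\<pi>2 D \<lhd> V)))"
      using dV[OF d(6)] tsum_whr[OF data(2) adcD, of V] adcD by simp
    then have "(cc D \<lhd> V) \<bullet> (TT D \<rhd> (ss D \<lhd> V)) \<bullet> (TT D \<rhd> h) =
      tsum D (TT D \<odot> V) ((cc D \<lhd> V) \<bullet> (TT D \<rhd> (\<pi>1 D \<lhd> V))) ((cc D \<lhd> V) \<bullet> (TT D \<rhd> (\<pi>2 D \<lhd> V))) \<bullet>
        (TT D \<rhd> h)"
      by (rule vcomp_extend) simp_all
    moreover have "(TT D \<rhd> (\<pi>1 D \<lhd> V)) \<bullet> (TT D \<rhd> h) = TT D \<rhd> V \<rhd> \<pi>1 Z"
      "(TT D \<rhd> (\<pi>2 D \<lhd> V)) \<bullet> (TT D \<rhd> h) = TT D \<rhd> V \<rhd> \<pi>2 Z"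
      using h(4,5)[THEN arg_cong, of "\<lambda>x. TT D \<rhd> x"] by simp_all
    ultimately show "V \<rhd> (cc Z \<bullet> (?T \<rhd> ss Z)) = V \<rhd> tsum Z ?T (cc Z \<bullet> (?T \<rhd> \<pi>1 Z))
      (cc Z \<bullet> (?T \<rhd> \<pi>2 Z))"
      using add(2)[OF adc] tsum_comp[OF data(2) aw, of "TT D \<rhd> h"] by (simp add: sh)
  qed (use adc in simp_all)
  have eqs: "tang_eqs Z" unfolding tang_eqs_def using l1 l2 ls c1 c2 cs l4 c3 lc c4 yb by blast
  have "vl_pb Z"
    unfolding vl_pb_def c
  proof (intro ballI)
    fix Y G assume "Y \<in> cells0 K" and G: "G \<in> hom1 K Y I"
    have G': "G \<in> cells1 K" "dom1 K G = Y" "cod1 K G = I" using G by simp_all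
    note [simp] = \<open>Y \<in> cells0 K\<close> G' vl_map_cells[OF Z eqs]
    note VD = strict_vl_pb[OF Z eqs D induced_pres_Tn[OF C], of G Y, unfolded c, OF G']
    note VX = strict_vl_pb[OF Z eqs X induced_pres_Tn_Tot(1)[OF C], of G Y, unfolded c, OF G']
    show "is_pb (homcat Y I) G (?T \<odot> ?T \<odot> G) (?T \<odot> G) (zz Z \<lhd> G) (?T \<rhd> (pp Z \<lhd> G))
           (T2 Z \<odot> G) ((pp Z \<lhd> G) \<bullet> (\<pi>1 Z \<lhd> G)) (vl_map Z \<lhd> G)"
      unfolding is_pb_iff_wide_pb
    proof (rule reflect_wide_pb)
      show "wide_pb (homcat Y (carr D)) 2 (\<lambda>j. V \<odot> two G (?T \<odot> ?T \<odot> G) j) (V \<odot> ?T \<odot> G) (\<lambda>j. V \<rhd> two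
        (zz Z \<lhd> G) (?T \<rhd> (pp Z \<lhd> G)) j)
         (V \<odot> T2 Z \<odot> G) (\<lambda>j. V \<rhd> two ((pp Z \<lhd> G) \<bullet> (\<pi>1 Z \<lhd> G)) (vl_map Z \<lhd> G) j)"
        by (rule wide_pb_transport[OF VD[unfolded is_pb_iff_wide_pb]]) auto
      show "wide_pb (homcat Y (carr X)) 2 (\<lambda>j. Tot \<odot> V \<odot> two G (?T \<odot> ?T \<odot> G) j) (Tot \<odot> V \<odot> ?T \<odot> G)
         (\<lambda>j. Tot \<rhd> V \<rhd> two (zz Z \<lhd> G) (?T \<rhd> (pp Z \<lhd> G)) j)
         (Tot \<odot> V \<odot> T2 Z \<odot> G) (\<lambda>j. Tot \<rhd> V \<rhd> two ((pp Z \<lhd> G) \<bullet> (\<pi>1 Z \<lhd> G)) (vl_map Z \<lhd> G) j)"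
        using VX[unfolded is_pb_iff_wide_pb] by simp (erule wide_pb_transport; auto)
    qed auto
  qed
  then show ?thesis unfolding tangentad_iff using Z monoid eqs by blast
qed

end

section \<open>Existence of the tangent structure, and the next stage\<close>

context bundle_data
begin

lemma vlc_eqs_Suc:
  assumes "vlc_eqs (Suc i) H k"
  shows "vlc_eqs i H k"
  unfolding vlc_eqs_def using vlc_eqsD[OF assms] by (intro conjI impI) simp_all

end

context stage
begin

text \<open>The 1-cell \<open>T\<close> classifies the connection on \<open>T V\<close>. Each structural 2-cell of \<open>D\<close> at \<open>V\<close>
  lifts, as it commutes with the connections by naturality and an axiom on \<open>c\<close> in \<open>X\<close>. For the
  addition, its naturality and the additivity of \<open>c\<close> are used.\<close>

lemma ex_induced: "\<exists>Z. induced I V \<kappa> Z"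
proof -
  let ?c = "cc X \<lhd> (Tot \<odot> V)" and ?TX = "TT X"
  obtain T where T: "T \<in> hom1 K I I" "V \<odot> T = TT D \<odot> V" "\<kappa> \<lhd> T = (TT X \<rhd> \<kappa>) \<bullet> ?c"
    using unique_lift1[OF pre_conn_T[OF V_pre_conn]] by metis
  note [simp] = T(1)[simplified] T(2)
  have VTG [simp]: "V \<odot> T \<odot> G = TT D \<odot> V \<odot> G" if "G \<in> cells1 K" "cod1 K G = I" for G
    using that comp1_assoc'[of G "T" V] comp1_assoc'[of G V "TT D"] by simp
  have VTp [simp]: "V \<rhd> T \<rhd> \<phi> = TT D \<rhd> V \<rhd> \<phi>" if "\<phi> \<in> cells2 K" "cod1 K (dom2 K \<phi>) = I" for \<phi>
    using that whl_comp[of "T" V \<phi>] whl_comp[of V "TT D" \<phi>] by simp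
  have \<kappa>TT: "\<kappa> \<lhd> (T \<odot> T) = (?TX \<rhd> ?TX \<rhd> \<kappa>) \<bullet> (?TX \<rhd> ?c) \<bullet> (cc X \<lhd> (?TX \<odot> Tot \<odot> V))"
  proof -
    have "\<kappa> \<lhd> (T \<odot> T) = (\<kappa> \<lhd> T) \<lhd> T" by simp
    also have "\<dots> = ((?TX \<rhd> \<kappa>) \<bullet> ?c) \<lhd> T" unfolding T(3) ..
    finally show ?thesis by (simp add: T(3))
  qed
  obtain p where p: "p \<in> hom2 K T (id1 K I)" "V \<rhd> p = pp D \<lhd> V"
  proof (rule lift2[of T I "id1 K I" "pp D \<lhd> V"])
    have 1: "(pp X \<lhd> (Tot \<odot> V)) \<bullet> (?TX \<rhd> \<kappa>) = \<kappa> \<bullet> (pp X \<lhd> (?TX \<odot> Tot \<odot> V))"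
      using nat_eq[of "pp X" ?TX "id1 K (carr X)" \<kappa> "?TX \<odot> Tot \<odot> V" "Tot \<odot> V"] by simp
    have 2: "(pp X \<lhd> (?TX \<odot> Tot \<odot> V)) \<bullet> ?c = ?TX \<rhd> (pp X \<lhd> (Tot \<odot> V))"
      using tangentadD(4)[OF X, THEN arg_cong, of "\<lambda>x. x \<lhd> (Tot \<odot> V)"] by simp
    have "(pp X \<lhd> (Tot \<odot> V)) \<bullet> (?TX \<rhd> \<kappa>) \<bullet> ?c = \<kappa> \<bullet> (pp X \<lhd> (?TX \<odot> Tot \<odot> V)) \<bullet> ?c"
      by (rule vcomp_extend2[OF 1]) simp_all
    then show "(Tot \<rhd> (pp D \<lhd> V)) \<bullet> (\<kappa> \<lhd> T) = (\<kappa> \<lhd> id1 K I) \<bullet> (?TX \<rhd> Tot \<rhd> (pp D \<lhd> V))"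
      using T(3) 2 by simp
  qed auto
  obtain z where z: "z \<in> hom2 K (id1 K I) T" "V \<rhd> z = zz D \<lhd> V"
  proof (rule lift2[of "id1 K I" I T "zz D \<lhd> V"])
    have 1: "(?TX \<rhd> \<kappa>) \<bullet> (zz X \<lhd> (?TX \<odot> Tot \<odot> V)) = (zz X \<lhd> (Tot \<odot> V)) \<bullet> \<kappa>"
      using nat_eq[of "zz X" "id1 K (carr X)" ?TX \<kappa> "?TX \<odot> Tot \<odot> V" "Tot \<odot> V"] by simp
    have 2: "?c \<bullet> (?TX \<rhd> (zz X \<lhd> (Tot \<odot> V))) = zz X \<lhd> (?TX \<odot> Tot \<odot> V)"
      using tangentadD(5)[OF X, THEN arg_cong, of "\<lambda>x. x \<lhd> (Tot \<odot> V)"] by simp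
    show "(Tot \<rhd> (zz D \<lhd> V)) \<bullet> (\<kappa> \<lhd> id1 K I) = (\<kappa> \<lhd> T) \<bullet> (?TX \<rhd> Tot \<rhd> (zz D \<lhd> V))"
      using T(3) 1 2 by simp
  qed auto
  obtain l' where l': "l' \<in> hom2 K T (T \<odot> T)" "V \<rhd> l' = ll D \<lhd> V"
  proof (rule lift2[of T I "T \<odot> T" "ll D \<lhd> V"])
    have 1: "(ll X \<lhd> (Tot \<odot> V)) \<bullet> (?TX \<rhd> \<kappa>) = (?TX \<rhd> ?TX \<rhd> \<kappa>) \<bullet> (ll X \<lhd> (?TX \<odot> Tot \<odot> V))"
      using nat_eq[of "ll X" ?TX "?TX \<odot> ?TX" \<kappa> "?TX \<odot> Tot \<odot> V" "Tot \<odot> V"] by simp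
    have 2: "(ll X \<lhd> (?TX \<odot> Tot \<odot> V)) \<bullet> ?c = (?TX \<rhd> ?c) \<bullet> (cc X \<lhd> (?TX \<odot> Tot \<odot> V)) \<bullet>
      (?TX \<rhd> (ll X \<lhd> (Tot \<odot> V)))"
      using laxD(10)[OF data(1) T_lax[OF X], THEN arg_cong, of "\<lambda>x. x \<lhd> (Tot \<odot> V)"] by simp
    have "(ll X \<lhd> (Tot \<odot> V)) \<bullet> (?TX \<rhd> \<kappa>) \<bullet> ?c = (?TX \<rhd> ?TX \<rhd> \<kappa>) \<bullet> (ll X \<lhd> (?TX \<odot> Tot \<odot> V)) \<bullet> ?c"
      by (rule vcomp_extend2[OF 1]) simp_all
    then show "(Tot \<rhd> (ll D \<lhd> V)) \<bullet> (\<kappa> \<lhd> T) = (\<kappa> \<lhd> (T \<odot> T)) \<bullet> (?TX \<rhd> Tot \<rhd> (ll D \<lhd> V))"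
      using T(3) 2 \<kappa>TT by simp
  qed auto
  obtain c' where c': "c' \<in> hom2 K (T \<odot> T) (T \<odot> T)" "V \<rhd> c' = cc D \<lhd> V"
  proof (rule lift2[of "T \<odot> T" I "T \<odot> T" "cc D \<lhd> V"])
    have 1: "?c \<bullet> (?TX \<rhd> ?TX \<rhd> \<kappa>) = (?TX \<rhd> ?TX \<rhd> \<kappa>) \<bullet> (cc X \<lhd> (?TX \<odot> Tot \<odot> V))"
      using nat_eq[of "cc X" "?TX \<odot> ?TX" "?TX \<odot> ?TX" \<kappa> "?TX \<odot> Tot \<odot> V" "Tot \<odot> V"] by simp
    have 2: "(cc X \<lhd> (?TX \<odot> Tot \<odot> V)) \<bullet> (?TX \<rhd> ?c) \<bullet> (cc X \<lhd> (?TX \<odot> Tot \<odot> V)) = (?TX \<rhd> ?c) \<bullet>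
      (cc X \<lhd> (?TX \<odot> Tot \<odot> V)) \<bullet> (?TX \<rhd> ?c)"
      using tangentadD(11)[OF X, THEN arg_cong, of "\<lambda>x. x \<lhd> (Tot \<odot> V)"] by simp
    have "?c \<bullet> (?TX \<rhd> ?TX \<rhd> \<kappa>) \<bullet> (?TX \<rhd> ?c) \<bullet> (cc X \<lhd> (?TX \<odot> Tot \<odot> V)) = (?TX \<rhd> ?TX \<rhd> \<kappa>) \<bullet>
      (cc X \<lhd> (?TX \<odot> Tot \<odot> V)) \<bullet> (?TX \<rhd> ?c) \<bullet> (cc X \<lhd> (?TX \<odot> Tot \<odot> V))"
      by (rule vcomp_extend2[OF 1]) simp_all
    then show "(Tot \<rhd> (cc D \<lhd> V)) \<bullet> (\<kappa> \<lhd> (T \<odot> T)) = (\<kappa> \<lhd> (T \<odot> T)) \<bullet> (?TX \<rhd> Tot \<rhd> (cc D \<lhd> V))"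
      using 2 \<kappa>TT by simp
  qed auto
  note [simp] = p(1)[simplified] z(1)[simplified] l'(1)[simplified] c'(1)[simplified]
  define Zs where "Zs s = \<lparr>carr = I, TT = T, pp = p, zz = z, ss = s, ll = l', cc = c'\<rparr>" for s
  have Zs [simp]: "carr (Zs s) = I" "TT (Zs s) = T" "pp (Zs s) = p" "zz (Zs s) = z" "ss (Zs s) = s"
    "ll (Zs s) = l'" "cc (Zs s) = c'" for s
    by (simp_all add: Zs_def)
  have lifts_T: "lifts_T (Zs s)" for s unfolding lifts_T_def using T(3) p(2) by simp
  define P2 where "P2 = kp0 (homcat I I) T (id1 K I) p"
  define p1 where "p1 = kp1 (homcat I I) T (id1 K I) p"
  define p2 where "p2 = kp2 (homcat I I) T (id1 K I) p"
  have T2s: "T2 (Zs s) = P2" "\<pi>1 (Zs s) = p1" "\<pi>2 (Zs s) = p2" for s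
    unfolding T2_def \<pi>1_def \<pi>2_def P2_def p1_def p2_def by simp_all
  have pb: "is_pb (homcat I I) T T (id1 K I) p p P2 p1 p2"
  proof -
    have "Tn_at D I V 2 (T2 D \<odot> V) (two (\<pi>1 D \<lhd> V) (\<pi>2 D \<lhd> V))" by (rule T2_Tn_at) simp_all
    then obtain J \<rho> where J: "Tn_at (Zs undefined) I (id1 K I) 2 J \<rho>"
      using lift_Tn[OF lifts_T] by metis
    note [simp] = Tn_at_cells(5-9)[OF J]
    have [simp]: "cod2 K (\<rho> i) = T" if "i < 2" for i using Tn_at_cells(10)[OF J that] by simp
    have "wide_pb (homcat I I) 2 (\<lambda>_. T) (id1 K I) (\<lambda>_. p) J \<rho>"
      using Tn_at_wide_pb[OF J, of I "id1 K I" 0] by simp (erule wide_pb_transport; simp)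
    then have "is_pb (homcat I I) T T (id1 K I) p p J (\<rho> 0) (\<rho> 1)"
      by (simp add: wide_pb_const_2_iff)
    from is_pb_kpair[OF this] show ?thesis unfolding P2_def p1_def p2_def .
  qed
  then have [simp]: "P2 \<in> cells1 K" "dom1 K P2 = I" "cod1 K P2 = I" "p1 \<in> cells2 K" "dom2 K p1 = P2"
    "cod2 K p1 = T"
    "p2 \<in> cells2 K" "dom2 K p2 = P2" "cod2 K p2 = T" and pp12: "p \<bullet> p1 = p \<bullet> p2"
    unfolding is_pb_def by simp_all
  have tn: "has_Tn (Zs s)" for s
  proof -
    have "\<exists>P \<pi>. Tn_at (Zs s) I (id1 K I) n P \<pi>" if n: "n \<ge> 1" for n
    proof -
      obtain P0 \<pi>0 where "Tn_at D (carr D) (id1 K (carr D)) n P0 \<pi>0"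
        using has_Tn_Tn_at[OF data(2) n] .
      from Tn_at_whr[OF data(2) this, of V I] have T0: "Tn_at D I V n (P0 \<odot> V) (\<lambda>i. \<pi>0 i \<lhd> V)"
        by simp
      show ?thesis using lift_Tn[OF lifts_T T0] by metis
    qed
    then show ?thesis by (subst has_Tn_iff) simp_all
  qed
  let ?E = "Tot \<odot> V"
  have aD: "addable D V (V \<rhd> p1) (V \<rhd> p2)"
    unfolding addable_def using pp12[THEN arg_cong, of "\<lambda>x. V \<rhd> x"] p(2) by simp
  have aX: "addable X ?E (Tot \<rhd> V \<rhd> p1) (Tot \<rhd> V \<rhd> p2)" and
    tX: "Tot \<rhd> tsum D V (V \<rhd> p1) (V \<rhd> p2) = tsum X ?E (Tot \<rhd> V \<rhd> p1) (Tot \<rhd> V \<rhd> p2)"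
    using strict_tsum[OF stTot data(2,1) aD] .
  obtain s where s: "s \<in> hom2 K P2 T" "V \<rhd> s = tsum D V (V \<rhd> p1) (V \<rhd> p2)"
  proof (rule lift2[of P2 I T "tsum D V (V \<rhd> p1) (V \<rhd> p2)"])
    note [simp] = aD aX
    have n: "(Tot \<rhd> V \<rhd> x) \<bullet> (\<kappa> \<lhd> P2) = (TT X \<rhd> \<kappa>) \<bullet> ?c \<bullet> (TT X \<rhd> Tot \<rhd> V \<rhd> x)"
      if "x \<in> cells2 K" "dom2 K x = P2" "cod2 K x = T" for x
      using nat_eq[of \<kappa> "TT X \<odot> Tot \<odot> V" "Tot \<odot> V" x P2 T] that T(3) by simp
    have aX': "addable X (TT X \<odot> ?E) (?c \<bullet> (TT X \<rhd> Tot \<rhd> V \<rhd> p1)) (?c \<bullet> (TT X \<rhd> Tot \<rhd> V \<rhd> p2))"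
      and tX': "?c \<bullet> (TT X \<rhd> tsum X ?E (Tot \<rhd> V \<rhd> p1) (Tot \<rhd> V \<rhd> p2)) = tsum X (TT X \<odot> ?E)
        (?c \<bullet> (TT X \<rhd> Tot \<rhd> V \<rhd> p1)) (?c \<bullet> (TT X \<rhd> Tot \<rhd> V \<rhd> p2))"
      using lax_tsum[OF data(1,1) T_lax[OF X] aX] .
    have "(Tot \<rhd> tsum D V (V \<rhd> p1) (V \<rhd> p2)) \<bullet> (\<kappa> \<lhd> P2) =
      tsum X ?E ((TT X \<rhd> \<kappa>) \<bullet> ?c \<bullet> (TT X \<rhd> Tot \<rhd> V \<rhd> p1)) ((TT X \<rhd> \<kappa>) \<bullet> ?c \<bullet> (TT X \<rhd> Tot \<rhd> V \<rhd> p2))"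
      unfolding tX by (subst tsum_comp[OF data(1) aX]) (simp_all add: n)
    also have "\<dots> = (TT X \<rhd> \<kappa>) \<bullet> tsum X (TT X \<odot> ?E) (?c \<bullet> (TT X \<rhd> Tot \<rhd> V \<rhd> p1))
      (?c \<bullet> (TT X \<rhd> Tot \<rhd> V \<rhd> p2))"
      by (rule tsum_nat[OF data(1) aX', symmetric]) simp_all
    also have "\<dots> = (\<kappa> \<lhd> T) \<bullet> (TT X \<rhd> Tot \<rhd> tsum D V (V \<rhd> p1) (V \<rhd> p2))"
      unfolding tX T(3) by (simp add: tX')
    finally show "(Tot \<rhd> tsum D V (V \<rhd> p1) (V \<rhd> p2)) \<bullet> (\<kappa> \<lhd> P2) = (\<kappa> \<lhd> T) \<bullet> (TT X \<rhd> Tot \<rhd> tsum D V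
      (V \<rhd> p1) (V \<rhd> p2))" .
  qed (use aD in auto)
  have td: "tang_data (Zs s)" unfolding tang_data_def using tn s(1) T2s by simp
  have "strict (Zs s) D V"
    unfolding strict_iff[OF td data(2)] using T2s s(2) p(2) z(2) l'(2) c'(2) by simp
  then have "induced I V \<kappa> (Zs s)" unfolding induced_def using td T(3) by simp
  then show ?thesis ..
qed

lemma pre_conn_whr:
  assumes J: "J \<in> hom1 K Y I"
  shows "pre_conn i Y (V \<odot> J) (\<kappa> \<lhd> J)"
proof -
  note [simp] = J[simplified]
  have [simp]: "Y \<in> cells0 K" using cells0_dom1[of J] by simp
  note e = vlc_eqsD[OF pre_conn_cells(8)[OF V_pre_conn], THEN arg_cong, of "\<lambda>x. x \<lhd> J"]
  show ?thesis unfolding pre_conn_def vlc_eqs_def using e by simp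
qed

text \<open>Factorisation through the equifier amounts to the next equation for the connection.\<close>

lemma stage_equifier:
  assumes E: "is_equifier I (carr X) F G \<phi> \<psi> E W"
    and eq: "\<And>Y J. J \<in> hom1 K Y I \<Longrightarrow> vlc_eqs i (V \<odot> J) (\<kappa> \<lhd> J) \<Longrightarrow> vlc_eqs (Suc i) (V \<odot> J) (\<kappa> \<lhd> J)
      \<longleftrightarrow> \<phi> \<lhd> J = \<psi> \<lhd> J"
  shows "stage K X D Bas Tot q l (Suc i) E (V \<odot> W) (\<kappa> \<lhd> W)"
proof
  note e = E[unfolded is_equifier_def]
  have W: "W \<in> hom1 K E I" and [simp]: "E \<in> cells0 K" and \<phi>W: "\<phi> \<lhd> W = \<psi> \<lhd> W" using e by blast+
  note [simp] = W[simplified]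
  show vW: "pre_conn (Suc i) E (V \<odot> W) (\<kappa> \<lhd> W)"
    using pre_conn_whr[OF W] eq[OF W] \<phi>W unfolding pre_conn_def by simp
  fix Y
  show "\<exists>!J. J \<in> hom1 K Y E \<and> (V \<odot> W) \<odot> J = H \<and> \<kappa> \<lhd> W \<lhd> J = k"
    if v: "pre_conn (Suc i) Y H k" for H k
  proof -
    have v': "pre_conn i Y H k" using v vlc_eqs_Suc[of i H k] unfolding pre_conn_def by simp
    obtain J where J: "J \<in> hom1 K Y I" "V \<odot> J = H" "\<kappa> \<lhd> J = k" using unique_lift1[OF v'] by metis
    have Y: "Y \<in> cells0 K" using v unfolding pre_conn_def by simp
    have "\<phi> \<lhd> J = \<psi> \<lhd> J" using eq[OF J(1)] v v' unfolding J pre_conn_def by blast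
    then obtain J' where J': "J' \<in> hom1 K Y E" "W \<odot> J' = J"
      and u: "\<And>J''. J'' \<in> hom1 K Y E \<Longrightarrow> W \<odot> J'' = J \<Longrightarrow> J'' = J'"
      using e Y J(1) by metis
    show ?thesis
    proof (rule ex1I[of _ J'])
      show "J' \<in> hom1 K Y E \<and> (V \<odot> W) \<odot> J' = H \<and> \<kappa> \<lhd> W \<lhd> J' = k" using J J' by simp
      fix J'' assume a: "J'' \<in> hom1 K Y E \<and> (V \<odot> W) \<odot> J'' = H \<and> \<kappa> \<lhd> W \<lhd> J'' = k"
      then have [simp]: "J'' \<in> cells1 K" "dom1 K J'' = Y" "cod1 K J'' = E" by simp_all
      have "W \<odot> J'' \<in> hom1 K Y I" by simp
      moreover have "V \<odot> W \<odot> J'' = H" "\<kappa> \<lhd> (W \<odot> J'') = k" using a by simp_all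
      ultimately have "W \<odot> J'' = J" using unique_lift1[OF v'] J by blast
      then show "J'' = J'" using u a by blast
    qed
  qed
  show "\<exists>!\<tau>. \<tau> \<in> hom2 K J J' \<and> (V \<odot> W) \<rhd> \<tau> = \<sigma>"
    if J: "J \<in> hom1 K Y E" "J' \<in> hom1 K Y E" and \<sigma>: "\<sigma> \<in> hom2 K ((V \<odot> W) \<odot> J) ((V \<odot> W) \<odot> J')"
      and c: "(Tot \<rhd> \<sigma>) \<bullet> (\<kappa> \<lhd> W \<lhd> J) = (\<kappa> \<lhd> W \<lhd> J') \<bullet> (TT X \<rhd> Tot \<rhd> \<sigma>)" for J J' \<sigma>
  proof -
    note [simp] = J[simplified] \<sigma>[simplified]
    have Y: "Y \<in> cells0 K" using cells0_dom1[of J] by simp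
    have h: "W \<odot> J \<in> hom1 K Y I" "W \<odot> J' \<in> hom1 K Y I" "\<sigma> \<in> hom2 K (V \<odot> W \<odot> J) (V \<odot> W \<odot> J')"
      by simp_all
    have c': "(Tot \<rhd> \<sigma>) \<bullet> (\<kappa> \<lhd> (W \<odot> J)) = (\<kappa> \<lhd> (W \<odot> J')) \<bullet> (TT X \<rhd> Tot \<rhd> \<sigma>)" using c by simp
    obtain \<tau>0 where \<tau>0: "\<tau>0 \<in> hom2 K (W \<odot> J) (W \<odot> J')" "V \<rhd> \<tau>0 = \<sigma>" using lift2[OF h c'] .
    have "\<exists>!\<tau>. \<tau> \<in> hom2 K J J' \<and> W \<rhd> \<tau> = \<tau>0" using e Y J \<tau>0(1) by blast
    then obtain \<tau> where \<tau>: "\<tau> \<in> hom2 K J J'" "W \<rhd> \<tau> = \<tau>0"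
      and u: "\<And>\<tau>'. \<tau>' \<in> hom2 K J J' \<Longrightarrow> W \<rhd> \<tau>' = \<tau>0 \<Longrightarrow> \<tau>' = \<tau>" by metis
    show ?thesis
    proof (rule ex1I[of _ \<tau>])
      show "\<tau> \<in> hom2 K J J' \<and> (V \<odot> W) \<rhd> \<tau> = \<sigma>" using \<tau> \<tau>0 by simp
      fix \<tau>' assume a: "\<tau>' \<in> hom2 K J J' \<and> (V \<odot> W) \<rhd> \<tau>' = \<sigma>"
      then have [simp]: "\<tau>' \<in> cells2 K" "dom2 K \<tau>' = J" "cod2 K \<tau>' = J'" by simp_all
      have "W \<rhd> \<tau>' = \<tau>0" by (rule faithful[OF h(1), of _ "W \<odot> J'"]) (use a \<tau>0 in simp_all)
      then show "\<tau>' = \<tau>" using u by simp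
    qed
  qed
qed

text \<open>\<open>W T\<close> and \<open>T W\<close> classify the same pair, hence are equal; the other conditions are tested
  after \<open>V\<close>.\<close>

lemma strict_next:
  assumes W: "W \<in> hom1 K E I"
    and C: "induced I V \<kappa> Z" and C': "induced E (V \<odot> W) (\<kappa> \<lhd> W) Z'"
  shows "strict Z' Z W"
proof -
  have Z [simp]: "tang_data Z" and c [simp]: "carr Z = I" and st: "strict Z D V"
    and \<kappa>Z: "\<kappa> \<lhd> TT Z = (TT X \<rhd> \<kappa>) \<bullet> (cc X \<lhd> (Tot \<odot> V))"
    using C unfolding induced_def by blast+
  have Z' [simp]: "tang_data Z'" and c' [simp]: "carr Z' = E" and st': "strict Z' D (V \<odot> W)"
    and \<kappa>Z': "\<kappa> \<lhd> W \<lhd> TT Z' = (TT X \<rhd> (\<kappa> \<lhd> W)) \<bullet> (cc X \<lhd> (Tot \<odot> V \<odot> W))"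
    using C' unfolding induced_def by blast+
  note [simp] = W[simplified]
  note [simp] = tang_data_cells[OF Z, unfolded c] tang_data_cells[OF Z', unfolded c']
    T2_cells[OF Z, unfolded c] T2_cells[OF Z', unfolded c']
  note sD = strictD[OF st Z data(2), unfolded c] and sD' = strictD[OF st' Z' data(2), unfolded c']
  note [simp] = sD
  have EI: "V \<odot> W \<odot> TT Z' = TT D \<odot> V \<odot> W" using sD'(4) by simp
  have t1: "\<kappa> \<lhd> (W \<odot> TT Z') = \<kappa> \<lhd> (TT Z \<odot> W)" using \<kappa>Z' arg_cong[OF \<kappa>Z, of "\<lambda>x. x \<lhd> W"] by simp
  have WT: "W \<odot> TT Z' = TT Z \<odot> W"
  proof -
    have h: "TT Z \<odot> W \<in> hom1 K E I" "W \<odot> TT Z' \<in> hom1 K E I" by simp_all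
    have "\<exists>!J. J \<in> hom1 K E I \<and> V \<odot> J = V \<odot> TT Z \<odot> W \<and> \<kappa> \<lhd> J = \<kappa> \<lhd> (TT Z \<odot> W)"
      by (rule unique_lift1[OF pre_conn_whr[OF h(1)]])
    moreover have "V \<odot> W \<odot> TT Z' = V \<odot> TT Z \<odot> W" using EI by simp
    ultimately show ?thesis using h t1 by metis
  qed
  have f: "\<tau> = \<tau>'" if "\<tau> \<in> cells2 K" "\<tau>' \<in> cells2 K" "dom2 K \<tau> = dom2 K \<tau>'" "cod2 K \<tau> = cod2 K \<tau>'"
    "cod1 K (dom2 K \<tau>) = I" "V \<rhd> \<tau> = V \<rhd> \<tau>'" for \<tau> \<tau>' by (rule induced_faithful[OF C that])
  note [simp] = WT
  have WTT: "W \<odot> TT Z' \<odot> TT Z' = TT Z \<odot> TT Z \<odot> W" using comp1_assoc'[of "TT Z'" "TT Z'" W] by simp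
  have V': "V \<rhd> W \<rhd> x = y" if "(V \<odot> W) \<rhd> x = y" "x \<in> cells2 K" "cod1 K (dom2 K x) = E" for x y
    using that by simp
  have p: "W \<rhd> pp Z' = pp Z \<lhd> W" by (rule f) (use V'[OF sD'(7)] in simp_all)
  have z: "W \<rhd> zz Z' = zz Z \<lhd> W" by (rule f) (use V'[OF sD'(9)] in simp_all)
  have l: "W \<rhd> ll Z' = ll Z \<lhd> W" by (rule f) (use V'[OF sD'(11)] in \<open>simp_all add: WTT\<close>)
  have cc: "W \<rhd> cc Z' = cc Z \<lhd> W" by (rule f) (use V'[OF sD'(13)] in \<open>simp_all add: WTT\<close>)
  have ad: "addable Z W (W \<rhd> \<pi>1 Z') (W \<rhd> \<pi>2 Z')"
    unfolding addable_def using p_pi[OF Z', THEN arg_cong, of "\<lambda>x. W \<rhd> x"] p by simp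
  have s: "W \<rhd> ss Z' = tsum Z W (W \<rhd> \<pi>1 Z') (W \<rhd> \<pi>2 Z')"
  proof (rule f)
    have "(V \<odot> W) \<rhd> ss Z' = tsum D (V \<odot> W) ((V \<odot> W) \<rhd> \<pi>1 Z') ((V \<odot> W) \<rhd> \<pi>2 Z')"
      using st' unfolding strict_iff[OF Z' data(2)] by blast
    then show "V \<rhd> W \<rhd> ss Z' = V \<rhd> tsum Z W (W \<rhd> \<pi>1 Z') (W \<rhd> \<pi>2 Z')"
      using strict_tsum(2)[OF st Z data(2) ad] by simp
  qed (use ad in simp_all)
  show ?thesis unfolding strict_iff[OF Z' Z] using WT p z l cc s by simp
qed

lemma induced_next:
  assumes W: "W \<in> hom1 K E I"
    and C: "induced I V \<kappa> Z" and Z': "tang_data Z'" "carr Z' = E" "strict Z' Z W"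
  shows "induced E (V \<odot> W) (\<kappa> \<lhd> W) Z'"
proof -
  have Z [simp]: "tang_data Z" and c [simp]: "carr Z = I" and st: "strict Z D V"
    and \<kappa>Z: "\<kappa> \<lhd> TT Z = (TT X \<rhd> \<kappa>) \<bullet> (cc X \<lhd> (Tot \<odot> V))"
    using C unfolding induced_def by blast+
  note [simp] = W[simplified] strictD(4)[OF Z'(3,1) Z] tang_data_cells[OF Z, unfolded c]
    tang_data_cells[OF Z'(1), unfolded Z'(2)]
  have "\<kappa> \<lhd> W \<lhd> TT Z' = (TT X \<rhd> (\<kappa> \<lhd> W)) \<bullet> (cc X \<lhd> (Tot \<odot> V \<odot> W))"
    using arg_cong[OF \<kappa>Z, of "\<lambda>x. x \<lhd> W"] by simp
  then show ?thesis unfolding induced_def using Z' strict_lax_strict_lax(2)[OF st Z data(2) Z'(3,1)]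
    by simp
qed

end

context bundle_data
begin

lemma stage_inserter:
  assumes "is_inserter (carr D) (carr X) (TT X \<odot> Tot) Tot I V \<kappa>"
  shows "stage K X D Bas Tot q l 0 I V \<kappa>"
proof
  note e = assms[unfolded is_inserter_def]
  have [simp]: "I \<in> cells0 K" "V \<in> cells1 K" "dom1 K V = I" "cod1 K V = carr D" using e by auto
  have \<kappa>: "\<kappa> \<in> hom2 K ((TT X \<odot> Tot) \<odot> V) (Tot \<odot> V)" using e by blast
  show "pre_conn 0 I V \<kappa>" unfolding pre_conn_def vlc_eqs_def using \<kappa> by simp
  show "\<exists>!J. J \<in> hom1 K Y I \<and> V \<odot> J = H \<and> \<kappa> \<lhd> J = k" if "pre_conn 0 Y H k" for Y H k
  proof -
    have h: "Y \<in> cells0 K" "H \<in> hom1 K Y (carr D)" "k \<in> hom2 K ((TT X \<odot> Tot) \<odot> H) (Tot \<odot> H)"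
      using that unfolding pre_conn_def by auto
    then show ?thesis using e by blast
  qed
  show "\<exists>!\<tau>. \<tau> \<in> hom2 K J J' \<and> V \<rhd> \<tau> = \<sigma>"
    if "J \<in> hom1 K Y I" "J' \<in> hom1 K Y I" "\<sigma> \<in> hom2 K (V \<odot> J) (V \<odot> J')"
      "(Tot \<rhd> \<sigma>) \<bullet> (\<kappa> \<lhd> J) = (\<kappa> \<lhd> J') \<bullet> (TT X \<rhd> Tot \<rhd> \<sigma>)" for Y J J' \<sigma>
  proof -
    have Y: "Y \<in> cells0 K" using cells0_dom1[of J] that(1) by (metis in_hom1)
    have "(TT X \<odot> Tot) \<rhd> \<sigma> = TT X \<rhd> Tot \<rhd> \<sigma>" using that by simp
    then have "(Tot \<rhd> \<sigma>) \<bullet> (\<kappa> \<lhd> J) = (\<kappa> \<lhd> J') \<bullet> ((TT X \<odot> Tot) \<rhd> \<sigma>)" using that(4) by simp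
    then show ?thesis using e Y that(1-3) by blast
  qed
qed

end

section \<open>Whiskering and sums in hom-categories\<close>

lemma conn_tcat_sel [simp]:
  "obj (conn_tcat C S) = {(B, k). B \<in> S \<and> vertical_linear_connection C B k}"
  "hom (conn_tcat C S) = (\<lambda>(A, j) (B, k).
        {(f, g). (f, g) \<in> linear_morphisms C A B \<and> g \<cdot>\<^bsub>C\<^esub> j = k \<cdot>\<^bsub>C\<^esub> tar C g})"
  "idm (conn_tcat C S) = (\<lambda>(B, k). (idm C (dM B), idm C (dE B)))"
  "cmp (conn_tcat C S) = (\<lambda>(f', g') (f, g). (f' \<cdot>\<^bsub>C\<^esub> f, g' \<cdot>\<^bsub>C\<^esub> g))"
  "tob (conn_tcat C S) = tangent_conn C" "tar (conn_tcat C S) = (\<lambda>(f, g). (tar C f, tar C g))"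
  "tp (conn_tcat C S) = (\<lambda>(B, k). (tp C (dM B), tp C (dE B)))"
  "tz (conn_tcat C S) = (\<lambda>(B, k). (tz C (dM B), tz C (dE B)))"
  "tcat.tl (conn_tcat C S) = (\<lambda>(B, k). (tcat.tl C (dM B), tcat.tl C (dE B)))"
  "tc (conn_tcat C S) = (\<lambda>(B, k). (tc C (dM B), tc C (dE B)))"
  by (simp_all add: conn_tcat_def conn_cat_def Let_def)

lemma ts_conn_tcat:
  "ts (conn_tcat C S) A =
    (let D = conn_tcat C S; T2 = fst (kp0 D (tob D A) A (tp D A)); k1 = kp1 D (tob D A) A (tp D A);
      k2 = kp2 D (tob D A) A (tp D A)
     in (tplus C (dM (fst A)) (dM T2) (fst k1) (fst k2), tplus C (dE (fst A)) (dE T2) (snd k1)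
       (snd k2)))"
proof -
  have "obj (conn_cat C S) = obj (conn_tcat C S)" "hom (conn_cat C S) = hom (conn_tcat C S)"
    "cmp (conn_cat C S) = cmp (conn_tcat C S)"
    by (simp_all add: conn_tcat_def Let_def)
  note k = kpair_cong[OF this]
  have "ts (conn_tcat C S) A =
    (let D = conn_cat C S; p = (\<lambda>(B, k). (tp C (dM B), tp C (dE B))); T2 = fst
      (kp0 D (tangent_conn C A) A (p A));
       k1 = kp1 D (tangent_conn C A) A (p A); k2 = kp2 D (tangent_conn C A) A (p A)
     in (tplus C (dM (fst A)) (dM T2) (fst k1) (fst k2), tplus C (dE (fst A)) (dE T2) (snd k1)
       (snd k2)))"
    by (simp add: conn_tcat_def Let_def)
  then show ?thesis unfolding Let_def k by simp
qed

context two_category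
begin

lemma hom_homt_whr:
  assumes X: "tang_data X" "tang_data X'" "tang_data Y" and A: "lax X' X A" and B: "lax X' X B"
    and \<phi>: "\<phi> \<in> hom (homt X' X) A B" and G: "lax Y X' G"
  shows "\<phi> \<lhd> fst G \<in> hom (homt Y X) (A \<odot>\<^sub>l G) (B \<odot>\<^sub>l G)"
proof -
  obtain F \<alpha> F' \<alpha>' G' \<beta> where e: "A = (F, \<alpha>)" "B = (F', \<alpha>')" "G = (G', \<beta>)" by (metis surj_pair)
  note [simp] = X laxD_pair[OF X(2) A, unfolded e fst_conv snd_conv] laxD_pair[OF X(2) B, unfolded e
    fst_conv snd_conv] laxD_pair[OF X(3) G, unfolded e fst_conv snd_conv]
  have c: "\<phi> \<in> cells2 K" "dom2 K \<phi> = F" "cod2 K \<phi> = F'" and t: "(TT X \<rhd> \<phi>) \<bullet> \<alpha> = \<alpha>' \<bullet> (\<phi> \<lhd> TT X')"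
    using \<phi> e by simp_all
  note [simp] = c
  have 1: "(TT X \<rhd> (\<phi> \<lhd> G')) \<bullet> (\<alpha> \<lhd> G') = (\<alpha>' \<lhd> G') \<bullet> (\<phi> \<lhd> (TT X' \<odot> G'))"
    using t[THEN arg_cong, of "\<lambda>x. x \<lhd> G'"] by simp
  have 2: "(TT X \<rhd> (\<phi> \<lhd> G')) \<bullet> (\<alpha> \<lhd> G') \<bullet> (F \<rhd> \<beta>) = (\<alpha>' \<lhd> G') \<bullet> (\<phi> \<lhd> (TT X' \<odot> G')) \<bullet> (F \<rhd> \<beta>)"
    by (rule vcomp_extend2[OF 1]) simp_all
  have 3: "(\<phi> \<lhd> (TT X' \<odot> G')) \<bullet> (F \<rhd> \<beta>) = (F' \<rhd> \<beta>) \<bullet> (\<phi> \<lhd> (G' \<odot> TT Y))" by (rule nat_eq) simp_all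
  show ?thesis using 2 3 by (simp add: e lcomp_def)
qed

lemma strict_lax_lcomp_pair:
  assumes S: "strict X' X F" and X: "tang_data X'" "tang_data X" "tang_data Y" and L: "lax Y X' G"
  shows "strict_lax X' F \<odot>\<^sub>l G = (F \<odot> fst G, F \<rhd> snd G)" "lax Y X (strict_lax X' F \<odot>\<^sub>l G)"
proof -
  show "strict_lax X' F \<odot>\<^sub>l G = (F \<odot> fst G, F \<rhd> snd G)"
    using strict_lax_lcomp[OF S X(1,2), of Y "fst G" "snd G"] L X(3) by simp
  show "lax Y X (strict_lax X' F \<odot>\<^sub>l G)"
    using lax_lcomp[OF X(3,1,2) S[unfolded strict_def strict_lax_def], of "fst G" "snd G"] L
      unfolding strict_lax_def by simp
qed

lemma hom_homt_strict:
  assumes S: "strict X' X F" and X: "tang_data X'" "tang_data X" "tang_data Y" and A: "lax Y X' A"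
    and B: "lax Y X' B"
    and \<phi>: "\<phi> \<in> hom (homt Y X') A B"
  shows "F \<rhd> \<phi> \<in> hom (homt Y X) (strict_lax X' F \<odot>\<^sub>l A) (strict_lax X' F \<odot>\<^sub>l B)"
proof -
  have c: "\<phi> \<in> cells2 K" "dom2 K \<phi> = fst A" "cod2 K \<phi> = fst B"
    and t: "(TT X' \<rhd> \<phi>) \<bullet> snd A = snd B \<bullet> (\<phi> \<lhd> TT Y)" using \<phi> by simp_all
  note [simp] = X strictD(1-6)[OF S X(1,2)] laxD_pair[OF X(3) A] laxD_pair[OF X(3) B] c
  show ?thesis using t[THEN arg_cong, of "\<lambda>x. F \<rhd> x"]
    unfolding strict_lax_lcomp_pair(1)[OF S X A] strict_lax_lcomp_pair(1)[OF S X B] by simp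
qed

lemma strict_tan_T:
  assumes S: "strict X' X F" and X: "tang_data X'" "tangentad X" "tang_data Y" and A: "lax Y X' A"
    and T: "tangentad X'"
  shows "strict_lax X' F \<odot>\<^sub>l tan_T X' A = tan_T X (strict_lax X' F \<odot>\<^sub>l A)"
proof -
  have Xd [simp]: "tang_data X" using X by simp
  note [simp] = X strictD[OF S X(1) Xd] laxD_pair[OF X(3) A]
  show ?thesis unfolding strict_lax_lcomp_pair(1)[OF S X(1) Xd X(3) A] strict_lax_lcomp_pair(1)[OF S
    X(1) Xd X(3) tan_T_lax[OF T X(3) A]]
    by (cases A) (use strictD(5)[OF S X(1) Xd] strictD(14)[OF S X(1) Xd] laxD_pair[OF X(3) A] in
      \<open>simp add: tan_T_def\<close>)
qed

lemma homt_kpair_pb: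
  assumes X': "tangentad X'" and X: "tangentad X" and L: "lax X' X A"
  shows "is_pb (homt X' X) (tan_T X A) (tan_T X A) A (pp X \<lhd> fst A) (pp X \<lhd> fst A) (kp0 (homt X' X)
    (tan_T X A) A (pp X \<lhd> fst A))
    (kp1 (homt X' X) (tan_T X A) A (pp X \<lhd> fst A)) (kp2 (homt X' X) (tan_T X A) A (pp X \<lhd> fst A))"
proof -
  obtain P \<pi> where "wide_pb (homt X' X) 2 (\<lambda>_. tan_T X A) A (\<lambda>_. pp X \<lhd> fst A) P \<pi>"
    using homt_ex_Tn[OF X' X L, of 2] by auto
  then show ?thesis using is_pb_kpair by (metis wide_pb_const_2_iff)
qed

lemma is_pbD:
  assumes "is_pb C A B D f g P u v"
  shows "A \<in> obj C" "B \<in> obj C" "D \<in> obj C" "f \<in> hom C A D" "g \<in> hom C B D" "P \<in> obj C"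
    "u \<in> hom C P A" "v \<in> hom C P B"
    "f \<cdot>\<^bsub>C\<^esub> u = g \<cdot>\<^bsub>C\<^esub> v"
  using assms unfolding is_pb_def by blast+

lemma homt_addable:
  assumes X': "tang_data X'" and X: "tang_data X" and L: "lax X' X A"
    and a: "a \<in> hom (homt X' X) Z (tan_T X A)" "b \<in> hom (homt X' X) Z (tan_T X A)"
    "(pp X \<lhd> fst A) \<bullet> a = (pp X \<lhd> fst A) \<bullet> b"
  shows "addable X (fst A) a b"
proof -
  have "fst (tan_T X A) = TT X \<odot> fst A" by (simp add: tan_T_def split: prod.splits)
  then show ?thesis unfolding addable_def using laxD_pair[OF X' L] a by simp
qed

lemma ts_homt:
  assumes X': "tangentad X'" and X: "tangentad X" and L: "lax X' X A"
  shows "ts (homt X' X) A = tsum X (fst A) (kp1 (homt X' X) (tan_T X A) A (pp X \<lhd> fst A))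
    (kp2 (homt X' X) (tan_T X A) A (pp X \<lhd> fst A))"
proof -
  have "obj (tancat X' X) = obj (homt X' X)" "hom (tancat X' X) = hom (homt X' X)"
    "cmp (tancat X' X) = cmp (homt X' X)"
    by (simp_all add: homt_def Let_def)
  note k = kpair_cong[OF this]
  have "dom2 K (kp1 (homt X' X) (tan_T X A) A (pp X \<lhd> fst A)) = fst (kp0 (homt X' X) (tan_T X A) A
    (pp X \<lhd> fst A))"
    using is_pbD(7)[OF homt_kpair_pb[OF assms]] by simp
  note t = pair_T2_tsum[OF this, of X "fst A" "carr X'"]
  have "ts (homt X' X) A = (ss X \<lhd> fst A) \<bullet>
               pair_T2 (carr X') X (fst A) (fst (kp0 (tancat X' X) (tan_T X A) A (pp X \<lhd> fst A)))
                 (kp1 (tancat X' X) (tan_T X A) A (pp X \<lhd> fst A)) (kp2 (tancat X' X) (tan_T X A) A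
                   (pp X \<lhd> fst A))"
    by (simp add: homt_def Let_def)
  then show ?thesis unfolding k t .
qed

text \<open>By \<open>ts_homt\<close>, the addition of a hom-category is \<open>s\<^sub>F\<close> composed with a comparison map. The
  comparison cancels, so sums do not depend on the chosen kernel pairs.\<close>

lemma tplus_homt:
  assumes X': "tangentad X'" and X: "tangentad X" and L: "lax X' X A" and Z: "lax X' X Z"
    and a: "a \<in> hom (homt X' X) Z (tan_T X A)" "b \<in> hom (homt X' X) Z (tan_T X A)"
      "(pp X \<lhd> fst A) \<bullet> a = (pp X \<lhd> fst A) \<bullet> b"
  shows "tplus (homt X' X) A Z a b = tsum X (fst A) a b"
proof -
  have Xd: "tang_data X" "tang_data X'" using X X' by simp_all
  note pb = homt_kpair_pb[OF X' X L]
  let ?k1 = "kp1 (homt X' X) (tan_T X A) A (pp X \<lhd> fst A)"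
    and ?k2 = "kp2 (homt X' X) (tan_T X A) A (pp X \<lhd> fst A)"
  let ?h = "pair (homt X' X) Z (kp0 (homt X' X) (tan_T X A) A (pp X \<lhd> fst A)) ?k1 ?k2 a b"
  have h: "?h \<in> hom (homt X' X) Z (kp0 (homt X' X) (tan_T X A) A (pp X \<lhd> fst A))" "?k1 \<bullet> ?h = a"
    "?k2 \<bullet> ?h = b"
    using pair_props[OF pb, of Z a b] Z a by simp_all
  have ad: "addable X (fst A) ?k1 ?k2"
    using homt_addable[OF Xd(2,1) L is_pbD(7)[OF pb] is_pbD(8)[OF pb]] is_pbD(9)[OF pb] by simp
  have "tplus (homt X' X) A Z a b = tsum X (fst A) ?k1 ?k2 \<bullet> ?h"
    unfolding tplus_def plus_over_def using ts_homt[OF X' X L] by simp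
  also have "\<dots> = tsum X (fst A) a b"
    using tsum_comp[OF Xd(1) ad, of ?h] h is_pbD(7)[OF pb] by simp
  finally show ?thesis .
qed

text \<open>The structure of a lax morphism on the apex is determined by the legs, hence is the one that
  makes the cone a limit.\<close>

lemma Tn_at_wide_pb_homt:
  assumes X': "tangentad X'" and X: "tangentad X" and L: "lax X' X A"
    and T: "Tn_at X (carr X') (fst A) n (fst P) \<pi>"
    and P: "lax X' X P" and \<pi>: "\<And>i. i < n \<Longrightarrow> \<pi> i \<in> hom (homt X' X) P (tan_T X A)"
  shows "wide_pb (homt X' X) n (\<lambda>_. tan_T X A) A (\<lambda>_. pp X \<lhd> fst A) P \<pi>"
proof -
  have Xd: "tang_data X" "tang_data X'" using X X' by simp_all
  have L': "lax X' X (fst A, snd A)" using L by simp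
  obtain \<gamma> where G: "lax X' X (fst P, \<gamma>)"
    and W: "wide_pb (homt X' X) n (\<lambda>_. tan_T X A) A (\<lambda>_. pp X \<lhd> fst A) (fst P, \<gamma>) \<pi>"
    using Tn_at_lax[OF X' X L' T] by auto
  note [simp] = laxD_pair[OF Xd(2) P] laxD_pair[OF Xd(2) G, unfolded fst_conv snd_conv] Xd
  have "\<gamma> = snd P"
  proof (rule category.wide_pb_eqI[OF category_homcat Tn_at_wide_pb_1[OF Xd(1) T], of
    "fst P \<odot> TT X'"])
    fix i assume i: "i < n"
    show "(TT X \<rhd> \<pi> i) \<cdot>\<^bsub>homcat (carr X') (carr X)\<^esub> \<gamma> = (TT X \<rhd> \<pi> i) \<cdot>\<^bsub>homcat (carr X')
      (carr X)\<^esub> snd P"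
      using wide_pbD(6)[OF W i] \<pi>[OF i] by simp
  qed simp_all
  then show ?thesis using W by simp
qed

text \<open>The additions of the two bundles differ by comparisons between chosen kernel pairs. All
  pullbacks involved are pointwise, so the comparisons on both sides have the same projections.\<close>

lemma bundle_at_lcomp:
  assumes X: "tangentad X" "tangentad D" "tangentad Z" "tangentad X'"
    and Q: "pointwise_display_bundle D X Q" and H0: "lax Z D H0"
      and B: "pointwise_display_bundle Z X (bundle_at Z D X Q H0)"
    and H: "lax X' Z H"
  shows "bundle_at X' Z X (bundle_at Z D X Q H0) H = bundle_at X' D X Q (H0 \<odot>\<^sub>l H)"
proof -
  have d [simp]: "tang_data X" "tang_data D" "tang_data Z" "tang_data X'" using X by simp_all
  let ?B = "bundle_at Z D X Q H0" and ?C = "homt D X" and ?C' = "homt Z X" and ?C'' = "homt X' X"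
  have ass: "(A \<odot>\<^sub>l H0) \<odot>\<^sub>l H = A \<odot>\<^sub>l (H0 \<odot>\<^sub>l H)" if "lax D X A" for A
    by (rule lcomp_assoc[OF d(3,2,1) that H0 H d(4)])
  note q = pointwise_display_bundleD[OF Q]
  note [simp] = laxD_pair[OF d(3) H0] laxD_pair[OF d(4) H] laxD_pair[OF d(2) q(1)]
    laxD_pair[OF d(2) q(2)]
  have qc [simp]: "dq Q \<in> cells2 K" "dom2 K (dq Q) = fst (dE Q)" "cod2 K (dq Q) = fst (dM Q)"
    "dl Q \<in> cells2 K" "dom2 K (dl Q) = fst (dE Q)" using q(3,4) by simp_all
  have zc [simp]: "dz Q \<in> cells2 K" "dom2 K (dz Q) = fst (dM Q)" and
     sc: "ds Q \<in> cells2 K" "dom2 K (ds Q) = fst (Esq ?C Q)"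
    using Q unfolding pointwise_display_bundle_def display_bundle_def comm_monoid_over_def Let_def
      Esq_def by simp_all
  have pbQ: "is_pb ?C (dE Q) (dE Q) (dM Q) (dq Q) (dq Q) (Esq ?C Q) (pi1 ?C Q) (pi2 ?C Q)"
    and pbQ0: "is_pb ?C' (dE Q \<odot>\<^sub>l H0) (dE Q \<odot>\<^sub>l H0) (dM Q \<odot>\<^sub>l H0) (dq Q \<lhd> fst H0) (dq Q \<lhd> fst H0)
      (Esq ?C Q \<odot>\<^sub>l H0) (pi1 ?C Q \<lhd> fst H0) (pi2 ?C Q \<lhd> fst H0)"
    using Q H0 X(3) unfolding pointwise_display_bundle_def pointwise_pb_def Let_def by blast+
  have H0H: "lax X' D (H0 \<odot>\<^sub>l H)" using lax_lcomp[OF d(4,3,2), of "fst H0" "snd H0" "fst H" "snd H"]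
    H0 H by simp
  have pbQ1: "is_pb ?C'' (dE Q \<odot>\<^sub>l H0 \<odot>\<^sub>l H) (dE Q \<odot>\<^sub>l H0 \<odot>\<^sub>l H) (dM Q \<odot>\<^sub>l H0 \<odot>\<^sub>l H) (dq Q \<lhd> fst
    (H0 \<odot>\<^sub>l H)) (dq Q \<lhd> fst (H0 \<odot>\<^sub>l H))
     (Esq ?C Q \<odot>\<^sub>l H0 \<odot>\<^sub>l H) (pi1 ?C Q \<lhd> fst (H0 \<odot>\<^sub>l H)) (pi2 ?C Q \<lhd> fst (H0 \<odot>\<^sub>l H))"
    using Q H0H X(4) unfolding pointwise_display_bundle_def pointwise_pb_def Let_def by blast
  have pbB: "is_pb ?C' (dE ?B) (dE ?B) (dM ?B) (dq ?B) (dq ?B) (Esq ?C' ?B) (pi1 ?C' ?B)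
    (pi2 ?C' ?B)"
    and pbB1: "is_pb ?C'' (dE ?B \<odot>\<^sub>l H) (dE ?B \<odot>\<^sub>l H) (dM ?B \<odot>\<^sub>l H) (dq ?B \<lhd> fst H) (dq ?B \<lhd> fst H)
      (Esq ?C' ?B \<odot>\<^sub>l H) (pi1 ?C' ?B \<lhd> fst H) (pi2 ?C' ?B \<lhd> fst H)"
    using B H X(4) unfolding pointwise_display_bundle_def pointwise_pb_def Let_def by blast+
  have EQ: "lax D X (Esq ?C Q)" using is_pbD(6)[OF pbQ] by simp
  have EB: "lax Z X (Esq ?C' ?B)" using is_pbD(6)[OF pbB] by simp
  note [simp] = laxD_pair[OF d(2) EQ] laxD_pair[OF d(3) EB]
  have [simp]: "pi1 ?C Q \<in> cells2 K" "dom2 K (pi1 ?C Q) = fst (Esq ?C Q)"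
    "cod2 K (pi1 ?C Q) = fst (dE Q)"
     "pi2 ?C Q \<in> cells2 K" "dom2 K (pi2 ?C Q) = fst (Esq ?C Q)" "cod2 K (pi2 ?C Q) = fst (dE Q)"
    using is_pbD(7,8)[OF pbQ] by simp_all
  note [simp] = sc
  define g
    where "g = pair ?C' (Esq ?C' ?B) (Esq ?C Q \<odot>\<^sub>l H0) (pi1 ?C Q \<lhd> fst H0) (pi2 ?C Q \<lhd> fst H0)
    (pi1 ?C' ?B) (pi2 ?C' ?B)"
  have g: "g \<in> hom ?C' (Esq ?C' ?B) (Esq ?C Q \<odot>\<^sub>l H0)" "(pi1 ?C Q \<lhd> fst H0) \<bullet> g = pi1 ?C' ?B"
    "(pi2 ?C Q \<lhd> fst H0) \<bullet> g = pi2 ?C' ?B"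
    unfolding g_def using pair_props[OF pbQ0, of "Esq ?C' ?B" "pi1 ?C' ?B" "pi2 ?C' ?B"]
      is_pbD(6-9)[OF pbB] by (simp_all del: hom_homt)
  have [simp]: "g \<in> cells2 K" "dom2 K g = fst (Esq ?C' ?B)" "cod2 K g = fst (Esq ?C Q) \<odot> fst H0"
    using g(1) by simp_all
  have dsB: "ds ?B = (ds Q \<lhd> fst H0) \<bullet> g"
    by (simp add: bundle_at_def Let_def g_def) (simp add: Esq_def pi1_def pi2_def)
  let ?q = "dq Q \<lhd> fst (H0 \<odot>\<^sub>l H)" and ?E = "dE Q \<odot>\<^sub>l H0 \<odot>\<^sub>l H" and ?M = "dM Q \<odot>\<^sub>l H0 \<odot>\<^sub>l H"
  let ?k0 = "kp0 ?C'' ?E ?M ?q" and ?k1 = "kp1 ?C'' ?E ?M ?q" and ?k2 = "kp2 ?C'' ?E ?M ?q"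
  have pbK: "is_pb ?C'' ?E ?E ?M ?q ?q ?k0 ?k1 ?k2" using is_pb_kpair[OF pbQ1] .
  have assE: "(dE Q \<odot>\<^sub>l H0) \<odot>\<^sub>l H = ?E" "(dM Q \<odot>\<^sub>l H0) \<odot>\<^sub>l H = ?M"
    "(Esq ?C Q \<odot>\<^sub>l H0) \<odot>\<^sub>l H = Esq ?C Q \<odot>\<^sub>l H0 \<odot>\<^sub>l H"
    using ass q(1,2) EQ by simp_all
  have pbB2: "is_pb ?C'' ?E ?E ?M ?q ?q (Esq ?C' ?B \<odot>\<^sub>l H) (pi1 ?C' ?B \<lhd> fst H)
    (pi2 ?C' ?B \<lhd> fst H)"
    using pbB1 by (simp add: assE)
  define h
    where "h = pair ?C'' ?k0 (Esq ?C' ?B \<odot>\<^sub>l H) (pi1 ?C' ?B \<lhd> fst H) (pi2 ?C' ?B \<lhd> fst H) ?k1 ?k2"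
  have h: "h \<in> hom ?C'' ?k0 (Esq ?C' ?B \<odot>\<^sub>l H)" "(pi1 ?C' ?B \<lhd> fst H) \<bullet> h = ?k1"
    "(pi2 ?C' ?B \<lhd> fst H) \<bullet> h = ?k2"
    unfolding h_def using pair_props[OF pbB2, of ?k0 ?k1 ?k2] is_pbD(6-9)[OF pbK]
      by (simp_all del: hom_homt)
  have [simp]: "h \<in> cells2 K" "cod2 K h = fst (Esq ?C' ?B) \<odot> fst H" using h(1) by simp_all
  have gH: "g \<lhd> fst H \<in> hom ?C'' (Esq ?C' ?B \<odot>\<^sub>l H) (Esq ?C Q \<odot>\<^sub>l H0 \<odot>\<^sub>l H)"
    using hom_homt_whr[OF d(1,3,4) EB _ g(1) H] is_pbD(6)[OF pbQ0] unfolding assE(3) by simp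
  have k0: "?k0 \<in> obj ?C''" using is_pbD(6)[OF pbK] .
  have gh: "(g \<lhd> fst H) \<bullet> h \<in> hom ?C'' ?k0 (Esq ?C Q \<odot>\<^sub>l H0 \<odot>\<^sub>l H)"
    using category.cmp_hom[OF category_homt[OF d(4,1)] k0 is_pbD(6)[OF pbB2] is_pbD(6)[OF pbQ1] h(1)
      gH] by (simp del: hom_homt)
  have p1: "(pi1 ?C Q \<lhd> fst (H0 \<odot>\<^sub>l H)) \<bullet> (g \<lhd> fst H) = pi1 ?C' ?B \<lhd> fst H"
    using g(2)[THEN arg_cong, of "\<lambda>x. x \<lhd> fst H"] by simp
  have p2: "(pi2 ?C Q \<lhd> fst (H0 \<odot>\<^sub>l H)) \<bullet> (g \<lhd> fst H) = pi2 ?C' ?B \<lhd> fst H"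
    using g(3)[THEN arg_cong, of "\<lambda>x. x \<lhd> fst H"] by simp
  have pe: "pair ?C'' ?k0 (Esq ?C Q \<odot>\<^sub>l H0 \<odot>\<^sub>l H) (pi1 ?C Q \<lhd> fst (H0 \<odot>\<^sub>l H)) (pi2 ?C Q \<lhd> fst
    (H0 \<odot>\<^sub>l H)) ?k1 ?k2 = (g \<lhd> fst H) \<bullet> h"
    using category.pair_eqI[OF category_homt[OF d(4,1)] pbQ1 k0 gh] vcomp_extend[OF p1, of h]
      vcomp_extend[OF p2, of h] h(2,3) by simp
  have "ds (bundle_at X' Z X ?B H) = (ds ?B \<lhd> fst H) \<bullet> h"
    by (simp add: bundle_at_def[of X' Z] Let_def h_def assE)
  also have "\<dots> = ds (bundle_at X' D X Q (H0 \<odot>\<^sub>l H))"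
    using pe by (simp add: dsB bundle_at_def[of X' D] Let_def)
  finally have s: "ds (bundle_at X' Z X ?B H) = ds (bundle_at X' D X Q (H0 \<odot>\<^sub>l H))" .
  have z: "dz (bundle_at X' Z X ?B H) = dz (bundle_at X' D X Q (H0 \<odot>\<^sub>l H))"
    by (simp add: bundle_at_def Let_def)
  show ?thesis
    by (rule dbun.equality) (use s z in \<open>simp_all add: assE\<close>)
qed

end

section \<open>The universal property\<close>

lemma cat_iso_tangent_isoI:
  assumes "cat_iso C D Fo Fa"
    "\<And>A. A \<in> obj C \<Longrightarrow> Fo (tob C A) = tob D (Fo A)"
    "\<And>A B f. A \<in> obj C \<Longrightarrow> B \<in> obj C \<Longrightarrow> f \<in> hom C A B \<Longrightarrow> Fa (tar C f) = tar D (Fa f)"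
    "\<And>A. A \<in> obj C \<Longrightarrow> Fa (tp C A) = tp D (Fo A)" "\<And>A. A \<in> obj C \<Longrightarrow> Fa (tz C A) = tz D (Fo A)"
    "\<And>A. A \<in> obj C \<Longrightarrow> Fa (tcat.tl C A) = tcat.tl D (Fo A)"
      "\<And>A. A \<in> obj C \<Longrightarrow> Fa (tc C A) = tc D (Fo A)"
    "\<And>A. A \<in> obj C \<Longrightarrow> Fa (ts C A) =
          tplus D (Fo A) (Fo (kp0 C (tob C A) A (tp C A)))
            (Fa (kp1 C (tob C A) A (tp C A))) (Fa (kp2 C (tob C A) A (tp C A)))"
  shows "tangent_iso C D Fo Fa"
  using assms unfolding tangent_iso_def cat_iso_def by simp

context two_category
begin

lemma VLC_sel [simp]:
  "obj (VLC X' X) = {(B, k). pointwise_display_bundle X' X B \<and> vertical_linear_connection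
    (homt X' X) B k}"
  "hom (VLC X' X) = (\<lambda>(A, j) (B, k).
        {(f, g). (f, g) \<in> linear_morphisms (homt X' X) A B \<and> g \<bullet> j = k \<bullet> (TT X \<rhd> g)})"
  "idm (VLC X' X) = (\<lambda>(B, k). (id2 K (fst (dM B)), id2 K (fst (dE B))))"
  "cmp (VLC X' X) = (\<lambda>(f', g') (f, g). (f' \<bullet> f, g' \<bullet> g))"
  "tob (VLC X' X) = tangent_conn (homt X' X)" "tar (VLC X' X) = (\<lambda>(f, g). (TT X \<rhd> f, TT X \<rhd> g))"
  "tp (VLC X' X) = (\<lambda>(B, k). (pp X \<lhd> fst (dM B), pp X \<lhd> fst (dE B)))"
  "tz (VLC X' X) = (\<lambda>(B, k). (zz X \<lhd> fst (dM B), zz X \<lhd> fst (dE B)))"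
  "tcat.tl (VLC X' X) = (\<lambda>(B, k). (ll X \<lhd> fst (dM B), ll X \<lhd> fst (dE B)))"
  "tc (VLC X' X) = (\<lambda>(B, k). (cc X \<lhd> fst (dM B), cc X \<lhd> fst (dE B)))"
  by (simp_all add: VLC_def)

lemma is_DB_bundle_data:
  assumes X: "tangentad X" and DB: "is_DB X D Bas Tot Q"
  shows "bundle_data K X D Bas Tot (dq Q) (dl Q)"
proof -
  have D: "tangentad D" and st: "strict D X Bas" "strict D X Tot" and Q: "dM Q = strict_lax D Bas"
    "dE Q = strict_lax D Tot"
    and pQ: "pointwise_display_bundle D X Q"
    using DB unfolding is_DB_def by blast+
  have d: "tang_data X" "tang_data D" using X D by simp_all
  note [simp] = d strictD(1-6)[OF st(1) d(2,1)] strictD(1-6)[OF st(2) d(2,1)]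
  note q = pointwise_display_bundleD(3,4)[OF pQ]
  have [simp]: "dq Q \<in> cells2 K" "dom2 K (dq Q) = Tot" "cod2 K (dq Q) = Bas" "dl Q \<in> cells2 K"
    "dom2 K (dl Q) = Tot" "cod2 K (dl Q) = TT X \<odot> Tot"
    using q by (simp_all add: Q strict_lax_def tan_T_def)
  show ?thesis
  proof
    show "pres_Tn D X Bas" "pres_Tn D X Tot" using is_DB_pres_Tn[OF X DB] .
    show "TT X \<rhd> dq Q = dq Q \<lhd> TT D" "TT X \<rhd> dl Q = (cc X \<lhd> Tot) \<bullet> (dl Q \<lhd> TT D)"
      using q by (simp_all add: Q strict_lax_def tan_T_def)
  qed (use X D in simp_all)
qed

end

text \<open>The last stage, with an arbitrary induced tangentad structure \<open>Z\<close>.\<close>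

locale vlc_stage = stage K X D Bas Tot "dq Q" "dl Q" 4 I V \<kappa>
  for K :: "('x, 'm, 'c) twocat" (structure) and X D :: "('x, 'm, 'c) tstruct" and Bas Tot :: 'm
    and Q :: "('m \<times> 'c, 'c) dbun" and I :: 'x and V :: 'm and \<kappa> :: 'c +
  fixes Z :: "('x, 'm, 'c) tstruct"
  assumes DB: "is_DB X D Bas Tot Q" and Z: "tangentad Z" and comp: "induced I V \<kappa> Z"
begin

lemma Zd [simp]: "tang_data Z" and carrZ [simp]: "carr Z = I" and stV: "strict Z D V"
  and \<kappa>T: "\<kappa> \<lhd> TT Z = (TT X \<rhd> \<kappa>) \<bullet> (cc X \<lhd> (Tot \<odot> V))"
  using Z comp unfolding induced_def by blast+

lemma QD: "dM Q = strict_lax D Bas" "dE Q = strict_lax D Tot"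
    and pQ: "pointwise_display_bundle D X Q"
  using DB unfolding is_DB_def by blast+

lemmas V_simps [simp] = strictD[OF stV Zd data(2), unfolded carrZ]
lemmas Z_cells [simp] = tang_data_cells[OF Zd, unfolded carrZ]

lemma DB_iso:
  "tangentad X' \<Longrightarrow> tangent_iso (homt X' D) (DBpt X' X) (\<lambda>H. bundle_at X' D X Q H)
    (\<lambda>\<phi>. (Bas \<rhd> \<phi>, Tot \<rhd> \<phi>))"
  using DB unfolding is_DB_def by blast

lemma pointwise_at: "tangentad X' \<Longrightarrow> lax X' D H \<Longrightarrow> pointwise_display_bundle X' X
    (bundle_at X' D X Q H)"
  using cat_iso_obj[OF tangent_iso_cat_iso[OF DB_iso], of X' H] by simp

lemma dE_at:
  assumes "tang_data X'" "lax X' D H"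
  shows "dE Q \<odot>\<^sub>l H = (Tot \<odot> fst H, Tot \<rhd> snd H)" "dM Q \<odot>\<^sub>l H = (Bas \<odot> fst H, Bas \<rhd> snd H)"
  unfolding QD using strict_lax_lcomp_pair(1)[OF stTot data(2,1) assms] strict_lax_lcomp_pair(1)[OF
    stBas data(2,1) assms] .

text \<open>The last condition says that \<open>k\<close> is a tangent 2-cell; it is also the condition for the
  structure \<open>snd H\<close> of the classifying lax morphism to lift along \<open>V\<close>.\<close>

lemma connection_at_iff:
  assumes X': "tang_data X'" and H: "lax X' D H"
  shows "vertical_linear_connection (homt X' X) (bundle_at X' D X Q H) k \<longleftrightarrow>
    pre_conn 4 (carr X') (fst H) k \<and> (TT X \<rhd> k) \<bullet> (cc X \<lhd> (Tot \<odot> fst H)) \<bullet> (TT X \<rhd> Tot \<rhd> snd H) =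
      (Tot \<rhd> snd H) \<bullet> (k \<lhd> TT X')"
proof -
  note [simp] = X' laxD_pair[OF X' H]
  have [simp]: "carr X' \<in> cells0 K" using X' by simp
  show ?thesis
    unfolding vertical_linear_connection_def pre_conn_def vlc_eqs_def
    by (simp add: dE_at[OF X' H] tan_T_def) blast
qed

definition U :: "('m \<times> 'c, 'c) dbun \<times> 'c" where
  "U = (bundle_at Z D X Q (strict_lax Z V), \<kappa>)"

lemma laxV: "lax Z D (strict_lax Z V)" using stV unfolding strict_def .

lemma laxVH:
  assumes X': "tang_data X'" and H: "lax X' Z H"
  shows "lax X' D (strict_lax Z V \<odot>\<^sub>l H)" "strict_lax Z V \<odot>\<^sub>l H = (V \<odot> fst H, V \<rhd> snd H)"
  using strict_lax_lcomp_pair(2,1)[OF stV Zd data(2) X' H] .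

lemma conn_at_U:
  assumes X': "tangentad X'" and H: "lax X' Z H"
  shows "conn_at X' Z X U H = (bundle_at X' D X Q (strict_lax Z V \<odot>\<^sub>l H), \<kappa> \<lhd> fst H)"
  unfolding conn_at_def U_def prod.case
  using bundle_at_lcomp[OF X D Z X' pQ laxV pointwise_at[OF Z laxV] H] by simp

lemma U_obj: "U \<in> obj (VLC Z X)"
proof -
  have "vertical_linear_connection (homt Z X) (bundle_at Z D X Q (strict_lax Z V)) \<kappa>"
    unfolding connection_at_iff[OF Zd laxV] using V_pre_conn \<kappa>T by (simp add: strict_lax_def)
  then show ?thesis unfolding U_def using pointwise_at[OF Z laxV] by simp
qed

lemma Fa_U: "fst (dM (fst U)) = Bas \<odot> V" "fst (dE (fst U)) = Tot \<odot> V"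
  unfolding U_def by (simp_all add: QD strict_lax_def)

context
  fixes X' assumes X': "tangentad X'"
begin

abbreviation "Fo \<equiv> \<lambda>H. conn_at X' Z X U H"
abbreviation "Fa \<equiv> \<lambda>\<phi>. ((Bas \<odot> V) \<rhd> \<phi>, (Tot \<odot> V) \<rhd> \<phi>)"

lemma X'd: "tang_data X'" using X' by simp

lemma Fo_obj:
  assumes H: "lax X' Z H"
  shows "Fo H \<in> obj (VLC X' X)"
proof -
  obtain J \<alpha> where e: "H = (J, \<alpha>)" by (metis surj_pair)
  note [simp] = X'd laxD_pair[OF X'd H, unfolded e fst_conv snd_conv, unfolded carrZ]
  have J: "J \<in> hom1 K (carr X') I" by simp
  have v: "pre_conn 4 (carr X') (V \<odot> J) (\<kappa> \<lhd> J)" by (rule pre_conn_whr[OF J])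
  have "(\<kappa> \<lhd> (TT Z \<odot> J)) = (TT X \<rhd> (\<kappa> \<lhd> J)) \<bullet> (cc X \<lhd> (Tot \<odot> V \<odot> J))"
    using \<kappa>T[THEN arg_cong, of "\<lambda>x. x \<lhd> J"] by simp
  moreover have "(Tot \<rhd> V \<rhd> \<alpha>) \<bullet> (\<kappa> \<lhd> (J \<odot> TT X')) = (\<kappa> \<lhd> (TT Z \<odot> J)) \<bullet> (TT X \<rhd> Tot \<rhd> V \<rhd> \<alpha>)"
    using nat_eq[of \<kappa> "TT X \<odot> Tot \<odot> V" "Tot \<odot> V" \<alpha> "J \<odot> TT X'" "TT Z \<odot> J"] by simp
  ultimately have
    "vertical_linear_connection (homt X' X) (bundle_at X' D X Q (strict_lax Z V \<odot>\<^sub>l H)) (\<kappa> \<lhd> J)"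
    unfolding connection_at_iff[OF X'd laxVH(1)[OF X'd H]] unfolding laxVH(2)[OF X'd H] using v
      by (simp add: e)
  then show ?thesis unfolding conn_at_U[OF X' H] using pointwise_at[OF X' laxVH(1)[OF X'd H]]
    by (simp add: e)
qed

text \<open>As \<open>V\<close> is faithful and strict, each axiom for \<open>\<alpha>\<close> is equivalent to the one for \<open>V \<alpha>\<close>.\<close>

lemma lax_reflect:
  assumes J: "J \<in> hom1 K (carr X') I" and a: "\<alpha> \<in> hom2 K (J \<odot> TT X') (TT Z \<odot> J)"
    and L: "lax X' D (V \<odot> J, V \<rhd> \<alpha>)"
  shows "lax X' Z (J, \<alpha>)"
proof -
  note [simp] = X'd J[simplified] a[simplified]
  note f = induced_faithful[OF comp]
  note l = laxD[OF X'd L]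
  have p: "(pp Z \<lhd> J) \<bullet> \<alpha> = J \<rhd> pp X'" by (rule f) (use l(7) in simp_all)
  have z: "\<alpha> \<bullet> (J \<rhd> zz X') = zz Z \<lhd> J" by (rule f) (use l(8) in simp_all)
  have pa: "(pp Z \<lhd> J) \<bullet> \<alpha> \<bullet> x = (J \<rhd> pp X') \<bullet> x" if "x \<in> cells2 K" "cod2 K x = J \<odot> TT X'" for x
    by (rule vcomp_extend[OF p]) (use that in simp_all)
  have ad: "addable Z J (\<alpha> \<bullet> (J \<rhd> \<pi>1 X')) (\<alpha> \<bullet> (J \<rhd> \<pi>2 X'))"
    unfolding addable_def using p_pi[OF X'd, THEN arg_cong, of "\<lambda>x. J \<rhd> x"] by (simp add: pa)
  have s: "\<alpha> \<bullet> (J \<rhd> ss X') = tsum Z J (\<alpha> \<bullet> (J \<rhd> \<pi>1 X')) (\<alpha> \<bullet> (J \<rhd> \<pi>2 X'))"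
  proof (rule f)
    show "V \<rhd> (\<alpha> \<bullet> (J \<rhd> ss X')) = V \<rhd> tsum Z J (\<alpha> \<bullet> (J \<rhd> \<pi>1 X')) (\<alpha> \<bullet> (J \<rhd> \<pi>2 X'))"
      using strict_tsum(2)[OF stV Zd data(2) ad] l(9) by simp
  qed (use ad in simp_all)
  have ll: "(ll Z \<lhd> J) \<bullet> \<alpha> = (TT Z \<rhd> \<alpha>) \<bullet> (\<alpha> \<lhd> TT X') \<bullet> (J \<rhd> ll X')"
    by (rule f) (use l(10) in simp_all)
  have cc: "(cc Z \<lhd> J) \<bullet> (TT Z \<rhd> \<alpha>) \<bullet> (\<alpha> \<lhd> TT X') = (TT Z \<rhd> \<alpha>) \<bullet> (\<alpha> \<lhd> TT X') \<bullet> (J \<rhd> cc X')"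
    by (rule f) (use l(11) in simp_all)
  show ?thesis unfolding lax_iff[OF X'd] using p z s ll cc by simp
qed

text \<open>Let \<open>B\<close> be classified by \<open>(H, \<beta>)\<close>. The pair \<open>(H, k)\<close> is classified by some \<open>J\<close>, and \<open>\<beta>\<close> lifts
  since \<open>k\<close> is a tangent 2-cell.\<close>

lemma Fo_surj:
  assumes A: "A \<in> obj (VLC X' X)"
  obtains H where "lax X' Z H" "Fo H = A"
proof -
  obtain B k where e: "A = (B, k)" and B: "pointwise_display_bundle X' X B"
    and k: "vertical_linear_connection (homt X' X) B k"
    using A by auto
  obtain H' where H': "lax X' D H'" "bundle_at X' D X Q H' = B"
    using cat_iso_surj[OF tangent_iso_cat_iso[OF DB_iso[OF X']], of B] B by auto
  obtain H \<beta> where h: "H' = (H, \<beta>)" by (metis surj_pair)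
  note v = k[folded H'(2), unfolded connection_at_iff[OF X'd H'(1)], unfolded h fst_conv snd_conv]
  note L = laxD_pair[OF X'd H'(1), unfolded h fst_conv snd_conv]
  note [simp] = X'd L pre_conn_cells(5-7)[OF conjunct1[OF v]]
  obtain J where J: "J \<in> hom1 K (carr X') I" "V \<odot> J = H" "\<kappa> \<lhd> J = k"
    using unique_lift1[OF conjunct1[OF v]] by metis
  note [simp] = J(1)[simplified]
  have VJT: "V \<odot> J \<odot> TT X' = H \<odot> TT X'" using comp1_assoc'[of "TT X'" J V] J(2) by simp
  have \<kappa>TJ: "\<kappa> \<lhd> (TT Z \<odot> J) = (TT X \<rhd> k) \<bullet> (cc X \<lhd> (Tot \<odot> H))"
    using \<kappa>T[THEN arg_cong, of "\<lambda>x. x \<lhd> J"] J by simp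
  have \<kappa>JT: "\<kappa> \<lhd> (J \<odot> TT X') = k \<lhd> TT X'" using whr_comp[of "TT X'" J \<kappa>] J(3) by simp
  obtain \<alpha> where a: "\<alpha> \<in> hom2 K (J \<odot> TT X') (TT Z \<odot> J)" "V \<rhd> \<alpha> = \<beta>"
  proof (rule lift2[of "J \<odot> TT X'" "carr X'" "TT Z \<odot> J" \<beta>])
    show "(Tot \<rhd> \<beta>) \<bullet> (\<kappa> \<lhd> (J \<odot> TT X')) = (\<kappa> \<lhd> (TT Z \<odot> J)) \<bullet> (TT X \<rhd> Tot \<rhd> \<beta>)"
      unfolding \<kappa>TJ \<kappa>JT using v by simp
  qed (simp_all add: VJT J(2))
  have La: "lax X' Z (J, \<alpha>)"
    by (rule lax_reflect[OF J(1) a(1)]) (use H'(1) in \<open>simp add: J(2) a(2) h\<close>)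
  have "Fo (J, \<alpha>) = A"
    unfolding conn_at_U[OF X' La] laxVH(2)[OF X'd La] using J(2,3) a(2) H'(2) by (simp add: h e)
  then show ?thesis using that La by blast
qed

lemma Fo_inj:
  assumes H: "lax X' Z H" and H': "lax X' Z H'" and e: "Fo H = Fo H'"
  shows "H = H'"
proof -
  have e1: "bundle_at X' D X Q (strict_lax Z V \<odot>\<^sub>l H) = bundle_at X' D X Q (strict_lax Z V \<odot>\<^sub>l H')"
    and e2: "\<kappa> \<lhd> fst H = \<kappa> \<lhd> fst H'"
    using e unfolding conn_at_U[OF X' H] conn_at_U[OF X' H'] by simp_all
  have inj: "inj_on (\<lambda>H. bundle_at X' D X Q H) (obj (homt X' D))"
    using tangent_iso_cat_iso[OF DB_iso[OF X']] unfolding cat_iso_def bij_betw_def by blast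
  have "strict_lax Z V \<odot>\<^sub>l H = strict_lax Z V \<odot>\<^sub>l H'"
    using inj_onD[OF inj e1] laxVH(1)[OF X'd H] laxVH(1)[OF X'd H'] by simp
  then have e3: "V \<odot> fst H = V \<odot> fst H'" "V \<rhd> snd H = V \<rhd> snd H'"
    unfolding laxVH(2)[OF X'd H] laxVH(2)[OF X'd H'] by simp_all
  note [simp] = X'd laxD_pair[OF X'd H, unfolded carrZ] laxD_pair[OF X'd H', unfolded carrZ]
  have h: "fst H \<in> hom1 K (carr X') I" "fst H' \<in> hom1 K (carr X') I" by simp_all
  have f: "fst H = fst H'" using unique_lift1[OF pre_conn_whr[OF h(1)]] e3(1) e2 h by metis
  have "snd H = snd H'" by (rule induced_faithful[OF comp]) (use e3(2) f in simp_all)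
  then show ?thesis using f by (simp add: prod_eq_iff)
qed

lemma Fa_hom:
  assumes H: "lax X' Z H" and H': "lax X' Z H'" and \<phi>: "\<phi> \<in> hom (homt X' Z) H H'"
  shows "Fa \<phi> \<in> hom (VLC X' X) (Fo H) (Fo H')"
proof -
  note [simp] = X'd laxD_pair[OF X'd H, unfolded carrZ] laxD_pair[OF X'd H', unfolded carrZ]
  have c: "\<phi> \<in> cells2 K" "dom2 K \<phi> = fst H" "cod2 K \<phi> = fst H'" using \<phi> by simp_all
  note [simp] = c
  have 1: "V \<rhd> \<phi> \<in> hom (homt X' D) (strict_lax Z V \<odot>\<^sub>l H) (strict_lax Z V \<odot>\<^sub>l H')"
    by (rule hom_homt_strict[OF stV Zd data(2) X'd H H' \<phi>])
  from cat_iso_hom[OF tangent_iso_cat_iso[OF DB_iso[OF X']] _ _ this]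
  have 2: "(Bas \<rhd> V \<rhd> \<phi>, Tot \<rhd> V \<rhd> \<phi>) \<in> linear_morphisms (homt X' X) (bundle_at X' D X Q
    (strict_lax Z V \<odot>\<^sub>l H)) (bundle_at X' D X Q (strict_lax Z V \<odot>\<^sub>l H'))"
    using laxVH(1)[OF X'd H] laxVH(1)[OF X'd H'] by simp
  have 3: "(Tot \<rhd> V \<rhd> \<phi>) \<bullet> (\<kappa> \<lhd> fst H) = (\<kappa> \<lhd> fst H') \<bullet> (TT X \<rhd> Tot \<rhd> V \<rhd> \<phi>)"
    using nat_eq[of \<kappa> "TT X \<odot> Tot \<odot> V" "Tot \<odot> V" \<phi> "fst H" "fst H'"] by simp
  show ?thesis unfolding conn_at_U[OF X' H] conn_at_U[OF X' H'] using 2 3 by simp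
qed

lemma Fa_inj:
  assumes H: "lax X' Z H" and H': "lax X' Z H'" and \<phi>: "\<phi> \<in> hom (homt X' Z) H H'"
    "\<psi> \<in> hom (homt X' Z) H H'" and e: "Fa \<phi> = Fa \<psi>"
  shows "\<phi> = \<psi>"
proof -
  note [simp] = X'd laxD_pair[OF X'd H, unfolded carrZ] laxD_pair[OF X'd H', unfolded carrZ]
  have c: "\<phi> \<in> cells2 K" "dom2 K \<phi> = fst H" "cod2 K \<phi> = fst H'" "\<psi> \<in> cells2 K" "dom2 K \<psi> = fst H"
    "cod2 K \<psi> = fst H'" using \<phi> by simp_all
  note [simp] = c
  have e': "(Bas \<rhd> V \<rhd> \<phi>, Tot \<rhd> V \<rhd> \<phi>) = (Bas \<rhd> V \<rhd> \<psi>, Tot \<rhd> V \<rhd> \<psi>)" using e by simp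
  have "V \<rhd> \<phi> = V \<rhd> \<psi>"
    by (rule cat_iso_inj[OF tangent_iso_cat_iso[OF DB_iso[OF X']] _ _ hom_homt_strict[OF stV Zd
      data(2) X'd H H' \<phi>(1)] hom_homt_strict[OF stV Zd data(2) X'd H H' \<phi>(2)] e'])
      (use laxVH(1)[OF X'd H] laxVH(1)[OF X'd H'] in simp_all)
  then show ?thesis by - (rule induced_faithful[OF comp], simp_all)
qed

lemma Fa_surj:
  assumes H: "lax X' Z H" and H': "lax X' Z H'" and \<psi>: "\<psi> \<in> hom (VLC X' X) (Fo H) (Fo H')"
  obtains \<phi> where "\<phi> \<in> hom (homt X' Z) H H'" "Fa \<phi> = \<psi>"
proof -
  note [simp] = X'd laxD_pair[OF X'd H, unfolded carrZ] laxD_pair[OF X'd H', unfolded carrZ]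
  have 1: "\<psi> \<in> linear_morphisms (homt X' X) (bundle_at X' D X Q (strict_lax Z V \<odot>\<^sub>l H))
    (bundle_at X' D X Q (strict_lax Z V \<odot>\<^sub>l H'))"
    and 2: "snd \<psi> \<bullet> (\<kappa> \<lhd> fst H) = (\<kappa> \<lhd> fst H') \<bullet> (TT X \<rhd> snd \<psi>)"
    using \<psi> unfolding conn_at_U[OF X' H] conn_at_U[OF X' H'] by auto
  obtain \<sigma> where s: "\<sigma> \<in> hom (homt X' D) (strict_lax Z V \<odot>\<^sub>l H) (strict_lax Z V \<odot>\<^sub>l H')"
    "(Bas \<rhd> \<sigma>, Tot \<rhd> \<sigma>) = \<psi>"
    by (rule cat_iso_full[OF tangent_iso_cat_iso[OF DB_iso[OF X']], of "strict_lax Z V \<odot>\<^sub>l H"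
      "strict_lax Z V \<odot>\<^sub>l H'" \<psi>])
      (use 1 laxVH(1)[OF X'd H] laxVH(1)[OF X'd H'] in simp_all)
  have c: "\<sigma> \<in> cells2 K" "dom2 K \<sigma> = V \<odot> fst H" "cod2 K \<sigma> = V \<odot> fst H'"
    and t: "(TT D \<rhd> \<sigma>) \<bullet> (V \<rhd> snd H) = (V \<rhd> snd H') \<bullet> (\<sigma> \<lhd> TT X')"
    using s(1) unfolding laxVH(2)[OF X'd H] laxVH(2)[OF X'd H'] by simp_all
  note [simp] = c
  obtain \<phi> where p: "\<phi> \<in> hom2 K (fst H) (fst H')" "V \<rhd> \<phi> = \<sigma>"
    by (rule lift2[of "fst H" "carr X'" "fst H'" \<sigma>]) (use 2 s(2) in auto)
  note [simp] = p(1)[simplified]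
  have "(TT Z \<rhd> \<phi>) \<bullet> snd H = snd H' \<bullet> (\<phi> \<lhd> TT X')"
  proof (rule induced_faithful[OF comp])
    have "V \<rhd> (\<phi> \<lhd> TT X') = \<sigma> \<lhd> TT X'" using p(2)[THEN arg_cong, of "\<lambda>x. x \<lhd> TT X'"] by simp
    then show "V \<rhd> ((TT Z \<rhd> \<phi>) \<bullet> snd H) = V \<rhd> (snd H' \<bullet> (\<phi> \<lhd> TT X'))" using t p(2) by simp
  qed simp_all
  then have "\<phi> \<in> hom (homt X' Z) H H'" by simp
  moreover have "Fa \<phi> = \<psi>" using p(2) s(2) by simp
  ultimately show ?thesis using that by blast
qed

lemma cat_iso_U: "cat_iso (homt X' Z) (VLC X' X) Fo Fa"
  unfolding cat_iso_def
proof (intro conjI ballI)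
  show "bij_betw Fo (obj (homt X' Z)) (obj (VLC X' X))"
    unfolding bij_betw_def inj_on_def
  proof (intro conjI set_eqI iffI ballI impI)
    fix A assume "A \<in> obj (VLC X' X)"
    then obtain H where "lax X' Z H" "Fo H = A" by (rule Fo_surj)
    then show "A \<in> Fo ` obj (homt X' Z)" by force
  qed (use Fo_inj Fo_obj in \<open>auto simp del: VLC_sel\<close>)
  fix H assume "H \<in> obj (homt X' Z)"
  then have H: "lax X' Z H" by simp
  note [simp] = X'd laxD_pair[OF X'd H, unfolded carrZ]
  show "Fa (idm (homt X' Z) H) = idm (VLC X' X) (Fo H)"
    unfolding conn_at_U[OF X' H] using dE_at[OF X'd laxVH(1)[OF X'd H]] laxVH(2)[OF X'd H] by simp
  fix H' assume "H' \<in> obj (homt X' Z)"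
  then have H': "lax X' Z H'" by simp
  note [simp] = laxD_pair[OF X'd H', unfolded carrZ]
  show "bij_betw Fa (hom (homt X' Z) H H') (hom (VLC X' X) (Fo H) (Fo H'))"
    unfolding bij_betw_def
  proof
    show "inj_on Fa (hom (homt X' Z) H H')" by (intro inj_onI Fa_inj[OF H H'])
    show "Fa ` hom (homt X' Z) H H' = hom (VLC X' X) (Fo H) (Fo H')"
    proof (intro set_eqI iffI)
      fix \<psi> assume "\<psi> \<in> hom (VLC X' X) (Fo H) (Fo H')"
      then obtain \<phi> where "\<phi> \<in> hom (homt X' Z) H H'" "Fa \<phi> = \<psi>" by (rule Fa_surj[OF H H'])
      then show "\<psi> \<in> Fa ` hom (homt X' Z) H H'" by (intro image_eqI[of _ _ \<phi>]) simp_all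
    next
      fix \<psi> assume "\<psi> \<in> Fa ` hom (homt X' Z) H H'"
      then show "\<psi> \<in> hom (VLC X' X) (Fo H) (Fo H')" using Fa_hom[OF H H'] by blast
    qed
  qed
  fix H'' \<phi> \<psi> assume "H'' \<in> obj (homt X' Z)" and p: "\<phi> \<in> hom (homt X' Z) H H'"
    "\<psi> \<in> hom (homt X' Z) H' H''"
  then show "Fa (\<psi> \<cdot>\<^bsub>homt X' Z\<^esub> \<phi>) = Fa \<psi> \<cdot>\<^bsub>VLC X' X\<^esub> Fa \<phi>" by simp
qed

lemma Fo_tob:
  assumes H: "lax X' Z H"
  shows "Fo (tan_T Z H) = tangent_conn (homt X' X) (Fo H)"
proof -
  note [simp] = X'd laxD_pair[OF X'd H, unfolded carrZ]
  have LT: "lax X' Z (tan_T Z H)" by (rule tan_T_lax[OF Z X'd H])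
  have 1: "strict_lax Z V \<odot>\<^sub>l tan_T Z H = tan_T D (strict_lax Z V \<odot>\<^sub>l H)"
    by (rule strict_tan_T[OF stV Zd D X'd H Z])
  have 2: "bundle_at X' D X Q (tan_T D (strict_lax Z V \<odot>\<^sub>l H)) = tangent_bundle (homt X' X)
    (bundle_at X' D X Q (strict_lax Z V \<odot>\<^sub>l H))"
    using tangent_iso_tob[OF DB_iso[OF X'], of "strict_lax Z V \<odot>\<^sub>l H"] laxVH(1)[OF X'd H] by simp
  have 3: "fst (tan_T Z H) = TT Z \<odot> fst H" by (simp add: tan_T_def split: prod.splits)
  have 4: "\<kappa> \<lhd> (TT Z \<odot> fst H) = (TT X \<rhd> (\<kappa> \<lhd> fst H)) \<bullet> (cc X \<lhd> (Tot \<odot> V \<odot> fst H))"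
    using \<kappa>T[THEN arg_cong, of "\<lambda>x. x \<lhd> fst H"] by simp
  show ?thesis
    unfolding conn_at_U[OF X' H] conn_at_U[OF X' LT] tangent_conn_def prod.case 1 2 3 4
    using dE_at[OF X'd laxVH(1)[OF X'd H]] laxVH(2)[OF X'd H] by simp
qed

lemma Fo_sel:
  assumes H: "lax X' Z H"
  shows "fst (dM (fst (Fo H))) = Bas \<odot> V \<odot> fst H" "fst (dE (fst (Fo H))) = Tot \<odot> V \<odot> fst H"
    "dM (fst (Fo H)) = strict_lax Z (Bas \<odot> V) \<odot>\<^sub>l H"
      "dE (fst (Fo H)) = strict_lax Z (Tot \<odot> V) \<odot>\<^sub>l H"
proof -
  note a = strict_lax_strict_lax[OF stBas data(2,1) stV Zd] strict_lax_strict_lax[OF stTot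
    data(2,1) stV Zd]
  have l: "lax D X (strict_lax D Bas)" "lax D X (strict_lax D Tot)" using stBas stTot
    unfolding strict_def .
  show 1: "dM (fst (Fo H)) = strict_lax Z (Bas \<odot> V) \<odot>\<^sub>l H"
    "dE (fst (Fo H)) = strict_lax Z (Tot \<odot> V) \<odot>\<^sub>l H"
    unfolding conn_at_U[OF X' H]
    using lcomp_assoc[OF Zd data(2,1) l(1) laxV H X'd] lcomp_assoc[OF Zd data(2,1) l(2) laxV H X'd]
      a(1,3) QD by simp_all
  note [simp] = X'd laxD_pair[OF X'd H, unfolded carrZ]
  show "fst (dM (fst (Fo H))) = Bas \<odot> V \<odot> fst H" "fst (dE (fst (Fo H))) = Tot \<odot> V \<odot> fst H"
    unfolding 1 by (simp_all add: strict_lax_def)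
qed

text \<open>The pullbacks of \<open>[X' | Z]\<close> are those of 1-cells, and both \<open>Bas V\<close> and \<open>Tot V\<close> preserve them.
  Their images under the isomorphism of categories are therefore componentwise.\<close>

lemma componentwise_U: "componentwise_Tn (homt X' X) (VLC X' X) (dM \<circ> fst) (dE \<circ> fst)"
  unfolding componentwise_Tn_def is_nfold_iff_wide_pb
proof (intro ballI allI impI)
  fix A n assume "A \<in> obj (VLC X' X)" and n: "1 \<le> (n::nat)"
  then obtain H where H: "lax X' Z H" and A: "A = Fo H" by (metis Fo_surj)
  note [simp] = X'd laxD_pair[OF X'd H, unfolded carrZ]
  obtain P \<pi> where W: "wide_pb (homt X' Z) n (\<lambda>_. tan_T Z H) H (\<lambda>_. pp Z \<lhd> fst H) P \<pi>"
    using homt_ex_Tn[OF X' Z H n] .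
  have P: "lax X' Z P" using wide_pbD(1)[OF W] by simp
  have LT: "lax X' Z (tan_T Z H)" by (rule tan_T_lax[OF Z X'd H])
  have T: "Tn_at Z (carr X') (fst H) n (fst P) \<pi>" by (rule homt_Tn[OF X' Z H W])
  have fp: "Fa (pp Z \<lhd> fst H) = tp (VLC X' X) A"
    using Fo_sel(1,2)[OF H] by (simp add: A split_beta)
  have "wide_pb (VLC X' X) n (\<lambda>_. Fo (tan_T Z H)) (Fo H) (\<lambda>_. Fa (pp Z \<lhd> fst H)) (Fo P)
    (\<lambda>i. Fa (\<pi> i))"
    using cat_iso_wide_pb[OF cat_iso_U category_homt[OF X'd Zd] W] .
  then have 1: "wide_pb (VLC X' X) n (\<lambda>_. tob (VLC X' X) A) A (\<lambda>_. tp (VLC X' X) A) (Fo P)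
    (\<lambda>i. Fa (\<pi> i))"
    unfolding fp using Fo_tob[OF H] by (simp add: A)
  have c: "wide_pb (homt X' X) n (\<lambda>_. tan_T X (strict_lax Z F \<odot>\<^sub>l H)) (strict_lax Z F \<odot>\<^sub>l H)
    (\<lambda>_. pp X \<lhd> fst (strict_lax Z F \<odot>\<^sub>l H))
      (strict_lax Z F \<odot>\<^sub>l P) (\<lambda>i. F \<rhd> \<pi> i)" if F: "pres_Tn Z X F" for F
  proof -
    have st: "strict Z X F" using F unfolding pres_Tn_def by blast
    note HH = strict_lax_lcomp_pair[OF st Zd data(1) X'd H]
      and PP = strict_lax_lcomp_pair[OF st Zd data(1) X'd P]
    show ?thesis
    proof (rule Tn_at_wide_pb_homt[OF X' X HH(2)])
      show "Tn_at X (carr X') (fst (strict_lax Z F \<odot>\<^sub>l H)) n (fst (strict_lax Z F \<odot>\<^sub>l P))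
        (\<lambda>i. F \<rhd> \<pi> i)"
        unfolding HH PP fst_conv by (rule pres_Tn_at[OF F Zd data(1) T])
      show "lax X' X (strict_lax Z F \<odot>\<^sub>l P)" by (rule PP(2))
      show "F \<rhd> \<pi> i \<in> hom (homt X' X) (strict_lax Z F \<odot>\<^sub>l P) (tan_T X (strict_lax Z F \<odot>\<^sub>l H))"
        if "i < n" for i
        unfolding strict_tan_T[OF st Zd X X'd H Z, symmetric]
        by (rule hom_homt_strict[OF st Zd data(1) X'd P LT]) (use wide_pbD(6)[OF W that] in simp)
    qed
  qed
  show "\<exists>P p. wide_pb (VLC X' X) n (\<lambda>_. tob (VLC X' X) A) A (\<lambda>_. tp (VLC X' X) A) P p \<and>
       wide_pb (homt X' X) n (\<lambda>_. tob (homt X' X) ((dM \<circ> fst) A)) ((dM \<circ> fst) A)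
         (\<lambda>_. tp (homt X' X) ((dM \<circ> fst) A)) ((dM \<circ> fst) P) (\<lambda>i. fst (p i)) \<and>
       wide_pb (homt X' X) n (\<lambda>_. tob (homt X' X) ((dE \<circ> fst) A)) ((dE \<circ> fst) A)
         (\<lambda>_. tp (homt X' X) ((dE \<circ> fst) A)) ((dE \<circ> fst) P) (\<lambda>i. snd (p i))"
  proof (rule exI[of _ "Fo P"], rule exI[of _ "\<lambda>i. Fa (\<pi> i)"], intro conjI)
    show "wide_pb (VLC X' X) n (\<lambda>_. tob (VLC X' X) A) A (\<lambda>_. tp (VLC X' X) A) (Fo P) (\<lambda>i. Fa (\<pi> i))"
      by (rule 1)
    show "wide_pb (homt X' X) n (\<lambda>_. tob (homt X' X) ((dM \<circ> fst) A)) ((dM \<circ> fst) A)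
      (\<lambda>_. tp (homt X' X) ((dM \<circ> fst) A)) ((dM \<circ> fst) (Fo P)) (\<lambda>i. fst (Fa (\<pi> i)))"
      unfolding A o_apply Fo_sel(3)[OF H] Fo_sel(3)[OF P] fst_conv homt_sel
        by (rule c[OF induced_pres_Tn_Tot(2)[OF comp]])
    show "wide_pb (homt X' X) n (\<lambda>_. tob (homt X' X) ((dE \<circ> fst) A)) ((dE \<circ> fst) A)
      (\<lambda>_. tp (homt X' X) ((dE \<circ> fst) A)) ((dE \<circ> fst) (Fo P)) (\<lambda>i. snd (Fa (\<pi> i)))"
      unfolding A o_apply Fo_sel(4)[OF H] Fo_sel(4)[OF P] snd_conv homt_sel
        by (rule c[OF induced_pres_Tn_Tot(1)[OF comp]])
  qed
qed

text \<open>Sums in \<open>[X' | Z]\<close> and \<open>[X' | X]\<close> are sums of 2-cells, and \<open>Bas V\<close> and \<open>Tot V\<close> preserve sums.\<close>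

lemma Fa_ts:
  assumes H: "lax X' Z H"
  shows "Fa (ts (homt X' Z) H) = tplus (VLC X' X) (Fo H) (Fo (kp0 (homt X' Z) (tan_T Z H) H
    (pp Z \<lhd> fst H)))
            (Fa (kp1 (homt X' Z) (tan_T Z H) H (pp Z \<lhd> fst H)))
              (Fa (kp2 (homt X' Z) (tan_T Z H) H (pp Z \<lhd> fst H)))"
proof -
  note [simp] = X'd laxD_pair[OF X'd H, unfolded carrZ]
  define P where "P = kp0 (homt X' Z) (tan_T Z H) H (pp Z \<lhd> fst H)"
  define a where "a = kp1 (homt X' Z) (tan_T Z H) H (pp Z \<lhd> fst H)"
  define b where "b = kp2 (homt X' Z) (tan_T Z H) H (pp Z \<lhd> fst H)"
  have pb: "is_pb (homt X' Z) (tan_T Z H) (tan_T Z H) H (pp Z \<lhd> fst H) (pp Z \<lhd> fst H) P a b"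
    using homt_kpair_pb[OF X' Z H] unfolding P_def a_def b_def .
  have P: "lax X' Z P" using is_pbD(6)[OF pb] by simp
  have fT: "fst (tan_T Z H) = TT Z \<odot> fst H" by (simp add: tan_T_def split: prod.splits)
  have ab: "a \<in> hom (homt X' Z) P (tan_T Z H)" "b \<in> hom (homt X' Z) P (tan_T Z H)"
    and pab: "(pp Z \<lhd> fst H) \<bullet> a = (pp Z \<lhd> fst H) \<bullet> b"
    using is_pbD(7-9)[OF pb] by (simp_all del: hom_homt)
  have [simp]: "a \<in> cells2 K" "dom2 K a = fst P" "cod2 K a = TT Z \<odot> fst H" "b \<in> cells2 K"
    "dom2 K b = fst P" "cod2 K b = TT Z \<odot> fst H"
    using ab fT by simp_all
  note [simp] = laxD_pair[OF X'd P, unfolded carrZ]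
  have ad: "addable Z (fst H) a b" by (rule homt_addable[OF X'd Zd H ab pab])
  let ?D = "VLC X' X" and ?A = "Fo H"
  define p where "p = tp ?D ?A"
  have fp: "Fa (pp Z \<lhd> fst H) = p"
    using Fo_sel(1,2)[OF H] by (simp add: p_def split_beta)
  have "is_pb ?D (Fo (tan_T Z H)) (Fo (tan_T Z H)) ?A (Fa (pp Z \<lhd> fst H)) (Fa (pp Z \<lhd> fst H)) (Fo P)
    (Fa a) (Fa b)"
    using cat_iso_wide_pb[OF cat_iso_U category_homt[OF X'd Zd], of 2 "\<lambda>_. tan_T Z H" H
      "\<lambda>_. pp Z \<lhd> fst H" P "two a b"] pb
    by (simp add: wide_pb_const_2_iff)
  then have pbV: "is_pb ?D (tob ?D ?A) (tob ?D ?A) ?A p p (Fo P) (Fa a) (Fa b)"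
    unfolding fp using Fo_tob[OF H] by simp
  let ?k0 = "kp0 ?D (tob ?D ?A) ?A p" and ?k1 = "kp1 ?D (tob ?D ?A) ?A p"
    and ?k2 = "kp2 ?D (tob ?D ?A) ?A p"
  have pbK: "is_pb ?D (tob ?D ?A) (tob ?D ?A) ?A p p ?k0 ?k1 ?k2" by (rule is_pb_kpair[OF pbV])
  define h where "h = pair ?D (Fo P) ?k0 ?k1 ?k2 (Fa a) (Fa b)"
  have h: "h \<in> hom ?D (Fo P) ?k0" "?k1 \<cdot>\<^bsub>?D\<^esub> h = Fa a" "?k2 \<cdot>\<^bsub>?D\<^esub> h = Fa b"
    unfolding h_def using pair_props[OF pbK, of "Fo P" "Fa a" "Fa b"] is_pbD(6-9)[OF pbV] by blast+
  have cmpD: "f \<cdot>\<^bsub>?D\<^esub> g = (fst f \<bullet> fst g, snd f \<bullet> snd g)" for f g by (simp split: prod.splits)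
  have homD: "fst f \<in> hom (homt X' X) (dM (fst B)) (dM (fst B'))"
    "snd f \<in> hom (homt X' X) (dE (fst B)) (dE (fst B'))"
    if "f \<in> hom ?D B B'" for f B B'
    using that by (auto simp: linear_morphisms_def simp del: hom_homt split: prod.splits)
  have objD: "lax X' X (dM (fst B))" "lax X' X (dE (fst B))" if "B \<in> obj ?D" for B
    using that pointwise_display_bundleD(1,2)[of X' X "fst B"] by auto
  have A: "?A \<in> obj ?D" and k0: "?k0 \<in> obj ?D" using is_pbD(3,6)[OF pbK] .
  have tA: "dM (fst (tob ?D ?A)) = tan_T X (dM (fst ?A))"
    "dE (fst (tob ?D ?A)) = tan_T X (dE (fst ?A))"
    by (simp_all add: tangent_conn_def split: prod.splits)
  have k1: "fst ?k1 \<in> hom (homt X' X) (dM (fst ?k0)) (tan_T X (dM (fst ?A)))"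
    "snd ?k1 \<in> hom (homt X' X) (dE (fst ?k0)) (tan_T X (dE (fst ?A)))"
    and k2: "fst ?k2 \<in> hom (homt X' X) (dM (fst ?k0)) (tan_T X (dM (fst ?A)))"
      "snd ?k2 \<in> hom (homt X' X) (dE (fst ?k0)) (tan_T X (dE (fst ?A)))"
    using homD[OF is_pbD(7)[OF pbK]] homD[OF is_pbD(8)[OF pbK]] unfolding tA by blast+
  have pA: "p = (pp X \<lhd> fst (dM (fst ?A)), pp X \<lhd> fst (dE (fst ?A)))" unfolding p_def
    by (simp split: prod.splits)
  have pk: "(pp X \<lhd> fst (dM (fst ?A))) \<bullet> fst ?k1 = (pp X \<lhd> fst (dM (fst ?A))) \<bullet> fst ?k2"
    "(pp X \<lhd> fst (dE (fst ?A))) \<bullet> snd ?k1 = (pp X \<lhd> fst (dE (fst ?A))) \<bullet> snd ?k2"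
    using is_pbD(9)[OF pbK] unfolding cmpD by (simp_all add: pA)
  have ts: "ts ?D ?A = (tsum X (fst (dM (fst ?A))) (fst ?k1) (fst ?k2), tsum X (fst (dE (fst ?A)))
    (snd ?k1) (snd ?k2))"
    unfolding VLC_def ts_conn_tcat Let_def
    unfolding VLC_def[symmetric] p_def[symmetric]
    using tplus_homt[OF X' X objD(1)[OF A] objD(1)[OF k0] k1(1) k2(1) pk(1)]
      tplus_homt[OF X' X objD(2)[OF A] objD(2)[OF k0] k1(2) k2(2) pk(2)] by simp
  have ad1: "addable X (fst (dM (fst ?A))) (fst ?k1) (fst ?k2)"
    "addable X (fst (dE (fst ?A))) (snd ?k1) (snd ?k2)"
    using homt_addable[OF X'd data(1) objD(1)[OF A] k1(1) k2(1) pk(1)] homt_addable[OF X'd data(1)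
      objD(2)[OF A] k1(2) k2(2) pk(2)] .
  have hc: "fst h \<in> cells2 K" "cod2 K (fst h) = dom2 K (fst ?k1)" "snd h \<in> cells2 K"
    "cod2 K (snd h) = dom2 K (snd ?k1)"
    using homD[OF h(1)] k1 by simp_all
  have "tplus ?D ?A (Fo P) (Fa a) (Fa b) = ts ?D ?A \<cdot>\<^bsub>?D\<^esub> h"
    unfolding tplus_def plus_over_def h_def p_def ..
  also have "\<dots> = (tsum X (fst (dM (fst ?A))) (fst ?k1) (fst ?k2) \<bullet> fst h, tsum X (fst (dE (fst ?A)))
    (snd ?k1) (snd ?k2) \<bullet> snd h)"
    unfolding cmpD ts by simp
  also have "\<dots> = (tsum X (fst (dM (fst ?A))) (fst (?k1 \<cdot>\<^bsub>?D\<^esub> h)) (fst (?k2 \<cdot>\<^bsub>?D\<^esub> h)), tsum X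
    (fst (dE (fst ?A))) (snd (?k1 \<cdot>\<^bsub>?D\<^esub> h)) (snd (?k2 \<cdot>\<^bsub>?D\<^esub> h)))"
    unfolding cmpD fst_conv snd_conv tsum_comp[OF data(1) ad1(1) hc(1,2)]
      tsum_comp[OF data(1) ad1(2) hc(3,4)] ..
  also have "\<dots> = (tsum X (Bas \<odot> V \<odot> fst H) (Bas \<rhd> V \<rhd> a) (Bas \<rhd> V \<rhd> b), tsum X (Tot \<odot> V \<odot> fst H)
    (Tot \<rhd> V \<rhd> a) (Tot \<rhd> V \<rhd> b))"
    unfolding h(2,3) Fo_sel(1,2)[OF H] by simp
  also have "\<dots> = Fa (tsum Z (fst H) a b)"
  proof -
    have aV: "addable D (V \<odot> fst H) (V \<rhd> a) (V \<rhd> b)"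
      "V \<rhd> tsum Z (fst H) a b = tsum D (V \<odot> fst H) (V \<rhd> a) (V \<rhd> b)"
      using strict_tsum[OF stV Zd data(2) ad] .
    show ?thesis using ad aV strict_tsum(2)[OF stTot data(2,1) aV(1)]
      strict_tsum(2)[OF stBas data(2,1) aV(1)] by simp
  qed
  finally show ?thesis unfolding ts_homt[OF X' Z H] P_def a_def b_def ..
qed

lemma tangent_iso_U: "tangent_iso (homt X' Z) (VLC X' X) Fo Fa"
proof (rule cat_iso_tangent_isoI[OF cat_iso_U])
  fix H assume "H \<in> obj (homt X' Z)"
  then have H: "lax X' Z H" by simp
  note [simp] = X'd laxD_pair[OF X'd H, unfolded carrZ]
  show "Fo (tob (homt X' Z) H) = tob (VLC X' X) (Fo H)" using Fo_tob[OF H] by simp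
  show "Fa (tp (homt X' Z) H) = tp (VLC X' X) (Fo H)" "Fa (tz (homt X' Z) H) = tz (VLC X' X) (Fo H)"
    "Fa (tcat.tl (homt X' Z) H) = tcat.tl (VLC X' X) (Fo H)"
      "Fa (tc (homt X' Z) H) = tc (VLC X' X) (Fo H)"
    using Fo_sel(1,2)[OF H] by (simp_all add: split_beta)
  show "Fa (ts (homt X' Z) H) = tplus (VLC X' X) (Fo H) (Fo (kp0 (homt X' Z) (tob (homt X' Z) H) H
    (tp (homt X' Z) H)))
            (Fa (kp1 (homt X' Z) (tob (homt X' Z) H) H (tp (homt X' Z) H)))
              (Fa (kp2 (homt X' Z) (tob (homt X' Z) H) H (tp (homt X' Z) H)))"
    using Fa_ts[OF H] by (simp del: V_simps Tot_simps Bas_simps whl_comp)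
  fix H' \<phi> assume "H' \<in> obj (homt X' Z)" "\<phi> \<in> hom (homt X' Z) H H'"
  then show "Fa (tar (homt X' Z) \<phi>) = tar (VLC X' X) (Fa \<phi>)" by simp
qed

end

theorem is_VLC_universal: "is_VLC X Z U"
  unfolding is_VLC_def Fa_U using Z U_obj componentwise_U tangent_iso_U by blast

end

section \<open>The construction of vertical linear connections\<close>

context two_category
begin

text \<open>Each equifier yields the next stage. Induced structures exist at every stage, and the
  projections between stages are strict for any choice of them. Conversely, strictness of these
  projections and the condition on \<open>K0\<close> make \<open>V4\<close> strict and \<open>K4\<close> a tangent 2-cell.\<close>

theorem admits_VLC_equifier:
  assumes X: "tangentad X" and DB: "is_DB X D Bas Tot Q"
    and I0: "is_inserter (carr D) (carr X) (TT X \<odot> Tot) Tot I0 V0 K0"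
    and E1: "is_equifier I0 (carr X) (Tot \<odot> V0) (Tot \<odot> V0) (K0 \<bullet> (dl Q \<lhd> V0))
      (id2 K (Tot \<odot> V0)) E1 W1"
    and V1: "V1 = V0 \<odot> W1" and K1: "K1 = K0 \<lhd> W1"
    and E2: "is_equifier E1 (carr X) (TT X \<odot> Tot \<odot> V1) (Bas \<odot> V1) ((dq Q \<lhd> V1) \<bullet> K1)
               ((dq Q \<lhd> V1) \<bullet> (pp X \<lhd> (Tot \<odot> V1))) E2 W2"
    and V2: "V2 = V1 \<odot> W2" and K2: "K2 = K1 \<lhd> W2"
    and E3: "is_equifier E2 (carr X) (TT X \<odot> Tot \<odot> V2) (TT X \<odot> Tot \<odot> V2) ((dl Q \<lhd> V2) \<bullet> K2)
               ((TT X \<rhd> K2) \<bullet> (ll X \<lhd> (Tot \<odot> V2))) E3 W3"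
    and V3: "V3 = V2 \<odot> W3" and K3: "K3 = K2 \<lhd> W3"
    and E4: "is_equifier E3 (carr X) (TT X \<odot> Tot \<odot> V3) (TT X \<odot> Tot \<odot> V3) ((dl Q \<lhd> V3) \<bullet> K3)
               ((TT X \<rhd> K3) \<bullet> (cc X \<lhd> (Tot \<odot> V3)) \<bullet> (TT X \<rhd> (dl Q \<lhd> V3))) E4 W4"
    and V4: "V4 = V3 \<odot> W4" and K4: "K4 = K3 \<lhd> W4"
  shows "\<exists>X0 X1 X2 X3 X4. induced_tangent_structures X D Tot I0 V0 K0 E1 W1 E2 W2 E3 W3 E4 W4 X0
    X1 X2 X3 X4"
    and "induced_tangent_structures X D Tot I0 V0 K0 E1 W1 E2 W2 E3 W3 E4 W4 X0 X1 X2 X3 X4 \<Longrightarrow>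
      is_VLC X X4 (bundle_at X4 D X Q (strict_lax X4 V4), K4)"
proof -
  interpret B: bundle_data K X D Bas Tot "dq Q" "dl Q" by (rule is_DB_bundle_data[OF X DB])
  have num: "Suc 0 = 1" "Suc 1 = 2" "Suc 2 = 3" "Suc 3 = 4" by simp_all
  interpret S0: stage K X D Bas Tot "dq Q" "dl Q" 0 I0 V0 K0 by (rule B.stage_inserter[OF I0])
  have "stage K X D Bas Tot (dq Q) (dl Q) (Suc 0) E1 V1 K1"
    unfolding V1 K1
  proof (rule S0.stage_equifier[OF E1])
    fix Y J assume J: "J \<in> hom1 K Y I0"
    note [simp] = J[simplified]
    show "B.vlc_eqs (Suc 0) (V0 \<odot> J) (K0 \<lhd> J) \<longleftrightarrow> (K0 \<bullet> (dl Q \<lhd> V0)) \<lhd> J = id2 K (Tot \<odot> V0) \<lhd> J"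
      unfolding B.vlc_eqs_def by simp
  qed
  then interpret S1: stage K X D Bas Tot "dq Q" "dl Q" 1 E1 V1 K1 unfolding num .
  have "stage K X D Bas Tot (dq Q) (dl Q) (Suc 1) E2 V2 K2"
    unfolding V2 K2
  proof (rule S1.stage_equifier[OF E2])
    fix Y J assume J: "J \<in> hom1 K Y E1" and e: "B.vlc_eqs 1 (V1 \<odot> J) (K1 \<lhd> J)"
    note [simp] = J[simplified]
    show "B.vlc_eqs (Suc 1) (V1 \<odot> J) (K1 \<lhd> J) \<longleftrightarrow>
      ((dq Q \<lhd> V1) \<bullet> K1) \<lhd> J = ((dq Q \<lhd> V1) \<bullet> (pp X \<lhd> (Tot \<odot> V1))) \<lhd> J"
      using B.vlc_eqsD(1)[OF e] unfolding B.vlc_eqs_def by simp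
  qed
  then interpret S2: stage K X D Bas Tot "dq Q" "dl Q" 2 E2 V2 K2 unfolding num .
  have "stage K X D Bas Tot (dq Q) (dl Q) (Suc 2) E3 V3 K3"
    unfolding V3 K3
  proof (rule S2.stage_equifier[OF E3])
    fix Y J assume J: "J \<in> hom1 K Y E2" and e: "B.vlc_eqs 2 (V2 \<odot> J) (K2 \<lhd> J)"
    note [simp] = J[simplified]
    show "B.vlc_eqs (Suc 2) (V2 \<odot> J) (K2 \<lhd> J) \<longleftrightarrow>
      ((dl Q \<lhd> V2) \<bullet> K2) \<lhd> J = ((TT X \<rhd> K2) \<bullet> (ll X \<lhd> (Tot \<odot> V2))) \<lhd> J"
      using B.vlc_eqsD(1,2)[OF e] unfolding B.vlc_eqs_def by simp
  qed
  then interpret S3: stage K X D Bas Tot "dq Q" "dl Q" 3 E3 V3 K3 unfolding num .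
  have "stage K X D Bas Tot (dq Q) (dl Q) (Suc 3) E4 V4 K4"
    unfolding V4 K4
  proof (rule S3.stage_equifier[OF E4])
    fix Y J assume J: "J \<in> hom1 K Y E3" and e: "B.vlc_eqs 3 (V3 \<odot> J) (K3 \<lhd> J)"
    note [simp] = J[simplified]
    have "B.vlc_eqs (Suc 3) (V3 \<odot> J) (K3 \<lhd> J) \<longleftrightarrow> B.vlc_eqs 3 (V3 \<odot> J) (K3 \<lhd> J) \<and>
       (dl Q \<lhd> (V3 \<odot> J)) \<bullet> (K3 \<lhd> J) = (TT X \<rhd> (K3 \<lhd> J)) \<bullet> (cc X \<lhd> (Tot \<odot> V3 \<odot> J)) \<bullet>
         (TT X \<rhd> (dl Q \<lhd> (V3 \<odot> J)))"
      unfolding B.vlc_eqs_def num by (simp del: B.l_cells) blast?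
    then show "B.vlc_eqs (Suc 3) (V3 \<odot> J) (K3 \<lhd> J) \<longleftrightarrow>
      ((dl Q \<lhd> V3) \<bullet> K3) \<lhd> J = ((TT X \<rhd> K3) \<bullet> (cc X \<lhd> (Tot \<odot> V3)) \<bullet> (TT X \<rhd> (dl Q \<lhd> V3))) \<lhd> J"
      using e by simp
  qed
  then interpret S4: stage K X D Bas Tot "dq Q" "dl Q" 4 E4 V4 K4 unfolding num .
  have W: "W1 \<in> hom1 K E1 I0" "W2 \<in> hom1 K E2 E1" "W3 \<in> hom1 K E3 E2" "W4 \<in> hom1 K E4 E3"
    using E1 E2 E3 E4 unfolding is_equifier_def by blast+
  have TotV0: "strict_lax D Tot \<odot>\<^sub>l strict_lax Z V0 = strict_lax Z (Tot \<odot> V0)"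
    if "tang_data Z" "strict Z D V0" for Z
    by (rule strict_lax_strict_lax(1)[OF B.stTot B.data(2,1) that(2,1)])
  have K0: "K0 \<in> hom (homt Z X) (tob (homt Z X) (strict_lax D Tot \<odot>\<^sub>l strict_lax Z V0))
    (strict_lax D Tot \<odot>\<^sub>l strict_lax Z V0) \<longleftrightarrow>
     K0 \<lhd> TT Z = (TT X \<rhd> K0) \<bullet> (cc X \<lhd> (Tot \<odot> V0))" if Z: "tang_data Z" "strict Z D V0" "carr Z
       = I0" for Z
  proof -
    note [simp] = Z(1) strictD(1-6)[OF Z(2,1) B.data(2), unfolded Z(3)] tang_data_cells[OF Z(1),
      unfolded Z(3)]
    show ?thesis unfolding TotV0[OF Z(1,2)] by (auto simp: strict_lax_def tan_T_def)
  qed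
  show "\<exists>X0 X1 X2 X3 X4. induced_tangent_structures X D Tot I0 V0 K0 E1 W1 E2 W2 E3 W3 E4 W4 X0
    X1 X2 X3 X4"
  proof -
    obtain X0 where c0: "B.induced I0 V0 K0 X0" using S0.ex_induced ..
    obtain X1 where c1: "B.induced E1 V1 K1 X1" using S1.ex_induced ..
    obtain X2 where c2: "B.induced E2 V2 K2 X2" using S2.ex_induced ..
    obtain X3 where c3: "B.induced E3 V3 K3 X3" using S3.ex_induced ..
    obtain X4 where c4: "B.induced E4 V4 K4 X4" using S4.ex_induced ..
    have t: "tangentad X0" "tangentad X1" "tangentad X2" "tangentad X3" "tangentad X4"
      using S0.induced_tangentad[OF c0] S1.induced_tangentad[OF c1] S2.induced_tangentad[OF c2]
        S3.induced_tangentad[OF c3] S4.induced_tangentad[OF c4] .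
    have c: "carr X0 = I0" "carr X1 = E1" "carr X2 = E2" "carr X3 = E3" "carr X4 = E4"
      and s0: "strict X0 D V0"
      and k: "K0 \<lhd> TT X0 = (TT X \<rhd> K0) \<bullet> (cc X \<lhd> (Tot \<odot> V0))"
      using c0 c1 c2 c3 c4 unfolding B.induced_def by blast+
    have "strict X1 X0 W1" "strict X2 X1 W2" "strict X3 X2 W3" "strict X4 X3 W4"
      using S0.strict_next[OF W(1) c0 c1[unfolded V1 K1]]
        S1.strict_next[OF W(2) c1 c2[unfolded V2 K2]]
        S2.strict_next[OF W(3) c2 c3[unfolded V3 K3]]
        S3.strict_next[OF W(4) c3 c4[unfolded V4 K4]] .
    then have "induced_tangent_structures X D Tot I0 V0 K0 E1 W1 E2 W2 E3 W3 E4 W4 X0 X1 X2 X3 X4"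
      unfolding induced_tangent_structures_def Let_def
        using t c s0 k K0[of X0] tangentad_tang_data[OF t(1)] by blast
    then show ?thesis by blast
  qed
  show "is_VLC X X4 (bundle_at X4 D X Q (strict_lax X4 V4), K4)"
    if "induced_tangent_structures X D Tot I0 V0 K0 E1 W1 E2 W2 E3 W3 E4 W4 X0 X1 X2 X3 X4"
      for X0 X1 X2 X3 X4
  proof -
    note i = that[unfolded induced_tangent_structures_def Let_def]
    have t: "tangentad X0" "tangentad X1" "tangentad X2" "tangentad X3" "tangentad X4"
      and c: "carr X0 = I0" "carr X1 = E1" "carr X2 = E2" "carr X3 = E3" "carr X4 = E4"
        and s0: "strict X0 D V0"
      and s: "strict X1 X0 W1" "strict X2 X1 W2" "strict X3 X2 W3" "strict X4 X3 W4"
      and k: "K0 \<in> hom (homt X0 X) (tob (homt X0 X) (strict_lax D Tot \<odot>\<^sub>l strict_lax X0 V0))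
        (strict_lax D Tot \<odot>\<^sub>l strict_lax X0 V0)"
      using i by blast+
    note td = t[THEN tangentad_tang_data]
    have c0: "B.induced I0 V0 K0 X0" unfolding B.induced_def
      using td(1) c(1) s0 k K0[OF td(1) s0 c(1)] by blast
    have c1: "B.induced E1 V1 K1 X1" unfolding V1 K1
      by (rule S0.induced_next[OF W(1) c0 td(2) c(2) s(1)])
    have c2: "B.induced E2 V2 K2 X2" unfolding V2 K2
      by (rule S1.induced_next[OF W(2) c1 td(3) c(3) s(2)])
    have c3: "B.induced E3 V3 K3 X3" unfolding V3 K3
      by (rule S2.induced_next[OF W(3) c2 td(4) c(4) s(3)])
    have c4: "B.induced E4 V4 K4 X4" unfolding V4 K4
      by (rule S3.induced_next[OF W(4) c3 td(5) c(5) s(4)])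
    interpret L: vlc_stage K X D Bas Tot Q E4 V4 K4 X4
      by unfold_locales (use DB t(5) c4 in simp_all)
    show ?thesis using L.is_VLC_universal unfolding L.U_def .
  qed
qed

end

theorem theorem5p51:
  fixes K :: "('x, 'm, 'c) twocat"
    and X D :: "('x, 'm, 'c) tstruct"
    and Bas Tot :: 'm
    and Q :: "('m \<times> 'c, 'c) dbun"
    and I0 E1 E2 E3 E4 :: 'x
    and V0 V1 V2 V3 V4 W1 W2 W3 W4 :: 'm
    and K0 K1 K2 K3 K4 :: 'c
  assumes K: "two_category K"
    and X: "two_category.tangentad K X"
    and DB: "two_category.is_DB K X D Bas Tot Q"
    and I0: "two_category.is_inserter K (carr D) (carr X) (TT X \<odot>\<^bsub>K\<^esub> Tot) Tot I0 V0 K0"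
    and E1: "two_category.is_equifier K I0 (carr X) (Tot \<odot>\<^bsub>K\<^esub> V0) (Tot \<odot>\<^bsub>K\<^esub> V0)
               (K0 \<bullet>\<^bsub>K\<^esub> (dl Q \<lhd>\<^bsub>K\<^esub> V0))
               (id2 K (Tot \<odot>\<^bsub>K\<^esub> V0)) E1 W1"
    and V1: "V1 = V0 \<odot>\<^bsub>K\<^esub> W1" and K1: "K1 = K0 \<lhd>\<^bsub>K\<^esub> W1"
    and E2: "two_category.is_equifier K E1 (carr X) (TT X \<odot>\<^bsub>K\<^esub> Tot \<odot>\<^bsub>K\<^esub> V1) (Bas \<odot>\<^bsub>K\<^esub> V1)
               ((dq Q \<lhd>\<^bsub>K\<^esub> V1) \<bullet>\<^bsub>K\<^esub> K1)
               ((dq Q \<lhd>\<^bsub>K\<^esub> V1) \<bullet>\<^bsub>K\<^esub> (pp X \<lhd>\<^bsub>K\<^esub> (Tot \<odot>\<^bsub>K\<^esub> V1))) E2 W2"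
    and V2: "V2 = V1 \<odot>\<^bsub>K\<^esub> W2" and K2: "K2 = K1 \<lhd>\<^bsub>K\<^esub> W2"
    and E3: "two_category.is_equifier K E2 (carr X) (TT X \<odot>\<^bsub>K\<^esub> Tot \<odot>\<^bsub>K\<^esub> V2)
               (TT X \<odot>\<^bsub>K\<^esub> Tot \<odot>\<^bsub>K\<^esub> V2)
               ((dl Q \<lhd>\<^bsub>K\<^esub> V2) \<bullet>\<^bsub>K\<^esub> K2)
               ((TT X \<rhd>\<^bsub>K\<^esub> K2) \<bullet>\<^bsub>K\<^esub> (ll X \<lhd>\<^bsub>K\<^esub> (Tot \<odot>\<^bsub>K\<^esub> V2))) E3 W3"
    and V3: "V3 = V2 \<odot>\<^bsub>K\<^esub> W3" and K3: "K3 = K2 \<lhd>\<^bsub>K\<^esub> W3"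
    and E4: "two_category.is_equifier K E3 (carr X) (TT X \<odot>\<^bsub>K\<^esub> Tot \<odot>\<^bsub>K\<^esub> V3)
               (TT X \<odot>\<^bsub>K\<^esub> Tot \<odot>\<^bsub>K\<^esub> V3)
               ((dl Q \<lhd>\<^bsub>K\<^esub> V3) \<bullet>\<^bsub>K\<^esub> K3)
               ((TT X \<rhd>\<^bsub>K\<^esub> K3) \<bullet>\<^bsub>K\<^esub> (cc X \<lhd>\<^bsub>K\<^esub> (Tot \<odot>\<^bsub>K\<^esub> V3)) \<bullet>\<^bsub>K\<^esub>
                  (TT X \<rhd>\<^bsub>K\<^esub> (dl Q \<lhd>\<^bsub>K\<^esub> V3))) E4 W4"
    and V4: "V4 = V3 \<odot>\<^bsub>K\<^esub> W4" and K4: "K4 = K3 \<lhd>\<^bsub>K\<^esub> W4"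
  shows "two_category.admits_VLC K X \<and>
    (\<exists>X0 X1 X2 X3 X4. two_category.induced_tangent_structures K X D Tot
        I0 V0 K0 E1 W1 E2 W2 E3 W3 E4 W4 X0 X1 X2 X3 X4) \<and>
    (\<forall>X0 X1 X2 X3 X4. two_category.induced_tangent_structures K X D Tot
        I0 V0 K0 E1 W1 E2 W2 E3 W3 E4 W4 X0 X1 X2 X3 X4 \<longrightarrow>
        two_category.is_VLC K X X4
          (two_category.bundle_at K X4 D X Q (two_category.strict_lax K X4 V4), K4))"
proof -
  interpret two_category K by (rule K)
  note ex = admits_VLC_equifier(1)[OF X DB I0 E1 V1 K1 E2 V2 K2 E3 V3 K3 E4 V4 K4]
    and univ = admits_VLC_equifier(2)[OF X DB I0 E1 V1 K1 E2 V2 K2 E3 V3 K3 E4 V4 K4]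
  have "admits_VLC X" unfolding admits_VLC_def using ex univ by blast
  then show ?thesis using ex univ by blast
qed

end
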